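(* Let $G=GL(m|n)$ over a field $K$ of characteristic $p>2$ and let $\Gamma$ be an ideal of $X(T)^+$. For each $\lambda\in\Gamma$ fix a finite-dimensional $G$-supermodule $W(\lambda)$ such that (1) $V_-(\lambda)$ is a subsupermodule of $W(\lambda)$; (2) $H^0_-(\lambda)$ is a quotient of $W(\lambda)$; (3) all weights of $W(\lambda)$ are less than or equal to $\lambda$ (with respect to $\unlhd$); (4) $\dim W(\lambda)_\lambda=1$. Then an element $\xi\in Dist(G)$ belongs to $\ker\pi_\Gamma$ if and only if $\xi$ acts trivially (i.e. as zero) on $W(\lambda)$ for every $\lambda\in\Gamma$.
   Context: $K$ is a field of characteristic $p>2$, $G=GL(m|n)$ with coordinate Hopf superalgebra $K[G]$; left $G$-supermodules are right $K[G]$-supercomodules, $\rho_r$ is the structure on $K[G]$ given by $\Delta_G$. $X(T)=\mathbb Z^{m+n}$ with basis $\epsilon_i$, ordered by $\mu\unlhd\lambda$ iff $\lambda-\mu$ is a nonnegative integer combination of $\epsilon_i-\epsilon_j$, $i<j$; $X(T)^+$ is the set of dominant weights ($\lambda_1\ge\dots\ge\lambda_m$, $\lambda_{m+1}\ge\dots\ge\lambda_{m+n}$); an ideal is a down-closed subset of $X(T)^+$. $H^0_-(\lambda)=\mathrm{ind}^G_{B^-}K_\lambda$ ($B^-$ lower triangular Borel, $K_\lambda$ even), with simple socle $L_-(\lambda)$. $V_-(\lambda)=Dist(G)\otimes_{Dist(P^+)}V_{ev,-}(\lambda)$ is the Weyl supermodule, where $P^+$ is the block upper triangular parabolic and $V_{ev,-}(\lambda)$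 is the Weyl module of highest weight $\lambda$ over $G_{ev}=GL(m)\times GL(n)$, inflated to $P^+$. Irreducible $G$-supermodules are $L_-(\lambda)$, $\Pi L_-(\lambda)$ ($\Pi$ parity shift), $\lambda\in X(T)^+$. $C_\Gamma=O_\Gamma(K[G])$ is the largest subsupermodule of $(K[G],\rho_r)$ all of whose composition factors are $L_-(\lambda)$ or $\Pi L_-(\lambda)$ with $\lambda\in\Gamma$; it is a subsupercoalgebra. $S_\Gamma=C_\Gamma^*$. $Dist(G)=\bigcup_{t\ge0}(K[G]/\mathfrak m^{t+1})^*\subseteq K[G]^*$, $\mathfrak m=\ker\epsilon_G$, and $\pi_\Gamma:Dist(G)\to S_\Gamma$ is the restriction $\xi\mapsto\xi|_{C_\Gamma}$. $Dist(G)$ acts on a $G$-supermodule $M$ with coaction $m\mapsto\sum m_1\otimes f_2$ by $\xi\cdot m=\sum(-1)^{|\xi||m_1|}m_1\xi(f_2)$. *)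

theory Defs
  imports
    Complex_Main
    "HOL-Library.Poly_Mapping"
    "HOL-Library.Type_Length"
    "HOL-Library.Function_Algebras"
begin

section \<open>Free algebras and two-sided ideals\<close>

datatype 'x fmon = FMon (letters: "'x list")

instantiation fmon :: (type) monoid_add
begin

definition zero_fmon :: "'a fmon" where "zero_fmon = FMon []"

definition plus_fmon :: "'a fmon \<Rightarrow> 'a fmon \<Rightarrow> 'a fmon"
  where "plus_fmon u v = FMon (letters u @ letters v)"

instance
  by standard (simp_all add: zero_fmon_def plus_fmon_def)

end

lemma letters_zero [simp]: "letters 0 = []"
  by (simp add: zero_fmon_def)

lemma letters_plus [simp]: "letters (u + v) = letters u @ letters v"
  by (simp add: plus_fmon_def)

text \<open>The monoid algebra of the free monoid on the set of letters \<open>'x\<close> is the free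
  associative unital algebra on \<open>'x\<close>.\<close>

type_synonym ('x, 'k) free_alg = "'x fmon \<Rightarrow>\<^sub>0 'k"

definition fgen :: "'x \<Rightarrow> ('x, 'k::ring_1) free_alg"
  where "fgen x = Poly_Mapping.single (FMon [x]) 1"

text \<open>The algebra homomorphism out of the free algebra sending the letter \<open>x\<close> to \<open>g x\<close>,
  where \<open>e\<close> is the structure map of the target algebra.\<close>

definition free_eval :: "('k::ring_1 \<Rightarrow> 'a::ring_1) \<Rightarrow> ('x \<Rightarrow> 'a) \<Rightarrow> ('x, 'k) free_alg \<Rightarrow> 'a"
  where "free_eval e g f =
    (\<Sum>w\<in>Poly_Mapping.keys f. e (Poly_Mapping.lookup f w) * prod_list (map g (letters w)))"

text \<open>Closure under negation is automatic: replace the left factor by its negative.\<close>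

inductive_set ideal_gen :: "'a::ring_1 set \<Rightarrow> 'a set" for S where
  zero: "0 \<in> ideal_gen S"
| step: "x \<in> ideal_gen S \<Longrightarrow> r \<in> S \<Longrightarrow> x + a * r * b \<in> ideal_gen S"

lemma ideal_gen_add:
  assumes "x \<in> ideal_gen S" "y \<in> ideal_gen S"
  shows "x + y \<in> ideal_gen S"
  using assms(2,1)
proof (induction y rule: ideal_gen.induct)
  case (step y r a b)
  then have "x + y + a * r * b \<in> ideal_gen S" by (intro ideal_gen.step) auto
  then show ?case by (simp add: algebra_simps)
qed simp

lemma ideal_gen_mult: "y \<in> ideal_gen S \<Longrightarrow> u * y * v \<in> ideal_gen S"
proof (induction y rule: ideal_gen.induct)
  case (step y r a b)
  then have "u * y * v + (u * a) * r * (b * v) \<in> ideal_gen S" by (intro ideal_gen.step) auto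
  then show ?case by (simp add: algebra_simps)
qed (simp add: ideal_gen.zero)

lemma ideal_gen_mult_left: "y \<in> ideal_gen S \<Longrightarrow> u * y \<in> ideal_gen S"
  using ideal_gen_mult[of y S u 1] by simp

lemma ideal_gen_mult_right: "y \<in> ideal_gen S \<Longrightarrow> y * v \<in> ideal_gen S"
  using ideal_gen_mult[of y S 1 v] by simp

lemma ideal_gen_uminus: "y \<in> ideal_gen S \<Longrightarrow> - y \<in> ideal_gen S"
  using ideal_gen_mult_left[of y S "-1"] by simp

lemma ideal_gen_diff: "x \<in> ideal_gen S \<Longrightarrow> y \<in> ideal_gen S \<Longrightarrow> x - y \<in> ideal_gen S"
  using ideal_gen_add[of x S "- y"] ideal_gen_uminus[of y S] by simp

lemma ideal_gen_base: "r \<in> S \<Longrightarrow> r \<in> ideal_gen S"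
  using ideal_gen.step[OF ideal_gen.zero, of r S 1 1] by simp

locale free_eval_hom =
  fixes e :: "'k::ring_1 \<Rightarrow> 'a::ring_1"
  assumes e_add: "e (c + d) = e c + e d"
    and e_mult: "e (c * d) = e c * e d"
    and e_one: "e 1 = 1"
    and e_central: "e c * y = y * e c"
begin

lemma e_zero: "e 0 = 0"
  using e_add[of 0 0] by simp

lemma eval_superset:
  "finite A \<Longrightarrow> Poly_Mapping.keys f \<subseteq> A \<Longrightarrow>
    free_eval e g f = (\<Sum>w\<in>A. e (Poly_Mapping.lookup f w) * prod_list (map g (letters w)))"
  unfolding free_eval_def
  by (rule sum.mono_neutral_left) (auto simp: in_keys_iff e_zero)

lemma eval_zero: "free_eval e g 0 = 0"
  by (simp add: free_eval_def)

lemma eval_add: "free_eval e g (f + h) = free_eval e g f + free_eval e g h"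
proof -
  let ?A = "Poly_Mapping.keys f \<union> Poly_Mapping.keys h"
  have "Poly_Mapping.keys (f + h) \<subseteq> ?A" by (rule Poly_Mapping.keys_add)
  then show ?thesis
    by (simp add: eval_superset[of ?A] lookup_add e_add distrib_right sum.distrib)
qed

lemma eval_single: "free_eval e g (Poly_Mapping.single w c) = e c * prod_list (map g (letters w))"
  by (cases "c = 0") (simp_all add: free_eval_def e_zero)

lemma eval_sum: "free_eval e g (sum F A) = (\<Sum>i\<in>A. free_eval e g (F i))"
  by (induction A rule: infinite_finite_induct) (simp_all add: eval_zero eval_add)

lemma eval_uminus: "free_eval e g (- f) = - free_eval e g f"
  using eval_add[of g f "- f"] by (simp add: eval_zero eq_neg_iff_add_eq_0 add.commute)

lemma eval_diff: "free_eval e g (f - h) = free_eval e g f - free_eval e g h"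
  using eval_add[of g f "- h"] by (simp add: eval_uminus)

lemma eval_one: "free_eval e g 1 = 1"
  using eval_single[of g 0 1] by (simp add: e_one)

lemma eval_fgen: "free_eval e g (fgen x) = g x"
  by (simp add: fgen_def eval_single e_one)

lemma eval_mult: "free_eval e g (f * h) = free_eval e g f * free_eval e g h"
proof -
  have single_sum: "p = (\<Sum>w\<in>Poly_Mapping.keys p. Poly_Mapping.single w (Poly_Mapping.lookup p w))"
    for p :: "('x, 'k) free_alg"
    by (rule poly_mapping_eqI) (auto simp: lookup_sum lookup_single when_def in_keys_iff sum.delta)
  have "free_eval e g (Poly_Mapping.single u c * Poly_Mapping.single v d) =
      free_eval e g (Poly_Mapping.single u c) * free_eval e g (Poly_Mapping.single v d)" for u v c d
  proof -
    have "e c * e d * (prod_list (map g (letters u)) * prod_list (map g (letters v))) =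
        e c * (e d * prod_list (map g (letters u))) * prod_list (map g (letters v))"
      by (simp add: mult.assoc)
    then show ?thesis
      by (simp add: mult_single eval_single e_mult e_central[of d "prod_list (map g (letters u))"] mult.assoc)
  qed
  then have prod_hom: "free_eval e g ((\<Sum>w\<in>A. Poly_Mapping.single w (F w)) * (\<Sum>w\<in>B. Poly_Mapping.single w (G w))) =
      free_eval e g (\<Sum>w\<in>A. Poly_Mapping.single w (F w)) * free_eval e g (\<Sum>w\<in>B. Poly_Mapping.single w (G w))"
    for A B F G
    by (simp add: sum_product eval_sum)
  let ?sum = "\<lambda>p. \<Sum>w\<in>Poly_Mapping.keys p. Poly_Mapping.single w (Poly_Mapping.lookup p w)"
  have "free_eval e g (?sum f * ?sum h) = free_eval e g (?sum f) * free_eval e g (?sum h)"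
    by (rule prod_hom)
  then show ?thesis
    by (simp only: single_sum[symmetric])
qed

lemma eval_ideal_gen:
  assumes "x \<in> ideal_gen S" and "\<And>r. r \<in> S \<Longrightarrow> free_eval e g r = 0"
  shows "free_eval e g x = 0"
  using assms by (induction rule: ideal_gen.induct) (simp_all add: eval_zero eval_add eval_mult)

end

interpretation id_eval: free_eval_hom "id :: 'k::comm_ring_1 \<Rightarrow> 'k"
  by standard (simp_all add: mult.commute)


section \<open>The coordinate superalgebra of \<open>GL(m|n)\<close>\<close>

text \<open>Parities are Booleans, \<open>True\<close> being odd; the sum of two parities is \<open>(\<noteq>)\<close>.
  Matrix indices are \<open>0, \<dots>, m + n - 1\<close>, the first \<open>m\<close> of them being even.\<close>

definition psign :: "bool \<Rightarrow> bool \<Rightarrow> 'a::ring_1"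
  where "psign s t = (if s \<and> t then - 1 else 1)"

definition idx_par :: "nat \<Rightarrow> nat \<Rightarrow> bool"
  where "idx_par m i \<longleftrightarrow> m \<le> i"

datatype glgen = GenC nat nat | GenD nat nat

fun gen_par :: "nat \<Rightarrow> glgen \<Rightarrow> bool" where
  "gen_par m (GenC i j) = (idx_par m i \<noteq> idx_par m j)"
| "gen_par m (GenD i j) = (idx_par m i \<noteq> idx_par m j)"

definition word_par :: "nat \<Rightarrow> glgen fmon \<Rightarrow> bool"
  where "word_par m w \<longleftrightarrow> odd (length (filter (gen_par m) (letters w)))"

text \<open>As a functor, \<open>GL(m|n)\<close> sends a supercommutative superalgebra \<open>R\<close> to the group of
  invertible even \<open>(m|n)\<close>-matrices over \<open>R\<close>. Its coordinate superalgebra is therefore the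
  supercommutative superalgebra generated by the entries of a generic even matrix \<open>C\<close> and of
  its inverse \<open>D\<close>. (Equivalently, it is the localization of the superalgebra of polynomials in
  the entries of \<open>C\<close> at the determinants of the two diagonal blocks.)
  The generators carry arbitrary indices in \<^typ>\<open>nat\<close>; those outside the range are set to 0.\<close>

inductive_set gl_rels :: "nat \<Rightarrow> nat \<Rightarrow> (glgen, 'k::ring_1) free_alg set"
  for m n :: nat where
  comm: "fgen x * fgen y - psign (gen_par m x) (gen_par m y) * (fgen y * fgen x) \<in> gl_rels m n"
| inv_right: "i < m + n \<Longrightarrow> j < m + n \<Longrightarrow>
    (\<Sum>k<m+n. fgen (GenC i k) * fgen (GenD k j)) - of_bool (i = j) \<in> gl_rels m n"
| inv_left: "i < m + n \<Longrightarrow> j < m + n \<Longrightarrow>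
    (\<Sum>k<m+n. fgen (GenD i k) * fgen (GenC k j)) - of_bool (i = j) \<in> gl_rels m n"
| rangeC: "\<not> (i < m + n \<and> j < m + n) \<Longrightarrow> fgen (GenC i j) \<in> gl_rels m n"
| rangeD: "\<not> (i < m + n \<and> j < m + n) \<Longrightarrow> fgen (GenD i j) \<in> gl_rels m n"

definition counit_gen :: "nat \<Rightarrow> glgen \<Rightarrow> 'k::ring_1" where
  "counit_gen N x = (case x of GenC i j \<Rightarrow> of_bool (i = j \<and> i < N)
                             | GenD i j \<Rightarrow> of_bool (i = j \<and> i < N))"

lemma counit_rels:
  assumes "r \<in> gl_rels m n"
  shows "free_eval (id :: 'k \<Rightarrow> 'k::comm_ring_1) (counit_gen (m + n)) r = 0"
proof -
  have sgn: "free_eval (id :: 'k \<Rightarrow> 'k) g (psign s t) = psign s t" for g :: "glgen \<Rightarrow> 'k" and s t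
    by (simp add: psign_def id_eval.eval_uminus id_eval.eval_one)
  have ob: "free_eval (id :: 'k \<Rightarrow> 'k) g (of_bool b) = of_bool b" for g :: "glgen \<Rightarrow> 'k" and b
    by (cases b) (simp_all add: id_eval.eval_zero id_eval.eval_one)
  have odd0: "counit_gen (m + n) x = (0 :: 'k)" if "gen_par m x" for x
    using that by (cases x) (auto simp: counit_gen_def)
  have comm: "counit_gen (m + n) x * counit_gen (m + n) y
      - psign (gen_par m x) (gen_par m y) * (counit_gen (m + n) y * counit_gen (m + n) x) = (0 :: 'k)"
    for x y
    using odd0[of x] odd0[of y] by (auto simp: psign_def)
  have inv: "(\<Sum>k<m + n. of_bool (i = k \<and> i < m + n) * of_bool (k = j \<and> k < m + n)) = (of_bool (i = j) :: 'k)"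
    if "i < m + n" for i j
  proof -
    have "(\<Sum>k<m + n. of_bool (i = k \<and> i < m + n) * of_bool (k = j \<and> k < m + n)) =
        (\<Sum>k<m + n. if k = i then of_bool (i = j) else (0 :: 'k))"
      by (rule sum.cong) (use that in auto)
    then show ?thesis using that by simp
  qed
  from assms show ?thesis
    by (cases, auto simp: id_eval.eval_diff id_eval.eval_mult id_eval.eval_sum id_eval.eval_fgen sgn ob comm,
      auto simp: counit_gen_def inv)
qed

quotient_type (overloaded) ('k, 'm, 'n) glc =
  "(glgen, 'k::field) free_alg" /
  "\<lambda>f g. f - g \<in> ideal_gen (gl_rels LENGTH('m::len0) LENGTH('n::len0))"
proof (rule equivpI)
  let ?J = "ideal_gen (gl_rels LENGTH('m) LENGTH('n)) :: (glgen, 'k) free_alg set"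
  show "reflp (\<lambda>f g. f - g \<in> ?J)"
    by (rule reflpI) (simp add: ideal_gen.zero)
  show "symp (\<lambda>f g. f - g \<in> ?J)"
  proof (rule sympI)
    fix f g :: "(glgen, 'k) free_alg"
    assume "f - g \<in> ?J"
    then have "- (f - g) \<in> ?J" by (rule ideal_gen_uminus)
    then show "g - f \<in> ?J" by simp
  qed
  show "transp (\<lambda>f g. f - g \<in> ?J)"
  proof (rule transpI)
    fix f g h :: "(glgen, 'k) free_alg"
    assume "f - g \<in> ?J" "g - h \<in> ?J"
    then have "(f - g) + (g - h) \<in> ?J" by (rule ideal_gen_add)
    then show "f - h \<in> ?J" by simp
  qed
qed

instantiation glc :: (field, len0, len0) ring_1
begin

lift_definition zero_glc :: "('a, 'b, 'c) glc" is 0 .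

lift_definition one_glc :: "('a, 'b, 'c) glc" is 1 .

lift_definition plus_glc :: "('a, 'b, 'c) glc \<Rightarrow> ('a, 'b, 'c) glc \<Rightarrow> ('a, 'b, 'c) glc" is "(+)"
proof -
  fix a b c d :: "(glgen, 'a) free_alg" and S
  assume "a - b \<in> ideal_gen S" "c - d \<in> ideal_gen S"
  then have "(a - b) + (c - d) \<in> ideal_gen S" by (rule ideal_gen_add)
  then show "a + c - (b + d) \<in> ideal_gen S" by (simp add: algebra_simps)
qed

lift_definition minus_glc :: "('a, 'b, 'c) glc \<Rightarrow> ('a, 'b, 'c) glc \<Rightarrow> ('a, 'b, 'c) glc" is "(-)"
proof -
  fix a b c d :: "(glgen, 'a) free_alg" and S
  assume "a - b \<in> ideal_gen S" "c - d \<in> ideal_gen S"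
  then have "(a - b) - (c - d) \<in> ideal_gen S" by (rule ideal_gen_diff)
  then show "a - c - (b - d) \<in> ideal_gen S" by (simp add: algebra_simps)
qed

lift_definition uminus_glc :: "('a, 'b, 'c) glc \<Rightarrow> ('a, 'b, 'c) glc" is uminus
proof -
  fix a b :: "(glgen, 'a) free_alg" and S
  assume "a - b \<in> ideal_gen S"
  then have "- (a - b) \<in> ideal_gen S" by (rule ideal_gen_uminus)
  then show "- a - - b \<in> ideal_gen S" by (simp add: algebra_simps)
qed

lift_definition times_glc :: "('a, 'b, 'c) glc \<Rightarrow> ('a, 'b, 'c) glc \<Rightarrow> ('a, 'b, 'c) glc" is "(*)"
proof -
  fix a b c d :: "(glgen, 'a) free_alg" and S
  assume "a - b \<in> ideal_gen S" "c - d \<in> ideal_gen S"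
  then have "a * (c - d) + (a - b) * d \<in> ideal_gen S"
    by (intro ideal_gen_add ideal_gen_mult_left ideal_gen_mult_right)
  then show "a * c - b * d \<in> ideal_gen S" by (simp add: algebra_simps)
qed

instance
proof
  show "(0 :: ('a, 'b, 'c) glc) \<noteq> 1"
  proof (transfer, rule notI)
    assume "(0 :: (glgen, 'a) free_alg) - 1 \<in> ideal_gen (gl_rels LENGTH('b) LENGTH('c))"
    then have "free_eval id (counit_gen (LENGTH('b) + LENGTH('c))) ((0 :: (glgen, 'a) free_alg) - 1) = 0"
      by (rule id_eval.eval_ideal_gen) (rule counit_rels)
    then show False
      by (simp add: id_eval.eval_uminus id_eval.eval_one)
  qed
qed (transfer; simp add: algebra_simps ideal_gen.zero)+

end

lift_definition glc_const :: "'k \<Rightarrow> ('k::field, 'm::len0, 'n::len0) glc"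
  is "Poly_Mapping.single 0" .

definition glc_scale :: "'k \<Rightarrow> ('k, 'm, 'n) glc \<Rightarrow> ('k::field, 'm::len0, 'n::len0) glc"
  where "glc_scale a f = glc_const a * f"

lift_definition glc_gen :: "glgen \<Rightarrow> ('k::field, 'm::len0, 'n::len0) glc" is fgen .

abbreviation cc :: "nat \<Rightarrow> nat \<Rightarrow> ('k::field, 'm::len0, 'n::len0) glc"
  where "cc i j \<equiv> glc_gen (GenC i j)"

abbreviation dd :: "nat \<Rightarrow> nat \<Rightarrow> ('k::field, 'm::len0, 'n::len0) glc"
  where "dd i j \<equiv> glc_gen (GenD i j)"

definition glc_par :: "bool \<Rightarrow> ('k::field, 'm::len0, 'n::len0) glc set" where
  "glc_par s = {abs_glc f | f. \<forall>w\<in>Poly_Mapping.keys f. word_par LENGTH('m) w = s}"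


lemma single_zero_central:
  fixes c :: "'k::comm_ring_1" and f :: "('x, 'k) free_alg"
  shows "Poly_Mapping.single 0 c * f = f * Poly_Mapping.single 0 c"
proof -
  have single_sum: "f = (\<Sum>w\<in>Poly_Mapping.keys f. Poly_Mapping.single w (Poly_Mapping.lookup f w))"
    by (rule poly_mapping_eqI) (auto simp: lookup_sum lookup_single when_def in_keys_iff sum.delta)
  have central: "Poly_Mapping.single 0 c * (\<Sum>w\<in>A. Poly_Mapping.single w (F w)) =
      (\<Sum>w\<in>A. Poly_Mapping.single w (F w)) * Poly_Mapping.single 0 c"
    for A and F :: "'x fmon \<Rightarrow> 'k"
    by (simp add: sum_distrib_left sum_distrib_right mult_single mult.commute)
  let ?sum = "\<Sum>w\<in>Poly_Mapping.keys f. Poly_Mapping.single w (Poly_Mapping.lookup f w)"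
  have "Poly_Mapping.single 0 c * ?sum = ?sum * Poly_Mapping.single 0 c"
    by (rule central)
  then show ?thesis
    by (simp only: single_sum[symmetric])
qed

interpretation free_endo:
  free_eval_hom "Poly_Mapping.single 0 :: 'k::comm_ring_1 \<Rightarrow> ('x, 'k) free_alg"
  by standard (simp add: single_add, simp add: mult_single, simp, rule single_zero_central)

lift_definition counit :: "('k::field, 'm::len0, 'n::len0) glc \<Rightarrow> 'k"
  is "free_eval id (counit_gen (LENGTH('m) + LENGTH('n)))"
proof -
  fix f g :: "(glgen, 'k) free_alg"
  assume "f - g \<in> ideal_gen (gl_rels LENGTH('m) LENGTH('n))"
  then have "free_eval id (counit_gen (LENGTH('m) + LENGTH('n))) (f - g) = 0"
    by (rule id_eval.eval_ideal_gen) (rule counit_rels)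
  then show "free_eval id (counit_gen (LENGTH('m) + LENGTH('n))) f =
      free_eval id (counit_gen (LENGTH('m) + LENGTH('n))) g"
    by (simp add: id_eval.eval_diff)
qed

text \<open>Since the coordinate superalgebra is supercommutative, its antipode is an (ungraded)
  algebra homomorphism. It corresponds to inversion of matrices.\<close>

fun swap_gen :: "glgen \<Rightarrow> glgen" where
  "swap_gen (GenC i j) = GenD i j"
| "swap_gen (GenD i j) = GenC i j"

lift_definition antipode :: "('k::field, 'm::len0, 'n::len0) glc \<Rightarrow> ('k, 'm, 'n) glc"
  is "free_eval (Poly_Mapping.single 0) (\<lambda>x. fgen (swap_gen x))"
proof -
  let ?S = "free_eval (Poly_Mapping.single 0) (\<lambda>x. fgen (swap_gen x))
    :: (glgen, 'k) free_alg \<Rightarrow> (glgen, 'k) free_alg"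
  let ?R = "gl_rels LENGTH('m) LENGTH('n) :: (glgen, 'k) free_alg set"
  note simps = free_endo.eval_diff free_endo.eval_mult free_endo.eval_sum free_endo.eval_fgen
    free_endo.eval_uminus free_endo.eval_one free_endo.eval_zero
  have par: "gen_par m (swap_gen x) = gen_par m x" for m x
    by (cases x) simp_all
  have sgn: "?S (psign s t) = psign s t" for s t
    by (simp add: psign_def simps)
  have ob: "?S (of_bool b) = of_bool b" for b
    by (cases b) (simp_all add: simps)
  have rel: "?S r \<in> ?R" if "r \<in> ?R" for r
    using that
  proof cases
    case (comm x y)
    then have S: "?S r = fgen (swap_gen x) * fgen (swap_gen y)
        - psign (gen_par LENGTH('m) (swap_gen x)) (gen_par LENGTH('m) (swap_gen y))
          * (fgen (swap_gen y) * fgen (swap_gen x))"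
      by (simp add: simps sgn par)
    show ?thesis unfolding S by (rule gl_rels.comm)
  next
    case (inv_right i j)
    then have S: "?S r = (\<Sum>k<LENGTH('m) + LENGTH('n). fgen (GenD i k) * fgen (GenC k j)) - of_bool (i = j)"
      by (simp add: simps ob)
    show ?thesis unfolding S by (rule gl_rels.inv_left) (use inv_right in auto)
  next
    case (inv_left i j)
    then have S: "?S r = (\<Sum>k<LENGTH('m) + LENGTH('n). fgen (GenC i k) * fgen (GenD k j)) - of_bool (i = j)"
      by (simp add: simps ob)
    show ?thesis unfolding S by (rule gl_rels.inv_right) (use inv_left in auto)
  next
    case (rangeC i j)
    then have S: "?S r = fgen (GenD i j)" by (simp add: simps)
    show ?thesis unfolding S by (rule gl_rels.rangeD) (use rangeC in auto)
  next
    case (rangeD i j)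
    then have S: "?S r = fgen (GenC i j)" by (simp add: simps)
    show ?thesis unfolding S by (rule gl_rels.rangeC) (use rangeD in auto)
  qed
  have ideal: "?S x \<in> ideal_gen ?R" if "x \<in> ideal_gen ?R" for x
    using that
  proof (induction rule: ideal_gen.induct)
    case zero
    show ?case by (simp add: simps ideal_gen.zero)
  next
    case (step x r a b)
    then have "?S x + ?S a * ?S r * ?S b \<in> ideal_gen ?R"
      by (intro ideal_gen.step rel)
    then show ?case by (simp add: simps free_endo.eval_add)
  qed
  fix f g :: "(glgen, 'k) free_alg"
  assume "f - g \<in> ideal_gen ?R"
  then have "?S (f - g) \<in> ideal_gen ?R" by (rule ideal)
  then show "?S f - ?S g \<in> ideal_gen ?R" by (simp add: simps)
qed


section \<open>Tensor products and the comultiplication\<close>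

definition fscale :: "'k::times \<Rightarrow> ('x \<Rightarrow> 'k) \<Rightarrow> 'x \<Rightarrow> 'k"
  where "fscale c f = (\<lambda>x. c * f x)"

definition bilin ::
  "('k::field \<Rightarrow> 'v \<Rightarrow> 'v) \<Rightarrow> ('k \<Rightarrow> 'w \<Rightarrow> 'w) \<Rightarrow> ('v::ab_group_add \<Rightarrow> 'w::ab_group_add \<Rightarrow> 'k) \<Rightarrow> bool"
  where "bilin sv sw b \<longleftrightarrow>
    (\<forall>v. Vector_Spaces.linear sw (*) (b v)) \<and> (\<forall>w. Vector_Spaces.linear sv (*) (\<lambda>v. b v w))"

text \<open>Over a field, \<open>V \<otimes> W\<close> embeds into the dual of the space of bilinear forms on
  \<open>V \<times> W\<close>, the pure tensor \<open>v \<otimes> w\<close> becoming evaluation at \<open>(v, w)\<close>; the tensor product is the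
  span of the pure tensors. In this model, for a tensor \<open>t = \<Sum> x\<^sub>1 \<otimes> x\<^sub>2\<close> and a bilinear
  form \<open>b\<close>, the value \<open>t b\<close> is the Sweedler sum \<open>\<Sum> b x\<^sub>1 x\<^sub>2\<close>. (Functionals are set to 0 on
  arguments that are not bilinear forms.)\<close>

type_synonym ('k, 'v, 'w) tensor = "('v \<Rightarrow> 'w \<Rightarrow> 'k) \<Rightarrow> 'k"

definition tens ::
  "('k::field \<Rightarrow> 'v \<Rightarrow> 'v) \<Rightarrow> ('k \<Rightarrow> 'w \<Rightarrow> 'w) \<Rightarrow>
    'v::ab_group_add \<Rightarrow> 'w::ab_group_add \<Rightarrow> ('k, 'v, 'w) tensor"
  where "tens sv sw v w = (\<lambda>b. if bilin sv sw b then b v w else 0)"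

text \<open>For subspaces \<open>V\<close>, \<open>W\<close>, the subspace \<open>V \<otimes> W\<close> of the tensor product of the ambient spaces.\<close>

definition tens_space ::
  "('k::field \<Rightarrow> 'v \<Rightarrow> 'v) \<Rightarrow> ('k \<Rightarrow> 'w \<Rightarrow> 'w) \<Rightarrow>
    'v::ab_group_add set \<Rightarrow> 'w::ab_group_add set \<Rightarrow> ('k, 'v, 'w) tensor set"
  where "tens_space sv sw V W = module.span fscale {tens sv sw v w | v w. v \<in> V \<and> w \<in> W}"

text \<open>Component of parity \<open>s\<close> with respect to a decomposition into \<open>P False\<close> and \<open>P True\<close>.\<close>

definition hcomp :: "(bool \<Rightarrow> 'v::ab_group_add set) \<Rightarrow> bool \<Rightarrow> 'v \<Rightarrow> 'v"
  where "hcomp P s v = (THE u. u \<in> P s \<and> v - u \<in> P (\<not> s))"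

abbreviation tensA ::
  "('k::field, 'm::len0, 'n::len0) glc \<Rightarrow> ('k, 'm, 'n) glc \<Rightarrow>
    ('k, ('k, 'm, 'n) glc, ('k, 'm, 'n) glc) tensor"
  where "tensA \<equiv> tens glc_scale glc_scale"

text \<open>\<open>(a \<otimes> b) (a' \<otimes> b') = (-1) ^ (|b| |a'|) aa' \<otimes> bb'\<close>, extended bilinearly.\<close>

definition tens_mult ::
  "('k::field, ('k, 'm::len0, 'n::len0) glc, ('k, 'm, 'n) glc) tensor \<Rightarrow>
    ('k, ('k, 'm, 'n) glc, ('k, 'm, 'n) glc) tensor \<Rightarrow>
    ('k, ('k, 'm, 'n) glc, ('k, 'm, 'n) glc) tensor"
  where "tens_mult t u = (\<lambda>\<beta>. if bilin glc_scale glc_scale \<beta>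
    then t (\<lambda>a b. u (\<lambda>a' b'. \<Sum>p\<in>UNIV. \<Sum>q\<in>UNIV.
           psign p q * \<beta> (a * hcomp glc_par q a') (hcomp glc_par p b * b')))
    else 0)"

fun comult_gen ::
  "glgen \<Rightarrow> ('k::field, ('k, 'm::len0, 'n::len0) glc, ('k, 'm, 'n) glc) tensor" where
  "comult_gen (GenC i j) = (\<Sum>k<LENGTH('m) + LENGTH('n). tensA (cc i k) (cc k j))"
| "comult_gen (GenD i j) = (\<Sum>k<LENGTH('m) + LENGTH('n).
     fscale (psign (gen_par LENGTH('m) (GenD i k)) (gen_par LENGTH('m) (GenD k j)))
       (tensA (dd k j) (dd i k)))"

primrec comult_letters ::
  "glgen list \<Rightarrow> ('k::field, ('k, 'm::len0, 'n::len0) glc, ('k, 'm, 'n) glc) tensor" where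
  "comult_letters [] = tensA 1 1"
| "comult_letters (x # xs) = tens_mult (comult_gen x) (comult_letters xs)"

text \<open>The superalgebra homomorphism extending \<^const>\<open>comult_gen\<close>, which encodes multiplication
  of matrices (the sign for the entries of the inverse comes from \<open>(gh)\<^sup>-\<^sup>1 = h\<^sup>-\<^sup>1 g\<^sup>-\<^sup>1\<close>).
  It annihilates the defining relations, hence the chosen representative is immaterial.\<close>

definition comult ::
  "('k::field, 'm::len0, 'n::len0) glc \<Rightarrow> ('k, ('k, 'm, 'n) glc, ('k, 'm, 'n) glc) tensor"
  where "comult f = (\<Sum>w\<in>Poly_Mapping.keys (rep_glc f).
    fscale (Poly_Mapping.lookup (rep_glc f) w) (comult_letters (letters w)))"


section \<open>Supermodules\<close>

text \<open>A supermodule is a graded subspace \<open>carrier\<close> of an ambient superspace, given by the whole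
  type \<open>'v\<close> with scalar multiplication \<open>sc\<close> and homogeneous components \<open>par\<close>, together with a
  right coaction of the coordinate superalgebra. The coaction is a linear map on the ambient
  space, but subject to the comodule axioms on the carrier only. This is no restriction: a
  coaction on a subspace extends to a linear map on the ambient space, and all notions below
  depend on its values on the carrier only.\<close>

record (overloaded) ('k, 'm, 'n, 'v) gsmod =
  carrier :: "'v set"
  sc :: "'k \<Rightarrow> 'v \<Rightarrow> 'v"
  par :: "bool \<Rightarrow> 'v set"
  coact :: "'v \<Rightarrow> ('k, 'v, ('k, 'm, 'n) glc) tensor"

definition superspace :: "('k::field \<Rightarrow> 'v \<Rightarrow> 'v) \<Rightarrow> (bool \<Rightarrow> 'v::ab_group_add set) \<Rightarrow> bool"
  where "superspace s P \<longleftrightarrow> vector_space s \<and> (\<forall>p. module.subspace s (P p))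
    \<and> P False \<inter> P True = {0} \<and> (\<forall>v. \<exists>x\<in>P False. \<exists>y\<in>P True. v = x + y)"

definition trilin ::
  "('k::field \<Rightarrow> 'v::ab_group_add \<Rightarrow> 'v) \<Rightarrow>
    ('v \<Rightarrow> ('k, 'm::len0, 'n::len0) glc \<Rightarrow> ('k, 'm, 'n) glc \<Rightarrow> 'k) \<Rightarrow> bool"
  where "trilin s \<theta> \<longleftrightarrow> (\<forall>a. bilin s glc_scale (\<lambda>v b. \<theta> v b a))
    \<and> (\<forall>v b. Vector_Spaces.linear glc_scale (*) (\<theta> v b))"

text \<open>The last two conditions of the definition are coassociativity
  \<open>\<Sum> m\<^sub>1\<^sub>1 \<otimes> m\<^sub>1\<^sub>2 \<otimes> f\<^sub>2 = \<Sum> m\<^sub>1 \<otimes> f\<^sub>2\<^sub>1 \<otimes> f\<^sub>2\<^sub>2\<close> and the counit law \<open>\<Sum> m\<^sub>1 \<epsilon>(f\<^sub>2) = m\<close>, tested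
  against trilinear and linear forms.\<close>

definition G_supermodule ::
  "('k::field, 'm::len0, 'n::len0, 'v::ab_group_add) gsmod \<Rightarrow> bool" where
  "G_supermodule M \<longleftrightarrow>
     superspace (sc M) (par M)
   \<and> module.subspace (sc M) (carrier M)
   \<and> (\<forall>v\<in>carrier M. \<forall>p. hcomp (par M) p v \<in> carrier M)
   \<and> Vector_Spaces.linear (sc M) fscale (coact M)
   \<and> range (coact M) \<subseteq> tens_space (sc M) glc_scale UNIV UNIV
   \<and> (\<forall>p. \<forall>v\<in>carrier M \<inter> par M p. coact M v \<in> module.span fscale
        {tens (sc M) glc_scale x a | x a q. x \<in> carrier M \<inter> par M q \<and> a \<in> glc_par (p \<noteq> q)})
   \<and> (\<forall>v\<in>carrier M. \<forall>\<theta>. trilin (sc M) \<theta> \<longrightarrow>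
        coact M v (\<lambda>x a. coact M x (\<lambda>y b. \<theta> y b a)) = coact M v (\<lambda>x a. comult a (\<theta> x)))
   \<and> (\<forall>v\<in>carrier M. \<forall>\<phi>. Vector_Spaces.linear (sc M) (*) \<phi> \<longrightarrow>
        coact M v (\<lambda>x a. \<phi> x * counit a) = \<phi> v)"

definition subsupermodule ::
  "('k::field, 'm::len0, 'n::len0, 'v::ab_group_add) gsmod \<Rightarrow> 'v set \<Rightarrow> bool"
  where "subsupermodule M N \<longleftrightarrow> N \<subseteq> carrier M \<and> G_supermodule (M\<lparr>carrier := N\<rparr>)"

definition finite_dimensional ::
  "('k::field, 'm::len0, 'n::len0, 'v::ab_group_add) gsmod \<Rightarrow> bool"
  where "finite_dimensional M \<longleftrightarrow> (\<exists>B. finite B \<and> carrier M = module.span (sc M) B)"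

text \<open>Even homomorphisms of supermodules. Linearity on the ambient space is again no
  restriction.\<close>

definition G_hom ::
  "('k::field, 'm::len0, 'n::len0, 'v::ab_group_add) gsmod \<Rightarrow>
    ('k, 'm, 'n, 'w::ab_group_add) gsmod \<Rightarrow> ('v \<Rightarrow> 'w) \<Rightarrow> bool"
  where "G_hom M L h \<longleftrightarrow> Vector_Spaces.linear (sc M) (sc L) h
    \<and> h ` carrier M \<subseteq> carrier L
    \<and> (\<forall>p. h ` (carrier M \<inter> par M p) \<subseteq> par L p)
    \<and> (\<forall>v\<in>carrier M. \<forall>b. bilin (sc L) glc_scale b \<longrightarrow>
         coact L (h v) b = coact M v (\<lambda>x a. b (h x) a))"

definition parity_shift ::
  "('k, 'm, 'n, 'v) gsmod \<Rightarrow> ('k, 'm, 'n, 'v) gsmod"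
  where "parity_shift M = M\<lparr>par := (\<lambda>p. par M (\<not> p))\<rparr>"

definition simple_supermodule ::
  "('k::field, 'm::len0, 'n::len0, 'v::ab_group_add) gsmod \<Rightarrow> bool"
  where "simple_supermodule M \<longleftrightarrow> G_supermodule M \<and> carrier M \<noteq> {0}
    \<and> (\<forall>N. subsupermodule M N \<longrightarrow> N = {0} \<or> N = carrier M)"

definition socle ::
  "('k::field, 'm::len0, 'n::len0, 'v::ab_group_add) gsmod \<Rightarrow> ('k, 'm, 'n, 'v) gsmod"
  where "socle M = M\<lparr>carrier := module.span (sc M)
    (\<Union>{N. subsupermodule M N \<and> simple_supermodule (M\<lparr>carrier := N\<rparr>)})\<rparr>"

definition subquotient_iso ::
  "('k::field, 'm::len0, 'n::len0, 'v::ab_group_add) gsmod \<Rightarrow> 'v set \<Rightarrow> 'v set \<Rightarrow>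
    ('k, 'm, 'n, 'w::ab_group_add) gsmod \<Rightarrow> bool"
  where "subquotient_iso M N1 N2 L \<longleftrightarrow> (\<exists>h. G_hom (M\<lparr>carrier := N2\<rparr>) L h
    \<and> h ` N2 = carrier L \<and> {x \<in> N2. h x = 0} = N1)"

definition simple_subquotient ::
  "('k::field, 'm::len0, 'n::len0, 'v::ab_group_add) gsmod \<Rightarrow> 'v set \<Rightarrow> 'v set \<Rightarrow> bool"
  where "simple_subquotient M N1 N2 \<longleftrightarrow> subsupermodule M N1 \<and> subsupermodule M N2 \<and> N1 \<subset> N2
    \<and> (\<forall>N. subsupermodule M N \<and> N1 \<subseteq> N \<and> N \<subseteq> N2 \<longrightarrow> N = N1 \<or> N = N2)"

text \<open>The action of functionals on the coordinate superalgebra,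
  \<open>\<xi> \<cdot> m = \<Sum> (-1) ^ (|\<xi>| |m\<^sub>1|) m\<^sub>1 \<xi>(f\<^sub>2)\<close>. The component of \<open>\<xi>\<close> of parity \<open>q\<close> is \<open>\<xi>\<close> composed with
  the projection to the component of parity \<open>q\<close>; the resulting vector is determined by its
  values under linear forms.\<close>

definition act ::
  "('k::field, 'm::len0, 'n::len0, 'v::ab_group_add) gsmod \<Rightarrow>
    (('k, 'm, 'n) glc \<Rightarrow> 'k) \<Rightarrow> 'v \<Rightarrow> 'v"
  where "act M \<xi> v = (THE u. \<forall>\<phi>. Vector_Spaces.linear (sc M) (*) \<phi> \<longrightarrow>
    \<phi> u = coact M v (\<lambda>x a. \<Sum>p\<in>UNIV. \<Sum>q\<in>UNIV.
      psign q p * (\<phi> (hcomp (par M) p x) * \<xi> (hcomp glc_par q a))))"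


section \<open>Distributions\<close>

definition ideal_power :: "'a::ring_1 set \<Rightarrow> nat \<Rightarrow> 'a set"
  where "ideal_power I t = ideal_gen {prod_list xs | xs. length xs = t \<and> set xs \<subseteq> I}"

definition Dist :: "(('k::field, 'm::len0, 'n::len0) glc \<Rightarrow> 'k) set"
  where "Dist = {\<xi>. Vector_Spaces.linear glc_scale (*) \<xi>
    \<and> (\<exists>t. \<forall>f\<in>ideal_power {g. counit g = 0} (t + 1). \<xi> f = 0)}"

definition Dist_par :: "bool \<Rightarrow> (('k::field, 'm::len0, 'n::len0) glc \<Rightarrow> 'k) set"
  where "Dist_par p = {\<xi> \<in> Dist. \<forall>f\<in>glc_par (\<not> p). \<xi> f = 0}"

text \<open>Distributions of the closed subsupergroup with defining ideal \<open>I\<close>, as a subalgebra of the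
  distributions of the whole group.\<close>

definition Dist_sub ::
  "('k::field, 'm::len0, 'n::len0) glc set \<Rightarrow> (('k, 'm, 'n) glc \<Rightarrow> 'k) set"
  where "Dist_sub I = {\<xi> \<in> Dist. \<forall>f\<in>I. \<xi> f = 0}"

text \<open>\<open>(\<xi>\<eta>)(f) = \<Sum> (-1) ^ (|\<eta>| |f\<^sub>1|) \<xi>(f\<^sub>1) \<eta>(f\<^sub>2)\<close>: the sign convention for which
  \<^const>\<open>act\<close> satisfies \<open>(\<xi>\<eta>) \<cdot> m = \<xi> \<cdot> (\<eta> \<cdot> m)\<close>.\<close>

definition conv ::
  "(('k::field, 'm::len0, 'n::len0) glc \<Rightarrow> 'k) \<Rightarrow> (('k, 'm, 'n) glc \<Rightarrow> 'k) \<Rightarrow>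
    ('k, 'm, 'n) glc \<Rightarrow> 'k"
  where "conv \<xi> \<eta> f = comult f (\<lambda>a b. \<Sum>p\<in>UNIV. \<Sum>q\<in>UNIV.
    psign q p * (\<xi> (hcomp glc_par p a) * \<eta> (hcomp glc_par q b)))"


section \<open>Weights\<close>

definition weight_lattice :: "nat \<Rightarrow> nat \<Rightarrow> (nat \<Rightarrow> int) set"
  where "weight_lattice m n = {\<mu>. \<forall>i\<ge>m + n. \<mu> i = 0}"

definition dominant_weights :: "nat \<Rightarrow> nat \<Rightarrow> (nat \<Rightarrow> int) set"
  where "dominant_weights m n = {\<mu> \<in> weight_lattice m n.
    (\<forall>i. i + 1 < m \<longrightarrow> \<mu> (i + 1) \<le> \<mu> i) \<and> (\<forall>i. m \<le> i \<and> i + 1 < m + n \<longrightarrow> \<mu> (i + 1) \<le> \<mu> i)}"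

definition eps :: "nat \<Rightarrow> nat \<Rightarrow> int"
  where "eps i = (\<lambda>l. of_bool (l = i))"

definition weight_le :: "nat \<Rightarrow> nat \<Rightarrow> (nat \<Rightarrow> int) \<Rightarrow> (nat \<Rightarrow> int) \<Rightarrow> bool"
  where "weight_le m n \<mu> lam \<longleftrightarrow> (\<exists>c :: nat \<Rightarrow> nat \<Rightarrow> nat. \<forall>l.
    lam l - \<mu> l = (\<Sum>j<m + n. \<Sum>i<j. int (c i j) * (eps i l - eps j l)))"

definition weight_ideal :: "nat \<Rightarrow> nat \<Rightarrow> (nat \<Rightarrow> int) set \<Rightarrow> bool"
  where "weight_ideal m n \<Gamma> \<longleftrightarrow> \<Gamma> \<subseteq> dominant_weights m n
    \<and> (\<forall>lam\<in>\<Gamma>. \<forall>\<mu>\<in>dominant_weights m n. weight_le m n \<mu> lam \<longrightarrow> \<mu> \<in> \<Gamma>)"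

text \<open>Defining ideals of the diagonal torus, the lower triangular Borel, the block upper
  triangular parabolic, the even part \<open>GL(m) \<times> GL(n)\<close>, and the lower triangular Borel of the
  even part.\<close>

definition I_torus :: "('k::field, 'm::len0, 'n::len0) glc set"
  where "I_torus = ideal_gen {cc i j | i j. i \<noteq> j}"

definition I_borel :: "('k::field, 'm::len0, 'n::len0) glc set"
  where "I_borel = ideal_gen {cc i j | i j. i < j}"

definition I_parabolic :: "('k::field, 'm::len0, 'n::len0) glc set"
  where "I_parabolic =
    ideal_gen {cc i j | i j. idx_par LENGTH('m) i \<and> \<not> idx_par LENGTH('m) j}"

definition I_ev :: "('k::field, 'm::len0, 'n::len0) glc set"
  where "I_ev = ideal_gen {cc i j | i j. idx_par LENGTH('m) i \<noteq> idx_par LENGTH('m) j}"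

definition I_borel_ev :: "('k::field, 'm::len0, 'n::len0) glc set"
  where "I_borel_ev =
    ideal_gen {cc i j | i j. i < j \<or> idx_par LENGTH('m) i \<noteq> idx_par LENGTH('m) j}"

text \<open>A lift of the character \<open>\<mu>\<close> of the torus, of \<open>B\<^sup>-\<close> and of its even part: modulo each of
  their defining ideals, \<open>dd i i\<close> is the inverse of \<open>cc i i\<close>.\<close>

definition character_lift :: "(nat \<Rightarrow> int) \<Rightarrow> ('k::field, 'm::len0, 'n::len0) glc"
  where "character_lift \<mu> = prod_list (map (\<lambda>i. if 0 \<le> \<mu> i then cc i i ^ nat (\<mu> i)
    else dd i i ^ nat (- \<mu> i)) [0..<LENGTH('m) + LENGTH('n)])"

definition weight_space ::
  "('k::field, 'm::len0, 'n::len0, 'v::ab_group_add) gsmod \<Rightarrow> (nat \<Rightarrow> int) \<Rightarrow> 'v set"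
  where "weight_space M \<mu> = {v \<in> carrier M.
    coact M v - tens (sc M) glc_scale v (character_lift \<mu>)
      \<in> tens_space (sc M) glc_scale (carrier M) I_torus}"

definition weights ::
  "('k::field, 'm::len0, 'n::len0, 'v::ab_group_add) gsmod \<Rightarrow> (nat \<Rightarrow> int) set"
  where "weights M = {\<mu> \<in> weight_lattice LENGTH('m) LENGTH('n). weight_space M \<mu> \<noteq> {0}}"


section \<open>Induced, simple and Weyl supermodules\<close>

definition regular :: "('k::field, 'm::len0, 'n::len0, ('k, 'm, 'n) glc) gsmod"
  where "regular = \<lparr>carrier = UNIV, sc = glc_scale, par = glc_par, coact = comult\<rparr>"

text \<open>The module induced from the even character \<open>lam\<close> of \<open>B\<^sup>-\<close> is the cotensor product of
  \<open>K\<^sub>\<lambda>\<close> with the coordinate superalgebra of \<open>G\<close>: all \<open>f\<close> whose image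
  under \<open>(\<pi> \<otimes> id) \<Delta>\<close>, with \<open>\<pi>\<close> the restriction to \<open>B\<^sup>-\<close>, is \<open>lam \<otimes> f\<close>. The kernel of
  \<open>\<pi> \<otimes> id\<close> is generated by the tensors with first factor in the defining ideal.\<close>

definition H0_minus :: "(nat \<Rightarrow> int) \<Rightarrow> ('k::field, 'm::len0, 'n::len0, ('k, 'm, 'n) glc) gsmod"
  where "H0_minus lam = regular\<lparr>carrier :=
    {f. comult f - tensA (character_lift lam) f \<in> tens_space glc_scale glc_scale I_borel UNIV}\<rparr>"

definition L_minus :: "(nat \<Rightarrow> int) \<Rightarrow> ('k::field, 'm::len0, 'n::len0, ('k, 'm, 'n) glc) gsmod"
  where "L_minus lam = socle (H0_minus lam)"

text \<open>The preimage, in the coordinate superalgebra of \<open>G\<close>, of the module over the even part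
  induced from the character \<open>\<mu>\<close> of its lower triangular Borel. The induced module itself is the
  quotient of this subspace by \<^const>\<open>I_ev\<close>.\<close>

definition H0_ev :: "(nat \<Rightarrow> int) \<Rightarrow> ('k::field, 'm::len0, 'n::len0) glc set"
  where "H0_ev \<mu> = {f. comult f - tensA (character_lift \<mu>) f \<in> module.span fscale
    (tens_space glc_scale glc_scale I_borel_ev UNIV \<union> tens_space glc_scale glc_scale UNIV I_ev)}"

text \<open>\<open>-w\<^sub>0 lam\<close>, for \<open>w\<^sub>0\<close> the longest element of the Weyl group of \<open>GL(m) \<times> GL(n)\<close>.\<close>

definition neg_w0 :: "nat \<Rightarrow> nat \<Rightarrow> (nat \<Rightarrow> int) \<Rightarrow> nat \<Rightarrow> int"
  where "neg_w0 m n lam i = (if i < m then - lam (m - 1 - i)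
    else if i < m + n then - lam (m + (m + n - 1 - i)) else 0)"

text \<open>The Weyl module over the even part is the dual of the induced module of highest weight
  \<open>-w\<^sub>0 lam\<close>; its elements are linear forms on \<^term>\<open>H0_ev (neg_w0 m n lam)\<close> vanishing on
  \<^const>\<open>I_ev\<close>, extended by 0 outside that space. It is purely even.\<close>

definition V_ev :: "(nat \<Rightarrow> int) \<Rightarrow> (('k::field, 'm::len0, 'n::len0) glc \<Rightarrow> 'k) set"
  where "V_ev lam = (let H = H0_ev (neg_w0 LENGTH('m) LENGTH('n) lam) in
    {\<phi>. (\<forall>f\<in>H. \<forall>g\<in>H. \<phi> (f + g) = \<phi> f + \<phi> g) \<and> (\<forall>c. \<forall>f\<in>H. \<phi> (glc_scale c f) = c * \<phi> f)
      \<and> (\<forall>f\<in>I_ev. \<phi> f = 0) \<and> (\<forall>f. f \<notin> H \<longrightarrow> \<phi> f = 0)})"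

text \<open>The image of a distribution of \<open>P\<^sup>+\<close> under the projection of \<open>P\<^sup>+\<close> onto its block diagonal
  part \<open>GL(m) \<times> GL(n)\<close>. On coordinate superalgebras this projection annihilates the generators
  outside the diagonal blocks and fixes the other ones; this is well-defined modulo the defining
  ideal of \<open>P\<^sup>+\<close>, on which \<open>\<eta>\<close> vanishes.\<close>

definition Dist_levi ::
  "(('k::field, 'm::len0, 'n::len0) glc \<Rightarrow> 'k) \<Rightarrow> ('k, 'm, 'n) glc \<Rightarrow> 'k"
  where "Dist_levi \<eta> f = \<eta> (abs_glc (free_eval (Poly_Mapping.single 0)
    (\<lambda>x. if gen_par LENGTH('m) x then 0 else fgen x) (rep_glc f)))"

text \<open>The contragredient action of a distribution of \<open>P\<^sup>+\<close> on the inflated Weyl module.\<close>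

definition V_ev_act ::
  "(nat \<Rightarrow> int) \<Rightarrow> (('k::field, 'm::len0, 'n::len0) glc \<Rightarrow> 'k) \<Rightarrow>
    (('k, 'm, 'n) glc \<Rightarrow> 'k) \<Rightarrow> ('k, 'm, 'n) glc \<Rightarrow> 'k"
  where "V_ev_act lam \<eta> \<phi> f = (if f \<in> H0_ev (neg_w0 LENGTH('m) LENGTH('n) lam)
    then \<phi> (act regular (\<lambda>g. Dist_levi \<eta> (antipode g)) f) else 0)"

text \<open>\<open>M\<close> is isomorphic, by an even isomorphism, to the quotient \<open>V_-(lam)\<close> of
  \<open>Dist(G) \<otimes>\<^sub>K V_ev(lam)\<close> by the balancing relations over \<open>Dist(P\<^sup>+)\<close>; the isomorphism is given by
  a surjection from the tensor product over \<open>K\<close> whose kernel is the span of these relations.\<close>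

definition is_V_minus ::
  "(nat \<Rightarrow> int) \<Rightarrow> ('k::field, 'm::len0, 'n::len0, 'v::ab_group_add) gsmod \<Rightarrow> bool"
  where "is_V_minus lam M \<longleftrightarrow> G_supermodule M \<and>
    (\<exists>h. Vector_Spaces.linear fscale (sc M) h
      \<and> h ` tens_space fscale fscale Dist (V_ev lam) = carrier M
      \<and> {t \<in> tens_space fscale fscale Dist (V_ev lam). h t = 0} = module.span fscale
          {tens fscale fscale (conv \<xi> \<eta>) v - tens fscale fscale \<xi> (V_ev_act lam \<eta> v) | \<xi> \<eta> v.
            \<xi> \<in> Dist \<and> \<eta> \<in> Dist_sub I_parabolic \<and> v \<in> V_ev lam}
      \<and> (\<forall>p. \<forall>\<xi>\<in>Dist_par p. \<forall>v\<in>V_ev lam. h (tens fscale fscale \<xi> v) \<in> par M p)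
      \<and> (\<forall>\<zeta>\<in>Dist. \<forall>\<xi>\<in>Dist. \<forall>v\<in>V_ev lam.
           h (tens fscale fscale (conv \<zeta> \<xi>) v) = act M \<zeta> (h (tens fscale fscale \<xi> v))))"


section \<open>Truncation at an ideal of weights\<close>

definition comp_factors_in ::
  "('k::field, 'm::len0, 'n::len0, 'v::ab_group_add) gsmod \<Rightarrow> (nat \<Rightarrow> int) set \<Rightarrow> bool"
  where "comp_factors_in M \<Gamma> \<longleftrightarrow> (\<forall>N1 N2. simple_subquotient M N1 N2 \<longrightarrow>
    (\<exists>lam\<in>\<Gamma>. subquotient_iso M N1 N2 (L_minus lam) \<or>
           subquotient_iso M N1 N2 (parity_shift (L_minus lam))))"

text \<open>The largest subsupermodule with all composition factors in \<open>\<Gamma>\<close> is the sum of all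
  subsupermodules with this property.\<close>

definition O_trunc ::
  "(nat \<Rightarrow> int) set \<Rightarrow> ('k::field, 'm::len0, 'n::len0, 'v::ab_group_add) gsmod \<Rightarrow> 'v set"
  where "O_trunc \<Gamma> M = module.span (sc M)
    (\<Union>{N. subsupermodule M N \<and> comp_factors_in (M\<lparr>carrier := N\<rparr>) \<Gamma>})"

definition C_trunc :: "(nat \<Rightarrow> int) set \<Rightarrow> ('k::field, 'm::len0, 'n::len0) glc set"
  where "C_trunc \<Gamma> = O_trunc \<Gamma> regular"

text \<open>Elements of the dual of \<^const>\<open>C_trunc\<close> are represented as functions that are 0 outside
  of it.\<close>

definition pi_trunc ::
  "(nat \<Rightarrow> int) set \<Rightarrow> (('k::field, 'm::len0, 'n::len0) glc \<Rightarrow> 'k) \<Rightarrow> ('k, 'm, 'n) glc \<Rightarrow> 'k"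
  where "pi_trunc \<Gamma> \<xi> = (\<lambda>f. if f \<in> C_trunc \<Gamma> then \<xi> f else 0)"

definition ker_pi :: "(nat \<Rightarrow> int) set \<Rightarrow> (('k::field, 'm::len0, 'n::len0) glc \<Rightarrow> 'k) set"
  where "ker_pi \<Gamma> = {\<xi> \<in> Dist. pi_trunc \<Gamma> \<xi> = 0}"

end

theory Submission
 imports "HOL-Computational_Algebra.Formal_Power_Series"
  "Jordan_Normal_Form.Determinant" Defs
begin

text \<open>A linear form \<open>\<xi>\<close> on \<open>K[G]\<close> acts as zero on a supermodule \<open>W\<close> iff it annihilates all
 matrix coefficients \<open>\<Sum> \<theta>(v\<^sub>1) v\<^sub>2\<close> of \<open>W\<close>. Those of \<open>W(lam)\<close> lie in the truncation: a highest
 weight \<open>\<mu>\<close> of a simple subquotient is at most \<open>lam\<close> and yields, by Frobenius reciprocity, an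
 embedding of the subquotient into \<open>H\<^sup>0\<^sub>-(\<mu>)\<close>.
 Conversely, let \<open>lam\<close> be a highest weight of the module generated by an element \<open>f\<close> of the
 truncation. Its vectors of weight \<open>lam\<close> are matrix coefficients of a highest weight vector of
 \<open>W(lam)\<close>, by the universal property of \<open>V\<^sub>-(lam)\<close> and since distributions separate functions;
 the forms dual to them map \<open>f\<close> to elements of \<open>H\<^sup>0\<^sub>-(lam)\<close>, which lift to \<open>W(lam)\<close>. As the weight
 \<open>lam\<close> has multiplicity one in \<open>W(lam)\<close>, subtracting a combination of matrix coefficients removes
 \<open>lam\<close> from the weights of \<open>f\<close>, and induction on the weights applies.\<close>

text \<open>The Weyl supermodule is given only through \<open>Dist\<close>, so its universal
  property yields statements about distributions, whereas matrix coefficients are tested by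
  arbitrary linear forms. The gap is closed by showing that the powers of the augmentation ideal of
  K[G] have zero intersection; a function outside a finite-dimensional subspace is then detected by
  a distribution that kills the subspace. Koszul signs are kept out: the working operations
  \<open>ract\<close>, \<open>tau\<close> and \<open>convu\<close> contract coactions without signs,
  and on homogeneous vectors \<open>act\<close> vanishes exactly when \<open>ract\<close> does. The
  induction on weights meets an obstacle: each subtraction may introduce new smaller weights, and
  dominant weights can descend forever along odd roots. Weights are therefore compared first by
  their degree in the first block and then by the pairing with the sum of the positive even roots,
  which is non-negative on dominant weights. The functional is shown to vanish on one weight
  component at a time: once all degrees are below that of the chosen component, nothing is left to
  show.\<close>

abbreviation "pkeys \<equiv> Poly_Mapping.keys"
abbreviation "plookup \<equiv> Poly_Mapping.lookup"
abbreviation "psingle \<equiv> Poly_Mapping.single"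

section \<open>Linear forms and tensors\<close>

definition lf :: "('k::field => 'v => 'v) => ('v::ab_group_add => 'k) => bool"
 where "lf s \<phi> \<longleftrightarrow> (ALL x y. \<phi> (x + y) = \<phi> x + \<phi> y) & (ALL c x. \<phi> (s c x) = c * \<phi> x)"

lemma lf_add: "lf s \<phi> ==> \<phi> (x + y) = \<phi> x + \<phi> y"
 and lf_scale: "lf s \<phi> ==> \<phi> (s c x) = c * \<phi> x"
 by (auto simp: lf_def)

lemma lf_zero: "lf s \<phi> ==> \<phi> 0 = 0"
 using lf_scale[of s \<phi> 0 0] lf_add[of s \<phi> 0 0] by (metis add_cancel_right_right add_0_right)

lemma lf_minus: "lf s \<phi> ==> \<phi> (- x) = - \<phi> x"
 using lf_add[of s \<phi> x "- x"] lf_zero[of s \<phi>] by (simp add: eq_neg_iff_add_eq_0 add.commute)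

lemma lf_diff: "lf s \<phi> ==> \<phi> (x - y) = \<phi> x - \<phi> y"
 using lf_add[of s \<phi> x "- y"] by (simp add: lf_minus)

lemma lf_sum: "lf s \<phi> ==> \<phi> (sum f S) = (\<Sum>i\<in>S. \<phi> (f i))"
 by (induction S rule: infinite_finite_induct) (simp_all add: lf_zero lf_add)

lemma lf_sum_list: "lf s \<phi> ==> \<phi> (sum_list (map f xs)) = sum_list (map (%x. \<phi> (f x)) xs)"
 by (induction xs) (simp_all add: lf_zero lf_add)

lemma lf_plus: "lf s f ==> lf s g ==> lf s (%x. f x + g x)"
 by (auto simp: lf_def algebra_simps)

lemma lf_cmult: "lf s f ==> lf s (%x. c * f x)"
 by (auto simp: lf_def algebra_simps)

lemma lf_multc: "lf s f ==> lf s (%x. f x * c)"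
 by (auto simp: lf_def algebra_simps)

lemma lf_const0: "lf s (%x. 0)"
 by (auto simp: lf_def)

lemma lf_setsum: "(!!i. i \<in> S ==> lf s (f i)) ==> lf s (%x. \<Sum>i\<in>S. f i x)"
 by (induction S rule: infinite_finite_induct) (simp_all add: lf_const0 lf_plus)

lemma linear_lf: "vector_space s ==> Vector_Spaces.linear s (*) \<phi> \<longleftrightarrow> lf s \<phi>"
proof -
 assume "vector_space s"
 then interpret vector_space_pair s "(*) :: 'a => 'a => 'a"
  by (auto simp: vector_space_pair_def vector_space_def algebra_simps)
 show ?thesis using \<open>vector_space s\<close> vs2.vector_space_axioms by (auto simp: Vector_Spaces.linear_iff lf_def)
qed

lemma bilin_iff: "vector_space sv ==> vector_space sw ==>
  bilin sv sw b \<longleftrightarrow> (ALL v. lf sw (b v)) & (ALL w. lf sv (%v. b v w))"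
 by (simp add: bilin_def linear_lf)

lemma bilinD:
 assumes "bilin sv sw b" "vector_space sv" "vector_space sw"
 shows bilin_lf_right: "lf sw (b v)" and bilin_lf_left: "lf sv (%v. b v w)"
  and bilin_add_left: "b (v + v') w = b v w + b v' w"
  and bilin_add_right: "b v (w + w') = b v w + b v w'"
  and bilin_diff_left: "b (v - v') w = b v w - b v' w"
  and bilin_diff_right: "b v (w - w') = b v w - b v w'"
  and bilin_minus_left: "b (- v) w = - b v w"
  and bilin_minus_right: "b v (- w) = - b v w"
  and bilin_scale_left: "b (sv c v) w = c * b v w"
  and bilin_scale_right: "b v (sw c w) = c * b v w"
  and bilin_zero_left: "b 0 w = 0"
  and bilin_zero_right: "b v 0 = 0"
proof -
 have *: "lf sw (b v)" "lf sv (%v. b v w)" for v w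
  using assms by (auto simp: bilin_iff)
 show "lf sw (b v)" "lf sv (%v. b v w)" by (fact *)+
 show "b (v + v') w = b v w + b v' w" "b (v - v') w = b v w - b v' w" "b (- v) w = - b v w"
  "b (sv c v) w = c * b v w" "b 0 w = 0"
  using lf_add[OF *(2)] lf_diff[OF *(2)] lf_minus[OF *(2)] lf_scale[OF *(2)] lf_zero[OF *(2)] by auto
 show "b v (w + w') = b v w + b v w'" "b v (w - w') = b v w - b v w'" "b v (- w) = - b v w"
  "b v (sw c w) = c * b v w" "b v 0 = 0"
  using lf_add[OF *(1)] lf_diff[OF *(1)] lf_minus[OF *(1)] lf_scale[OF *(1)] lf_zero[OF *(1)] by auto
qed

lemma bilin_prod:
 "vector_space sv ==> vector_space sw ==> lf sv g ==> lf sw h ==> bilin sv sw (%v w. g v * h w)"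
 by (auto simp: bilin_iff intro: lf_cmult lf_multc)

lemma vector_space_fscale: "vector_space (fscale :: 'k::field => ('x => 'k) => _)"
 by standard (auto simp: fscale_def fun_eq_iff algebra_simps)

lemma lf_extend:
 assumes "vector_space s" "module.subspace s U" "e \<notin> U"
 obtains \<phi> where "lf s \<phi>" "!!u. u \<in> U ==> \<phi> u = 0" "\<phi> e = 1"
proof -
 interpret vector_space_pair s "(*) :: 'a => 'a => 'a"
  using assms(1) by (auto simp: vector_space_pair_def vector_space_def algebra_simps)
 obtain B where B: "B \<subseteq> U" "vs1.independent B" "U \<subseteq> vs1.span B"
  using vs1.maximal_independent_subset by metis
 have "vs1.span B \<subseteq> U"
  using B(1) assms(2) by (rule vs1.span_minimal)
 hence e: "e \<notin> vs1.span B" using assms(3) by auto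
 hence ind: "vs1.independent (insert e B)"
  using B(2) by (simp add: vs1.independent_insertI)
 obtain g where g: "Vector_Spaces.linear s (*) g" "ALL x:insert e B. g x = (if x = e then 1 else 0)"
  using linear_independent_extend[OF ind, of "%x. if x = e then 1 else 0"] by auto
 have eB: "e \<notin> B" using e by (auto intro: vs1.span_base)
 have "g u = 0" if "u \<in> U" for u
 proof -
  have "u \<in> vs1.span B" using that B by auto
  moreover have "ALL x:B. g x = 0" using g eB by auto
  ultimately show ?thesis
   using linear_eq_0_on_span[OF g(1)] by auto
 qed
 thus ?thesis using that[of g] g linear_lf[OF assms(1)] by auto
qed

lemma lf_separate:
 assumes "vector_space s" "!!\<phi>. lf s \<phi> ==> \<phi> u = \<phi> v"
 shows "u = v"
proof (rule ccontr)
 assume ne: "u ~= v"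
 interpret vector_space s by fact
 have "module.subspace s {0}" by (rule subspace_single_0)
 moreover have "u - v \<notin> {0}" using ne by auto
 ultimately obtain \<phi> where "lf s \<phi>" "\<phi> (u - v) = 1"
  using lf_extend[OF assms(1)] by blast
 thus False using assms(2)[of \<phi>] by (simp add: lf_diff)
qed

text \<open>A basis of \<open>U\<close> is extended to the whole space; its members go to 0 and the
  added vectors are fixed. A form composed with \<open>p\<close> vanishes on \<open>U\<close>, so
  forms on a quotient are obtained without forming quotient spaces.\<close>

lemma subspace_projection:
 assumes "vector_space s" "module.subspace s U"
 obtains p where "Vector_Spaces.linear s s p" "!!u. u \<in> U ==> p u = 0" "!!v. p v - v \<in> U"
proof -
 interpret vector_space_pair s s
  using assms(1) by (auto simp: vector_space_pair_def)
 obtain B where B: "B \<subseteq> U" "vs1.independent B" "U \<subseteq> vs1.span B"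
  using vs1.maximal_independent_subset by metis
 obtain C where C: "B \<subseteq> C" "vs1.independent C" "UNIV \<subseteq> vs1.span C"
  using vs1.maximal_independent_subset_extend[OF _ B(2), of UNIV] by auto
 obtain p where p: "Vector_Spaces.linear s s p" "ALL x:C. p x = (if x \<in> B then 0 else x)"
  using linear_independent_extend[OF C(2), of "%x. if x \<in> B then 0 else x"] by auto
 interpret p: Vector_Spaces.linear s s p by fact
 have z: "p u = 0" if "u \<in> U" for u
 proof -
  have "u \<in> vs1.span B" using that B by auto
  moreover have "ALL x:B. p x = 0" using p C by auto
  ultimately show ?thesis
   using linear_eq_0_on_span[OF p(1)] by auto
 qed
 have "p v - v \<in> U" for v
 proof -
  have "v \<in> vs1.span C" using C by auto
  thus ?thesis
  proof (rule vs1.span_induct)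
   show "p x - x \<in> U" if "x \<in> C" for x
    using that p(2) B(1) vs1.subspace_neg[OF assms(2), of x]
    by (auto simp: vs1.subspace_0[OF assms(2)])
  next
   show "vs1.subspace {v. p v - v \<in> U}"
   proof (rule vs1.subspaceI)
    show "0 \<in> {a. p a - a \<in> U}" by (simp add: vs1.subspace_0[OF assms(2)] p.zero)
    show "x + y \<in> {a. p a - a \<in> U}" if "x \<in> {a. p a - a \<in> U}" "y \<in> {a. p a - a \<in> U}" for x y
     using vs1.subspace_add[OF assms(2), of "p x - x" "p y - y"] that
     by (simp add: p.add algebra_simps)
    show "s c x \<in> {a. p a - a \<in> U}" if "x \<in> {a. p a - a \<in> U}" for c x
     using vs1.subspace_scale[OF assms(2), of "p x - x" c] that
     by (simp add: p.scale vs1.scale_right_diff_distrib)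
   qed
  qed
 qed
 thus ?thesis using that p(1) z by blast
qed

section \<open>Tensors as functionals on bilinear forms\<close>

lemma sum_fun_apply: "(\<Sum>i\<in>S. F i) x = (\<Sum>i\<in>S. F i x)" for F :: "'i => 'x => 'k::comm_monoid_add"
 by (induction S rule: infinite_finite_induct) auto

lemma tens_apply: "bilin sv sw b ==> tens sv sw v w b = b v w"
 by (simp add: tens_def)

text \<open>The second hypothesis lets the coefficients of a linear combination be absorbed into the
  left factors. A tensor thus becomes a bare list of pairs, and its value at a bilinear form a sum
  over that list.\<close>

lemma tens_space_span:
 fixes sv :: "'k::field => 'v::ab_group_add => 'v" and sw :: "'k => 'w::ab_group_add => 'w"
 assumes "t \<in> module.span fscale {tens sv sw v w | v w. P v w}"
  and scl: "!!c v w. P v w ==> P (sv c v) w" and "vector_space sv" "vector_space sw"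
 obtains xs where "!!v w. (v, w) \<in> set xs ==> P v w"
  "t = (\<Sum>(v, w)\<leftarrow>xs. tens sv sw v w)"
proof -
 interpret F: vector_space "fscale :: 'k => (('v => 'w => 'k) => 'k) => _" by (rule vector_space_fscale)
 have "EX xs. (ALL v w. (v, w) \<in> set xs --> P v w) & t = (\<Sum>(v, w)\<leftarrow>xs. tens sv sw v w)"
  using assms(1)
 proof (induction rule: F.span_induct_alt)
  case base
  show ?case by (rule exI[of _ "[]"]) auto
 next
  case (step c x y)
  then obtain v w xs where *: "x = tens sv sw v w" "P v w"
   "ALL v w. (v, w) \<in> set xs --> P v w" "y = (\<Sum>(v, w)\<leftarrow>xs. tens sv sw v w)"
   by auto
  have "fscale c x = tens sv sw (sv c v) w"
   using assms(3,4) * by (auto simp: tens_def fscale_def fun_eq_iff bilin_scale_left)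
  thus ?case
   using * scl by (intro exI[of _ "(sv c v, w) # xs"]) auto
 qed
 thus ?thesis using that by blast
qed

lemma tens_space_rep:
 assumes "t \<in> tens_space sv sw V W" "module.subspace sv V" "vector_space sv" "vector_space sw"
 obtains xs where "set xs \<subseteq> V \<times> W" "t = (\<Sum>(v, w)\<leftarrow>xs. tens sv sw v w)"
proof -
 interpret vector_space sv by fact
 obtain xs where "!!v w. (v, w) \<in> set xs ==> v \<in> V & w \<in> W"
  "t = (\<Sum>(v, w)\<leftarrow>xs. tens sv sw v w)"
  by (rule tens_space_span[OF assms(1)[unfolded tens_space_def] _ assms(3,4)])
   (use subspace_scale[OF assms(2)] in auto)
 thus ?thesis using that[of xs] by (metis mem_Sigma_iff subrelI)
qed

lemma sum_list_fun_apply: "(\<Sum>i\<leftarrow>xs. F i) x = (\<Sum>i\<leftarrow>xs. F i x)" for F :: "'i => 'x => 'k::comm_monoid_add"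
 by (induction xs) auto

lemma tens_list_apply:
 "bilin sv sw b ==> (\<Sum>(v, w)\<leftarrow>xs. tens sv sw v w) b = (\<Sum>(v, w)\<leftarrow>xs. b v w)"
 by (simp add: sum_list_fun_apply split_def tens_apply cong: map_cong)

lemma tens_list_apply_non:
 "~ bilin sv sw b ==> (\<Sum>(v, w)\<leftarrow>xs. tens sv sw v w) b = 0"
 by (induction xs) (auto simp: tens_def)

text \<open>A finite family of vectors is expanded in a basis of its span, so that a tensor
 is determined by its values on products of linear forms.\<close>

lemma tens_list_eq_0:
 fixes xs :: "('v::ab_group_add \<times> 'w::ab_group_add) list"
 assumes vs: "vector_space sv" "vector_space sw"
  and z: "!!g h. lf sv g ==> lf sw h ==> (\<Sum>(v, w)\<leftarrow>xs. g v * h w) = 0"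
  and b: "bilin sv sw b"
 shows "(\<Sum>(v, w)\<leftarrow>xs. b v w) = 0"
proof -
 interpret V: vector_space sv by fact
 interpret W: vector_space sw by fact
 interpret vector_space_pair sv "(*) :: 'a => 'a => 'a"
  using vs(1) by (auto simp: vector_space_pair_def vector_space_def algebra_simps)
 obtain B where B: "V.independent B" "UNIV \<subseteq> V.span B"
  using V.maximal_independent_subset[of UNIV] by auto
 define r where "r = V.representation B"
 have r: "lf sv (%v. r v c)" for c
  using V.linear_representation[OF B(1)] B(2) linear_lf[OF vs(1)]
  unfolding r_def by (simp add: subset_eq linear_lf[OF vs(1)] lf_def V.representation_add V.representation_scale B)
 define C where "C = (\<Union>v\<in>fst ` set xs. {c. r v c ~= 0})"
 have finC: "finite C" unfolding C_def r_def by (auto simp: V.finite_representation)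
 have expand: "v = (\<Sum>c\<in>C. sv (r v c) c)" if "v \<in> fst ` set xs" for v
 proof -
  have "v = (\<Sum>c | r v c ~= 0. sv (r v c) c)"
   unfolding r_def using V.sum_nonzero_representation_eq[OF B(1), of v, symmetric] B(2) by blast
  also have "... = (\<Sum>c\<in>C. sv (r v c) c)"
   by (rule sum.mono_neutral_left) (use that finC in \<open>auto simp: C_def\<close>)
  finally show ?thesis .
 qed
 have b1: "lf sw (b v)" and b2: "lf sv (%v. b v w)" for v w
  using b vs by (auto simp: bilin_iff)
 define y where "y c = (\<Sum>(v, w)\<leftarrow>xs. sw (r v c) w)" for c
 have y0: "y c = 0" for c
 proof (rule lf_separate[OF vs(2)])
  fix h assume h: "lf sw h"
  have "h (y c) = (\<Sum>(v, w)\<leftarrow>xs. r v c * h w)"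
   unfolding y_def by (simp add: lf_sum_list[OF h] split_def lf_scale[OF h])
  thus "h (y c) = h 0"
   using z[OF r h] by (simp add: lf_zero[OF h])
 qed
 have "(\<Sum>(v, w)\<leftarrow>xs. b v w) = (\<Sum>(v, w)\<leftarrow>xs. \<Sum>c\<in>C. r v c * b c w)"
 proof (rule arg_cong[where f = sum_list], rule map_cong[OF refl], clarify)
  fix v w assume vw: "(v, w) \<in> set xs"
  hence "v \<in> fst ` set xs" by force
  from arg_cong[OF expand[OF this], of "%v. b v w"]
  show "b v w = (\<Sum>c\<in>C. r v c * b c w)"
   by (simp add: lf_sum[OF b2] lf_scale[OF b2])
 qed
 also have "... = (\<Sum>c\<in>C. \<Sum>(v, w)\<leftarrow>xs. r v c * b c w)"
  by (induction xs) (auto simp: sum.distrib)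
 also have "... = (\<Sum>c\<in>C. b c (y c))"
  unfolding y_def by (simp add: lf_sum_list[OF b1] split_def lf_scale[OF b1])
 also have "... = 0" by (simp add: y0 lf_zero[OF b1])
 finally show ?thesis .
qed

text \<open>Project away from \<open>I\<close> by \<open>p\<close> and from \<open>J\<close> by
  \<open>q\<close>. Modulo the two subspaces \<open>t\<close> does not change, and the projected
  tensor is zero: a product of forms \<open>g\<close>, \<open>h\<close> takes on it the value of
  \<open>t\<close> at the forms \<open>g\<close> after \<open>p\<close> and \<open>h\<close> after
  \<open>q\<close>, which vanish on \<open>I\<close> and \<open>J\<close>. By this duality the
  containments in the definitions of induced modules and weight spaces become identities between
  linear forms.\<close>

lemma tensor_duality:
 fixes sv :: "'k::field => 'v::ab_group_add => 'v" and sw :: "'k => 'w::ab_group_add => 'w"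
 assumes vs: "vector_space sv" "vector_space sw"
  and sub: "module.subspace sv I" "module.subspace sw J"
  and t: "t \<in> tens_space sv sw UNIV UNIV"
  and z: "!!g h. lf sv g ==> lf sw h ==> (!!v. v \<in> I ==> g v = 0) ==> (!!w. w \<in> J ==> h w = 0)
    ==> t (%v w. g v * h w) = 0"
 shows "t \<in> module.span fscale (tens_space sv sw I UNIV \<union> tens_space sv sw UNIV J)"
proof -
 interpret F: vector_space "fscale :: 'k => (('v => 'w => 'k) => 'k) => _" by (rule vector_space_fscale)
 interpret V: vector_space sv by fact
 interpret W: vector_space sw by fact
 let ?S = "F.span (tens_space sv sw I UNIV \<union> tens_space sv sw UNIV J)"
 obtain xs where xs: "t = (\<Sum>(v, w)\<leftarrow>xs. tens sv sw v w)"
  using tens_space_rep[OF t V.subspace_UNIV vs] by blast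
 obtain p where p: "Vector_Spaces.linear sv sv p" "!!u. u \<in> I ==> p u = 0" "!!v. p v - v \<in> I"
  using subspace_projection[OF vs(1) sub(1)] by blast
 obtain q where q: "Vector_Spaces.linear sw sw q" "!!u. u \<in> J ==> q u = 0" "!!v. q v - v \<in> J"
  using subspace_projection[OF vs(2) sub(2)] by blast
 interpret p: Vector_Spaces.linear sv sv p by fact
 interpret q: Vector_Spaces.linear sw sw q by fact
 have bil: "bilin sv sw (%v w. g v * h w)" if "lf sv g" "lf sw h" for g h
  using that by (auto simp: bilin_iff[OF vs] intro: lf_cmult lf_multc)
 have "(\<Sum>(v, w)\<leftarrow>xs. tens sv sw (p v) (q w)) = 0"
 proof
  fix b
  show "(\<Sum>(v, w)\<leftarrow>xs. tens sv sw (p v) (q w)) b = 0 b"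
  proof (cases "bilin sv sw b")
   case False
   thus ?thesis by (induction xs) (auto simp: tens_def)
  next
   case True
   have "(\<Sum>(v, w)\<leftarrow>map (%(v, w). (p v, q w)) xs. b v w) = 0"
   proof (rule tens_list_eq_0[OF vs _ True])
    fix g h assume gh: "lf sv g" "lf sw h"
    have gp: "lf sv (%v. g (p v))" and hq: "lf sw (%v. h (q v))"
     using gh by (auto simp: lf_def p.add p.scale q.add q.scale)
    have "t (%v w. g (p v) * h (q w)) = 0"
     by (rule z[OF gp hq]) (auto simp: p q lf_zero[OF gh(1)] lf_zero[OF gh(2)])
    thus "(\<Sum>(v, w)\<leftarrow>map (%(v, w). (p v, q w)) xs. g v * h w) = 0"
     unfolding xs using tens_list_apply[OF bil[OF gp hq], of xs] by (simp add: split_def o_def)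
   qed
   thus ?thesis
    by (simp add: sum_list_fun_apply split_def tens_apply[OF True] o_def)
  qed
 qed
 \<comment> \<open>The difference passes through the tensor of \<open>p v\<close> and
   \<open>w\<close>: the first summand has its left factor in \<open>I\<close>, the second its right
   factor in \<open>J\<close>.\<close>
 moreover have d: "tens sv sw v w - tens sv sw (p v) (q w) \<in> ?S" for v w
 proof -
  have e1: "tens sv sw v w - tens sv sw (p v) w = - tens sv sw (p v - v) w"
   by (auto simp: fun_eq_iff tens_def bilin_diff_left[OF _ vs])
  have e2: "tens sv sw (p v) w - tens sv sw (p v) (q w) = - tens sv sw (p v) (q w - w)"
   by (auto simp: fun_eq_iff tens_def bilin_diff_right[OF _ vs])
  have "tens sv sw (p v - v) w \<in> ?S"
   by (rule F.span_base, rule UnI1) (use p(3) in \<open>auto simp: tens_space_def intro!: F.span_base\<close>)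
  moreover have "tens sv sw (p v) (q w - w) \<in> ?S"
   by (rule F.span_base, rule UnI2) (use q(3)[of w] in \<open>unfold tens_space_def, intro F.span_base, blast\<close>)
  ultimately have "- tens sv sw (p v - v) w + - tens sv sw (p v) (q w - w) \<in> ?S"
   by (intro F.span_add F.span_neg)
  thus ?thesis unfolding e1[symmetric] e2[symmetric] by simp
 qed
 have "(\<Sum>(v, w)\<leftarrow>ys. tens sv sw v w) - (\<Sum>(v, w)\<leftarrow>ys. tens sv sw (p v) (q w)) \<in> ?S" for ys
 proof (induction ys)
  case (Cons y ys)
  obtain v w where y: "y = (v, w)" by force
  have add4: "a - b + (c - e) = a + c - (b + e)" for a b c e :: "('v => 'w => 'k) => 'k"
   by (simp only: algebra_simps)
  show ?case
   using F.span_add[OF d[of v w] Cons.IH] by (simp only: y list.map sum_list.Cons split add4)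
 next
  case Nil
  show ?case using F.span_zero by (simp only: list.map sum_list.Nil diff_0_right)
 qed
 from this[of xs] show ?thesis using calculation xs by simp
qed

lemma tensor_duality_left:
 fixes sv :: "'k::field => 'v::ab_group_add => 'v" and sw :: "'k => 'w::ab_group_add => 'w"
 assumes vs: "vector_space sv" "vector_space sw" and sub: "module.subspace sv I"
  and t: "t \<in> tens_space sv sw UNIV UNIV"
  and z: "!!g h. lf sv g ==> lf sw h ==> (!!v. v \<in> I ==> g v = 0) ==> t (%v w. g v * h w) = 0"
 shows "t \<in> tens_space sv sw I UNIV"
proof -
 interpret F: vector_space "fscale :: 'k => (('v => 'w => 'k) => 'k) => _" by (rule vector_space_fscale)
 interpret V: vector_space sv by fact
 interpret W: vector_space sw by fact
 have "t \<in> F.span (tens_space sv sw I UNIV \<union> tens_space sv sw UNIV {0})"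
  by (rule tensor_duality[OF vs sub _ t]) (auto intro: z)
 also have "tens sv sw v 0 = 0" for v
  by (auto simp: fun_eq_iff tens_def bilin_zero_right[OF _ vs])
 hence "{tens sv sw v w | v w. v \<in> UNIV & w \<in> {0}} \<subseteq> {0}" by auto
 hence "tens_space sv sw UNIV {0} \<subseteq> {0}"
  unfolding tens_space_def by (rule F.span_minimal) simp
 hence "F.span (tens_space sv sw I UNIV \<union> tens_space sv sw UNIV {0}) \<subseteq> tens_space sv sw I UNIV"
  by (intro F.span_minimal) (auto simp: tens_space_def F.span_zero)
 finally show ?thesis .
qed

section \<open>The coordinate superalgebra\<close>

definition word_elt :: "glgen list => ('k::field,'m::len0,'n::len0) glc"
 where "word_elt xs = prod_list (map glc_gen xs)"

lemma word_elt_Nil [simp]: "word_elt [] = 1"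
 and word_elt_Cons [simp]: "word_elt (x # xs) = glc_gen x * word_elt xs"
 by (simp_all add: word_elt_def)

lemma abs_rep_glc [simp]: "abs_glc (rep_glc a) = a"
 using Quotient3_abs_rep[OF Quotient3_glc] .

lemma abs_glc_eq_iff:
 "(abs_glc f :: ('k::field,'m::len0,'n::len0) glc) = abs_glc g \<longleftrightarrow>
  f - g \<in> ideal_gen (gl_rels LENGTH('m) LENGTH('n))"
 using glc.abs_eq_iff by blast

lemma abs_glc_add: "abs_glc (f + g) = abs_glc f + abs_glc g"
 by (simp add: plus_glc.abs_eq)

lemma abs_glc_mult: "abs_glc (f * g) = abs_glc f * abs_glc g"
 by (simp add: times_glc.abs_eq)

lemma abs_glc_zero: "abs_glc 0 = 0" and abs_glc_one: "abs_glc 1 = 1"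
 by (simp_all add: zero_glc_def one_glc_def)

lemma abs_glc_const: "abs_glc (psingle 0 c) = glc_const c"
 by (simp add: glc_const.abs_eq)

lemma abs_glc_fgen: "abs_glc (fgen x) = glc_gen x"
 by (simp add: glc_gen.abs_eq)

lemma glc_const_add: "glc_const (c + d) = glc_const c + glc_const d"
 by transfer (simp add: single_add ideal_gen.zero)

lemma glc_const_mult: "glc_const (c * d) = glc_const c * glc_const d"
 by transfer (simp add: mult_single ideal_gen.zero)

lemma glc_const_one: "glc_const 1 = 1"
 by transfer (simp add: ideal_gen.zero)

lemma glc_const_central: "glc_const c * a = a * glc_const c"
proof (transfer, goal_cases)
 case (1 c a)
 show ?case by (subst single_zero_central) (simp add: ideal_gen.zero)
qed

interpretation glc_eval: free_eval_hom "glc_const :: 'k::field => ('k, 'm::len0, 'n::len0) glc"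
 by standard (rule glc_const_add glc_const_mult glc_const_one glc_const_central)+

abbreviation scA :: "'k => ('k::field,'m::len0,'n::len0) glc => ('k,'m,'n) glc"
 where "scA \<equiv> glc_scale"

lemma vs_glc: "vector_space (scA :: 'k::field => ('k, 'm::len0, 'n::len0) glc => _)"
 by standard
  (simp_all add: glc_scale_def glc_const_add glc_const_mult glc_const_one distrib_left distrib_right mult.assoc)

interpretation glc: vector_space "scA :: 'k::field => ('k, 'm::len0, 'n::len0) glc => _"
 by (rule vs_glc)

lemma glc_scale_mult_left: "scA c a * b = scA c (a * b)"
 by (simp add: glc_scale_def mult.assoc)

lemma glc_scale_mult_right: "a * scA c b = scA c (a * b)"
 by (simp only: glc_scale_def mult.assoc[symmetric] glc_const_central[of c a])

lemma poly_mapping_sum_single: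
 fixes f :: "'a \<Rightarrow>\<^sub>0 'b::comm_monoid_add"
 shows "f = (\<Sum>w\<in>pkeys f. psingle w (plookup f w))"
proof (rule poly_mapping_eqI)
 fix v
 have "(\<Sum>w\<in>pkeys f. if w = v then plookup f w else 0) = plookup f v"
  by (subst sum.delta) (auto simp: in_keys_iff)
 thus "plookup f v = plookup
   (\<Sum>w\<in>pkeys f. psingle w (plookup f w)) v"
  by (simp only: lookup_sum lookup_single when_def)
qed

lemma abs_glc_sum: "abs_glc (sum F S) = (\<Sum>i\<in>S. abs_glc (F i))"
 by (induction S rule: infinite_finite_induct) (simp_all add: abs_glc_zero abs_glc_add)

lemma abs_glc_single_one:
 "abs_glc (psingle w 1) = (word_elt (letters w) :: ('k::field,'m::len0,'n::len0) glc)"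
proof -
 have "abs_glc (psingle (FMon xs) 1) = (word_elt xs :: ('k,'m,'n) glc)" for xs
 proof (induction xs)
  case Nil
  have "psingle (FMon []) 1 = (1 :: (glgen, 'k) free_alg)"
   by (metis single_one zero_fmon_def)
  thus ?case by (simp only: abs_glc_one word_elt_Nil)
 next
  case (Cons x xs)
  have "psingle (FMon (x # xs)) 1 = fgen x * (psingle (FMon xs) 1 :: (glgen, 'k) free_alg)"
   by (simp add: fgen_def mult_single plus_fmon_def)
  thus ?case using Cons by (metis abs_glc_mult abs_glc_fgen word_elt_Cons)
 qed
 from this[of "letters w"] show ?thesis by simp
qed

lemma abs_glc_single: "abs_glc (psingle w c) = scA c (word_elt (letters w))"
proof -
 have "psingle w c = psingle 0 c * psingle w (1::'a)"
  by (simp add: mult_single)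
 thus ?thesis
  by (simp add: abs_glc_mult abs_glc_const abs_glc_single_one glc_scale_def)
qed

lemma abs_glc_expand: "abs_glc f =
  (\<Sum>w\<in>pkeys f. scA (plookup f w) (word_elt (letters w)))"
 using arg_cong[OF poly_mapping_sum_single[of f], of abs_glc] by (simp only: abs_glc_sum abs_glc_single)

definition word_in_range :: "nat => glgen list => bool"
 where "word_in_range N xs \<longleftrightarrow> (ALL x:set xs. case x of GenC i j => i < N & j < N | GenD i j => i < N & j < N)"

lemma word_in_range_Nil [simp]: "word_in_range N []"
 and word_in_range_Cons: "word_in_range N (x # xs) \<longleftrightarrow> word_in_range N [x] & word_in_range N xs"
 by (auto simp: word_in_range_def)

lemma glc_gen_out_of_range:
 assumes "~ word_in_range (LENGTH('m) + LENGTH('n)) [x]"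
 shows "glc_gen x = (0 :: ('k::field,'m::len0,'n::len0) glc)"
proof -
 have "fgen x \<in> (gl_rels LENGTH('m) LENGTH('n) :: (glgen, 'k) free_alg set)"
  using assms by (cases x) (auto simp: word_in_range_def intro: gl_rels.intros)
 hence "(abs_glc (fgen x) :: ('k,'m,'n) glc) = abs_glc 0"
  by (simp add: abs_glc_eq_iff ideal_gen_base)
 thus ?thesis by (simp add: abs_glc_fgen abs_glc_zero)
qed

lemma word_elt_out_of_range:
 "~ word_in_range (LENGTH('m) + LENGTH('n)) xs ==> word_elt xs = (0 :: ('k::field,'m::len0,'n::len0) glc)"
proof (induction xs)
 case (Cons x xs)
 thus ?case
  using glc_gen_out_of_range[of x, where ?'k = 'k and ?'m = 'm and ?'n = 'n] word_in_range_Cons[of "LENGTH('m) + LENGTH('n)" x xs] by auto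
qed simp

text \<open>Words span the superalgebra, and a word with a letter out of range is zero. Identities
  that are linear in \<open>a\<close> therefore only have to be checked on words in range.\<close>

lemma glc_word_induct [case_names subspace word]:
 fixes a :: "('k::field,'m::len0,'n::len0) glc"
 assumes sub: "glc.subspace S"
  and "!!xs. word_in_range (LENGTH('m) + LENGTH('n)) xs ==> word_elt xs \<in> S"
 shows "a \<in> S"
proof -
 have w: "word_elt xs \<in> S" for xs
  using assms(2)[of xs] word_elt_out_of_range[of xs, where ?'k = 'k and ?'m = 'm and ?'n = 'n] glc.subspace_0[OF sub]
  by (cases "word_in_range (LENGTH('m) + LENGTH('n)) xs") auto
 have "abs_glc (rep_glc a) \<in> S"
  unfolding abs_glc_expand by (intro glc.subspace_sum[OF sub] glc.subspace_scale[OF sub] w)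
 thus ?thesis by simp
qed

lemma lf_subspace_eq: "lf scA g ==> lf scA h ==>
  glc.subspace {a :: ('k::field,'m::len0,'n::len0) glc. g a = h a}"
 by (rule glc.subspaceI) (auto simp: lf_zero lf_add lf_scale)

lemma lf_eq_on_words:
 fixes a :: "('k::field,'m::len0,'n::len0) glc"
 assumes "lf scA g" "lf scA h"
  "!!xs. word_in_range (LENGTH('m) + LENGTH('n)) xs ==> g (word_elt xs) = h (word_elt xs)"
 shows "g a = h a"
 using glc_word_induct[OF lf_subspace_eq[OF assms(1,2)], of a] assms(3) by auto

lemma glc_gen_comm:
 fixes x y :: glgen
 shows "glc_gen x * glc_gen y = psign (gen_par LENGTH('m) x) (gen_par LENGTH('m) y)
  * (glc_gen y * (glc_gen x :: ('k::field,'m::len0,'n::len0) glc))"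
proof -
 have "(fgen x * fgen y - psign (gen_par LENGTH('m) x) (gen_par LENGTH('m) y) * (fgen y * fgen x) :: (glgen, 'k) free_alg)
   \<in> ideal_gen (gl_rels LENGTH('m) LENGTH('n))"
  by (intro ideal_gen_base gl_rels.intros)
 hence *: "(abs_glc (fgen x * fgen y) :: ('k,'m,'n) glc) =
   abs_glc (psign (gen_par LENGTH('m) x) (gen_par LENGTH('m) y) * (fgen y * fgen x))"
  by (simp only: abs_glc_eq_iff)
 have ps: "(abs_glc (psign p q) :: ('k,'m,'n) glc) = psign p q" for p q
  by (auto simp: psign_def abs_glc_one uminus_glc.abs_eq[symmetric])
 show ?thesis using * by (simp add: abs_glc_mult abs_glc_fgen ps)
qed

lemma glc_inverse_right:
 assumes "i < LENGTH('m) + LENGTH('n)" "j < LENGTH('m) + LENGTH('n)"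
 shows "(\<Sum>k<LENGTH('m) + LENGTH('n). cc i k * dd k j) = (of_bool (i = j) :: ('k::field,'m::len0,'n::len0) glc)"
proof -
 have "((\<Sum>k<LENGTH('m) + LENGTH('n). fgen (GenC i k) * fgen (GenD k j)) - of_bool (i = j) :: (glgen, 'k) free_alg)
   \<in> ideal_gen (gl_rels LENGTH('m) LENGTH('n))"
  by (intro ideal_gen_base gl_rels.intros assms)
 hence "(abs_glc (\<Sum>k<LENGTH('m) + LENGTH('n). fgen (GenC i k) * fgen (GenD k j)) :: ('k,'m,'n) glc)
   = abs_glc (of_bool (i = j))"
  by (simp only: abs_glc_eq_iff)
 thus ?thesis
  by (cases "i = j") (simp_all add: abs_glc_sum abs_glc_mult abs_glc_fgen abs_glc_one abs_glc_zero)
qed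

lemma glc_inverse_left:
 assumes "i < LENGTH('m) + LENGTH('n)" "j < LENGTH('m) + LENGTH('n)"
 shows "(\<Sum>k<LENGTH('m) + LENGTH('n). dd i k * cc k j) = (of_bool (i = j) :: ('k::field,'m::len0,'n::len0) glc)"
proof -
 have "((\<Sum>k<LENGTH('m) + LENGTH('n). fgen (GenD i k) * fgen (GenC k j)) - of_bool (i = j) :: (glgen, 'k) free_alg)
   \<in> ideal_gen (gl_rels LENGTH('m) LENGTH('n))"
  by (intro ideal_gen_base gl_rels.intros assms)
 hence "(abs_glc (\<Sum>k<LENGTH('m) + LENGTH('n). fgen (GenD i k) * fgen (GenC k j)) :: ('k,'m,'n) glc)
   = abs_glc (of_bool (i = j))"
  by (simp only: abs_glc_eq_iff)
 thus ?thesis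
  by (cases "i = j") (simp_all add: abs_glc_sum abs_glc_mult abs_glc_fgen abs_glc_one abs_glc_zero)
qed

text \<open>The universal property of the coordinate superalgebra. Its instances are the parity
  automorphism, the restriction to the torus, the curve with values in power series and the
  evaluation at permutation matrices.\<close>

locale glc_lift = free_eval_hom e for e :: "'k::field => 'b::ring_1" +
 fixes g :: "glgen => 'b" and ty :: "('k, 'm::len0, 'n::len0) glc itself"
 assumes comm: "g x * g y = psign (gen_par LENGTH('m) x) (gen_par LENGTH('m) y) * (g y * g x)"
  and inv_right: "i < LENGTH('m) + LENGTH('n) ==> j < LENGTH('m) + LENGTH('n) ==>
   (\<Sum>k<LENGTH('m) + LENGTH('n). g (GenC i k) * g (GenD k j)) = of_bool (i = j)"
  and inv_left: "i < LENGTH('m) + LENGTH('n) ==> j < LENGTH('m) + LENGTH('n) ==>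
   (\<Sum>k<LENGTH('m) + LENGTH('n). g (GenD i k) * g (GenC k j)) = of_bool (i = j)"
  and range: "~ word_in_range (LENGTH('m) + LENGTH('n)) [x] ==> g x = 0"
begin

definition lifted :: "('k,'m,'n) glc => 'b"
 where "lifted a = free_eval e g (rep_glc a)"

lemma eval_rels: "r \<in> gl_rels LENGTH('m) LENGTH('n) ==> free_eval e g r = 0"
proof -
 have sgn: "free_eval e g (psign s t) = psign s t" for s t
  by (simp add: psign_def eval_uminus eval_one)
 have ob: "free_eval e g (of_bool b) = of_bool b" for b
  by (cases b) (simp_all add: eval_zero eval_one)
 assume "r \<in> gl_rels LENGTH('m) LENGTH('n)"
 thus ?thesis
 proof cases
  case (comm x y)
  thus ?thesis using glc_lift.comm[OF glc_lift_axioms, of x y]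
   by (simp add: eval_diff eval_mult eval_fgen sgn)
 qed (auto simp: eval_diff eval_mult eval_fgen eval_sum ob inv_right inv_left range word_in_range_def)
qed

lemma lifted_abs: "lifted (abs_glc f) = free_eval e g f"
proof -
 have "(abs_glc (rep_glc (abs_glc f :: ('k,'m,'n) glc)) :: ('k,'m,'n) glc) = abs_glc f" by simp
 hence "rep_glc (abs_glc f :: ('k,'m,'n) glc) - f \<in> ideal_gen (gl_rels LENGTH('m) LENGTH('n))"
  by (simp only: abs_glc_eq_iff)
 hence "free_eval e g (rep_glc (abs_glc f :: ('k,'m,'n) glc) - f) = 0"
  by (rule eval_ideal_gen) (rule eval_rels)
 thus ?thesis by (simp add: lifted_def eval_diff)
qed

lemma lifted_add: "lifted (a + b) = lifted a + lifted b"
 by (metis lifted_abs abs_glc_add abs_rep_glc eval_add)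

lemma lifted_mult: "lifted (a * b) = lifted a * lifted b"
 by (metis lifted_abs abs_glc_mult abs_rep_glc eval_mult)

lemma lifted_zero: "lifted 0 = 0"
 by (metis lifted_abs abs_glc_zero eval_zero)

lemma lifted_one: "lifted 1 = 1"
 by (metis lifted_abs abs_glc_one eval_one)

lemma lifted_gen: "lifted (glc_gen x) = g x"
 by (metis lifted_abs abs_glc_fgen eval_fgen)

lemma lifted_const: "lifted (glc_const c) = e c"
 using lifted_abs[of "psingle 0 c"] by (simp add: abs_glc_const eval_single)

lemma lifted_scale: "lifted (scA c a) = e c * lifted a"
 by (simp add: glc_scale_def lifted_mult lifted_const)

lemma lifted_minus: "lifted (- a) = - lifted a"
 using lifted_add[of a "- a"] by (simp add: lifted_zero eq_neg_iff_add_eq_0 add.commute)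

lemma lifted_diff: "lifted (a - b) = lifted a - lifted b"
 using lifted_add[of a "- b"] by (simp add: lifted_minus)

end

subsection \<open>Parity\<close>

definition parity_gen :: "glgen => ('k::field,'m::len0,'n::len0) glc"
 where "parity_gen x = psign (gen_par LENGTH('m) x) True * glc_gen x"

lemma psign_square [simp]: "psign s t * psign s t = (1::'a::ring_1)"
 by (simp add: psign_def)

lemma psign_square' [simp]: "psign s t * (psign s t * a) = (a::'a::ring_1)"
 by (simp add: psign_def)

lemma psign_add_left: "psign (s ~= s') t = psign s t * (psign s' t :: 'a::ring_1)"
 by (auto simp: psign_def)

lemma psign_False [simp]: "psign False t = 1" "psign t False = 1"
 by (auto simp: psign_def)

interpretation parity_lift: glc_lift glc_const
 "parity_gen :: glgen => ('k::field,'m::len0,'n::len0) glc" "TYPE(('k,'m,'n) glc)"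
proof
 fix x y :: glgen
 show "parity_gen x * (parity_gen y :: ('k,'m,'n) glc)
   = psign (gen_par LENGTH('m) x) (gen_par LENGTH('m) y) * (parity_gen y * parity_gen x)"
  using glc_gen_comm[of x y, where ?'k = 'k and ?'m = 'm and ?'n = 'n]
  by (cases "gen_par LENGTH('m) x"; cases "gen_par LENGTH('m) y"; simp add: parity_gen_def psign_def)
next
 fix i j assume ij: "i < LENGTH('m) + LENGTH('n)" "j < LENGTH('m) + LENGTH('n)"
 have "parity_gen (GenC i k) * parity_gen (GenD k j) =
  psign (idx_par LENGTH('m) i ~= idx_par LENGTH('m) j) True * (cc i k * dd k j :: ('k,'m,'n) glc)" for k
  by (auto simp: parity_gen_def psign_def)
 hence "(\<Sum>k<LENGTH('m) + LENGTH('n). parity_gen (GenC i k) * parity_gen (GenD k j)) =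
   psign (idx_par LENGTH('m) i ~= idx_par LENGTH('m) j) True * (of_bool (i = j) :: ('k,'m,'n) glc)"
  using glc_inverse_right[OF ij, where ?'k = 'k] by (simp add: sum_distrib_left[symmetric])
 thus "(\<Sum>k<LENGTH('m) + LENGTH('n). parity_gen (GenC i k) * parity_gen (GenD k j)) = (of_bool (i = j) :: ('k,'m,'n) glc)"
  by auto
 have "parity_gen (GenD i k) * parity_gen (GenC k j) =
  psign (idx_par LENGTH('m) i ~= idx_par LENGTH('m) j) True * (dd i k * cc k j :: ('k,'m,'n) glc)" for k
  by (auto simp: parity_gen_def psign_def)
 hence "(\<Sum>k<LENGTH('m) + LENGTH('n). parity_gen (GenD i k) * parity_gen (GenC k j)) =
   psign (idx_par LENGTH('m) i ~= idx_par LENGTH('m) j) True * (of_bool (i = j) :: ('k,'m,'n) glc)"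
  using glc_inverse_left[OF ij, where ?'k = 'k] by (simp add: sum_distrib_left[symmetric])
 thus "(\<Sum>k<LENGTH('m) + LENGTH('n). parity_gen (GenD i k) * parity_gen (GenC k j)) = (of_bool (i = j) :: ('k,'m,'n) glc)"
  by auto
next
 fix x :: glgen assume "~ word_in_range (LENGTH('m) + LENGTH('n)) [x]"
 thus "parity_gen x = (0 :: ('k,'m,'n) glc)"
  by (simp add: parity_gen_def glc_gen_out_of_range)
qed

text \<open>The parity automorphism, with sign -1 on odd elements. As 2 is invertible, it gives
  explicit formulas for homogeneous components, which are defined by a description.\<close>

definition pinv :: "('k::field,'m::len0,'n::len0) glc => ('k,'m,'n) glc"
 where "pinv = parity_lift.lifted"

lemma pinv_add: "pinv (a + b) = pinv a + pinv b"
 and pinv_mult: "pinv (a * b) = pinv a * pinv b"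
 and pinv_zero [simp]: "pinv 0 = 0"
 and pinv_one [simp]: "pinv 1 = 1"
 and pinv_minus: "pinv (- a) = - pinv a"
 and pinv_diff: "pinv (a - b) = pinv a - pinv b"
 and pinv_gen: "pinv (glc_gen x :: ('k::field,'m::len0,'n::len0) glc) = psign (gen_par LENGTH('m) x) True * glc_gen x"
 by (simp_all add: pinv_def parity_lift.lifted_add parity_lift.lifted_mult parity_lift.lifted_zero
   parity_lift.lifted_one parity_lift.lifted_minus parity_lift.lifted_diff parity_lift.lifted_gen parity_gen_def)

lemma pinv_scale: "pinv (scA c a) = scA c (pinv a)"
 unfolding glc_scale_def by (simp add: pinv_def parity_lift.lifted_mult parity_lift.lifted_const)

lemma pinv_psign: "pinv (psign p q) = psign p q"
 by (simp add: psign_def pinv_minus)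

lemma glc_subspace_pinv: "glc.subspace {a. pinv a = psign s True * a}"
 by (rule glc.subspaceI)
  (auto simp: pinv_add pinv_scale distrib_left glc_scale_mult_right)

definition list_par :: "nat => glgen list => bool"
 where "list_par m xs \<longleftrightarrow> odd (length (filter (gen_par m) xs))"

lemma list_par_Nil [simp]: "~ list_par m []"
 and list_par_Cons [simp]: "list_par m (x # xs) \<longleftrightarrow> gen_par m x ~= list_par m xs"
 by (auto simp: list_par_def)

lemma pinv_word: "pinv (word_elt xs) = psign (list_par LENGTH('m) xs) True * (word_elt xs :: ('k::field,'m::len0,'n::len0) glc)"
proof (induction xs)
 case (Cons x xs)
 have "psign (gen_par LENGTH('m) x) True * glc_gen x * (psign (list_par LENGTH('m) xs) True * word_elt xs) =
   psign (gen_par LENGTH('m) x) True * psign (list_par LENGTH('m) xs) True * (glc_gen x * word_elt xs :: ('k,'m,'n) glc)"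
  by (cases "gen_par LENGTH('m) x"; cases "list_par LENGTH('m) xs"; simp add: psign_def)
 thus ?case
  by (simp only: word_elt_Cons list_par_Cons pinv_mult pinv_gen Cons psign_add_left)
qed simp

lemma pinv_pinv [simp]: "pinv (pinv a) = a"
proof -
 have "a \<in> {a. pinv (pinv a) = a}"
  by (rule glc_word_induct)
   (auto intro!: glc.subspaceI simp: pinv_add pinv_scale pinv_word pinv_mult pinv_psign)
 thus ?thesis by simp
qed

text \<open>The Koszul sign for an element of parity \<open>s\<close> passing \<open>a\<close>,
  applied to inhomogeneous \<open>a\<close> as well.\<close>

definition sig :: "bool => ('k::field,'m::len0,'n::len0) glc => ('k,'m,'n) glc"
 where "sig s a = (if s then pinv a else a)"

lemma sig_add: "sig s (a + b) = sig s a + sig s b"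
 and sig_mult: "sig s (a * b) = sig s a * sig s b"
 and sig_scale: "sig s (scA c a) = scA c (sig s a)"
 and sig_minus: "sig s (- a) = - sig s a"
 and sig_zero [simp]: "sig s 0 = 0"
 and sig_one [simp]: "sig s 1 = 1"
 and sig_False [simp]: "sig False a = a"
 and sig_sig: "sig s (sig t a) = sig (s ~= t) a"
 and sig_psign: "sig s (psign p q) = psign p q"
 by (auto simp: sig_def pinv_add pinv_mult pinv_scale pinv_minus pinv_psign)

lemma sig_gen: "sig s (glc_gen x :: ('k::field,'m::len0,'n::len0) glc) = psign s (gen_par LENGTH('m) x) * glc_gen x"
 by (auto simp: sig_def pinv_gen psign_def)

lemma subspace_glc_par: "glc.subspace (glc_par s :: ('k::field,'m::len0,'n::len0) glc set)"
proof (rule glc.subspaceI)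
 show "0 \<in> (glc_par s :: ('k,'m,'n) glc set)"
  unfolding glc_par_def by (auto intro!: exI[of _ 0] simp: abs_glc_zero)
next
 fix x y :: "('k,'m,'n) glc" assume "x \<in> glc_par s" "y \<in> glc_par s"
 then obtain f g :: "(glgen, 'k) free_alg" where "x = abs_glc f" "ALL w:pkeys f. word_par LENGTH('m) w = s"
  "y = abs_glc g" "ALL w:pkeys g. word_par LENGTH('m) w = s"
  by (auto simp: glc_par_def)
 thus "x + y \<in> glc_par s"
  unfolding glc_par_def using Poly_Mapping.keys_add[of f g]
  by (auto intro!: exI[of _ "f + g"] simp: abs_glc_add)
next
 fix x :: "('k,'m,'n) glc" and c assume "x \<in> glc_par s"
 then obtain f :: "(glgen, 'k) free_alg" where f: "x = abs_glc f" "ALL w:pkeys f. word_par LENGTH('m) w = s"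
  by (auto simp: glc_par_def)
 have lk: "plookup (psingle 0 c * f) w = c * plookup f w" for w
 proof -
  have "psingle 0 c * f = (\<Sum>v\<in>pkeys f. psingle v (c * plookup f v))"
   by (subst poly_mapping_sum_single[of f]) (simp add: sum_distrib_left mult_single)
  thus ?thesis
   by (auto simp: lookup_sum lookup_single when_def sum.delta in_keys_iff)
 qed
 hence "pkeys (psingle 0 c * f) \<subseteq> pkeys f"
  by (auto simp: in_keys_iff lk)
 thus "scA c x \<in> glc_par s"
  unfolding glc_par_def using f
  by (auto intro!: exI[of _ "psingle 0 c * f"] simp: abs_glc_mult abs_glc_const glc_scale_def)
qed

lemma word_par_letters: "word_par m w = list_par m (letters w)"
 by (simp add: word_par_def list_par_def)

lemma word_elt_par: "word_elt xs \<in> (glc_par (list_par LENGTH('m) xs) :: ('k::field,'m::len0,'n::len0) glc set)"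
 unfolding glc_par_def
 by (auto intro!: exI[of _ "psingle (FMon xs) 1"] simp: abs_glc_single_one word_par_letters)

lemma glc_gen_par: "glc_gen x \<in> (glc_par (gen_par LENGTH('m) x) :: ('k::field,'m::len0,'n::len0) glc set)"
 using word_elt_par[of "[x]"] by simp

lemma glc_par_pinv: "a \<in> glc_par s ==> pinv a = psign s True * a"
proof -
 assume "a \<in> glc_par s"
 then obtain f where f: "a = abs_glc f" "ALL w:pkeys f. word_par LENGTH('b) w = s"
  by (auto simp: glc_par_def)
 have "a \<in> {a. pinv a = psign s True * a}"
  unfolding f(1) abs_glc_expand using f(2)
  by (intro glc.subspace_sum[OF glc_subspace_pinv] glc.subspace_scale[OF glc_subspace_pinv])
   (auto simp: pinv_word word_par_letters)
 thus ?thesis by simp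
qed

lemma glc_par_even: "a \<in> glc_par False ==> pinv a = a"
 and glc_par_odd: "a \<in> glc_par True ==> pinv a = - a"
 using glc_par_pinv[of a False] glc_par_pinv[of a True] by (simp_all add: psign_def)

lemma glc_par_sig: "a \<in> glc_par s ==> sig t a = psign t s * a"
 using glc_par_even[of a] glc_par_odd[of a] by (cases s) (simp_all add: sig_def psign_def)

lemma glc_par_sum: "EX x:glc_par False. EX y:glc_par True. (a :: ('k::field,'m::len0,'n::len0) glc) = x + y"
proof -
 let ?S = "{a :: ('k,'m,'n) glc. EX x:glc_par False. EX y:glc_par True. a = x + y}"
 have "glc.subspace ?S"
  by (rule back_subst[where P = glc.subspace, OF glc.subspace_sums[OF subspace_glc_par[of False] subspace_glc_par[of True]]]) auto
 moreover have "word_elt xs \<in> ?S" for xs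
  using word_elt_par[of xs, where ?'k = 'k and ?'m = 'm and ?'n = 'n]
   glc.subspace_0[OF subspace_glc_par[of False]] glc.subspace_0[OF subspace_glc_par[of True]]
  by (cases "list_par LENGTH('m) xs") force+
 ultimately have "a \<in> ?S" by (rule glc_word_induct)
 thus ?thesis by simp
qed

lemma glc_supercomm:
 fixes a b :: "('k::field,'m::len0,'n::len0) glc"
 assumes "a \<in> glc_par p" "b \<in> glc_par q"
 shows "a * b = psign p q * (b * a)"
proof -
 have sgn: "psign a b * (y * (psign a c * z)) = psign a (b ~= c) * (y * z)"
  "y * (psign a b * z) = psign a b * (y * z)"
  "psign b c * (psign a c * y * z) = psign (a ~= b) c * (y * z)" for a b c and y z :: "('k,'m,'n) glc"
  by (cases a; cases b; cases c; simp add: psign_def)+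
 have gw: "glc_gen x * word_elt ys = psign (gen_par LENGTH('m) x) (list_par LENGTH('m) ys)
   * (word_elt ys * (glc_gen x :: ('k,'m,'n) glc))" for x ys
 proof (induction ys)
  case (Cons y ys)
  have "glc_gen x * word_elt (y # ys) = (glc_gen x * glc_gen y) * (word_elt ys :: ('k,'m,'n) glc)"
   by (simp add: mult.assoc)
  also have "... = psign (gen_par LENGTH('m) x) (gen_par LENGTH('m) y) * (glc_gen y * (glc_gen x * word_elt ys))"
   by (simp only: glc_gen_comm[of x y] mult.assoc)
  also have "... = psign (gen_par LENGTH('m) x) (list_par LENGTH('m) (y # ys)) * (glc_gen y * (word_elt ys * glc_gen x))"
   by (simp only: Cons list_par_Cons sgn(1))
  finally show ?case by (simp only: word_elt_Cons mult.assoc)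
 qed simp
 have ww: "word_elt xs * word_elt ys = psign (list_par LENGTH('m) xs) (list_par LENGTH('m) ys)
   * (word_elt ys * (word_elt xs :: ('k,'m,'n) glc))" for xs ys
 proof (induction xs)
  case (Cons x xs)
  have "word_elt (x # xs) * word_elt ys = glc_gen x * (word_elt xs * (word_elt ys :: ('k,'m,'n) glc))"
   by (simp add: mult.assoc)
  also have "... = psign (list_par LENGTH('m) xs) (list_par LENGTH('m) ys) * ((glc_gen x * word_elt ys) * word_elt xs)"
   by (simp only: Cons sgn(2) mult.assoc)
  also have "... = psign (list_par LENGTH('m) (x # xs)) (list_par LENGTH('m) ys) * (word_elt ys * glc_gen x * word_elt xs)"
   by (simp only: gw list_par_Cons sgn(3))
  finally show ?case by (simp only: word_elt_Cons mult.assoc)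
 qed simp
 obtain f where f: "a = abs_glc f" "ALL w:pkeys f. word_par LENGTH('m) w = p"
  using assms by (auto simp: glc_par_def)
 obtain g where g: "b = abs_glc g" "ALL w:pkeys g. word_par LENGTH('m) w = q"
  using assms by (auto simp: glc_par_def)
 have 1: "glc.subspace {b. u * b = psign p q * (b * u)}" for u :: "('k,'m,'n) glc"
  by (rule glc.subspaceI) (auto simp: distrib_left distrib_right glc_scale_mult_left glc_scale_mult_right)
 have 2: "glc.subspace {u. u * b = psign p q * (b * u)}" for b :: "('k,'m,'n) glc"
  by (rule glc.subspaceI) (auto simp: distrib_left distrib_right glc_scale_mult_left glc_scale_mult_right)
 have "word_elt xs * b = psign p q * (b * word_elt xs)" if "list_par LENGTH('m) xs = p" for xs
 proof -
  have "b \<in> {b. word_elt xs * b = psign p q * (b * word_elt xs)}"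
   unfolding g(1) abs_glc_expand[of g]
   by (intro glc.subspace_sum[OF 1] glc.subspace_scale[OF 1])
    (use g(2) that ww[of xs] in \<open>auto simp only: word_par_letters mem_Collect_eq\<close>)
  thus ?thesis by simp
 qed
 hence "a \<in> {a. a * b = psign p q * (b * a)}"
  unfolding f(1) abs_glc_expand[of f]
  by (intro glc.subspace_sum[OF 2] glc.subspace_scale[OF 2])
   (use f(2) in \<open>auto simp only: word_par_letters mem_Collect_eq\<close>)
 thus ?thesis by simp
qed

lemma glc_half:
 assumes "(2::'k) ~= 0"
 shows "scA (1/2) (a + a) = (a :: ('k::field,'m::len0,'n::len0) glc)"
proof -
 have "scA (1/2) (a + a) = scA (1/2) (scA 2 a)"
  using glc.scale_left_distrib[of 1 1 a] by simp
 thus ?thesis using assms by simp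
qed

abbreviation hcA :: "bool => ('k::field,'m::len0,'n::len0) glc => ('k,'m,'n) glc"
 where "hcA \<equiv> hcomp glc_par"

text \<open>The components are eigenvectors of \<open>pinv\<close> for the eigenvalues 1 and -1.
  Adding or subtracting \<open>pinv a\<close> doubles the wanted component, which also gives the
  uniqueness required by the description operator.\<close>

lemma hcomp_glc:
 assumes two: "(2::'k) ~= 0"
 shows "hcA s a = scA (1/2) (a + psign s True * pinv (a :: ('k::field,'m::len0,'n::len0) glc))"
proof -
 obtain x y where xy: "x \<in> glc_par False" "y \<in> glc_par True" "a = x + y"
  using glc_par_sum by blast
 have p: "pinv x = x" "pinv y = - y"
  using glc_par_even[OF xy(1)] glc_par_odd[OF xy(2)] by auto
 define u where "u = (if s then y else x)"
 have sums: "a + pinv a = x + x" "a - pinv a = y + y"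
  by (simp_all add: xy(3) pinv_add p)
 have u: "u = scA (1/2) (a + psign s True * pinv a)"
  by (cases s) (simp_all add: u_def psign_def sums glc_half[OF two])
 have "u \<in> glc_par s & a - u \<in> glc_par (~ s)"
  using xy(1,2) by (cases s) (simp_all add: u_def xy(3))
 moreover have "u' = u" if u': "u' \<in> glc_par s & a - u' \<in> glc_par (~ s)" for u'
 proof (cases s)
  case True
  have "pinv a = pinv (a - u') + pinv u'" by (simp add: pinv_diff)
  also have "... = (a - u') + - u'" using u' True by (simp add: glc_par_even glc_par_odd)
  finally have "a - pinv a = u' + u'" by simp
  hence "u' + u' = y + y" using sums by argo
  from arg_cong[OF this, of "scA (1/2)"] have "u' = y"
   by (simp only: glc_half[OF two])
  thus ?thesis using True by (simp add: u_def)
 next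
  case False
  have "pinv a = pinv (a - u') + pinv u'" by (simp add: pinv_diff)
  also have "... = - (a - u') + u'" using u' False by (simp add: glc_par_even glc_par_odd)
  finally have "a + pinv a = u' + u'" by simp
  hence "u' + u' = x + x" using sums by argo
  from arg_cong[OF this, of "scA (1/2)"] have "u' = x"
   by (simp only: glc_half[OF two])
  thus ?thesis using False by (simp add: u_def)
 qed
 ultimately have "hcA s a = u"
  unfolding hcomp_def by (rule the_equality[where P = "%u. u \<in> glc_par s & a - u \<in> glc_par (~ s)"])
 thus ?thesis using u by simp
qed

lemma superspace_glc:
 assumes two: "(2::'k) ~= 0"
 shows "superspace (scA :: 'k => ('k::field,'m::len0,'n::len0) glc => _) glc_par"
 unfolding superspace_def
proof (intro conjI allI)
 show "glc_par False \<inter> glc_par True = {0 :: ('k,'m,'n) glc}"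
 proof -
  have "a = 0" if "a \<in> glc_par False" "a \<in> glc_par True" for a :: "('k,'m,'n) glc"
  proof -
   have "a = - a" using glc_par_even[OF that(1)] glc_par_odd[OF that(2)] by (rule trans[OF sym])
   hence "a + a = 0" by (simp only: eq_neg_iff_add_eq_0)
   thus ?thesis using glc_half[OF two, of a] by simp
  qed
  thus ?thesis using glc.subspace_0[OF subspace_glc_par] by blast
 qed
qed (rule vs_glc subspace_glc_par glc_par_sum)+

lemma hcomp_glc_par:
 assumes two: "(2::'k) ~= 0"
 shows "hcA s (a :: ('k::field,'m::len0,'n::len0) glc) \<in> glc_par s"
  and hcomp_glc_sum: "hcA False a + hcA True a = a"
proof -
 obtain x y where xy: "x \<in> glc_par False" "y \<in> glc_par True" "a = x + y"
  using glc_par_sum by blast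
 have p: "pinv x = x" "pinv y = - y"
  using glc_par_even[OF xy(1)] glc_par_odd[OF xy(2)] by auto
 have sums: "a + pinv a = x + x" "a - pinv a = y + y"
  by (simp_all add: xy(3) pinv_add p)
 have h: "hcA False a = x" "hcA True a = y"
  by (simp_all add: hcomp_glc[OF two] psign_def sums glc_half[OF two])
 show "hcA s a \<in> glc_par s"
  using xy(1,2) h by (cases s) simp_all
 show "hcA False a + hcA True a = a"
  unfolding h by (rule xy(3)[symmetric])
qed

lemma hcomp_glc_hom:
 assumes two: "(2::'k) ~= 0" and "(a :: ('k::field,'m::len0,'n::len0) glc) \<in> glc_par s"
 shows "hcA t a = (if t = s then a else 0)"
 using glc_par_even[of a] glc_par_odd[of a] assms(2) glc_half[OF two, of a]
 by (cases s; cases t) (simp_all add: hcomp_glc[OF two] psign_def)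

lemma hcomp_glc_linear:
 assumes two: "(2::'k) ~= 0"
 shows "hcA s (a + b :: ('k::field,'m::len0,'n::len0) glc) = hcA s a + hcA s b"
  and "hcA s (scA c a) = scA c (hcA s a)"
proof -
 show "hcA s (a + b) = hcA s a + hcA s b"
  by (simp add: hcomp_glc[OF two] pinv_add distrib_left glc.scale_right_distrib)
 show "hcA s (scA c a) = scA c (hcA s a)"
  by (simp only: hcomp_glc[OF two] pinv_scale glc_scale_mult_right glc.scale_right_distrib[symmetric])
   (simp only: glc.scale_scale mult.commute)
qed

text \<open>Replaces the sums over parities in \<open>tens_mult\<close>, \<open>conv\<close> and
  \<open>act\<close> by the single automorphism \<open>sig\<close>.\<close>

lemma sum_psign_hcomp:
 assumes two: "(2::'k) ~= 0"
 shows "(\<Sum>q\<in>UNIV. psign p q * hcA q a) = sig p (a :: ('k::field,'m::len0,'n::len0) glc)"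
proof -
 have "sig p a = sig p (hcA False a) + sig p (hcA True a)"
  by (simp add: sig_add[symmetric] hcomp_glc_sum[OF two])
 also have "... = psign p False * hcA False a + psign p True * hcA True a"
  by (simp only: glc_par_sig[OF hcomp_glc_par(1)[OF two]])
 finally show ?thesis by (simp add: UNIV_bool add.commute)
qed

section \<open>The comultiplication\<close>

abbreviation bilA :: "(('k::field,'m::len0,'n::len0) glc => ('k,'m,'n) glc => 'k) => bool"
 where "bilA \<equiv> bilin scA scA"

abbreviation lfA :: "(('k::field,'m::len0,'n::len0) glc => 'k) => bool"
 where "lfA \<equiv> lf scA"

lemmas bilA_iff = bilin_iff[OF vs_glc vs_glc]
lemmas bilA_lf_right = bilin_lf_right[OF _ vs_glc vs_glc]
lemmas bilA_lf_left = bilin_lf_left[OF _ vs_glc vs_glc]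
lemmas bilA_simps = bilin_add_left[OF _ vs_glc vs_glc]
 bilin_add_right[OF _ vs_glc vs_glc]
 bilin_diff_left[OF _ vs_glc vs_glc]
 bilin_diff_right[OF _ vs_glc vs_glc]
 bilin_minus_left[OF _ vs_glc vs_glc]
 bilin_minus_right[OF _ vs_glc vs_glc]
 bilin_scale_left[OF _ vs_glc vs_glc]
 bilin_scale_right[OF _ vs_glc vs_glc]
 bilin_zero_left[OF _ vs_glc vs_glc]
 bilin_zero_right[OF _ vs_glc vs_glc]
lemmas bilA_prod = bilin_prod[OF vs_glc vs_glc]

lemma bilA_compose:
 assumes "bilA \<beta>" "!!a b. f (a + b) = f a + f b" "!!c a. f (scA c a) = scA c (f a)"
  "!!a b. g (a + b) = g a + g b" "!!c a. g (scA c a) = scA c (g a)"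
 shows "bilA (%u v. \<beta> (f u) (g v))"
 using assms by (auto simp: bilA_iff lf_def)

lemma bilA_sum: "(!!i. i \<in> S ==> bilA (\<beta> i)) ==> bilA (%u v. \<Sum>i\<in>S. \<beta> i u v)"
 by (auto simp: bilA_iff intro!: lf_setsum)

lemma bilA_cmult: "bilA \<beta> ==> bilA (%u v. c * \<beta> u v)"
 by (auto simp: bilA_iff intro!: lf_cmult)

lemma bilA_psign_left: "bilA \<beta> ==> \<beta> (psign p q * u) v = psign p q * \<beta> u v"
 and bilA_psign_right: "bilA \<beta> ==> \<beta> u (psign p q * v) = psign p q * \<beta> u v"
 by (auto simp: psign_def bilA_simps)

text \<open>Uniform notation for both clauses of \<open>comult_gen\<close>: the coproduct of a
  letter \<open>x\<close> is the sum over \<open>k\<close> of \<open>gen_sign\<close> times the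
  tensor of \<open>genL x k\<close> and \<open>genR x k\<close>. For entries of the inverse the two
  factors come in reversed order.\<close>

fun genL :: "glgen => nat => glgen" where
 "genL (GenC i j) k = GenC i k"
| "genL (GenD i j) k = GenD k j"

fun genR :: "glgen => nat => glgen" where
 "genR (GenC i j) k = GenC k j"
| "genR (GenD i j) k = GenD i k"

fun gen_sign :: "nat => glgen => nat => 'a::ring_1" where
 "gen_sign m (GenC i j) k = 1"
| "gen_sign m (GenD i j) k = psign (gen_par m (GenD i k)) (gen_par m (GenD k j))"

lemma gen_par_left_right: "gen_par m x = (gen_par m (genL x k) ~= gen_par m (genR x k))"
 by (cases x) auto

lemma comult_gen_eq: "(comult_gen x :: ('k::field, ('k, 'm::len0, 'n::len0) glc, ('k,'m,'n) glc) tensor) =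
  (\<Sum>k<LENGTH('m) + LENGTH('n). fscale (gen_sign LENGTH('m) x k) (tensA (glc_gen (genL x k)) (glc_gen (genR x k))))"
proof (cases x)
 case (GenC i j)
 have "fscale 1 t = t" for t :: "('k, ('k,'m,'n) glc, ('k,'m,'n) glc) tensor"
  by (simp add: fscale_def)
 thus ?thesis
  by (simp only: GenC comult_gen.simps genL.simps genR.simps gen_sign.simps)
next
 case (GenD i j)
 show ?thesis
  by (simp only: GenD comult_gen.simps genL.simps genR.simps gen_sign.simps)
qed

text \<open>Tensors are functionals on bilinear forms, so multiplying a tensor from the left by the
  coproduct of \<open>x\<close> amounts to changing the form. This is the transpose of that
  multiplication; the sign for \<open>genR x k\<close> passing \<open>a\<close> is carried by
  \<open>sig\<close>.\<close>

definition gen_op :: "glgen => (('k::field,'m::len0,'n::len0) glc => ('k,'m,'n) glc => 'k) => ('k,'m,'n) glc => ('k,'m,'n) glc => 'k"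
 where "gen_op x \<beta> = (%a b. \<Sum>k<LENGTH('m) + LENGTH('n). gen_sign LENGTH('m) x k *
   \<beta> (glc_gen (genL x k) * sig (gen_par LENGTH('m) (genR x k)) a) (glc_gen (genR x k) * b))"

lemma bilA_gen_op:
 assumes "bilA \<beta>"
 shows "bilA (gen_op x \<beta>)"
 unfolding gen_op_def
 by (intro bilA_sum bilA_cmult bilA_compose[OF assms])
  (simp_all add: sig_add sig_scale distrib_left glc_scale_mult_right)

lemma psign_bilA_sum:
 assumes "(2::'k::field) ~= 0" "bilA \<beta>" "(b :: ('k, 'm::len0, 'n::len0) glc) \<in> glc_par s"
 shows "(\<Sum>p\<in>UNIV. \<Sum>q\<in>UNIV. psign p q * \<beta> (a * hcA q c) (hcA p b * d)) = \<beta> (a * sig s c) (b * d)"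
proof -
 have "(\<Sum>p\<in>UNIV. \<Sum>q\<in>UNIV. psign p q * \<beta> (a * hcA q c) (hcA p b * d)) =
   (\<Sum>p\<in>UNIV. if p = s then (\<Sum>q\<in>UNIV. psign s q * \<beta> (a * hcA q c) (b * d)) else 0)"
  by (rule sum.cong[OF refl]) (auto simp: hcomp_glc_hom[OF assms(1,3)] bilA_simps[OF assms(2)])
 also have "... = (\<Sum>q\<in>UNIV. psign s q * \<beta> (a * hcA q c) (b * d))" by simp
 also have "... = (\<Sum>q\<in>UNIV. \<beta> (a * (psign s q * hcA q c)) (b * d))"
  by (rule sum.cong[OF refl]) (auto simp: psign_def bilA_simps[OF assms(2)])
 also have "... = \<beta> (a * (\<Sum>q\<in>UNIV. psign s q * hcA q c)) (b * d)"
  by (simp add: lf_sum[OF bilA_lf_left[OF assms(2)]] sum_distrib_left)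
 finally show ?thesis by (simp only: sum_psign_hcomp[OF assms(1)])
qed

lemma tens_mult_gen:
 assumes two: "(2::'k::field) ~= 0" and \<beta>: "bilA (\<beta> :: ('k, 'm::len0, 'n::len0) glc => _)"
  and u: "u = (\<Sum>(v, w)\<leftarrow>xs. tensA v w)"
 shows "tens_mult (comult_gen x) u \<beta> = u (gen_op x \<beta>)"
proof -
 define \<gamma> where "\<gamma> = (%a b. u (%a' b'. \<Sum>p\<in>UNIV. \<Sum>q\<in>UNIV. psign p q * \<beta> (a * hcA q a') (hcA p b * b')))"
 have bil: "bilA (%a' b'. \<Sum>p\<in>UNIV. \<Sum>q\<in>UNIV. psign p q * \<beta> (a * hcA q a') (hcA p b * b'))" for a b
  by (intro bilA_sum bilA_cmult bilA_compose[OF \<beta>])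
   (auto simp: hcomp_glc_linear[OF two] distrib_left glc_scale_mult_right)
 have \<gamma>: "\<gamma> a b = (\<Sum>(v, w)\<leftarrow>xs. \<Sum>p\<in>UNIV. \<Sum>q\<in>UNIV. psign p q * \<beta> (a * hcA q v) (hcA p b * w))" for a b
  unfolding \<gamma>_def u by (rule tens_list_apply[OF bil])
 have "bilA (%a b. \<Sum>p\<in>UNIV. \<Sum>q\<in>UNIV. psign p q * \<beta> (a * hcA q v) (hcA p b * w))" for v w
  by (intro bilA_sum bilA_cmult bilA_compose[OF \<beta>])
   (auto simp: hcomp_glc_linear[OF two] distrib_right glc_scale_mult_left)
 hence bil\<gamma>: "bilA \<gamma>"
  unfolding \<gamma>[abs_def]
  by (induction xs) (auto simp: bilA_iff lf_const0 lf_plus)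
 have "tens_mult (comult_gen x) u \<beta> = comult_gen x \<gamma>"
  using \<beta> by (simp add: tens_mult_def \<gamma>_def)
 also have "... = (\<Sum>k<LENGTH('m) + LENGTH('n). gen_sign LENGTH('m) x k * \<gamma> (glc_gen (genL x k)) (glc_gen (genR x k)))"
  by (simp add: comult_gen_eq sum_fun_apply fscale_def tens_apply[OF bil\<gamma>])
 also have "... = (\<Sum>k<LENGTH('m) + LENGTH('n). gen_sign LENGTH('m) x k *
   (\<Sum>(v, w)\<leftarrow>xs. \<beta> (glc_gen (genL x k) * sig (gen_par LENGTH('m) (genR x k)) v) (glc_gen (genR x k) * w)))"
  by (simp only: \<gamma> psign_bilA_sum[OF two \<beta> glc_gen_par])
 also have "... = (\<Sum>(v, w)\<leftarrow>xs. gen_op x \<beta> v w)"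
  by (induction xs) (auto simp: gen_op_def distrib_left sum.distrib)
 also have "... = u (gen_op x \<beta>)"
  unfolding u by (rule tens_list_apply[OF bilA_gen_op[OF \<beta>], symmetric])
 finally show ?thesis .
qed

primrec word_op :: "glgen list => (('k::field,'m::len0,'n::len0) glc => ('k,'m,'n) glc => 'k) => ('k,'m,'n) glc => ('k,'m,'n) glc => 'k" where
 "word_op [] \<beta> = \<beta>"
| "word_op (x # xs) \<beta> = word_op xs (gen_op x \<beta>)"

lemma bilA_word_op: "bilA \<beta> ==> bilA (word_op xs \<beta>)"
 by (induction xs arbitrary: \<beta>) (auto simp: bilA_gen_op)

lemma word_op_append: "word_op (xs @ ys) \<beta> = word_op ys (word_op xs \<beta>)"
 by (induction xs arbitrary: \<beta>) auto

lemma comult_letters_rep: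
 assumes two: "(2::'k::field) ~= 0"
 shows "EX ys. (comult_letters xs :: ('k, ('k, 'm::len0, 'n::len0) glc, ('k,'m,'n) glc) tensor) = (\<Sum>(v, w)\<leftarrow>ys. tensA v w)"
proof (induction xs)
 case Nil
 show ?case by (rule exI[of _ "[(1, 1)]"]) simp
next
 case (Cons x xs)
 then obtain ys where ys: "(comult_letters xs :: ('k, ('k,'m,'n) glc, ('k,'m,'n) glc) tensor) = (\<Sum>(v, w)\<leftarrow>ys. tensA v w)"
  by blast
 define f :: "nat => ('k,'m,'n) glc \<times> ('k,'m,'n) glc => ('k,'m,'n) glc \<times> ('k,'m,'n) glc"
  where "f k = (%(v, w). (scA (gen_sign LENGTH('m) x k) (glc_gen (genL x k) * sig (gen_par LENGTH('m) (genR x k)) v), glc_gen (genR x k) * w))" for k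
 define zs where "zs = concat (map (%vw. map (%k. f k vw) [0..<LENGTH('m) + LENGTH('n)]) ys)"
 have "comult_letters (x # xs) \<beta> = (\<Sum>(v, w)\<leftarrow>zs. tensA v w) \<beta>" for \<beta>
 proof (cases "bilA \<beta>")
  case True
  have g: "gen_op x \<beta> v w = (\<Sum>(v, w)\<leftarrow>map (%k. f k (v, w)) [0..<LENGTH('m) + LENGTH('n)]. \<beta> v w)" for v w
   by (simp add: gen_op_def f_def interv_sum_list_conv_sum_set_nat o_def bilA_simps[OF True] atLeast0LessThan)
  have "comult_letters (x # xs) \<beta> = (\<Sum>(v, w)\<leftarrow>ys. gen_op x \<beta> v w)"
   using tens_mult_gen[OF two True ys] tens_list_apply[OF bilA_gen_op[OF True]] by (simp add: ys)
  also have "... = (\<Sum>(v, w)\<leftarrow>zs. \<beta> v w)"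
   unfolding zs_def g by (induction ys) auto
  finally show ?thesis by (simp only: tens_list_apply[OF True])
 next
  case False
  thus ?thesis using tens_list_apply_non[OF False] by (simp add: tens_mult_def)
 qed
 thus ?case by blast
qed

lemma comult_letters_word_op:
 assumes two: "(2::'k::field) ~= 0" and \<beta>: "bilA (\<beta> :: ('k, 'm::len0, 'n::len0) glc => _)"
 shows "comult_letters xs \<beta> = word_op xs \<beta> 1 1"
 using \<beta>
proof (induction xs arbitrary: \<beta>)
 case Nil
 thus ?case by (simp add: tens_apply)
next
 case (Cons x xs)
 obtain ys where ys: "(comult_letters xs :: ('k, ('k,'m,'n) glc, ('k,'m,'n) glc) tensor) = (\<Sum>(v, w)\<leftarrow>ys. tensA v w)"
  using comult_letters_rep[OF two] by blast
 show ?case using tens_mult_gen[OF two Cons.prems ys] Cons.IH[OF bilA_gen_op[OF Cons.prems]] by simp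
qed

section \<open>The comultiplication respects the defining relations\<close>

definition alg_op :: "(glgen, 'k::field) free_alg => (('k, 'm::len0, 'n::len0) glc => ('k,'m,'n) glc => 'k) => ('k,'m,'n) glc => ('k,'m,'n) glc => 'k"
 where "alg_op f \<beta> a b = (\<Sum>w\<in>pkeys f. plookup f w * word_op (letters w) \<beta> a b)"

lemma alg_op_superset:
 "finite S ==> pkeys f \<subseteq> S ==>
  alg_op f \<beta> a b = (\<Sum>w\<in>S. plookup f w * word_op (letters w) \<beta> a b)"
 unfolding alg_op_def by (rule sum.mono_neutral_left) (auto simp: in_keys_iff)

lemma alg_op_add: "alg_op (f + g) \<beta> a b = alg_op f \<beta> a b + alg_op g \<beta> a b"
proof -
 let ?S = "pkeys f \<union> pkeys g"
 have "pkeys (f + g) \<subseteq> ?S" by (rule Poly_Mapping.keys_add)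
 thus ?thesis
  by (simp add: alg_op_superset[of ?S] lookup_add distrib_right sum.distrib)
qed

lemma alg_op_zero: "alg_op 0 \<beta> a b = 0"
 by (simp add: alg_op_def)

lemma alg_op_minus: "alg_op (- f) \<beta> a b = - alg_op f \<beta> a b"
 using alg_op_add[of f "- f" \<beta> a b] by (simp add: alg_op_zero eq_neg_iff_add_eq_0 add.commute)

lemma alg_op_diff: "alg_op (f - g) \<beta> a b = alg_op f \<beta> a b - alg_op g \<beta> a b"
 using alg_op_add[of f "- g" \<beta> a b] by (simp add: alg_op_minus)

lemma alg_op_sum: "alg_op (sum F S) \<beta> a b = (\<Sum>i\<in>S. alg_op (F i) \<beta> a b)"
 by (induction S rule: infinite_finite_induct) (simp_all add: alg_op_zero alg_op_add)

lemma alg_op_single: "alg_op (psingle w c) \<beta> a b = c * word_op (letters w) \<beta> a b"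
 by (cases "c = 0") (simp_all add: alg_op_def)

lemma word_op_linear:
 "word_op xs (%a b. \<Sum>i\<in>S. c i * \<beta> i a b) a b = (\<Sum>i\<in>S. c i * word_op xs (\<beta> i) a b)"
proof (induction xs arbitrary: \<beta>)
 case (Cons x xs)
 have "gen_op x (%a b. \<Sum>i\<in>S. c i * \<beta> i a b) = (%a b. \<Sum>i\<in>S. c i * gen_op x (\<beta> i) a b)"
  unfolding gen_op_def sum_distrib_left
  by (intro ext, subst sum.swap) (simp add: mult.left_commute)
 thus ?case using Cons by simp
qed simp

text \<open>Transposition reverses products: the left factor \<open>f\<close> acts on the form
  first.\<close>

lemma alg_op_mult: "alg_op (f * g) \<beta> a b = alg_op g (alg_op f \<beta>) a b"
proof -
 have f: "f = (\<Sum>w\<in>pkeys f. psingle w (plookup f w))"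
  and g: "g = (\<Sum>w\<in>pkeys g. psingle w (plookup g w))"
  by (rule poly_mapping_sum_single)+
 have "f * g = (\<Sum>v\<in>pkeys g. \<Sum>w\<in>pkeys f.
   psingle (w + v) (plookup f w * plookup g v))"
  by (subst f, subst g) (simp add: sum_product mult_single sum.swap[of _ "pkeys g"])
 hence "alg_op (f * g) \<beta> a b = (\<Sum>v\<in>pkeys g. \<Sum>w\<in>pkeys f.
   plookup f w * plookup g v * word_op (letters v) (word_op (letters w) \<beta>) a b)"
  by (simp add: alg_op_sum alg_op_single word_op_append)
 also have "... = (\<Sum>v\<in>pkeys g. plookup g v * word_op (letters v) (alg_op f \<beta>) a b)"
  unfolding alg_op_def[of f, abs_def] word_op_linear sum_distrib_left
  by (intro sum.cong refl) (simp only: mult.assoc mult.left_commute)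
 finally show ?thesis by (simp add: alg_op_def)
qed

lemma alg_op_fgen: "alg_op (fgen x) \<beta> a b = gen_op x \<beta> a b"
 by (simp add: fgen_def alg_op_single)

lemma alg_op_one: "alg_op 1 \<beta> a b = \<beta> a b"
 using alg_op_single[of 0 1 \<beta> a b] by simp

lemma bilA_alg_op: "bilA \<beta> ==> bilA (alg_op f \<beta>)"
 unfolding alg_op_def[abs_def] by (intro bilA_sum bilA_cmult bilA_word_op)

text \<open>Both letters are collected in each tensor factor, which costs the sign of
  \<open>genR x k\<close> passing \<open>genL y l\<close>. The relations can then be checked
  separately in the two factors.\<close>

lemma gen_op_gen_op:
 assumes \<beta>: "bilA (\<beta> :: ('k::field,'m::len0,'n::len0) glc => _)"
 shows "gen_op y (gen_op x \<beta>) a b = (\<Sum>l<LENGTH('m) + LENGTH('n). \<Sum>k<LENGTH('m) + LENGTH('n).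
  gen_sign LENGTH('m) y l * gen_sign LENGTH('m) x k
   * psign (gen_par LENGTH('m) (genR x k)) (gen_par LENGTH('m) (genL y l)) *
  \<beta> (glc_gen (genL x k) * glc_gen (genL y l)
     * sig (gen_par LENGTH('m) (genR x k) ~= gen_par LENGTH('m) (genR y l)) a)
   (glc_gen (genR x k) * glc_gen (genR y l) * b))"
 unfolding gen_op_def sum_distrib_left
proof (intro sum.cong refl)
 fix l k
 have "glc_gen (genL x k) * sig (gen_par LENGTH('m) (genR x k))
   (glc_gen (genL y l) * sig (gen_par LENGTH('m) (genR y l)) a) =
  psign (gen_par LENGTH('m) (genR x k)) (gen_par LENGTH('m) (genL y l))
   * (glc_gen (genL x k) * glc_gen (genL y l)
     * sig (gen_par LENGTH('m) (genR x k) ~= gen_par LENGTH('m) (genR y l)) a)"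
  by (cases "gen_par LENGTH('m) (genR x k)"; cases "gen_par LENGTH('m) (genL y l)")
   (simp_all add: sig_mult sig_gen sig_sig psign_def mult.assoc)
 thus "gen_sign LENGTH('m) y l * (gen_sign LENGTH('m) x k *
   \<beta> (glc_gen (genL x k) * sig (gen_par LENGTH('m) (genR x k))
     (glc_gen (genL y l) * sig (gen_par LENGTH('m) (genR y l)) a))
    (glc_gen (genR x k) * (glc_gen (genR y l) * b))) =
   gen_sign LENGTH('m) y l * gen_sign LENGTH('m) x k
   * psign (gen_par LENGTH('m) (genR x k)) (gen_par LENGTH('m) (genL y l)) *
  \<beta> (glc_gen (genL x k) * glc_gen (genL y l)
     * sig (gen_par LENGTH('m) (genR x k) ~= gen_par LENGTH('m) (genR y l)) a)
   (glc_gen (genR x k) * glc_gen (genR y l) * b)"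
  by (simp only: bilA_psign_left[OF \<beta>] mult.assoc)
qed

text \<open>Supercommutativity of the tensor square: the letters are exchanged in each factor, and
  the resulting signs combine because the parity of a letter is the sum of the parities of its two
  coproduct factors.\<close>

lemma gen_op_comm:
 assumes \<beta>: "bilA (\<beta> :: ('k::field,'m::len0,'n::len0) glc => _)"
 shows "gen_op y (gen_op x \<beta>) a b = psign (gen_par LENGTH('m) x) (gen_par LENGTH('m) y) * gen_op x (gen_op y \<beta>) a b"
proof -
 let ?p = "gen_par LENGTH('m)"
 have eq: "gen_sign LENGTH('m) y l * gen_sign LENGTH('m) x k * psign (?p (genR x k)) (?p (genL y l)) *
  \<beta> (glc_gen (genL x k) * glc_gen (genL y l) * sig (?p (genR x k) ~= ?p (genR y l)) a)
   (glc_gen (genR x k) * glc_gen (genR y l) * b) =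
   psign (?p x) (?p y) * (gen_sign LENGTH('m) x k * gen_sign LENGTH('m) y l * psign (?p (genR y l)) (?p (genL x k)) *
  \<beta> (glc_gen (genL y l) * glc_gen (genL x k) * sig (?p (genR y l) ~= ?p (genR x k)) a)
   (glc_gen (genR y l) * glc_gen (genR x k) * b))" for k l
 proof -
  have s: "sig (?p (genR x k) ~= ?p (genR y l)) a = sig (?p (genR y l) ~= ?p (genR x k)) a"
   by (simp add: sig_def)
  have "\<beta> (glc_gen (genL x k) * glc_gen (genL y l) * sig (?p (genR x k) ~= ?p (genR y l)) a)
    (glc_gen (genR x k) * glc_gen (genR y l) * b) =
    psign (?p (genL x k)) (?p (genL y l)) * (psign (?p (genR x k)) (?p (genR y l)) *
    \<beta> (glc_gen (genL y l) * glc_gen (genL x k) * sig (?p (genR y l) ~= ?p (genR x k)) a)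
    (glc_gen (genR y l) * glc_gen (genR x k) * b))"
   unfolding s glc_gen_comm[of "genL x k" "genL y l"] glc_gen_comm[of "genR x k" "genR y l"] mult.assoc
   by (simp only: bilA_psign_left[OF \<beta>] bilA_psign_right[OF \<beta>] mult.left_commute)
  moreover have "gen_sign LENGTH('m) y l * gen_sign LENGTH('m) x k * psign (?p (genR x k)) (?p (genL y l)) *
    (psign (?p (genL x k)) (?p (genL y l)) * (psign (?p (genR x k)) (?p (genR y l)) * z)) =
   psign (?p x) (?p y) * (gen_sign LENGTH('m) x k * gen_sign LENGTH('m) y l * psign (?p (genR y l)) (?p (genL x k)) * z)" for z :: 'k
   unfolding gen_par_left_right[of "LENGTH('m)" x k] gen_par_left_right[of "LENGTH('m)" y l]
   by (cases "?p (genL x k)"; cases "?p (genL y l)"; cases "?p (genR x k)"; cases "?p (genR y l)")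
    (simp_all add: psign_def)
  ultimately show ?thesis by (simp only:)
 qed
 show ?thesis
  unfolding gen_op_gen_op[OF \<beta>] sum_distrib_left
  by (subst sum.swap) (intro sum.cong refl eq)
qed

text \<open>After reordering, the sum over \<open>k\<close> contains the entries of \<open>C\<close>
  times \<open>D\<close> in the right tensor factor and yields a Kronecker delta; the sum that
  remains is again an entry of \<open>C\<close> times \<open>D\<close>, now in the left
  factor.\<close>

lemma gen_op_inv_right:
 assumes \<beta>: "bilA (\<beta> :: ('k::field,'m::len0,'n::len0) glc => _)"
  and ij: "i < LENGTH('m) + LENGTH('n)" "j < LENGTH('m) + LENGTH('n)"
 shows "(\<Sum>k<LENGTH('m) + LENGTH('n). gen_op (GenD k j) (gen_op (GenC i k) \<beta>) a b) = of_bool (i = j) * \<beta> a b"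
proof -
 let ?N = "LENGTH('m) + LENGTH('n)" and ?p = "idx_par LENGTH('m)"
 have bs: "\<beta> u (sum F {..<?N} * b) = (\<Sum>k<?N. \<beta> u (F k * b))" for u F
  by (simp add: sum_distrib_right lf_sum[OF bilA_lf_right[OF \<beta>]])
 have bs': "\<beta> (sum F {..<?N} * u) b = (\<Sum>k<?N. \<beta> (F k * u) b)" for u F
  by (simp add: sum_distrib_right lf_sum[OF bilA_lf_left[OF \<beta>]])
 have sgn: "psign (?p k ~= ?p l) (?p l ~= ?p j) * psign (?p r ~= ?p k) (?p l ~= ?p j) = (psign (?p r ~= ?p l) (?p l ~= ?p j) :: 'k)" for k l r
  by (cases "?p k"; cases "?p l"; cases "?p r"; cases "?p j") (auto simp: psign_def)
 have "(\<Sum>k<?N. gen_op (GenD k j) (gen_op (GenC i k) \<beta>) a b) =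
   (\<Sum>k<?N. \<Sum>l<?N. \<Sum>r<?N. psign (?p r ~= ?p l) (?p l ~= ?p j) *
    \<beta> (cc i r * dd l j * sig ((?p r ~= ?p k) ~= (?p k ~= ?p l)) a) (cc r k * dd k l * b))"
  unfolding gen_op_gen_op[OF \<beta>]
  by (intro sum.cong refl)
   (simp only: genL.simps genR.simps gen_sign.simps gen_par.simps mult_1_left mult_1_right sgn)
 also have "... = (\<Sum>k<?N. \<Sum>l<?N. \<Sum>r<?N. psign (?p r ~= ?p l) (?p l ~= ?p j) *
    \<beta> (cc i r * dd l j * sig (?p r ~= ?p l) a) (cc r k * dd k l * b))"
 proof (intro sum.cong refl)
  fix k l r
  have "((?p r ~= ?p k) ~= (?p k ~= ?p l)) = (?p r ~= ?p l)" by blast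
  thus "psign (?p r ~= ?p l) (?p l ~= ?p j) *
    \<beta> (cc i r * dd l j * sig ((?p r ~= ?p k) ~= (?p k ~= ?p l)) a) (cc r k * dd k l * b) =
    psign (?p r ~= ?p l) (?p l ~= ?p j) *
    \<beta> (cc i r * dd l j * sig (?p r ~= ?p l) a) (cc r k * dd k l * b)" by (simp only:)
 qed
 also have "... = (\<Sum>l<?N. \<Sum>r<?N. \<Sum>k<?N. psign (?p r ~= ?p l) (?p l ~= ?p j) *
    \<beta> (cc i r * dd l j * sig (?p r ~= ?p l) a) (cc r k * dd k l * b))"
  by (subst sum.swap, rule sum.cong[OF refl], subst sum.swap, rule refl)
 also have "... = (\<Sum>l<?N. \<Sum>r<?N. psign (?p r ~= ?p l) (?p l ~= ?p j) *
    \<beta> (cc i r * dd l j * sig (?p r ~= ?p l) a) (of_bool (r = l) * b))"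
  by (intro sum.cong refl) (simp only: sum_distrib_left[symmetric] bs[symmetric] glc_inverse_right lessThan_iff)
 also have "... = (\<Sum>l<?N. \<Sum>r<?N. if r = l then \<beta> (cc i l * dd l j * a) b else 0)"
  by (intro sum.cong refl) (auto simp: bilA_simps[OF \<beta>])
 also have "... = (\<Sum>l<?N. \<beta> (cc i l * dd l j * a) b)" by simp
 also have "... = \<beta> (of_bool (i = j) * a) b"
  by (simp only: bs'[symmetric] glc_inverse_right[OF ij])
 finally show ?thesis by (simp add: bilA_simps[OF \<beta>])
qed

text \<open>As before, except that the left tensor factor collapses first.\<close>

lemma gen_op_inv_left:
 assumes \<beta>: "bilA (\<beta> :: ('k::field,'m::len0,'n::len0) glc => _)"
  and ij: "i < LENGTH('m) + LENGTH('n)" "j < LENGTH('m) + LENGTH('n)"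
 shows "(\<Sum>k<LENGTH('m) + LENGTH('n). gen_op (GenC k j) (gen_op (GenD i k) \<beta>) a b) = of_bool (i = j) * \<beta> a b"
proof -
 let ?N = "LENGTH('m) + LENGTH('n)" and ?p = "idx_par LENGTH('m)"
 have bs: "\<beta> u (sum F {..<?N} * b) = (\<Sum>k<?N. \<beta> u (F k * b))" for u F
  by (simp add: sum_distrib_right lf_sum[OF bilA_lf_right[OF \<beta>]])
 have bs': "\<beta> (sum F {..<?N} * u) b = (\<Sum>k<?N. \<beta> (F k * u) b)" for u F b
  by (simp add: sum_distrib_right lf_sum[OF bilA_lf_left[OF \<beta>]])
 have sgn: "psign (?p i ~= ?p r) (?p r ~= ?p k) * psign (?p i ~= ?p r) (?p k ~= ?p l) = (psign (?p i ~= ?p r) (?p r ~= ?p l) :: 'k)" for k l r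
  by (cases "?p k"; cases "?p l"; cases "?p r"; cases "?p i") (auto simp: psign_def)
 have "(\<Sum>k<?N. gen_op (GenC k j) (gen_op (GenD i k) \<beta>) a b) =
   (\<Sum>k<?N. \<Sum>l<?N. \<Sum>r<?N. psign (?p i ~= ?p r) (?p r ~= ?p l) *
    \<beta> (dd r k * cc k l * sig ((?p i ~= ?p r) ~= (?p l ~= ?p j)) a) (dd i r * cc l j * b))"
  unfolding gen_op_gen_op[OF \<beta>]
  by (intro sum.cong refl)
   (simp only: genL.simps genR.simps gen_sign.simps gen_par.simps mult_1_left mult_1_right sgn)
 also have "... = (\<Sum>l<?N. \<Sum>r<?N. \<Sum>k<?N. psign (?p i ~= ?p r) (?p r ~= ?p l) *
    \<beta> (dd r k * cc k l * sig ((?p i ~= ?p r) ~= (?p l ~= ?p j)) a) (dd i r * cc l j * b))"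
  by (subst sum.swap, rule sum.cong[OF refl], subst sum.swap, rule refl)
 also have "... = (\<Sum>l<?N. \<Sum>r<?N. psign (?p i ~= ?p r) (?p r ~= ?p l) *
    \<beta> (of_bool (r = l) * sig ((?p i ~= ?p r) ~= (?p l ~= ?p j)) a) (dd i r * cc l j * b))"
  by (intro sum.cong refl) (simp only: sum_distrib_left[symmetric] bs'[symmetric] glc_inverse_left lessThan_iff)
 also have "... = (\<Sum>l<?N. \<Sum>r<?N. if r = l then \<beta> (sig (?p i ~= ?p j) a) (dd i l * cc l j * b) else 0)"
 proof (intro sum.cong refl)
  fix l r
  have "((?p i ~= ?p l) ~= (?p l ~= ?p j)) = (?p i ~= ?p j)" by auto
  thus "psign (?p i ~= ?p r) (?p r ~= ?p l) *
    \<beta> (of_bool (r = l) * sig ((?p i ~= ?p r) ~= (?p l ~= ?p j)) a) (dd i r * cc l j * b) =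
    (if r = l then \<beta> (sig (?p i ~= ?p j) a) (dd i l * cc l j * b) else 0)"
   by (cases "r = l") (simp_all only: of_bool_eq bilA_simps[OF \<beta>] mult_1_left psign_False mult_zero_left mult_zero_right if_True if_False simp_thms)
 qed
 also have "... = (\<Sum>l<?N. \<beta> (sig (?p i ~= ?p j) a) (dd i l * cc l j * b))" by simp
 also have "... = \<beta> (sig (?p i ~= ?p j) a) (of_bool (i = j) * b)"
  by (simp only: bs[symmetric] glc_inverse_left[OF ij])
 finally show ?thesis by (simp add: bilA_simps[OF \<beta>])
qed

lemma alg_op_rels:
 assumes \<beta>: "bilA (\<beta> :: ('k::field,'m::len0,'n::len0) glc => _)"
  and r: "r \<in> gl_rels LENGTH('m) LENGTH('n)"
 shows "alg_op r \<beta> a b = 0"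
 using r
proof cases
 case (comm x y)
 have ps: "alg_op (psign p q * f) \<beta> a b = psign p q * alg_op f \<beta> a b" for p q f
  by (simp add: psign_def alg_op_minus)
 have ff: "alg_op (fgen z * fgen z') \<beta> a b = gen_op z' (gen_op z \<beta>) a b" for z z'
  by (simp only: alg_op_mult alg_op_fgen alg_op_fgen[abs_def])
 show ?thesis
  unfolding comm alg_op_diff ps ff
  using gen_op_comm[OF \<beta>, of y x a b] by (simp only: diff_self)
next
 case (inv_right i j)
 have af: "alg_op (fgen z) \<gamma> = gen_op z \<gamma>" for z and \<gamma> :: "('k,'m,'n) glc => ('k,'m,'n) glc => 'k"
  by (intro ext) (rule alg_op_fgen)
 have "alg_op (of_bool (i = j)) \<beta> a b = of_bool (i = j) * \<beta> a b"
  by (cases "i = j") (simp_all add: alg_op_zero alg_op_one)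
 thus ?thesis
  unfolding inv_right(1) alg_op_diff alg_op_mult alg_op_sum af
  using gen_op_inv_right[OF \<beta> inv_right(2,3)] by simp
next
 case (inv_left i j)
 have af: "alg_op (fgen z) \<gamma> = gen_op z \<gamma>" for z and \<gamma> :: "('k,'m,'n) glc => ('k,'m,'n) glc => 'k"
  by (intro ext) (rule alg_op_fgen)
 have "alg_op (of_bool (i = j)) \<beta> a b = of_bool (i = j) * \<beta> a b"
  by (cases "i = j") (simp_all add: alg_op_zero alg_op_one)
 thus ?thesis
  unfolding inv_left(1) alg_op_diff alg_op_mult alg_op_sum af
  using gen_op_inv_left[OF \<beta> inv_left(2,3)] by simp
next
 case (rangeC i j)
 have "glc_gen (GenC i k) = (0 :: ('k,'m,'n) glc) \<or> glc_gen (GenC k j) = (0 :: ('k,'m,'n) glc)" for k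
  using rangeC(2) glc_gen_out_of_range[of "GenC i k", where ?'k = 'k and ?'m = 'm and ?'n = 'n]
   glc_gen_out_of_range[of "GenC k j", where ?'k = 'k and ?'m = 'm and ?'n = 'n]
  by (auto simp: word_in_range_def)
 hence "\<beta> (cc i k * u) (cc k j * v) = 0" for k u v
  by (metis bilA_simps(9)[OF \<beta>] bilA_simps(10)[OF \<beta>] mult_zero_left)
 thus ?thesis unfolding rangeC(1) alg_op_fgen by (simp add: gen_op_def)
next
 case (rangeD i j)
 have "glc_gen (GenD i k) = (0 :: ('k,'m,'n) glc) \<or> glc_gen (GenD k j) = (0 :: ('k,'m,'n) glc)" for k
  using rangeD(2) glc_gen_out_of_range[of "GenD i k", where ?'k = 'k and ?'m = 'm and ?'n = 'n]
   glc_gen_out_of_range[of "GenD k j", where ?'k = 'k and ?'m = 'm and ?'n = 'n]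
  by (auto simp: word_in_range_def)
 hence "\<beta> (dd k j * u) (dd i k * v) = 0" for k u v
  by (metis bilA_simps(9)[OF \<beta>] bilA_simps(10)[OF \<beta>] mult_zero_left)
 thus ?thesis unfolding rangeD(1) alg_op_fgen by (simp add: gen_op_def)
qed

lemma alg_op_ideal:
 assumes "f \<in> ideal_gen (gl_rels LENGTH('m) LENGTH('n))" and \<beta>: "bilA (\<beta> :: ('k::field,'m::len0,'n::len0) glc => _)"
 shows "alg_op f \<beta> a b = 0"
 using assms(1)
proof (induction f rule: ideal_gen.induct)
 case (step x r u v)
 have z: "word_op xs (%a b. 0 :: 'k) = (%(a :: ('k,'m,'n) glc) (b :: ('k,'m,'n) glc). 0)" for xs
  by (induction xs) (auto simp: gen_op_def fun_eq_iff)
 have "alg_op (u * r) \<beta> = (%a b. 0)"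
  by (intro ext) (simp only: alg_op_mult alg_op_rels[OF bilA_alg_op[OF \<beta>] step(2)])
 hence "alg_op (u * r * v) \<beta> a b = alg_op v (%a b. 0) a b"
  by (simp only: alg_op_mult[of "u * r" v])
 hence "alg_op (u * r * v) \<beta> a b = 0" by (simp add: alg_op_def[of v] z)
 thus ?case using step by (simp only: alg_op_add add_0_left)
qed (simp add: alg_op_zero)

text \<open>\<open>comult\<close> is defined through the representative \<open>rep_glc\<close>;
  since relations are annihilated, any other representative may be used instead.\<close>

lemma comult_abs:
 assumes two: "(2::'k::field) ~= 0" and \<beta>: "bilA (\<beta> :: ('k, 'm::len0, 'n::len0) glc => _)"
 shows "comult (abs_glc f) \<beta> = alg_op f \<beta> 1 1"
proof -
 have 1: "comult a \<beta> = alg_op (rep_glc a) \<beta> 1 1" for a :: "('k,'m,'n) glc"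
  by (simp add: comult_def sum_fun_apply fscale_def alg_op_def comult_letters_word_op[OF two \<beta>])
 have "(abs_glc (rep_glc (abs_glc f :: ('k,'m,'n) glc)) :: ('k,'m,'n) glc) = abs_glc f" by simp
 hence "rep_glc (abs_glc f :: ('k,'m,'n) glc) - f \<in> ideal_gen (gl_rels LENGTH('m) LENGTH('n))"
  by (simp only: abs_glc_eq_iff)
 from alg_op_ideal[OF this \<beta>, of 1 1] show ?thesis by (simp add: 1 alg_op_diff)
qed

lemma comult_non_bilin: "~ bilA \<beta> ==> comult a \<beta> = 0"
proof -
 assume n: "~ bilA \<beta>"
 have "comult_letters xs \<beta> = 0" for xs
  using n by (cases xs) (auto simp: tens_def tens_mult_def)
 thus ?thesis by (simp add: comult_def sum_fun_apply fscale_def)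
qed

lemma comult_add:
 assumes two: "(2::'k::field) ~= 0"
 shows "comult (a + b :: ('k, 'm::len0, 'n::len0) glc) = comult a + comult b"
proof
 fix \<beta> :: "('k,'m,'n) glc => ('k,'m,'n) glc => 'k"
 have "comult (abs_glc (rep_glc a + rep_glc b) :: ('k,'m,'n) glc) \<beta> = comult (abs_glc (rep_glc a) :: ('k,'m,'n) glc) \<beta> + comult (abs_glc (rep_glc b) :: ('k,'m,'n) glc) \<beta>"
  if "bilA \<beta>" unfolding comult_abs[OF two that] by (rule alg_op_add)
 thus "comult (a + b) \<beta> = (comult a + comult b) \<beta>"
  by (cases "bilA \<beta>") (simp_all add: abs_glc_add comult_non_bilin)
qed

lemma comult_scale:
 assumes two: "(2::'k::field) ~= 0"
 shows "comult (scA c a :: ('k, 'm::len0, 'n::len0) glc) = fscale c (comult a)"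
proof
 fix \<beta> :: "('k,'m,'n) glc => ('k,'m,'n) glc => 'k"
 have "comult (abs_glc (psingle 0 c * rep_glc a) :: ('k,'m,'n) glc) \<beta> = c * comult (abs_glc (rep_glc a) :: ('k,'m,'n) glc) \<beta>"
  if b: "bilA \<beta>"
 proof -
  have "alg_op (psingle 0 c) \<beta> = (%u v. c * \<beta> u v)"
   by (intro ext) (simp add: alg_op_single)
  moreover have "alg_op f (%u v. c * \<beta> u v) 1 1 = c * alg_op f \<beta> 1 1" for f
   unfolding alg_op_def sum_distrib_left
   using word_op_linear[of _ "%_. c" "%_. \<beta>" "{()}"] by (simp add: mult.left_commute)
  ultimately show ?thesis unfolding comult_abs[OF two b] alg_op_mult by simp
 qed
 thus "comult (scA c a) \<beta> = fscale c (comult a) \<beta>"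
  by (cases "bilA \<beta>") (simp_all add: abs_glc_mult abs_glc_const glc_scale_def comult_non_bilin fscale_def)
qed

lemma comult_one: "(2::'k::field) ~= 0 ==> bilA \<beta> ==> comult (1 :: ('k, 'm::len0, 'n::len0) glc) \<beta> = \<beta> 1 1"
 using comult_abs[of \<beta> 1] by (simp add: abs_glc_one alg_op_one)

text \<open>The recursion that, together with \<open>glc_gen_induct\<close>, proves the counit laws,
  coassociativity and the compatibility with parity.\<close>

lemma comult_gen_mult:
 assumes two: "(2::'k::field) ~= 0" and \<beta>: "bilA \<beta>"
 shows "comult (glc_gen x * a :: ('k, 'm::len0, 'n::len0) glc) \<beta> = comult a (gen_op x \<beta>)"
proof -
 have "glc_gen x * a = abs_glc (fgen x * rep_glc a)"
  by (simp add: abs_glc_mult abs_glc_fgen)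
 hence "comult (glc_gen x * a) \<beta> = alg_op (rep_glc a) (alg_op (fgen x) \<beta>) 1 1"
  by (simp add: comult_abs[OF two \<beta>] alg_op_mult)
 also have "alg_op (fgen x) \<beta> = gen_op x \<beta>" by (intro ext) (rule alg_op_fgen)
 also have "alg_op (rep_glc a) (gen_op x \<beta>) 1 1 = comult (abs_glc (rep_glc a) :: ('k,'m,'n) glc) (gen_op x \<beta>)"
  by (rule comult_abs[OF two bilA_gen_op[OF \<beta>], symmetric])
 finally show ?thesis by simp
qed

lemma comult_in_tens_space:
 assumes two: "(2::'k::field) ~= 0"
 shows "comult (a :: ('k, 'm::len0, 'n::len0) glc) \<in> tens_space scA scA UNIV UNIV"
proof -
 interpret F: vector_space "fscale :: 'k => ('k, ('k,'m,'n) glc, ('k,'m,'n) glc) tensor => _" by (rule vector_space_fscale)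
 have l: "(\<Sum>(v, w)\<leftarrow>ys. tensA v w) \<in> F.span {tensA v w | v w. v \<in> UNIV & w \<in> UNIV}" for ys :: "(('k,'m,'n) glc \<times> ('k,'m,'n) glc) list"
 proof (induction ys)
  case (Cons y ys)
  obtain v w where y: "y = (v, w)" by force
  have "tensA v w \<in> F.span {tensA v w | v w. v \<in> UNIV & w \<in> UNIV}"
   by (rule F.span_base) blast
  from F.span_add[OF this Cons] show ?case by (simp only: y list.map sum_list.Cons split)
 next
  case Nil
  show ?case using F.span_zero by (simp only: list.map sum_list.Nil)
 qed
 have "comult_letters xs \<in> F.span {tensA v w | v w. v \<in> UNIV & w \<in> UNIV}" for xs
 proof -
  obtain ys where "(comult_letters xs :: ('k, ('k,'m,'n) glc, ('k,'m,'n) glc) tensor) = (\<Sum>(v, w)\<leftarrow>ys. tensA v w)"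
   using comult_letters_rep[OF two] by blast
  with l[of ys] show ?thesis by (simp only:)
 qed
 thus ?thesis
  unfolding comult_def tens_space_def by (intro F.span_sum F.span_scale)
qed

lemma comult_rep:
 assumes two: "(2::'k::field) ~= 0"
 obtains xs where "!!\<beta>. bilA \<beta> ==> comult (a :: ('k, 'm::len0, 'n::len0) glc) \<beta> = (\<Sum>(v, w)\<leftarrow>xs. \<beta> v w)"
proof -
 obtain xs where "comult a = (\<Sum>(v, w)\<leftarrow>xs. tensA v w)"
  using tens_space_rep[OF comult_in_tens_space[OF two] glc.subspace_UNIV vs_glc vs_glc, of a]
  by blast
 thus ?thesis using that[of xs] by (simp add: tens_list_apply)
qed

lemma comult_form_sum:
 assumes two: "(2::'k::field) ~= 0" and "!!i. i \<in> S ==> bilA (\<beta> i)"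
 shows "comult (a :: ('k, 'm::len0, 'n::len0) glc) (%u v. \<Sum>i\<in>S. c i * \<beta> i u v) = (\<Sum>i\<in>S. c i * comult a (\<beta> i))"
proof -
 obtain xs where xs: "!!\<beta>. bilA \<beta> ==> comult a \<beta> = (\<Sum>(v, w)\<leftarrow>xs. \<beta> v w)"
  using comult_rep[OF two] by blast
 have "comult a (%u v. \<Sum>i\<in>S. c i * \<beta> i u v) = (\<Sum>(v, w)\<leftarrow>xs. \<Sum>i\<in>S. c i * \<beta> i v w)"
  by (rule xs) (intro bilA_sum bilA_cmult assms(2))
 also have "... = (\<Sum>i\<in>S. c i * (\<Sum>(v, w)\<leftarrow>xs. \<beta> i v w))"
  by (induction xs) (auto simp: distrib_left sum.distrib)
 also have "... = (\<Sum>i\<in>S. c i * comult a (\<beta> i))"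
  using xs assms(2) by (intro sum.cong refl) auto
 finally show ?thesis .
qed

lemma glc_gen_induct [case_names subspace one gen]:
 fixes a :: "('k::field,'m::len0,'n::len0) glc"
 assumes "glc.subspace S" "1 \<in> S" "!!x a. a \<in> S ==> glc_gen x * a \<in> S"
 shows "a \<in> S"
proof (rule glc_word_induct[OF assms(1)])
 show "word_elt xs \<in> S" for xs
  by (induction xs) (auto intro: assms)
qed

lemma lf_comult: "(2::'k::field) ~= 0 ==> lfA (%a :: ('k, 'm::len0, 'n::len0) glc. comult a \<beta>)"
 by (simp add: lf_def comult_add comult_scale fscale_def)

section \<open>Comodules as modules over the dual algebra\<close>

lemma counit_add: "counit (a + b) = counit a + counit b"
 by transfer (simp add: id_eval.eval_add)

lemma counit_mult: "counit (a * b) = counit a * counit b"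
 by transfer (simp add: id_eval.eval_mult)

lemma counit_one [simp]: "counit 1 = 1"
 by transfer (simp add: id_eval.eval_one)

lemma counit_zero [simp]: "counit 0 = 0"
 by transfer (simp add: id_eval.eval_zero)

lemma counit_gen_eq: "counit (glc_gen x :: ('k::field,'m::len0,'n::len0) glc) = counit_gen (LENGTH('m) + LENGTH('n)) x"
 by transfer (simp add: id_eval.eval_fgen)

lemma counit_scale: "counit (scA c a) = c * counit a"
proof -
 have "counit (glc_const c :: ('a, 'b, 'c) glc) = c"
  by transfer (simp add: id_eval.eval_single)
 thus ?thesis by (simp add: glc_scale_def counit_mult)
qed

lemma lf_counit: "lfA counit"
 by (simp add: lf_def counit_add counit_scale)

lemma counit_pinv: "counit (pinv a) = counit (a :: ('k::field,'m::len0,'n::len0) glc)"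
proof -
 have "a \<in> {a. counit (pinv a) = counit a}"
 proof (rule glc_gen_induct)
  show "glc.subspace {a :: ('k,'m,'n) glc. counit (pinv a) = counit a}"
   by (rule glc.subspaceI) (auto simp: pinv_add counit_add pinv_scale counit_scale)
 next
  fix x and a :: "('k,'m,'n) glc" assume "a \<in> {a. counit (pinv a) = counit a}"
  moreover have "counit (psign (gen_par LENGTH('m) x) True * glc_gen x :: ('k,'m,'n) glc) = counit (glc_gen x :: ('k,'m,'n) glc)"
  proof (cases "gen_par LENGTH('m) x")
   case True
   hence "counit (glc_gen x :: ('k,'m,'n) glc) = 0"
    by (cases x) (auto simp: counit_gen_eq counit_gen_def)
   thus ?thesis by (simp add: counit_mult)
  qed simp
  ultimately show "glc_gen x * a \<in> {a. counit (pinv a) = counit a}"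
   by (simp add: pinv_mult pinv_gen counit_mult)
 qed simp
 thus ?thesis by simp
qed

lemma counit_sig: "counit (sig s a) = counit a"
 by (simp add: sig_def counit_pinv)

text \<open>The form is generalized because pulling out a letter replaces \<open>g\<close> by
  \<open>g\<close> after left multiplication. Of the sum over the inner index one term survives, at
  the row index for an entry of \<open>C\<close> and at the column index for an entry of
  \<open>D\<close>.\<close>

lemma comult_counit_left:
 assumes two: "(2::'k::field) ~= 0" and g: "lfA g"
 shows "comult (a :: ('k, 'm::len0, 'n::len0) glc) (%u v. counit u * g v) = g a"
proof -
 let ?N = "LENGTH('m) + LENGTH('n)"
 have bil: "bilA (%u v. counit (u :: ('k,'m,'n) glc) * h v)" if "lfA h" for h :: "('k,'m,'n) glc => 'k"
  by (rule bilA_prod[OF lf_counit that])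
 have "a \<in> {a. ALL g. lfA g --> comult a (%u v. counit u * g v) = g a}"
 proof (rule glc_gen_induct)
  show "glc.subspace {a :: ('k,'m,'n) glc. ALL g. lfA g --> comult a (%u v. counit u * g v) = g a}"
   by (rule glc.subspaceI)
    (auto simp: comult_add[OF two] comult_scale[OF two] fscale_def lf_add lf_scale lf_zero
     lf_zero[OF lf_comult[OF two]])
 next
  show "1 \<in> {a :: ('k,'m,'n) glc. ALL g. lfA g --> comult a (%u v. counit u * g v) = g a}"
   by (auto simp: comult_one[OF two bil])
 next
  fix x and a :: "('k,'m,'n) glc" assume a: "a \<in> {a. ALL g. lfA g --> comult a (%u v. counit u * g v) = g a}"
  show "glc_gen x * a \<in> {a. ALL g. lfA g --> comult a (%u v. counit u * g v) = g a}"
  proof (intro CollectI allI impI)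
   fix g :: "('k,'m,'n) glc => 'k" assume g: "lfA g"
   have gx: "lfA (%v. g (glc_gen x * v))"
    using g by (auto simp: lf_def distrib_left glc_scale_mult_right)
   have "gen_op x (%u v. counit u * g v) = (%u v. counit u * g (glc_gen x * v))"
   proof (intro ext)
    fix u v :: "('k,'m,'n) glc"
    define i where "i = (case x of GenC i j => i | GenD i j => j)"
    have k: "gen_sign LENGTH('m) x k * (counit (glc_gen (genL x k) * sig (gen_par LENGTH('m) (genR x k)) u)
      * g (glc_gen (genR x k) * v)) = (if k = i then counit u * g (glc_gen x * v) else 0)" if "k < ?N" for k
     using that by (cases x) (auto simp: i_def counit_mult counit_sig counit_gen_eq counit_gen_def psign_def)
    have "(if i < ?N then counit u * g (glc_gen x * v) else 0) = counit u * g (glc_gen x * v)"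
     using glc_gen_out_of_range[of x, where ?'k = 'k and ?'m = 'm and ?'n = 'n]
     by (cases x) (auto simp: i_def word_in_range_def lf_zero[OF g])
    moreover have "gen_op x (%u v. counit u * g v) u v = (\<Sum>k<?N. if k = i then counit u * g (glc_gen x * v) else 0)"
     unfolding gen_op_def by (rule sum.cong[OF refl], rule k) simp
    ultimately show "gen_op x (%u v. counit u * g v) u v = counit u * g (glc_gen x * v)"
     by (simp only: sum.delta finite_lessThan lessThan_iff)
   qed
   thus "comult (glc_gen x * a) (%u v. counit u * g v) = g (glc_gen x * a)"
    using a gx by (simp add: comult_gen_mult[OF two bil[OF g]])
  qed
 qed
 from this[unfolded mem_Collect_eq, rule_format, OF g] show ?thesis .
qed

lemma comult_counit_right:
 assumes two: "(2::'k::field) ~= 0" and g: "lfA g"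
 shows "comult (a :: ('k, 'm::len0, 'n::len0) glc) (%u v. g u * counit v) = g a"
proof -
 let ?N = "LENGTH('m) + LENGTH('n)"
 have bil: "bilA (%u v. h u * counit (v :: ('k,'m,'n) glc))" if "lfA h" for h :: "('k,'m,'n) glc => 'k"
  by (rule bilA_prod[OF that lf_counit])
 have "a \<in> {a. ALL g. lfA g --> comult a (%u v. g u * counit v) = g a}"
 proof (rule glc_gen_induct)
  show "glc.subspace {a :: ('k,'m,'n) glc. ALL g. lfA g --> comult a (%u v. g u * counit v) = g a}"
   by (rule glc.subspaceI)
    (auto simp: comult_add[OF two] comult_scale[OF two] fscale_def lf_add lf_scale lf_zero
     lf_zero[OF lf_comult[OF two]])
 next
  show "1 \<in> {a :: ('k,'m,'n) glc. ALL g. lfA g --> comult a (%u v. g u * counit v) = g a}"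
   by (auto simp: comult_one[OF two bil])
 next
  fix x and a :: "('k,'m,'n) glc" assume a: "a \<in> {a. ALL g. lfA g --> comult a (%u v. g u * counit v) = g a}"
  show "glc_gen x * a \<in> {a. ALL g. lfA g --> comult a (%u v. g u * counit v) = g a}"
  proof (intro CollectI allI impI)
   fix g :: "('k,'m,'n) glc => 'k" assume g: "lfA g"
   have gx: "lfA (%v. g (glc_gen x * v))"
    using g by (auto simp: lf_def distrib_left glc_scale_mult_right)
   have "gen_op x (%u v. g u * counit v) = (%u v. g (glc_gen x * u) * counit v)"
   proof (intro ext)
    fix u v :: "('k,'m,'n) glc"
    define i where "i = (case x of GenC i j => j | GenD i j => i)"
    have k: "gen_sign LENGTH('m) x k * (g (glc_gen (genL x k) * sig (gen_par LENGTH('m) (genR x k)) u)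
      * counit (glc_gen (genR x k) * v)) = (if k = i then g (glc_gen x * u) * counit v else 0)" if "k < ?N" for k
     using that by (cases x) (auto simp: i_def counit_mult counit_gen_eq counit_gen_def psign_def)
    have "(if i < ?N then g (glc_gen x * u) * counit v else 0) = g (glc_gen x * u) * counit v"
     using glc_gen_out_of_range[of x, where ?'k = 'k and ?'m = 'm and ?'n = 'n]
     by (cases x) (auto simp: i_def word_in_range_def lf_zero[OF g])
    moreover have "gen_op x (%u v. g u * counit v) u v = (\<Sum>k<?N. if k = i then g (glc_gen x * u) * counit v else 0)"
     unfolding gen_op_def by (rule sum.cong[OF refl], rule k) simp
    ultimately show "gen_op x (%u v. g u * counit v) u v = g (glc_gen x * u) * counit v"
     by (simp only: sum.delta finite_lessThan lessThan_iff)
   qed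
   thus "comult (glc_gen x * a) (%u v. g u * counit v) = g (glc_gen x * a)"
    using a gx by (simp add: comult_gen_mult[OF two bil[OF g]])
  qed
 qed
 from this[unfolded mem_Collect_eq, rule_format, OF g] show ?thesis .
qed

text \<open>The signs which \<open>pinv\<close> puts on the two coproduct factors of a letter
  multiply to the sign of the letter itself.\<close>

lemma comult_pinv:
 assumes two: "(2::'k::field) ~= 0" and \<beta>: "bilA \<beta>"
 shows "comult (pinv a :: ('k, 'm::len0, 'n::len0) glc) \<beta> = comult a (%u v. \<beta> (pinv u) (pinv v))"
proof -
 have bil: "bilA (%u v. \<beta> (pinv u) (pinv v))" if "bilA \<beta>" for \<beta> :: "('k,'m,'n) glc => ('k,'m,'n) glc => 'k"
  by (rule bilA_compose[OF that]) (simp_all add: pinv_add pinv_scale)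
 have "a \<in> {a. ALL \<beta>. bilA \<beta> --> comult (pinv a) \<beta> = comult a (%u v. \<beta> (pinv u) (pinv v))}"
 proof (rule glc_gen_induct)
  show "glc.subspace {a :: ('k,'m,'n) glc. ALL \<beta>. bilA \<beta> --> comult (pinv a) \<beta> = comult a (%u v. \<beta> (pinv u) (pinv v))}"
   by (rule glc.subspaceI)
    (auto simp: comult_add[OF two] comult_scale[OF two] fscale_def pinv_add pinv_scale
     lf_zero[OF lf_comult[OF two]])
 next
  show "1 \<in> {a :: ('k,'m,'n) glc. ALL \<beta>. bilA \<beta> --> comult (pinv a) \<beta> = comult a (%u v. \<beta> (pinv u) (pinv v))}"
   by (auto simp: comult_one[OF two] bil)
 next
  fix x and a :: "('k,'m,'n) glc"
  assume a: "a \<in> {a. ALL \<beta>. bilA \<beta> --> comult (pinv a) \<beta> = comult a (%u v. \<beta> (pinv u) (pinv v))}"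
  show "glc_gen x * a \<in> {a. ALL \<beta>. bilA \<beta> --> comult (pinv a) \<beta> = comult a (%u v. \<beta> (pinv u) (pinv v))}"
  proof (intro CollectI allI impI)
   fix \<beta> :: "('k,'m,'n) glc => ('k,'m,'n) glc => 'k" assume \<beta>: "bilA \<beta>"
   let ?p = "gen_par LENGTH('m)"
   let ?s = "psign (?p x) True"
   have ps: "comult (psign p q * b) \<gamma> = psign p q * comult b \<gamma>" for p q and b :: "('k,'m,'n) glc" and \<gamma>
    by (simp add: psign_def lf_minus[OF lf_comult[OF two]])
   have "gen_op x (%u v. \<beta> (pinv u) (pinv v)) = (%u v. ?s * gen_op x \<beta> (pinv u) (pinv v))"
   proof (intro ext)
    fix u v :: "('k,'m,'n) glc"
    have "\<beta> (pinv (glc_gen (genL x k) * sig (?p (genR x k)) u)) (pinv (glc_gen (genR x k) * v)) =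
     ?s * \<beta> (glc_gen (genL x k) * sig (?p (genR x k)) (pinv u)) (glc_gen (genR x k) * pinv v)" for k
    proof -
     have "pinv (sig t u) = sig t (pinv u)" for t by (simp add: sig_def)
     thus ?thesis
      unfolding pinv_mult pinv_gen gen_par_left_right[of "LENGTH('m)" x k] mult.assoc
      by (cases "?p (genL x k)"; cases "?p (genR x k)") (simp_all add: psign_def bilA_simps[OF \<beta>])
    qed
    thus "gen_op x (%u v. \<beta> (pinv u) (pinv v)) u v = ?s * gen_op x \<beta> (pinv u) (pinv v)"
     unfolding gen_op_def sum_distrib_left by (simp only: mult.left_commute)
   qed
   hence "comult (glc_gen x * a) (%u v. \<beta> (pinv u) (pinv v)) = comult a (%u v. ?s * gen_op x \<beta> (pinv u) (pinv v))"
    by (simp only: comult_gen_mult[OF two bil[OF \<beta>]])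
   also have "... = ?s * comult a (%u v. gen_op x \<beta> (pinv u) (pinv v))"
    using comult_form_sum[OF two, of "{()}" "%_ u v. gen_op x \<beta> (pinv u) (pinv v)" a "%_. ?s"] bil[OF bilA_gen_op[OF \<beta>]] by simp
   also have "... = ?s * comult (pinv a) (gen_op x \<beta>)"
    using a bilA_gen_op[OF \<beta>] by simp
   also have "... = comult (pinv (glc_gen x * a)) \<beta>"
    by (simp only: comult_gen_mult[OF two \<beta>, symmetric] ps[symmetric] pinv_mult pinv_gen mult.assoc)
   finally show "comult (pinv (glc_gen x * a)) \<beta> = comult (glc_gen x * a) (%u v. \<beta> (pinv u) (pinv v))" ..
  qed
 qed
 from this[unfolded mem_Collect_eq, rule_format, OF \<beta>] show ?thesis .
qed

lemma comult_sig:
 assumes two: "(2::'k::field) ~= 0" and \<beta>: "bilA \<beta>"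
 shows "comult (sig s a :: ('k, 'm::len0, 'n::len0) glc) \<beta> = comult a (%u v. \<beta> (sig s u) (sig s v))"
 using comult_pinv[OF two \<beta>, of a] by (cases s) (simp_all add: sig_def)

section \<open>Coassociativity\<close>

abbreviation triA :: "(('k::field,'m::len0,'n::len0) glc => ('k,'m,'n) glc => ('k,'m,'n) glc => 'k) => bool"
 where "triA \<equiv> trilin scA"

lemma triA_iff: "triA \<theta> \<longleftrightarrow> (ALL a b. lfA (%v. \<theta> v b a)) & (ALL v a. lfA (%b. \<theta> v b a)) & (ALL v b. lfA (\<theta> v b))"
 by (auto simp: trilin_def bilA_iff linear_lf[OF vs_glc])

lemma bilA_comult_left:
 assumes two: "(2::'k::field) ~= 0" and \<theta>: "triA (\<theta> :: ('k, 'm::len0, 'n::len0) glc => _)"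
 shows "bilA (%u v. comult u (%y b. \<theta> y b v))"
proof -
 have "lfA (%v. comult u (%y b. \<theta> y b v))" for u
 proof -
  obtain xs where xs: "!!\<beta>. bilA \<beta> ==> comult u \<beta> = (\<Sum>(v, w)\<leftarrow>xs. \<beta> v w)"
   using comult_rep[OF two] by blast
  have "comult u (%y b. \<theta> y b v) = (\<Sum>(y, b)\<leftarrow>xs. \<theta> y b v)" for v
   by (rule xs) (use \<theta> in \<open>simp add: triA_iff bilA_iff\<close>)
  moreover have "lfA (%v. \<Sum>(y, b)\<leftarrow>xs. \<theta> y b v)"
   using \<theta> by (induction xs) (auto simp: triA_iff lf_const0 intro: lf_plus)
  ultimately show ?thesis by simp
 qed
 thus ?thesis by (simp add: bilA_iff lf_comult[OF two])
qed

lemma bilA_comult_right: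
 assumes two: "(2::'k::field) ~= 0" and \<theta>: "triA (\<theta> :: ('k, 'm::len0, 'n::len0) glc => _)"
 shows "bilA (%u v. comult v (\<theta> u))"
proof -
 have "lfA (%u. comult v (\<theta> u))" for v
 proof -
  obtain xs where xs: "!!\<beta>. bilA \<beta> ==> comult v \<beta> = (\<Sum>(v, w)\<leftarrow>xs. \<beta> v w)"
   using comult_rep[OF two] by blast
  have "comult v (\<theta> u) = (\<Sum>(y, b)\<leftarrow>xs. \<theta> u y b)" for u
   by (rule xs) (use \<theta> in \<open>simp add: triA_iff bilA_iff\<close>)
  moreover have "lfA (%u. \<Sum>(y, b)\<leftarrow>xs. \<theta> u y b)"
   using \<theta> by (induction xs) (auto simp: triA_iff lf_const0 intro: lf_plus)
  ultimately show ?thesis by simp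
 qed
 thus ?thesis by (simp add: bilA_iff lf_comult[OF two])
qed

text \<open>The iterated coproduct of a generator, written as \<open>\<Delta> \<otimes> id\<close> and as \<open>id \<otimes> \<Delta>\<close>.\<close>

lemma gen_op_coassoc_left:
 assumes two: "(2::'k::field) ~= 0" and \<theta>: "triA (\<theta> :: ('k, 'm::len0, 'n::len0) glc => _)"
 defines "p \<equiv> gen_par LENGTH('m)"
 shows "gen_op x (%u v. comult u (%y b. \<theta> y b v)) =
  (%u v. comult u (%y b. \<Sum>k<LENGTH('m) + LENGTH('n). \<Sum>l<LENGTH('m) + LENGTH('n).
   gen_sign LENGTH('m) x k * gen_sign LENGTH('m) (genL x k) l *
   \<theta> (glc_gen (genL (genL x k) l) * sig (p (genR (genL x k) l) ~= p (genR x k)) y)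
    (glc_gen (genR (genL x k) l) * sig (p (genR x k)) b) (glc_gen (genR x k) * v)))"
proof (intro ext)
 fix u v :: "('k,'m,'n) glc"
 let ?N = "LENGTH('m) + LENGTH('n)"
 have b: "bilA (%y b. \<theta> y b w)" for w using \<theta> by (simp add: triA_iff bilA_iff)
 have bs: "bilA (%y b. gen_op z (%y b. \<theta> y b w) (sig t y) (sig t b))" for z w t
  by (rule bilA_compose[OF bilA_gen_op[OF b]]) (simp_all add: sig_add sig_scale)
 have "gen_op x (%u v. comult u (%y b. \<theta> y b v)) u v =
   (\<Sum>k<?N. gen_sign LENGTH('m) x k *
    comult u (%y b. gen_op (genL x k) (%y b. \<theta> y b (glc_gen (genR x k) * v)) (sig (p (genR x k)) y) (sig (p (genR x k)) b)))"
  by (simp only: gen_op_def[of x] comult_gen_mult[OF two b] comult_sig[OF two bilA_gen_op[OF b]] p_def)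
 also have "... = comult u (%y b. \<Sum>k<?N. gen_sign LENGTH('m) x k *
    gen_op (genL x k) (%y b. \<theta> y b (glc_gen (genR x k) * v)) (sig (p (genR x k)) y) (sig (p (genR x k)) b))"
  by (rule comult_form_sum[OF two bs, symmetric])
 finally show "gen_op x (%u v. comult u (%y b. \<theta> y b v)) u v =
  comult u (%y b. \<Sum>k<?N. \<Sum>l<?N.
   gen_sign LENGTH('m) x k * gen_sign LENGTH('m) (genL x k) l *
   \<theta> (glc_gen (genL (genL x k) l) * sig (p (genR (genL x k) l) ~= p (genR x k)) y)
    (glc_gen (genR (genL x k) l) * sig (p (genR x k)) b) (glc_gen (genR x k) * v))"
  by (simp only: gen_op_def sum_distrib_left mult.assoc sig_sig p_def)
qed

lemma gen_op_coassoc_right: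
 assumes two: "(2::'k::field) ~= 0" and \<theta>: "triA (\<theta> :: ('k, 'm::len0, 'n::len0) glc => _)"
 defines "p \<equiv> gen_par LENGTH('m)"
 shows "gen_op x (%u v. comult v (\<theta> u)) =
  (%u v. comult v (%b c. \<Sum>k<LENGTH('m) + LENGTH('n). \<Sum>l<LENGTH('m) + LENGTH('n).
   gen_sign LENGTH('m) x k * gen_sign LENGTH('m) (genR x k) l *
   \<theta> (glc_gen (genL x k) * sig (p (genR x k)) u)
    (glc_gen (genL (genR x k) l) * sig (p (genR (genR x k) l)) b)
    (glc_gen (genR (genR x k) l) * c)))"
proof (intro ext)
 fix u v :: "('k,'m,'n) glc"
 let ?N = "LENGTH('m) + LENGTH('n)"
 have b: "bilA (\<theta> w)" for w using \<theta> by (simp add: triA_iff bilA_iff)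
 have "gen_op x (%u v. comult v (\<theta> u)) u v =
   (\<Sum>k<?N. gen_sign LENGTH('m) x k *
    comult v (gen_op (genR x k) (\<theta> (glc_gen (genL x k) * sig (p (genR x k)) u))))"
  by (simp only: gen_op_def[of x] comult_gen_mult[OF two b] p_def)
 also have "... = comult v (%b c. \<Sum>k<?N. gen_sign LENGTH('m) x k *
    gen_op (genR x k) (\<theta> (glc_gen (genL x k) * sig (p (genR x k)) u)) b c)"
  by (rule comult_form_sum[OF two bilA_gen_op[OF b], symmetric])
 finally show "gen_op x (%u v. comult v (\<theta> u)) u v =
  comult v (%b c. \<Sum>k<?N. \<Sum>l<?N.
   gen_sign LENGTH('m) x k * gen_sign LENGTH('m) (genR x k) l *
   \<theta> (glc_gen (genL x k) * sig (p (genR x k)) u)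
    (glc_gen (genL (genR x k) l) * sig (p (genR (genR x k) l)) b)
    (glc_gen (genR (genR x k) l) * c))"
  by (simp only: gen_op_def sum_distrib_left mult.assoc p_def)
qed

text \<open>Induction on letters with the trilinear form generalized: pulling out a letter
  transforms the form, and both orders of taking coproducts must transform it in the same
  way.\<close>

lemma comult_coassoc:
 assumes two: "(2::'k::field) ~= 0" and \<theta>: "triA \<theta>"
 shows "comult (a :: ('k, 'm::len0, 'n::len0) glc) (%u v. comult u (%y b. \<theta> y b v)) = comult a (%u v. comult v (\<theta> u))"
proof -
 let ?N = "LENGTH('m) + LENGTH('n)" and ?p = "gen_par LENGTH('m)"
 have "a \<in> {a. ALL \<theta>. triA \<theta> --> comult a (%u v. comult u (%y b. \<theta> y b v)) = comult a (%u v. comult v (\<theta> u))}" (is "a \<in> ?S")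
 proof (rule glc_gen_induct)
  show "glc.subspace ?S"
   by (rule glc.subspaceI)
    (auto simp: comult_add[OF two] comult_scale[OF two] fscale_def lf_zero[OF lf_comult[OF two]])
 next
  show "1 \<in> ?S"
  proof (intro CollectI allI impI)
   fix \<theta> :: "('k,'m,'n) glc => ('k,'m,'n) glc => ('k,'m,'n) glc => 'k" assume t: "triA \<theta>"
   hence "bilA (%y b. \<theta> y b 1)" "bilA (\<theta> 1)" by (auto simp: triA_iff bilA_iff)
   thus "comult 1 (%u v. comult u (%y b. \<theta> y b v)) = comult 1 (%u v. comult v (\<theta> u))"
    by (simp add: comult_one[OF two] bilA_comult_left[OF two t] bilA_comult_right[OF two t])
  qed
 next
  fix x and a :: "('k,'m,'n) glc" assume a: "a \<in> ?S"
  show "glc_gen x * a \<in> ?S"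
  proof (intro CollectI allI impI)
   fix \<theta> :: "('k,'m,'n) glc => ('k,'m,'n) glc => ('k,'m,'n) glc => 'k" assume t: "triA \<theta>"
   define \<theta>' where "\<theta>' y b v = (\<Sum>k<?N. \<Sum>l<?N.
    gen_sign LENGTH('m) x k * gen_sign LENGTH('m) (genL x k) l *
    \<theta> (glc_gen (genL (genL x k) l) * sig (?p (genR (genL x k) l) ~= ?p (genR x k)) y)
     (glc_gen (genR (genL x k) l) * sig (?p (genR x k)) b) (glc_gen (genR x k) * v))" for y b v
   define \<theta>'' where "\<theta>'' u b c = (\<Sum>k<?N. \<Sum>l<?N.
    gen_sign LENGTH('m) x k * gen_sign LENGTH('m) (genR x k) l *
    \<theta> (glc_gen (genL x k) * sig (?p (genR x k)) u)
     (glc_gen (genL (genR x k) l) * sig (?p (genR (genR x k) l)) b)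
     (glc_gen (genR (genR x k) l) * c))" for u b c
   \<comment> \<open>The iterated coproduct of a letter is a sum over two inner indices. The two
     bracketings differ by exchanging these indices, and their signs agree.\<close>
   have "\<theta>'' = \<theta>'"
   proof (intro ext)
    fix u b c
    have "\<theta>'' u b c = (\<Sum>k<?N. \<Sum>l<?N.
     gen_sign LENGTH('m) x l * gen_sign LENGTH('m) (genR x l) k *
     \<theta> (glc_gen (genL x l) * sig (?p (genR x l)) u)
      (glc_gen (genL (genR x l) k) * sig (?p (genR (genR x l) k)) b)
      (glc_gen (genR (genR x l) k) * c))"
     unfolding \<theta>''_def by (rule sum.swap)
    also have "... = \<theta>' u b c"
     unfolding \<theta>'_def
    proof (intro sum.cong refl)
     fix k l
     have gens: "genL (genL x k) l = genL x l" "genR (genL x k) l = genL (genR x l) k"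
      "genR x k = genR (genR x l) k"
      by (cases x; simp)+
     have par: "(?p (genR (genL x k) l) ~= ?p (genR x k)) = ?p (genR x l)"
      by (cases x) auto
     have sgn: "gen_sign LENGTH('m) x l * gen_sign LENGTH('m) (genR x l) k =
       (gen_sign LENGTH('m) x k * gen_sign LENGTH('m) (genL x k) l :: 'k)"
      by (cases x; simp add: psign_def; blast)
     show "gen_sign LENGTH('m) x l * gen_sign LENGTH('m) (genR x l) k *
      \<theta> (glc_gen (genL x l) * sig (?p (genR x l)) u)
       (glc_gen (genL (genR x l) k) * sig (?p (genR (genR x l) k)) b)
       (glc_gen (genR (genR x l) k) * c) =
      gen_sign LENGTH('m) x k * gen_sign LENGTH('m) (genL x k) l *
      \<theta> (glc_gen (genL (genL x k) l) * sig (?p (genR (genL x k) l) ~= ?p (genR x k)) u)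
       (glc_gen (genR (genL x k) l) * sig (?p (genR x k)) b) (glc_gen (genR x k) * c)"
      unfolding sgn par by (simp only: gens(1,2) gens(3)[symmetric])
    qed
    finally show "\<theta>'' u b c = \<theta>' u b c" .
   qed
   moreover have "triA \<theta>'"
   proof -
    have 1: "lfA (%v. h (g * sig s v))" "lfA (%v. h (g * v))" if "lfA h" for h and g :: "('k,'m,'n) glc" and s
     using that by (auto simp: lf_def sig_add sig_scale distrib_left glc_scale_mult_right)
    show ?thesis
     unfolding triA_iff \<theta>'_def using t unfolding triA_iff
     by (intro conjI allI lf_setsum lf_cmult 1) auto
   qed
   ultimately show "comult (glc_gen x * a) (%u v. comult u (%y b. \<theta> y b v)) = comult (glc_gen x * a) (%u v. comult v (\<theta> u))"
    using a unfolding comult_gen_mult[OF two bilA_comult_left[OF two t]] comult_gen_mult[OF two bilA_comult_right[OF two t]]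
     gen_op_coassoc_left[OF two t] gen_op_coassoc_right[OF two t] \<theta>'_def[symmetric] \<theta>''_def[symmetric]
    by auto
  qed
 qed
 from this[unfolded mem_Collect_eq, rule_format, OF \<theta>] show ?thesis .
qed

text \<open>Convolution without Koszul signs. The signed operations are reduced to contractions of
  this kind in \<open>conv_eq\<close> and \<open>act_eq\<close>.\<close>

definition convu :: "(('k::field,'m::len0,'n::len0) glc => 'k) => (('k,'m,'n) glc => 'k) => ('k,'m,'n) glc => 'k"
 where "convu g h a = comult a (%u v. g u * h v)"

lemma lf_convu: "(2::'k) ~= 0 ==> lfA (convu g h :: ('k::field,'m::len0,'n::len0) glc => 'k)"
 unfolding convu_def by (rule lf_comult)

text \<open>Collects what a coaction satisfies on the ambient space; the comodule axioms, valid on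
  the carrier only, are added in \<open>comod\<close>.\<close>

locale precomod =
 fixes s :: "'k::field => 'v::ab_group_add => 'v"
  and ca :: "'v => ('k, 'v, ('k, 'm::len0, 'n::len0) glc) tensor"
 assumes vs: "vector_space s"
  and ca_linear: "Vector_Spaces.linear s fscale ca"
  and ca_range: "ca v \<in> tens_space s scA UNIV UNIV"
begin

sublocale vector_space s by (rule vs)

lemma ca_add: "ca (v + w) \<beta> = ca v \<beta> + ca w \<beta>"
 and ca_scale: "ca (s c v) \<beta> = c * ca v \<beta>"
 using ca_linear by (auto simp: Vector_Spaces.linear_iff fscale_def)

lemma ca_rep:
 obtains xs where "!!\<beta>. bilin s scA \<beta> ==> ca v \<beta> = (\<Sum>(x, a)\<leftarrow>xs. \<beta> x a)"
proof -
 obtain xs where "ca v = (\<Sum>(x, a)\<leftarrow>xs. tens s scA x a)"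
  using tens_space_rep[OF ca_range subspace_UNIV vs vs_glc, of v] by blast
 thus ?thesis using that[of xs] by (simp add: tens_list_apply)
qed

text \<open>Contraction of the coaction with a form on the coordinate ring. The companion
  \<open>tau\<close> contracts with a form on the module and produces matrix coefficients. Both
  results are pinned down by their values under linear forms, since a tensor is itself only known
  through bilinear forms.\<close>

definition ract :: "(('k,'m,'n) glc => 'k) => 'v => 'v"
 where "ract g v = (THE u. ALL \<phi>. lf s \<phi> --> \<phi> u = ca v (%x a. \<phi> x * g a))"

definition tau :: "('v => 'k) => 'v => ('k,'m,'n) glc"
 where "tau \<phi> v = (THE a. ALL g. lfA g --> g a = ca v (%x a. \<phi> x * g a))"

lemma bil_prod: "lf s \<phi> ==> lfA g ==> bilin s scA (%x a. \<phi> x * g a)"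
 by (rule bilin_prod[OF vs vs_glc])

lemma lf_ract:
 assumes g: "lfA g" and \<phi>: "lf s \<phi>"
 shows "\<phi> (ract g v) = ca v (%x a. \<phi> x * g a)"
proof -
 obtain xs where xs: "!!\<beta>. bilin s scA \<beta> ==> ca v \<beta> = (\<Sum>(x, a)\<leftarrow>xs. \<beta> x a)"
  using ca_rep by blast
 define u where "u = (\<Sum>(x, a)\<leftarrow>xs. s (g a) x)"
 have u: "\<phi> u = ca v (%x a. \<phi> x * g a)" if "lf s \<phi>" for \<phi>
  unfolding u_def xs[OF bil_prod[OF that g]]
  by (simp add: lf_sum_list[OF that] split_def lf_scale[OF that] mult.commute)
 have "ract g v = u"
  unfolding ract_def
 proof (rule the_equality)
  show "ALL \<phi>. lf s \<phi> --> \<phi> u = ca v (%x a. \<phi> x * g a)" using u by blast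
  show "u' = u" if "ALL \<phi>. lf s \<phi> --> \<phi> u' = ca v (%x a. \<phi> x * g a)" for u'
   by (rule lf_separate[OF vs]) (simp add: that u)
 qed
 thus ?thesis using u[OF \<phi>] by simp
qed

lemma lf_tau_ca:
 assumes g: "lfA g" and \<phi>: "lf s \<phi>"
 shows "g (tau \<phi> v) = ca v (%x a. \<phi> x * g a)"
proof -
 obtain xs where xs: "!!\<beta>. bilin s scA \<beta> ==> ca v \<beta> = (\<Sum>(x, a)\<leftarrow>xs. \<beta> x a)"
  using ca_rep by blast
 define u where "u = (\<Sum>(x, a)\<leftarrow>xs. scA (\<phi> x) a)"
 have u: "g u = ca v (%x a. \<phi> x * g a)" if "lfA g" for g
  unfolding u_def xs[OF bil_prod[OF \<phi> that]]
  by (simp add: lf_sum_list[OF that] split_def lf_scale[OF that])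
 have "tau \<phi> v = u"
  unfolding tau_def
 proof (rule the_equality)
  show "ALL g. lfA g --> g u = ca v (%x a. \<phi> x * g a)" using u by blast
  show "u' = u" if "ALL g. lfA g --> g u' = ca v (%x a. \<phi> x * g a)" for u'
   by (rule lf_separate[OF vs_glc]) (simp add: that u)
 qed
 thus ?thesis using u[OF g] by simp
qed

lemma lf_tau: "lfA g ==> lf s \<phi> ==> g (tau \<phi> v) = \<phi> (ract g v)"
 by (simp add: lf_tau_ca lf_ract)

lemma ract_eqI:
 assumes "lfA g" "!!\<phi>. lf s \<phi> ==> \<phi> u = g (tau \<phi> v)"
 shows "ract g v = u"
proof (rule lf_separate[OF vs])
 fix \<phi> assume "lf s \<phi>"
 thus "\<phi> (ract g v) = \<phi> u" by (simp only: assms(2) lf_tau[OF assms(1)])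
qed

lemma tau_eqI:
 assumes "lf s \<phi>" "!!g. lfA g ==> g a = \<phi> (ract g v)"
 shows "tau \<phi> v = a"
proof (rule lf_separate[OF vs_glc])
 fix g :: "('k,'m,'n) glc => 'k" assume "lfA g"
 thus "g (tau \<phi> v) = g a" by (simp only: assms(2) lf_tau[OF _ assms(1)])
qed

lemma ract_add: "lfA g ==> ract g (v + w) = ract g v + ract g w"
 by (rule lf_separate[OF vs]) (simp add: lf_ract lf_add ca_add)

lemma ract_scale: "lfA g ==> ract g (s c v) = s c (ract g v)"
 by (rule lf_separate[OF vs]) (simp add: lf_ract lf_scale ca_scale)

lemma ract_zero: "lfA g ==> ract g 0 = 0"
 using ract_scale[of g 0 0] by simp

lemma ract_diff: "lfA g ==> ract g (v - w) = ract g v - ract g w"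
 using ract_add[of g v "- w"] ract_scale[of g "- 1" w] by simp

lemma ract_sum: "lfA g ==> ract g (sum f S) = (\<Sum>i\<in>S. ract g (f i))"
 by (induction S rule: infinite_finite_induct) (simp_all add: ract_zero ract_add)

lemma lf_compose_ract: "lfA g ==> lf s \<phi> ==> lf s (%v. \<phi> (ract g v))"
 by (simp add: lf_def ract_add ract_scale)

lemma tau_add: "lf s \<phi> ==> tau \<phi> (v + w) = tau \<phi> v + tau \<phi> w"
 by (rule tau_eqI) (simp_all add: lf_add lf_tau ract_add)

lemma tau_scale: "lf s \<phi> ==> tau \<phi> (s c v) = scA c (tau \<phi> v)"
 by (rule tau_eqI) (simp_all add: lf_scale lf_tau ract_scale)

lemma tau_zero: "lf s \<phi> ==> tau \<phi> 0 = 0"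
 using tau_scale[of \<phi> 0 0] by simp

lemma tau_linear: "lf s \<phi> ==> Vector_Spaces.linear s scA (tau \<phi>)"
 by (simp add: Vector_Spaces.linear_iff vs vs_glc tau_add tau_scale)

lemma tau_plus_form: "lf s \<phi> ==> lf s \<psi> ==> tau (%x. \<phi> x + \<psi> x) v = tau \<phi> v + tau \<psi> v"
 by (rule tau_eqI) (simp_all add: lf_plus lf_add lf_tau)

lemma tau_cmult_form: "lf s \<phi> ==> tau (%x. c * \<phi> x) v = scA c (tau \<phi> v)"
 by (rule tau_eqI) (simp_all add: lf_cmult lf_scale lf_tau)

lemma tau_zero_form: "tau (%x. 0) v = 0"
 by (rule tau_eqI) (simp_all add: lf_const0 lf_zero)

lemma ract_plus_form: "lfA g ==> lfA h ==> ract (%x. g x + h x) v = ract g v + ract h v"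
 by (rule ract_eqI) (simp_all add: lf_plus lf_add lf_tau)

lemma ract_cmult_form: "lfA g ==> ract (%x. c * g x) v = s c (ract g v)"
 by (rule ract_eqI) (simp_all add: lf_cmult lf_scale lf_tau)

lemma ract_zero_form: "ract (%x. 0) v = 0"
 by (rule ract_eqI) (simp_all add: lf_const0 lf_zero)

lemma tau_finite:
 obtains B where "finite B" "!!\<phi>. lf s \<phi> ==> tau \<phi> v \<in> glc.span B"
proof -
 obtain xs where xs: "!!\<beta>. bilin s scA \<beta> ==> ca v \<beta> = (\<Sum>(x, a)\<leftarrow>xs. \<beta> x a)"
  using ca_rep by blast
 have "tau \<phi> v \<in> glc.span (snd ` set xs)" if \<phi>: "lf s \<phi>" for \<phi>
 proof -
  have "tau \<phi> v = (\<Sum>(x, a)\<leftarrow>xs. scA (\<phi> x) a)"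
   by (rule tau_eqI[OF \<phi>])
    (simp add: lf_sum_list split_def lf_scale lf_ract[OF _ \<phi>] xs[OF bil_prod[OF \<phi>]])
  moreover have "(\<Sum>(x, a)\<leftarrow>ys. scA (\<phi> x) a) \<in> glc.span (snd ` set xs)" if "set ys \<subseteq> set xs" for ys
   using that by (induction ys) (force intro: glc.span_add glc.span_scale glc.span_base glc.span_zero)+
  ultimately show ?thesis by simp
 qed
 thus ?thesis using that[of "snd ` set xs"] by blast
qed

lemma ract_finite:
 obtains B where "finite B" "!!g. lfA g ==> ract g v \<in> span B"
proof -
 obtain xs where xs: "!!\<beta>. bilin s scA \<beta> ==> ca v \<beta> = (\<Sum>(x, a)\<leftarrow>xs. \<beta> x a)"
  using ca_rep by blast
 have "ract g v \<in> span (fst ` set xs)" if g: "lfA g" for g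
 proof -
  have "ract g v = (\<Sum>(x, a)\<leftarrow>xs. s (g a) x)"
   by (rule ract_eqI[OF g])
    (simp add: lf_sum_list split_def lf_scale lf_tau_ca[OF g] xs[OF bil_prod[OF _ g]] mult.commute)
  moreover have "(\<Sum>(x, a)\<leftarrow>ys. s (g a) x) \<in> span (fst ` set xs)" if "set ys \<subseteq> set xs" for ys
   using that by (induction ys) (force intro: span_add span_scale span_base span_zero)+
  ultimately show ?thesis by simp
 qed
 thus ?thesis using that[of "fst ` set xs"] by blast
qed

end

text \<open>\<open>closed\<close> expresses by forms that the coaction maps \<open>C\<close> to
  tensors with left factors in \<open>C\<close>.\<close>

locale comod = precomod s ca
 for s :: "'k::field => 'v::ab_group_add => 'v"
  and ca :: "'v => ('k, 'v, ('k, 'm::len0, 'n::len0) glc) tensor" +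
 fixes C :: "'v set"
 assumes two: "(2::'k) ~= 0"
  and sub: "module.subspace s C"
  and coassoc: "v \<in> C ==> trilin s \<theta> ==> ca v (%x a. ca x (%y b. \<theta> y b a)) = ca v (%x a. comult a (\<theta> x))"
  and counit_law: "v \<in> C ==> lf s \<phi> ==> ca v (%x a. \<phi> x * counit a) = \<phi> v"
  and closed: "v \<in> C ==> lfA g ==> ract g v \<in> C"
begin

text \<open>Coassociativity tested against the product of three forms: linear forms act as an
  algebra under convolution, from the left.\<close>

lemma ract_ract:
 assumes v: "v \<in> C" and g: "lfA g" and h: "lfA h"
 shows "ract g (ract h v) = ract (convu g h) v"
proof (rule lf_separate[OF vs])
 fix \<phi> assume \<phi>: "lf s \<phi>"
 have bgh: "bilA (%a b. g a * h b)" by (rule bilA_prod[OF g h])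
 have tri: "trilin s (%y b a. \<phi> y * (g b * h a))"
  unfolding trilin_def linear_lf[OF vs_glc] bilin_iff[OF vs vs_glc]
  using \<phi> g h by (auto simp: lf_def algebra_simps)
 have b3: "bilin s scA (%y b. \<phi> y * (g b * h a))" for a
  using bil_prod[OF \<phi> lf_multc[OF g]] by simp
 have in1: "ca x (%y b. \<phi> y * (g b * h a)) = ca x (%y b. \<phi> y * g b) * h a" for x a
 proof -
  obtain xs where xs: "!!\<beta>. bilin s scA \<beta> ==> ca x \<beta> = (\<Sum>(x, a)\<leftarrow>xs. \<beta> x a)"
   using ca_rep by blast
  have "(\<Sum>(y, b)\<leftarrow>xs. \<phi> y * (g b * h a)) = (\<Sum>(y, b)\<leftarrow>xs. \<phi> y * g b) * h a"
   by (induction xs) (auto simp: algebra_simps)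
  thus ?thesis by (simp add: xs b3 bil_prod[OF \<phi> g])
 qed
 have in2: "comult a (%b c. \<phi> x * (g b * h c)) = \<phi> x * convu g h a" for x a
  using comult_form_sum[OF two, of "{()}" "%_ b c. g b * h c" a "%_. \<phi> x"] bgh
  by (simp add: convu_def)
 have "\<phi> (ract g (ract h v)) = ca v (%x a. \<phi> (ract g x) * h a)"
  by (rule lf_ract[OF h lf_compose_ract[OF g \<phi>]])
 also have "... = ca v (%x a. ca x (%y b. \<phi> y * (g b * h a)))"
  by (simp only: in1 lf_ract[OF g \<phi>])
 also have "... = ca v (%x a. comult a (%b c. \<phi> x * (g b * h c)))"
  by (rule coassoc[OF v tri])
 also have "... = \<phi> (ract (convu g h) v)"
  by (simp only: in2 lf_ract[OF lf_convu[OF two] \<phi>])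
 finally show "\<phi> (ract g (ract h v)) = \<phi> (ract (convu g h) v)" .
qed

lemma ract_counit: "v \<in> C ==> ract counit v = v"
 by (rule ract_eqI[OF lf_counit]) (simp add: lf_tau_ca[OF lf_counit] counit_law)

lemma counit_tau: "v \<in> C ==> lf s \<phi> ==> counit (tau \<phi> v) = \<phi> v"
 by (simp add: lf_tau lf_counit ract_counit)

end

lemma precomod_comult: "(2::'k) ~= 0 ==> precomod scA (comult :: ('k::field,'m::len0,'n::len0) glc => _)"
 unfolding precomod_def Vector_Spaces.linear_iff
 by (intro conjI allI vs_glc vector_space_fscale comult_add comult_scale comult_in_tens_space)

locale odd_char =
 fixes ty :: "('k::field,'m::len0,'n::len0) glc itself"
 assumes two: "(2::'k) ~= 0"
begin

abbreviation H0m where "H0m \<mu> \<equiv> H0_minus \<mu> :: ('k, 'm, 'n, ('k,'m,'n) glc) gsmod"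
abbreviation L0m where "L0m \<mu> \<equiv> L_minus \<mu> :: ('k, 'm, 'n, ('k,'m,'n) glc) gsmod"
abbreviation regA where "regA N \<equiv> regular\<lparr>carrier := N\<rparr> :: ('k, 'm, 'n, ('k,'m,'n) glc) gsmod"

sublocale reg: comod scA "comult :: ('k,'m,'n) glc => _" UNIV
proof -
 interpret precomod scA "comult :: ('k,'m,'n) glc => _"
  by (rule precomod_comult[OF two])
 show "comod scA (comult :: ('k,'m,'n) glc => _) UNIV"
  by standard (simp_all add: two comult_coassoc[OF two] comult_counit_right[OF two])
qed

lemma lf_convu': "lfA (convu g h :: ('k,'m,'n) glc => 'k)"
 by (rule lf_convu[OF two])

lemma convu_ract: "lfA g ==> lfA h ==> convu g h a = g (reg.ract h a)"
 and convu_tau: "lfA g ==> lfA h ==> convu g h a = h (reg.tau g a)"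
 by (simp_all add: convu_def reg.lf_ract reg.lf_tau_ca)

lemma convu_counit_left: "lfA g ==> convu counit g = (g :: ('k,'m,'n) glc => 'k)"
 and convu_counit_right: "lfA g ==> convu g counit = (g :: ('k,'m,'n) glc => 'k)"
 by (auto simp: convu_def comult_counit_left[OF two] comult_counit_right[OF two])

lemma counit_ract: "lfA g ==> counit (reg.ract g a) = g (a :: ('k,'m,'n) glc)"
 by (simp add: convu_ract[symmetric] lf_counit convu_counit_left)

lemma ract_eq_zero: "(!!g. lfA g ==> counit (reg.ract g a) = 0) ==> a = (0 :: ('k,'m,'n) glc)"
 by (rule lf_separate[OF vs_glc]) (simp add: counit_ract lf_zero)

end

context comod begin

sublocale odd_char "TYPE(('k,'m,'n) glc)" by standard (rule two)

text \<open>Hence \<open>tau \<phi>\<close> is a homomorphism from the comodule \<open>C\<close> to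
  the regular comodule. All maps into induced modules below are of this kind.\<close>

lemma ract_tau:
 assumes v: "v \<in> C" and g: "lfA g" and \<phi>: "lf s \<phi>"
 shows "reg.ract g (tau \<phi> v) = tau \<phi> (ract g v)"
 by (rule lf_separate[OF vs_glc])
  (simp add: convu_ract[symmetric] g lf_tau[OF lf_convu' \<phi>] lf_tau[OF _ \<phi>] ract_ract[OF v])

lemma tau_tau:
 assumes v: "v \<in> C" and g: "lfA g" and \<phi>: "lf s \<phi>"
 shows "reg.tau g (tau \<phi> v) = tau (%x. \<phi> (ract g x)) v"
 by (rule lf_separate[OF vs_glc])
  (simp add: convu_tau[symmetric] g lf_tau[OF lf_convu' \<phi>] lf_tau[OF _ lf_compose_ract[OF g \<phi>]] ract_ract[OF v])

end

section \<open>Superspaces and supermodules\<close>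

lemma superspace_hcomp:
 assumes "superspace s P"
 shows hcomp_mem: "hcomp P p v \<in> P p"
  and hcomp_sum: "hcomp P False v + hcomp P True v = v"
  and hcomp_hom: "v \<in> P q ==> hcomp P p v = (if p = q then v else 0)"
  and hcomp_add: "hcomp P p (v + w) = hcomp P p v + hcomp P p w"
  and hcomp_scale: "hcomp P p (s c v) = s c (hcomp P p v)"
proof -
 interpret vector_space s using assms by (simp add: superspace_def)
 have sub: "subspace (P p)" for p using assms by (simp add: superspace_def)
 have int: "x = 0" if "x \<in> P p" "x \<in> P (~ p)" for x p
  using assms that by (cases p) (auto simp: superspace_def)
 have uniq: "hcomp P p v = u" if "u \<in> P p" "v - u \<in> P (~ p)" for u v p
  unfolding hcomp_def
 proof (rule the_equality)
  show "u \<in> P p & v - u \<in> P (~ p)" using that by blast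
  fix u' assume u': "u' \<in> P p & v - u' \<in> P (~ p)"
  have "u' - u \<in> P p" using u' that subspace_diff[OF sub] by blast
  moreover have "(v - u) - (v - u') \<in> P (~ p)" using u' that subspace_diff[OF sub] by blast
  ultimately have "u' - u = 0" by (intro int[of _ p]) simp_all
  thus "u' = u" by simp
 qed
 have ex: "hcomp P p v \<in> P p & v - hcomp P p v \<in> P (~ p)" for p v
 proof -
  obtain x y where xy: "x \<in> P False" "y \<in> P True" "v = x + y"
   using assms unfolding superspace_def by blast
  show ?thesis
  proof (cases p)
   case True
   have "hcomp P p v = y" using True xy by (intro uniq) simp_all
   thus ?thesis using True xy by simp
  next
   case False
   have "hcomp P p v = x" using False xy by (intro uniq) simp_all
   thus ?thesis using False xy by simp
  qed
 qed
 show "hcomp P p v \<in> P p" using ex by blast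
 show "hcomp P False v + hcomp P True v = v"
 proof -
  have "hcomp P True v = v - hcomp P False v"
   using ex[of False v] by (intro uniq) simp_all
  thus ?thesis by simp
 qed
 show "hcomp P p v = (if p = q then v else 0)" if "v \<in> P q"
  using that subspace_0[OF sub] by (cases "p = q") (auto intro!: uniq)
 show "hcomp P p (v + w) = hcomp P p v + hcomp P p w"
  using ex[of p v] ex[of p w] subspace_add[OF sub]
  by (intro uniq) (simp_all add: add_diff_add)
 show "hcomp P p (s c v) = s c (hcomp P p v)"
  using ex[of p v] subspace_scale[OF sub]
  by (intro uniq) (simp_all add: scale_right_diff_distrib[symmetric])
qed

lemma hcomp_hcomp: "superspace s P ==> hcomp P p (hcomp P q v) = (if p = q then hcomp P q v else 0)"
 by (rule hcomp_hom[OF _ hcomp_mem])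

lemma lf_hcomp: "superspace s P ==> lf s \<phi> ==> lf s (%x. \<phi> (hcomp P p x))"
 by (simp add: lf_def hcomp_add hcomp_scale)

lemma G_supermodule_superspace: "G_supermodule M ==> superspace (sc M) (par M)"
 by (simp add: G_supermodule_def)

lemma G_supermodule_hcomp: "G_supermodule M ==> v \<in> carrier M ==> hcomp (par M) p v \<in> carrier M"
 by (simp add: G_supermodule_def)

lemma G_supermodule_vs: "G_supermodule M ==> vector_space (sc M)"
 by (simp add: G_supermodule_def superspace_def)

lemma G_supermodule_subspace: "G_supermodule M ==> module.subspace (sc M) (carrier M)"
 by (simp add: G_supermodule_def)

lemma G_supermodule_precomod: "G_supermodule M ==> precomod (sc M) (coact M)"
 unfolding precomod_def using G_supermodule_vs by (auto simp: G_supermodule_def)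

text \<open>The definition describes the coaction of homogeneous vectors only. Stability of the
  carrier under \<open>ract\<close> is thus obtained for them first, and then by splitting a vector
  into its two components.\<close>

lemma G_supermodule_comod:
 assumes G: "G_supermodule (M :: ('k::field, 'm::len0, 'n::len0, 'v::ab_group_add) gsmod)" and two: "(2::'k) ~= 0"
 shows "comod (sc M) (coact M) (carrier M)"
proof -
 have ss: "superspace (sc M) (par M)" by (rule G_supermodule_superspace[OF G])
 interpret precomod "sc M" "coact M" by (rule G_supermodule_precomod[OF G])
 have vs: "vector_space (sc M)" by (rule G_supermodule_vs[OF G])
 have sub: "module.subspace (sc M) (carrier M)" by (rule G_supermodule_subspace[OF G])
 have cl: "ract g v \<in> carrier M" if g: "lfA g" and v: "v \<in> carrier M" "v \<in> par M p" for g v p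
 proof -
  have "coact M v \<in> module.span fscale
    {tens (sc M) scA x a | x a q. x \<in> carrier M \<inter> par M q & a \<in> glc_par (p ~= q)}"
   using G v unfolding G_supermodule_def by blast
  also have "{tens (sc M) scA x a | x a q. x \<in> carrier M \<inter> par M q & a \<in> glc_par (p ~= q)}
   = {tens (sc M) scA x a | x a. EX q. x \<in> carrier M \<inter> par M q & a \<in> glc_par (p ~= q)}" by blast
  finally obtain xs where xs: "!!x a. (x, a) \<in> set xs ==> EX q. x \<in> carrier M \<inter> par M q & a \<in> glc_par (p ~= q)"
   "coact M v = (\<Sum>(x, a)\<leftarrow>xs. tens (sc M) scA x a)"
  proof (rule tens_space_span[OF _ _ vs vs_glc])
   fix c x a assume "EX q. x \<in> carrier M \<inter> par M q & a \<in> glc_par (p ~= q)"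
   then obtain q where q: "x \<in> carrier M" "x \<in> par M q" "a \<in> glc_par (p ~= q)" by blast
   have "module.subspace (sc M) (par M q)" using ss by (simp only: superspace_def)
   hence "sc M c x \<in> par M q" using q(2) by (rule subspace_scale)
   thus "EX q. sc M c x \<in> carrier M \<inter> par M q & a \<in> glc_par (p ~= q)"
    using subspace_scale[OF sub q(1)] q(3) by blast
  qed blast
  have xs2: "coact M v \<beta> = (\<Sum>(x, a)\<leftarrow>xs. \<beta> x a)" if "bilin (sc M) scA \<beta>" for \<beta>
   unfolding xs(2) by (rule tens_list_apply[OF that])
  have "ract g v = (\<Sum>(x, a)\<leftarrow>xs. sc M (g a) x)"
   by (rule ract_eqI[OF g])
    (simp add: lf_sum_list split_def lf_scale lf_tau_ca[OF g] xs2[OF bil_prod[OF _ g]] mult.commute)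
  moreover have "(\<Sum>(x, a)\<leftarrow>ys. sc M (g a) x) \<in> carrier M" if "set ys \<subseteq> set xs" for ys
   using that
  proof (induction ys)
   case (Cons y ys)
   obtain x a where y: "y = (x, a)" by force
   have "x \<in> carrier M" using xs(1)[of x a] Cons.prems y by auto
   thus ?case using Cons y by (simp add: subspace_add[OF sub] subspace_scale[OF sub])
  qed (simp add: subspace_0[OF sub])
  ultimately show ?thesis by simp
 qed
 show "comod (sc M) (coact M) (carrier M)"
 proof
  show "(2::'k) ~= 0" by fact
  show "module.subspace (sc M) (carrier M)" by fact
 next
  fix v and \<theta> :: "'v => ('k,'m,'n) glc => ('k,'m,'n) glc => 'k"
  assume "v \<in> carrier M" "trilin (sc M) \<theta>"
  thus "coact M v (%x a. coact M x (%y b. \<theta> y b a)) = coact M v (%x a. comult a (\<theta> x))"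
   using G[unfolded G_supermodule_def, THEN conjunct2, THEN conjunct2, THEN conjunct2, THEN conjunct2,
     THEN conjunct2, THEN conjunct2, THEN conjunct1] by blast
 next
  fix v \<phi> assume "v \<in> carrier M" "lf (sc M) \<phi>"
  thus "coact M v (%x a. \<phi> x * counit a) = \<phi> v"
   using G[unfolded G_supermodule_def linear_lf[OF vs], THEN conjunct2, THEN conjunct2, THEN conjunct2, THEN conjunct2,
     THEN conjunct2, THEN conjunct2, THEN conjunct2] by blast
 next
  fix v and g :: "('k,'m,'n) glc => 'k" assume v: "v \<in> carrier M" and g: "lfA g"
  have "ract g (hcomp (par M) False v) + ract g (hcomp (par M) True v) \<in> carrier M"
   using v by (intro subspace_add[OF sub] cl[OF g, of _ False] cl[OF g, of _ True] hcomp_mem[OF ss] G_supermodule_hcomp[OF G])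
  thus "ract g v \<in> carrier M"
   by (simp only: ract_add[OF g, symmetric] hcomp_sum[OF ss])
 qed
qed

section \<open>Torus weights\<close>

text \<open>Weights of the letters under left and right translation by the torus. Passing to the
  inverse matrix interchanges the two sides and negates the weights.\<close>

fun gen_lw :: "glgen => nat => int" where
 "gen_lw (GenC i j) = eps i"
| "gen_lw (GenD i j) = - eps j"

fun gen_rw :: "glgen => nat => int" where
 "gen_rw (GenC i j) = eps j"
| "gen_rw (GenD i j) = - eps i"

fun gen_row :: "glgen => nat" where
 "gen_row (GenC i j) = i" | "gen_row (GenD i j) = i"

fun gen_col :: "glgen => nat" where
 "gen_col (GenC i j) = j" | "gen_col (GenD i j) = j"

definition list_lw :: "glgen list => nat => int"
 where "list_lw xs = sum_list (map gen_lw xs)"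

definition list_rw :: "glgen list => nat => int"
 where "list_rw xs = sum_list (map gen_rw xs)"

lemma list_lw_Nil [simp]: "list_lw [] = 0" and list_lw_Cons [simp]: "list_lw (x # xs) = gen_lw x + list_lw xs"
 and list_rw_Nil [simp]: "list_rw [] = 0" and list_rw_Cons [simp]: "list_rw (x # xs) = gen_rw x + list_rw xs"
 by (simp_all add: list_lw_def list_rw_def)

definition diag_word :: "glgen list => bool"
 where "diag_word xs \<longleftrightarrow> (ALL x:set xs. gen_row x = gen_col x)"

lemma diag_word_Nil [simp]: "diag_word []"
 and diag_word_Cons [simp]: "diag_word (x # xs) \<longleftrightarrow> gen_row x = gen_col x & diag_word xs"
 by (auto simp: diag_word_def)

lemma word_in_range_single: "word_in_range N [x] \<longleftrightarrow> gen_row x < N & gen_col x < N"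
 by (cases x) (auto simp: word_in_range_def)

lemma diag_word_lw_rw: "diag_word xs ==> list_rw xs = list_lw xs"
proof (induction xs)
 case (Cons x xs)
 thus ?case by (cases x) auto
qed simp

text \<open>Restriction to the diagonal torus. The target is the group algebra of the weights,
  realized as finitely supported functions on them with convolution as product; off-diagonal entries
  vanish.\<close>

definition torus_gen :: "nat => glgen => (nat => int) \<Rightarrow>\<^sub>0 'k::field"
 where "torus_gen N x = (if gen_row x = gen_col x & gen_row x < N then psingle (gen_lw x) 1 else 0)"

interpretation torus_lift: glc_lift "psingle 0 :: 'k::field => (nat => int) \<Rightarrow>\<^sub>0 'k"
 "torus_gen (LENGTH('m) + LENGTH('n))" "TYPE(('k, 'm::len0, 'n::len0) glc)"
proof
 fix c d :: 'k and y :: "(nat => int) \<Rightarrow>\<^sub>0 'k"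
 show "psingle 0 (c + d) = psingle (0 :: nat => int) c + psingle 0 d"
  by (rule single_add)
 show "psingle 0 (c * d) = psingle (0 :: nat => int) c * psingle 0 d"
  by (simp add: mult_single)
 show "psingle (0 :: nat => int) (1::'k) = 1" by simp
 show "psingle 0 c * y = y * psingle 0 c" by (rule mult.commute)
next
 fix x y :: glgen
 let ?N = "LENGTH('m) + LENGTH('n)"
 have "torus_gen ?N z = (0 :: (nat => int) \<Rightarrow>\<^sub>0 'k)" if "gen_par LENGTH('m) z" for z
  using that by (cases z) (auto simp: torus_gen_def)
 hence "psign (gen_par LENGTH('m) x) (gen_par LENGTH('m) y) * (torus_gen ?N y * torus_gen ?N x) =
   (torus_gen ?N y * torus_gen ?N x :: (nat => int) \<Rightarrow>\<^sub>0 'k)"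
  by (auto simp: psign_def)
 thus "torus_gen ?N x * torus_gen ?N y = psign (gen_par LENGTH('m) x) (gen_par LENGTH('m) y)
   * (torus_gen ?N y * torus_gen ?N x :: (nat => int) \<Rightarrow>\<^sub>0 'k)"
  by (simp only: mult.commute)
next
 fix i j assume ij: "i < LENGTH('m) + LENGTH('n)" "j < LENGTH('m) + LENGTH('n)"
 let ?N = "LENGTH('m) + LENGTH('n)"
 have "(torus_gen ?N (GenC i k) * torus_gen ?N (GenD k j) :: (nat => int) \<Rightarrow>\<^sub>0 'k) = (if k = i then of_bool (i = j) else 0)" for k
  using ij by (auto simp: torus_gen_def mult_single)
 thus "(\<Sum>k<?N. torus_gen ?N (GenC i k) * torus_gen ?N (GenD k j)) = (of_bool (i = j) :: (nat => int) \<Rightarrow>\<^sub>0 'k)"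
  using ij by simp
 have "(torus_gen ?N (GenD i k) * torus_gen ?N (GenC k j) :: (nat => int) \<Rightarrow>\<^sub>0 'k) = (if k = i then of_bool (i = j) else 0)" for k
  using ij by (auto simp: torus_gen_def mult_single)
 thus "(\<Sum>k<?N. torus_gen ?N (GenD i k) * torus_gen ?N (GenC k j)) = (of_bool (i = j) :: (nat => int) \<Rightarrow>\<^sub>0 'k)"
  using ij by simp
next
 fix x assume "~ word_in_range (LENGTH('m) + LENGTH('n)) [x]"
 thus "torus_gen (LENGTH('m) + LENGTH('n)) x = (0 :: (nat => int) \<Rightarrow>\<^sub>0 'k)"
  by (auto simp: torus_gen_def word_in_range_single)
qed

definition torus :: "('k::field,'m::len0,'n::len0) glc => (nat => int) \<Rightarrow>\<^sub>0 'k"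
 where "torus = torus_lift.lifted"

lemma torus_add: "torus (a + b) = torus a + torus b"
 and torus_mult: "torus (a * b) = torus a * torus b"
 and torus_scale: "torus (scA c a) = psingle 0 c * torus a"
 and torus_zero [simp]: "torus 0 = 0"
 and torus_one [simp]: "torus 1 = 1"
 and torus_gen: "torus (glc_gen x :: ('k::field,'m::len0,'n::len0) glc) = torus_gen (LENGTH('m) + LENGTH('n)) x"
 and torus_minus: "torus (- a) = - torus a"
 by (simp_all add: torus_def torus_lift.lifted_add torus_lift.lifted_mult torus_lift.lifted_scale
   torus_lift.lifted_zero torus_lift.lifted_one torus_lift.lifted_gen torus_lift.lifted_minus)

lemma torus_word:
 assumes "word_in_range (LENGTH('m) + LENGTH('n)) xs"
 shows "torus (word_elt xs :: ('k::field,'m::len0,'n::len0) glc) =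
  (if diag_word xs then psingle (list_lw xs) 1 else 0)"
 using assms
proof (induction xs)
 case Nil
 show ?case by simp
next
 case (Cons x xs)
 hence x: "gen_row x < LENGTH('m) + LENGTH('n)" and xs: "word_in_range (LENGTH('m) + LENGTH('n)) xs"
  using word_in_range_Cons[of _ x xs] by (auto simp: word_in_range_single)
 show ?case using x
  by (cases "gen_row x = gen_col x"; cases "diag_word xs")
   (simp_all add: torus_mult torus_gen torus_gen_def mult_single Cons.IH[OF xs])
qed

lemma torus_psign: "gen_row x = gen_col x ==> ~ gen_par m x"
 by (cases x) auto

lemma torus_pinv: "torus (pinv a) = torus (a :: ('k::field,'m::len0,'n::len0) glc)"
proof -
 have "a \<in> {a. torus (pinv a) = torus a}"
 proof (rule glc_gen_induct)
  show "glc.subspace {a :: ('k,'m,'n) glc. torus (pinv a) = torus a}"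
   by (rule glc.subspaceI) (auto simp: pinv_add torus_add pinv_scale torus_scale)
 next
  fix x and a :: "('k,'m,'n) glc" assume "a \<in> {a. torus (pinv a) = torus a}"
  moreover have "torus (psign (gen_par LENGTH('m) x) True * glc_gen x :: ('k,'m,'n) glc) = torus (glc_gen x :: ('k,'m,'n) glc)"
  proof (cases "gen_row x = gen_col x")
   case True
   thus ?thesis by (simp add: torus_psign)
  next
   case False
   hence "torus (glc_gen x :: ('k,'m,'n) glc) = 0"
    by (simp add: torus_gen torus_gen_def)
   thus ?thesis by (simp add: torus_mult)
  qed
  ultimately show "glc_gen x * a \<in> {a. torus (pinv a) = torus a}"
   by (simp add: pinv_mult pinv_gen torus_mult)
 qed simp
 thus ?thesis by simp
qed

lemma torus_sig: "torus (sig s a) = torus a"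
 by (simp add: sig_def torus_pinv)

definition coeff_sum :: "('x => bool) => ('x \<Rightarrow>\<^sub>0 'k::comm_ring_1) => 'k"
 where "coeff_sum Q f = (\<Sum>\<mu>\<in>pkeys f. of_bool (Q \<mu>) * plookup f \<mu>)"

lemma coeff_sum_superset: "finite S ==> pkeys f \<subseteq> S ==>
  coeff_sum Q f = (\<Sum>\<mu>\<in>S. of_bool (Q \<mu>) * plookup f \<mu>)"
 unfolding coeff_sum_def by (rule sum.mono_neutral_left) (auto simp: in_keys_iff)

lemma coeff_sum_add: "coeff_sum Q (f + g) = coeff_sum Q f + coeff_sum Q g"
proof -
 let ?S = "pkeys f \<union> pkeys g"
 have "pkeys (f + g) \<subseteq> ?S" by (rule Poly_Mapping.keys_add)
 thus ?thesis
  by (simp add: coeff_sum_superset[of ?S] lookup_add distrib_left sum.distrib)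
qed

lemma coeff_sum_zero [simp]: "coeff_sum Q 0 = 0"
 by (simp add: coeff_sum_def)

lemma coeff_sum_sum: "coeff_sum Q (sum F S) = (\<Sum>i\<in>S. coeff_sum Q (F i))"
 by (induction S rule: infinite_finite_induct) (simp_all add: coeff_sum_add)

lemma coeff_sum_single [simp]: "coeff_sum Q (psingle \<mu> c) = of_bool (Q \<mu>) * c"
 by (cases "c = 0") (simp_all add: coeff_sum_def)

lemma coeff_sum_single_mult:
 "coeff_sum Q (psingle \<alpha> c * f) = c * coeff_sum (%\<mu>. Q (\<alpha> + \<mu>)) f"
proof -
 have f: "f = (\<Sum>w\<in>pkeys f. psingle w (plookup f w))"
  by (rule poly_mapping_sum_single)
 have "psingle \<alpha> c * f = (\<Sum>w\<in>pkeys f. psingle (\<alpha> + w) (c * plookup f w))"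
  by (subst f) (simp add: sum_distrib_left mult_single)
 hence "coeff_sum Q (psingle \<alpha> c * f) = (\<Sum>w\<in>pkeys f. of_bool (Q (\<alpha> + w)) * (c * plookup f w))"
  by (simp only: coeff_sum_sum coeff_sum_single)
 thus ?thesis
  unfolding coeff_sum_def sum_distrib_left by (simp only: mult.left_commute)
qed

text \<open>Restriction to the torus followed by the sum of the coefficients of the characters in \<open>Q\<close>:
 acting on a comodule, this form projects onto the sum of the weight spaces in \<open>Q\<close>.\<close>

definition wform :: "((nat => int) => bool) => ('k::field,'m::len0,'n::len0) glc => 'k"
 where "wform Q a = coeff_sum Q (torus a)"

lemma lf_wform: "lfA (wform Q)"
 by (simp add: lf_def wform_def torus_add torus_scale coeff_sum_add coeff_sum_single_mult)

lemma wform_one: "wform Q 1 = of_bool (Q 0)"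
 using coeff_sum_single[of Q 0 1] by (simp add: wform_def)

lemma wform_word:
 assumes "word_in_range (LENGTH('m) + LENGTH('n)) xs"
 shows "wform Q (word_elt xs :: ('k::field,'m::len0,'n::len0) glc) = of_bool (diag_word xs & Q (list_lw xs))"
 by (simp add: wform_def torus_word[OF assms])

lemma wform_gen_mult:
 "wform Q (glc_gen x * sig s a :: ('k::field,'m::len0,'n::len0) glc) =
  (if gen_row x = gen_col x & gen_row x < LENGTH('m) + LENGTH('n) then wform (%\<mu>. Q (gen_lw x + \<mu>)) a else 0)"
 by (simp add: wform_def torus_mult torus_gen torus_gen_def torus_sig coeff_sum_single_mult)

lemma counit_word:
 assumes "word_in_range (LENGTH('m) + LENGTH('n)) xs"
 shows "counit (word_elt xs :: ('k::field,'m::len0,'n::len0) glc) = of_bool (diag_word xs)"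
 using assms
proof (induction xs)
 case (Cons x xs)
 hence x: "gen_row x < LENGTH('m) + LENGTH('n)" and xs: "word_in_range (LENGTH('m) + LENGTH('n)) xs"
  using word_in_range_Cons[of _ x xs] by (auto simp: word_in_range_single)
 show ?case using x Cons.IH[OF xs]
  by (cases x) (auto simp: counit_mult counit_gen_eq counit_gen_def)
qed simp

lemma wform_True: "wform (%_. True) = (counit :: ('k::field,'m::len0,'n::len0) glc => 'k)"
 by (rule ext, rule lf_eq_on_words[OF lf_wform lf_counit]) (simp add: wform_word counit_word)

lemma wform_finite:
 assumes "finite S" "pkeys (torus a) \<subseteq> S"
 shows "wform Q a = (\<Sum>\<mu>\<in>S. of_bool (Q \<mu>) * wform ((=) \<mu>) a)"
proof -
 have "wform ((=) \<mu>) a = plookup (torus a) \<mu>" for \<mu>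
 proof -
  have "(\<Sum>\<nu>\<in>pkeys (torus a). of_bool (\<mu> = \<nu>) * plookup (torus a) \<nu>) =
    (\<Sum>\<nu>\<in>pkeys (torus a). if \<nu> = \<mu> then plookup (torus a) \<nu> else 0)"
   by (rule sum.cong) auto
  thus ?thesis
   unfolding wform_def coeff_sum_def by (auto simp: sum.delta in_keys_iff)
 qed
 thus ?thesis using coeff_sum_superset[OF assms] by (simp add: wform_def)
qed

section \<open>Words as torus eigenvectors on both sides\<close>

context odd_char begin

text \<open>Only diagonal letters survive restriction to the torus, so a single inner index
  contributes for each letter, and pulling the letter out shifts the condition \<open>Q\<close> by
  its left weight.\<close>

lemma convu_wform_left:
 assumes h: "lfA h" and xs: "word_in_range (LENGTH('m) + LENGTH('n)) xs"
 shows "convu (wform Q) h (word_elt xs :: ('k,'m,'n) glc) = of_bool (Q (list_lw xs)) * h (word_elt xs)"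
 using h xs
proof (induction xs arbitrary: h Q)
 case Nil
 thus ?case
  by (simp only: convu_def word_elt_Nil comult_one[OF two bilA_prod[OF lf_wform Nil(1)]] wform_one list_lw_Nil)
next
 case (Cons x xs)
 let ?N = "LENGTH('m) + LENGTH('n)"
 have x: "gen_row x < ?N" "gen_col x < ?N" and xs: "word_in_range ?N xs"
  using word_in_range_Cons[of _ x xs] Cons.prems by (auto simp: word_in_range_single)
 have hx: "lfA (%v. h (glc_gen x * v))"
  using Cons.prems by (auto simp: lf_def distrib_left glc_scale_mult_right)
 have "gen_op x (%u v. wform Q u * h v) = (%u v. wform (%\<mu>. Q (gen_lw x + \<mu>)) u * h (glc_gen x * v))"
 proof (intro ext)
  fix u v :: "('k,'m,'n) glc"
  define i where "i = (case x of GenC i j => i | GenD i j => j)"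
  have k: "gen_sign LENGTH('m) x k * (wform Q (glc_gen (genL x k) * sig (gen_par LENGTH('m) (genR x k)) u)
    * h (glc_gen (genR x k) * v)) = (if k = i then wform (%\<mu>. Q (gen_lw x + \<mu>)) u * h (glc_gen x * v) else 0)" if "k < ?N" for k
   using that by (cases x) (auto simp: i_def wform_gen_mult psign_def)
  have "gen_op x (%u v. wform Q u * h v) u v = (\<Sum>k<?N. if k = i then wform (%\<mu>. Q (gen_lw x + \<mu>)) u * h (glc_gen x * v) else 0)"
   unfolding gen_op_def by (rule sum.cong[OF refl], rule k) simp
  moreover have "i < ?N" using x by (cases x) (auto simp: i_def)
  ultimately show "gen_op x (%u v. wform Q u * h v) u v = wform (%\<mu>. Q (gen_lw x + \<mu>)) u * h (glc_gen x * v)"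
   by simp
 qed
 hence "convu (wform Q) h (word_elt (x # xs)) = convu (wform (%\<mu>. Q (gen_lw x + \<mu>))) (%v. h (glc_gen x * v)) (word_elt xs)"
  by (simp add: convu_def comult_gen_mult[OF two bilA_prod[OF lf_wform Cons.prems(1)]])
 also have "... = of_bool (Q (gen_lw x + list_lw xs)) * h (glc_gen x * word_elt xs)"
  by (rule Cons.IH[OF hx xs])
 finally show ?case by (simp only: word_elt_Cons list_lw_Cons list_rw_Cons)
qed

lemma convu_wform_right:
 assumes h: "lfA h" and xs: "word_in_range (LENGTH('m) + LENGTH('n)) xs"
 shows "convu h (wform Q) (word_elt xs :: ('k,'m,'n) glc) = of_bool (Q (list_rw xs)) * h (word_elt xs)"
 using h xs
proof (induction xs arbitrary: h Q)
 case Nil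
 thus ?case
  by (simp only: convu_def word_elt_Nil comult_one[OF two bilA_prod[OF Nil(1) lf_wform]] wform_one list_rw_Nil mult.commute)
next
 case (Cons x xs)
 let ?N = "LENGTH('m) + LENGTH('n)"
 have x: "gen_row x < ?N" "gen_col x < ?N" and xs: "word_in_range ?N xs"
  using word_in_range_Cons[of _ x xs] Cons.prems by (auto simp: word_in_range_single)
 have hx: "lfA (%v. h (glc_gen x * v))"
  using Cons.prems by (auto simp: lf_def distrib_left glc_scale_mult_right)
 have "gen_op x (%u v. h u * wform Q v) = (%u v. h (glc_gen x * u) * wform (%\<mu>. Q (gen_rw x + \<mu>)) v)"
 proof (intro ext)
  fix u v :: "('k,'m,'n) glc"
  define i where "i = (case x of GenC i j => j | GenD i j => i)"
  have k: "gen_sign LENGTH('m) x k * (h (glc_gen (genL x k) * sig (gen_par LENGTH('m) (genR x k)) u)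
    * wform Q (glc_gen (genR x k) * v)) = (if k = i then h (glc_gen x * u) * wform (%\<mu>. Q (gen_rw x + \<mu>)) v else 0)" if "k < ?N" for k
   using that wform_gen_mult[of Q "genR x k" False v] by (cases x) (auto simp: i_def psign_def)
  have "gen_op x (%u v. h u * wform Q v) u v = (\<Sum>k<?N. if k = i then h (glc_gen x * u) * wform (%\<mu>. Q (gen_rw x + \<mu>)) v else 0)"
   unfolding gen_op_def by (rule sum.cong[OF refl], rule k) simp
  moreover have "i < ?N" using x by (cases x) (auto simp: i_def)
  ultimately show "gen_op x (%u v. h u * wform Q v) u v = h (glc_gen x * u) * wform (%\<mu>. Q (gen_rw x + \<mu>)) v"
   by simp
 qed
 hence "convu h (wform Q) (word_elt (x # xs)) = convu (%v. h (glc_gen x * v)) (wform (%\<mu>. Q (gen_rw x + \<mu>))) (word_elt xs)"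
  by (simp add: convu_def comult_gen_mult[OF two bilA_prod[OF Cons.prems(1) lf_wform]])
 also have "... = of_bool (Q (gen_rw x + list_rw xs)) * h (glc_gen x * word_elt xs)"
  by (rule Cons.IH[OF hx xs])
 finally show ?case by (simp only: word_elt_Cons list_lw_Cons list_rw_Cons)
qed

lemma convu_wform_wform: "convu (wform P) (wform Q) = (wform (%\<mu>. P \<mu> & Q \<mu>) :: ('k,'m,'n) glc => 'k)"
proof (rule ext, rule lf_eq_on_words[OF lf_convu' lf_wform])
 fix xs assume "word_in_range (LENGTH('m) + LENGTH('n)) xs"
 thus "convu (wform P) (wform Q) (word_elt xs :: ('k,'m,'n) glc) = wform (%\<mu>. P \<mu> & Q \<mu>) (word_elt xs :: ('k,'m,'n) glc)"
  by (auto simp: convu_wform_left lf_wform wform_word)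
qed

definition words :: "(glgen list => bool) => ('k,'m,'n) glc set"
 where "words P = glc.span (word_elt ` {xs. word_in_range (LENGTH('m) + LENGTH('n)) xs & P xs})"

lemma words_induct [consumes 1, case_names subspace word]:
 assumes "a \<in> words P" "glc.subspace S"
  "!!xs. word_in_range (LENGTH('m) + LENGTH('n)) xs ==> P xs ==> word_elt xs \<in> S"
 shows "a \<in> S"
 using glc.span_minimal[of "word_elt ` {xs. word_in_range (LENGTH('m) + LENGTH('n)) xs & P xs}" S] assms
 by (auto simp: words_def)

text \<open>The two projections keep the words whose weights satisfy \<open>Q1\<close> and
  \<open>Q2\<close> and kill all others. An element fixed by both is therefore a combination of the
  words that are kept.\<close>

lemma bihomogeneous_words:
 assumes l: "reg.tau (wform Q1) y = y" and r: "reg.ract (wform Q2) y = y"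
 shows "y \<in> words (%xs. Q1 (list_lw xs) & Q2 (list_rw xs))"
proof -
 let ?W = "words (%xs. Q1 (list_lw xs) & Q2 (list_rw xs))"
 have sub: "glc.subspace ?W" unfolding words_def by (rule glc.subspace_span)
 have "z \<in> {z. reg.tau (wform Q1) (reg.ract (wform Q2) z) \<in> ?W}" for z
 proof (rule glc_word_induct)
  show "glc.subspace {z. reg.tau (wform Q1) (reg.ract (wform Q2) z) \<in> ?W}"
   by (rule glc.subspaceI)
    (simp_all add: reg.ract_zero reg.tau_zero reg.ract_add reg.tau_add reg.ract_scale reg.tau_scale lf_wform
     glc.subspace_0[OF sub] glc.subspace_add[OF sub] glc.subspace_scale[OF sub])
 next
  fix xs assume xs: "word_in_range (LENGTH('m) + LENGTH('n)) xs"
  have 1: "reg.ract (wform Q2) (word_elt xs) = scA (of_bool (Q2 (list_rw xs))) (word_elt xs)"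
  proof (rule lf_separate[OF vs_glc])
   fix g :: "('k,'m,'n) glc => 'k" assume g: "lfA g"
   show "g (reg.ract (wform Q2) (word_elt xs)) = g (scA (of_bool (Q2 (list_rw xs))) (word_elt xs))"
    by (simp only: convu_ract[OF g lf_wform, symmetric] convu_wform_right[OF g xs] lf_scale[OF g])
  qed
  have 2: "reg.tau (wform Q1) (word_elt xs) = scA (of_bool (Q1 (list_lw xs))) (word_elt xs)"
  proof (rule lf_separate[OF vs_glc])
   fix g :: "('k,'m,'n) glc => 'k" assume g: "lfA g"
   show "g (reg.tau (wform Q1) (word_elt xs)) = g (scA (of_bool (Q1 (list_lw xs))) (word_elt xs))"
    by (simp only: convu_tau[OF lf_wform g, symmetric] convu_wform_left[OF g xs] lf_scale[OF g])
  qed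
  have "word_elt xs \<in> ?W" if "Q1 (list_lw xs) & Q2 (list_rw xs)"
   unfolding words_def using xs that by (intro glc.span_base) blast
  thus "word_elt xs \<in> {z. reg.tau (wform Q1) (reg.ract (wform Q2) z) \<in> ?W}"
   by (auto simp: 1 2 reg.tau_scale lf_wform glc.subspace_0[OF sub])
 qed
 hence "reg.tau (wform Q1) (reg.ract (wform Q2) y) \<in> ?W" by blast
 thus ?thesis by (simp add: l r)
qed

lemma torus_keys_lattice: "pkeys (torus (a :: ('k,'m,'n) glc)) \<subseteq> weight_lattice LENGTH('m) LENGTH('n)"
proof -
 have "a \<in> {a. pkeys (torus a) \<subseteq> weight_lattice LENGTH('m) LENGTH('n)}" (is "a \<in> ?S")
 proof (rule glc_word_induct)
  show "glc.subspace ?S"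
  proof (rule glc.subspaceI)
   show "0 \<in> ?S" by simp
   show "x + y \<in> ?S" if "x \<in> ?S" "y \<in> ?S" for x y
    using that Poly_Mapping.keys_add[of "torus x" "torus y"] by (auto simp: torus_add)
   show "scA c x \<in> ?S" if "x \<in> ?S" for c x
    using that Poly_Mapping.keys_mult[of "psingle 0 c" "torus x"] by (auto simp: torus_scale split: if_splits)
  qed
 next
  fix xs assume xs: "word_in_range (LENGTH('m) + LENGTH('n)) xs"
  hence "list_lw xs \<in> weight_lattice LENGTH('m) LENGTH('n)"
  proof (induction xs)
   case (Cons x xs)
   hence "word_in_range (LENGTH('m) + LENGTH('n)) [x]" "list_lw xs \<in> weight_lattice LENGTH('m) LENGTH('n)"
    using word_in_range_Cons[of _ x xs] by auto
   thus ?case by (cases x) (auto simp: weight_lattice_def word_in_range_def eps_def)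
  qed (simp add: weight_lattice_def)
  thus "word_elt xs \<in> ?S" by (simp add: torus_word[OF xs])
 qed
 thus ?thesis by simp
qed

end

context comod begin

abbreviation wp where "wp \<mu> \<equiv> ract (wform ((=) \<mu>))"

lemma wproj_wproj: "v \<in> C ==> ract (wform P) (ract (wform Q) v) = ract (wform (%\<mu>. P \<mu> & Q \<mu>)) v"
 by (simp add: ract_ract lf_wform convu_wform_wform)

lemma wproj_True: "v \<in> C ==> ract (wform (%_. True)) v = v"
 by (simp add: wform_True ract_counit)

text \<open>The coaction of \<open>v\<close> involves finitely many functions, and the restriction
  of each to the torus is a finite sum of characters.\<close>

lemma wproj_finite:
 obtains S where "finite S" "S \<subseteq> weight_lattice LENGTH('m) LENGTH('n)"
  "!!Q. ract (wform Q) v = (\<Sum>\<mu>\<in>S. s (of_bool (Q \<mu>)) (wp \<mu> v))"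
proof -
 obtain xs where xs: "!!\<beta>. bilin s scA \<beta> ==> ca v \<beta> = (\<Sum>(x, a)\<leftarrow>xs. \<beta> x a)"
  using ca_rep by blast
 define S where "S = (\<Union>(x, a)\<in>set xs. pkeys (torus a))"
 have fin: "finite S" unfolding S_def by auto
 have keys: "pkeys (torus a) \<subseteq> S" if "(x, a) \<in> set xs" for x a
  unfolding S_def using that by blast
 have "ract (wform Q) v = (\<Sum>\<mu>\<in>S. s (of_bool (Q \<mu>)) (wp \<mu> v))" for Q
 proof (rule lf_separate[OF vs])
  fix \<phi> assume \<phi>: "lf s \<phi>"
  have r: "\<phi> (ract (wform P) v) = (\<Sum>(x, a)\<leftarrow>xs. \<phi> x * wform P a)" for P
   by (simp add: lf_ract[OF lf_wform \<phi>] xs[OF bil_prod[OF \<phi> lf_wform]])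
  have "(\<Sum>(x, a)\<leftarrow>ys. \<phi> x * wform Q a) = (\<Sum>\<mu>\<in>S. of_bool (Q \<mu>) * (\<Sum>(x, a)\<leftarrow>ys. \<phi> x * wform ((=) \<mu>) a))"
   if "set ys \<subseteq> set xs" for ys
   using that
  proof (induction ys)
   case (Cons y ys)
   obtain x a where y: "y = (x, a)" by force
   have "wform Q a = (\<Sum>\<mu>\<in>S. of_bool (Q \<mu>) * wform ((=) \<mu>) a)"
    using keys[of x a] Cons.prems y by (intro wform_finite[OF fin]) auto
   hence "\<phi> x * wform Q a = (\<Sum>\<mu>\<in>S. of_bool (Q \<mu>) * (\<phi> x * wform ((=) \<mu>) a))"
    by (simp only: sum_distrib_left mult.left_commute)
   thus ?case using Cons y by (simp add: distrib_left sum.distrib)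
  qed simp
  from this[of xs] show "\<phi> (ract (wform Q) v) = \<phi> (\<Sum>\<mu>\<in>S. s (of_bool (Q \<mu>)) (wp \<mu> v))"
   by (simp only: r lf_sum[OF \<phi>] lf_scale[OF \<phi>] subset_refl)
 qed
 moreover have "S \<subseteq> weight_lattice LENGTH('m) LENGTH('n)"
  unfolding S_def using torus_keys_lattice by blast
 ultimately show ?thesis using that fin by blast
qed

lemma wproj_sum:
 assumes "v \<in> C"
 obtains S where "finite S" "S \<subseteq> weight_lattice LENGTH('m) LENGTH('n)"
  "v = (\<Sum>\<mu>\<in>S. wp \<mu> v)"
proof -
 obtain S where S: "finite S" "S \<subseteq> weight_lattice LENGTH('m) LENGTH('n)"
  "!!Q. ract (wform Q) v = (\<Sum>\<mu>\<in>S. s (of_bool (Q \<mu>)) (wp \<mu> v))"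
  using wproj_finite by blast
 have "v = (\<Sum>\<mu>\<in>S. wp \<mu> v)"
  using S(3)[of "%_. True"] assms by (simp add: wproj_True)
 thus ?thesis using that S by blast
qed

lemma tau_left_homogeneous:
 assumes v: "v \<in> C" and \<phi>: "lf s \<phi>" and Q: "!!x. x \<in> C ==> \<phi> (ract (wform Q) x) = \<phi> x"
 shows "reg.tau (wform Q) (tau \<phi> v) = tau \<phi> v"
proof (rule lf_separate[OF vs_glc])
 fix g :: "('k,'m,'n) glc => 'k" assume g: "lfA g"
 show "g (reg.tau (wform Q) (tau \<phi> v)) = g (tau \<phi> v)"
  by (simp add: tau_tau[OF v lf_wform \<phi>] lf_tau[OF g lf_compose_ract[OF lf_wform \<phi>]] lf_tau[OF g \<phi>] Q closed[OF v g])
qed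

lemma tau_right_homogeneous:
 assumes v: "v \<in> C" and \<phi>: "lf s \<phi>" and Q: "ract (wform Q) v = v"
 shows "reg.ract (wform Q) (tau \<phi> v) = tau \<phi> v"
 by (simp add: ract_tau[OF v lf_wform \<phi>] Q)

text \<open>The left weight of a matrix coefficient is that of the form, the right weight that of
  the vector. This reduces congruences for coefficients of weight vectors to congruences for
  words.\<close>

lemma tau_words:
 assumes "v \<in> C" "lf s \<phi>" "!!x. x \<in> C ==> \<phi> (ract (wform P) x) = \<phi> x" "ract (wform Q) v = v"
 shows "tau \<phi> v \<in> words (%xs. P (list_lw xs) & Q (list_rw xs))"
 by (rule bihomogeneous_words) (rule tau_left_homogeneous tau_right_homogeneous; use assms in simp)+

end

section \<open>Distributions separate functions\<close>

subsection \<open>Matrices over commutative rings\<close>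

text \<open>The Jacobson radical of a commutative ring. It contains the products of two odd
  elements, and a determinant congruent to 1 modulo it is a unit.\<close>

definition jac :: "'a::comm_ring_1 set"
 where "jac = {x. ALL y. (1 + x * y) dvd 1}"

lemma jac_zero: "0 \<in> jac"
 by (simp add: jac_def)

lemma jac_mult: "x \<in> jac ==> x * z \<in> jac"
 by (simp add: jac_def mult.assoc)

lemma jac_add: "x \<in> jac ==> x' \<in> jac ==> x + x' \<in> jac"
proof -
 assume x: "x \<in> jac" and x': "x' \<in> jac"
 have "(1 + (x + x') * y) dvd 1" for y
 proof -
  from x have "(1 + x * y) dvd 1" by (simp add: jac_def)
  then obtain v where v: "1 = (1 + x * y) * v" by (rule dvdE)
  have "(1 + x' * (y * v)) dvd 1" using x' by (simp add: jac_def)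
  then obtain w where w: "1 = (1 + x' * (y * v)) * w" by (rule dvdE)
  have "1 + (x + x') * y = (1 + x * y) + x' * y * ((1 + x * y) * v)"
   unfolding v[symmetric] by (simp add: algebra_simps)
  also have "... = (1 + x * y) * (1 + x' * (y * v))" by (simp add: algebra_simps)
  finally have e: "1 + (x + x') * y = (1 + x * y) * (1 + x' * (y * v))" .
  have "(1 + x * y) * (1 + x' * (y * v)) * (v * w) = ((1 + x * y) * v) * ((1 + x' * (y * v)) * w)"
   by (simp only: mult.assoc mult.left_commute)
  also have "... = 1" by (simp only: v[symmetric] w[symmetric] mult_1_left)
  finally show ?thesis unfolding e by (metis dvdI)
 qed
 thus ?thesis by (simp add: jac_def)
qed

lemma jac_sum: "(!!i. i \<in> S ==> f i \<in> jac) ==> sum f S \<in> jac"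
 by (induction S rule: infinite_finite_induct) (auto simp: jac_zero jac_add)

lemma jac_prod_diff:
 assumes "finite S" "!!i. i \<in> S ==> f i - g i \<in> jac"
 shows "prod f S - prod g S \<in> jac"
 using assms
proof (induction S rule: finite_induct)
 case (insert i S)
 have "prod f (insert i S) - prod g (insert i S) = (f i - g i) * prod f S + (prod f S - prod g S) * g i"
  using insert by (simp add: algebra_simps)
 also have "... \<in> jac" using insert by (intro jac_add jac_mult) auto
 finally show ?case .
qed (simp add: jac_zero)

lemma det_cong_jac:
 assumes "!!i j. i < N ==> j < N ==> f i j - g i j \<in> (jac :: 'a::comm_ring_1 set)"
 shows "Determinant.det (mat N N (%(i, j). f i j)) - Determinant.det (mat N N (%(i, j). g i j)) \<in> jac"
proof -
 have d: "Determinant.det (mat N N (%(i, j). h i j)) = (\<Sum>p | p permutes {0..<N}. signof p * (\<Prod>i = 0..<N. h i (p i)))" for h :: "nat => nat => 'a"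
 proof -
  have "mat N N (%(i, j). h i j) $$ (i, p i) = h i (p i)" if "p permutes {0..<N}" "i < N" for p i
   using that permutes_in_image[of p "{0..<N}" i] by simp
  thus ?thesis by (auto simp: Determinant.det_def intro!: sum.cong prod.cong)
 qed
 have "(\<Prod>i = 0..<N. f i (p i)) - (\<Prod>i = 0..<N. g i (p i)) \<in> jac" if "p permutes {0..<N}" for p
  by (rule jac_prod_diff) (use assms that permutes_in_image[OF that] in auto)
 hence "((\<Prod>i = 0..<N. f i (p i)) - (\<Prod>i = 0..<N. g i (p i))) * signof p \<in> jac" if "p permutes {0..<N}" for p
  using that by (intro jac_mult) auto
 hence "(\<Sum>p | p permutes {0..<N}. ((\<Prod>i = 0..<N. f i (p i)) - (\<Prod>i = 0..<N. g i (p i))) * signof p) \<in> jac"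
  by (intro jac_sum) auto
 thus ?thesis
  unfolding d by (simp add: sum_subtractf[symmetric] algebra_simps)
qed

definition kron :: "nat => nat => 'a::zero_neq_one"
 where "kron i j = of_bool (i = j)"

lemma kron_simps [simp]: "kron i i = 1" "i ~= j ==> kron i j = 0"
 by (auto simp: kron_def)

lemma sum_kron_left [simp]: "i < N ==> (\<Sum>k<N. kron i k * f k) = (f i :: 'a::semiring_1)"
proof -
 assume i: "i < N"
 have "(\<Sum>k<N. kron i k * f k) = (\<Sum>k<N. if k = i then f i else 0)"
  by (rule sum.cong) (auto simp: kron_def)
 thus ?thesis using i by simp
qed

lemma sum_kron_right [simp]: "j < N ==> (\<Sum>k<N. f k * kron k j) = (f j :: 'a::semiring_1)"
proof -
 assume i: "j < N"
 have "(\<Sum>k<N. f k * kron k j) = (\<Sum>k<N. if k = j then f j else 0)"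
  by (rule sum.cong) (auto simp: kron_def)
 thus ?thesis using i by simp
qed

lemma det_kron: "Determinant.det (mat N N (%(i, j). kron i j)) = (1 :: 'a::comm_ring_1)"
proof -
 have "mat N N (%(i, j). kron i j) = (1\<^sub>m N :: 'a mat)"
  by (rule eq_matI) (auto simp: kron_def)
 thus ?thesis by simp
qed

text \<open>Applied to the functions that become polynomial along the curve below: determinants and
  cofactors of matrices with such entries are again of this kind.\<close>

definition subring_set :: "'a::ring_1 set => bool"
 where "subring_set S \<longleftrightarrow> 1 \<in> S & - 1 \<in> S & (ALL x:S. ALL y:S. x + y \<in> S & x * y \<in> S)"

lemma subring_set_zero: "subring_set S ==> 0 \<in> S"
 unfolding subring_set_def by (metis add.right_inverse)

lemma subring_set_sum: "subring_set S ==> (!!i. i \<in> A ==> f i \<in> S) ==> sum f A \<in> S"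
 by (induction A rule: infinite_finite_induct) (auto simp: subring_set_zero subring_set_def)

lemma subring_set_det:
 fixes A :: "'a::comm_ring_1 mat"
 assumes S: "subring_set S" and A: "A \<in> carrier_mat n n" "!!i j. i < n ==> j < n ==> A $$ (i, j) \<in> S"
 shows "Determinant.det A \<in> S"
 unfolding det_def'[OF A(1)]
proof (rule subring_set_sum[OF S])
 fix p assume "p \<in> {p. p permutes {0..<n}}"
 hence "i < n ==> p i < n" for i using permutes_in_image[of p "{0..<n}" i] by auto
 hence "(\<Prod>i\<in>T. A $$ (i, p i)) \<in> S" if "T \<subseteq> {0..<n}" for T
  using that A(2) S by (induction T rule: infinite_finite_induct) (auto simp: subring_set_def)
 thus "signof p * (\<Prod>i = 0..<n. A $$ (i, p i)) \<in> S"
  using S signof_pm_one[of p, where ?'a = 'a] by (auto simp: subring_set_def)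
qed

lemma subring_set_adj:
 fixes A :: "'a::comm_ring_1 mat"
 assumes S: "subring_set S" and A: "A \<in> carrier_mat n n" "!!i j. i < n ==> j < n ==> A $$ (i, j) \<in> S"
  and ij: "i < n" "j < n"
 shows "adj_mat A $$ (i, j) \<in> S"
proof -
 have "Determinant.det (mat_delete A j i) \<in> S"
  by (rule subring_set_det[OF S, of _ "n - 1"]) (use A ij in \<open>auto simp: mat_delete_def\<close>)
 moreover have "(- 1) ^ k \<in> S" for k using S by (induction k) (auto simp: subring_set_def)
 ultimately show ?thesis using S A(1) ij by (simp add: adj_mat_def cofactor_def subring_set_def)
qed

lemma det_mult_fun:
 fixes f g :: "nat => nat => 'a::comm_ring_1"
 shows "Determinant.det (mat N N (%(i, j). \<Sum>k<N. f i k * g k j)) =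
  Determinant.det (mat N N (%(i, j). f i j)) * Determinant.det (mat N N (%(i, j). g i j))"
proof -
 have "mat N N (%(i, j). \<Sum>k<N. f i k * g k j) = mat N N (%(i, j). f i j) * mat N N (%(i, j). g i j)"
  by (rule eq_matI) (auto simp: scalar_prod_def atLeast0LessThan)
 thus ?thesis using det_mult[of "mat N N (%(i, j). f i j)" N "mat N N (%(i, j). g i j)"] by simp
qed

text \<open>The inverse of a block diagonal matrix, made block diagonal by truncation.\<close>

lemma block_inverse:
 fixes f :: "nat => nat => 'a::comm_ring_1" and b :: "nat => bool"
 assumes blk: "!!i j. b i ~= b j ==> f i j = 0"
  and u: "Determinant.det (mat N N (%(i, j). f i j)) * u = 1"
 obtains g where "!!i j. b i ~= b j ==> g i j = 0"
  "!!i j. i < N ==> j < N ==> (\<Sum>k<N. g i k * f k j) = kron i j"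
  "!!S i j. subring_set S ==> ALL i<N. ALL j<N. f i j \<in> S ==> i < N ==> j < N ==>
   Determinant.det (mat N N (%(i, j). f i j)) * g i j \<in> S"
proof -
 let ?A = "mat N N (%(i, j). f i j)"
 have A: "?A \<in> carrier_mat N N" by simp
 note adj = adj_mat[OF A]
 define g where "g i j = (if b i = b j then u * adj_mat ?A $$ (i, j) else 0)" for i j
 have "(\<Sum>k<N. g i k * f k j) = kron i j" if ij: "i < N" "j < N" for i j
 proof (cases "b i = b j")
  case True
  have "(\<Sum>k<N. g i k * f k j) = (\<Sum>k<N. u * (adj_mat ?A $$ (i, k) * f k j))"
   by (rule sum.cong[OF refl]) (use blk True in \<open>auto simp: g_def mult.assoc\<close>)
  also have "... = u * (adj_mat ?A * ?A) $$ (i, j)"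
   using ij adj(1) by (simp add: scalar_prod_def atLeast0LessThan sum_distrib_left)
  also have "... = (Determinant.det ?A * u) * kron i j" using ij by (simp add: adj(3) kron_def)
  finally show ?thesis by (simp only: u mult_1_left)
 next
  case False
  have "(\<Sum>k<N. g i k * f k j) = 0"
   by (rule sum.neutral) (use blk False in \<open>auto simp: g_def\<close>)
  thus ?thesis using False by (auto simp: kron_def)
 qed
 moreover have "Determinant.det ?A * g i j \<in> S"
  if "subring_set S" "ALL i<N. ALL j<N. f i j \<in> S" "i < N" "j < N" for S i j
  using subring_set_adj[OF that(1) A _ that(3,4)] that subring_set_zero[OF that(1)]
  by (simp add: g_def mult.assoc[symmetric] u)
 ultimately show ?thesis by (intro that[of g]) (auto simp: g_def)
qed

subsection \<open>The even part\<close>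

lemma glc_par_mult:
 assumes "a \<in> glc_par p" "b \<in> glc_par q"
 shows "a * b \<in> (glc_par (p ~= q) :: ('k::field,'m::len0,'n::len0) glc set)"
proof -
 have ww: "word_elt xs * word_elt ys = (word_elt (xs @ ys) :: ('k,'m,'n) glc)" for xs ys
  by (induction xs) (simp_all add: mult.assoc)
 have lp: "list_par m (xs @ ys) = (list_par m xs ~= list_par m ys)" for m xs ys
  by (induction xs) auto
 obtain f where f: "a = abs_glc f" "ALL w:pkeys f. word_par LENGTH('m) w = p"
  using assms by (auto simp: glc_par_def)
 obtain g where g: "b = abs_glc g" "ALL w:pkeys g. word_par LENGTH('m) w = q"
  using assms by (auto simp: glc_par_def)
 note sub = subspace_glc_par[of "p ~= q", where ?'k = 'k and ?'m = 'm and ?'n = 'n]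
 show ?thesis
  unfolding f(1) g(1) abs_glc_expand sum_product glc_scale_mult_left glc_scale_mult_right ww
 proof (intro glc.subspace_sum[OF sub] glc.subspace_scale[OF sub])
  fix v w assume "v \<in> pkeys f" "w \<in> pkeys g"
  hence "list_par LENGTH('m) (letters v @ letters w) = (p ~= q)"
   using f(2) g(2) by (simp add: lp word_par_letters)
  thus "word_elt (letters v @ letters w) \<in> (glc_par (p ~= q) :: ('k,'m,'n) glc set)"
   using word_elt_par[of "letters v @ letters w", where ?'k = 'k and ?'m = 'm and ?'n = 'n] by (simp only:)
 qed
qed

lemma one_glc_par: "1 \<in> (glc_par False :: ('k::field,'m::len0,'n::len0) glc set)"
 using word_elt_par[of "[]", where ?'k = 'k and ?'m = 'm and ?'n = 'n] by simp

lemma zero_glc_par: "0 \<in> glc_par s"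
 by (rule glc.subspace_0[OF subspace_glc_par])

lemma sum_glc_par: "(!!i. i \<in> S ==> f i \<in> glc_par s) ==> sum f S \<in> glc_par s"
 by (rule glc.subspace_sum[OF subspace_glc_par])

text \<open>The even elements form a commutative ring; as a type of their own they admit the theory
  of determinants and adjugates.\<close>

typedef (overloaded) ('k,'m,'n) glc0 = "glc_par False :: ('k::field,'m::len0,'n::len0) glc set"
 morphisms of_even to_even
 using zero_glc_par by blast

setup_lifting type_definition_glc0

instantiation glc0 :: (field, len0, len0) comm_ring_1
begin

lift_definition zero_glc0 :: "('a, 'b, 'c) glc0" is 0 by (rule zero_glc_par)
lift_definition one_glc0 :: "('a, 'b, 'c) glc0" is 1 by (rule one_glc_par)
lift_definition plus_glc0 :: "('a, 'b, 'c) glc0 => ('a, 'b, 'c) glc0 => ('a, 'b, 'c) glc0" is "(+)"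
 by (rule glc.subspace_add[OF subspace_glc_par])
lift_definition minus_glc0 :: "('a, 'b, 'c) glc0 => ('a, 'b, 'c) glc0 => ('a, 'b, 'c) glc0" is "(-)"
 by (rule glc.subspace_diff[OF subspace_glc_par])
lift_definition uminus_glc0 :: "('a, 'b, 'c) glc0 => ('a, 'b, 'c) glc0" is uminus
 by (rule glc.subspace_neg[OF subspace_glc_par])
lift_definition times_glc0 :: "('a, 'b, 'c) glc0 => ('a, 'b, 'c) glc0 => ('a, 'b, 'c) glc0" is "(*)"
 using glc_par_mult[of _ False _ False] by simp

instance
proof
 fix a b c :: "('a, 'b, 'c) glc0"
 show "a * b = b * a"
 proof transfer
  fix a b :: "('a, 'b, 'c) glc" assume "a \<in> glc_par False" "b \<in> glc_par False"
  thus "a * b = b * a" using glc_supercomm[of a False b False] by simp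
 qed
qed (transfer; simp add: algebra_simps)+

end

lemma of_even_add: "of_even (a + b) = of_even a + of_even b"
 and of_even_mult: "of_even (a * b) = of_even a * of_even b"
 and of_even_zero [simp]: "of_even 0 = 0"
 and of_even_one [simp]: "of_even 1 = 1"
 and of_even_minus: "of_even (- a) = - of_even a"
 and of_even_diff: "of_even (a - b) = of_even a - of_even b"
 by (transfer; simp)+

lemma of_even_sum: "of_even (sum f S) = (\<Sum>i\<in>S. of_even (f i))"
 by (induction S rule: infinite_finite_induct) (simp_all add: of_even_add)

lemma of_even_par: "of_even a \<in> glc_par False"
 by (rule of_even)

lemma of_even_to_even: "a \<in> glc_par False ==> of_even (to_even a) = a"
 by (rule to_even_inverse)

lemma of_even_kron [simp]: "of_even (kron i j) = kron i j"
 by (simp add: kron_def)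

lemma even_central:
 fixes a b :: "('k::field,'m::len0,'n::len0) glc"
 assumes "a \<in> glc_par False"
 shows "a * b = b * a"
proof -
 obtain x y where xy: "x \<in> glc_par False" "y \<in> glc_par True" "b = x + y"
  using glc_par_sum by blast
 show ?thesis
  using glc_supercomm[OF assms xy(1)] glc_supercomm[OF assms xy(2)]
  by (simp add: xy(3) distrib_left distrib_right)
qed

lemma odd_square:
 assumes two: "(2::'k) ~= 0" and a: "(a :: ('k::field,'m::len0,'n::len0) glc) \<in> glc_par True"
 shows "a * a = 0"
proof -
 have "a * a = - (a * a)" using glc_supercomm[OF a a] by (simp add: psign_def)
 hence "a * a + a * a = 0" by (simp only: eq_neg_iff_add_eq_0)
 thus ?thesis using glc_half[OF two, of "a * a"] by simp
qed

text \<open>Odd elements anticommute and have square 0, so a product \<open>z\<close> of two of them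
  has square 0 and \<open>1 - z * y\<close> inverts \<open>1 + z * y\<close>.\<close>

lemma jac_even:
 assumes two: "(2::'k) ~= 0" and a: "a \<in> glc_par True" "b \<in> glc_par True"
  and z: "of_even z = (a * b :: ('k::field,'m::len0,'n::len0) glc)"
 shows "z \<in> jac"
proof -
 have "of_even (z * z) = a * (b * a) * b" by (simp add: of_even_mult z mult.assoc)
 also have "b * a = - (a * b)" using glc_supercomm[OF a(2,1)] by (simp add: psign_def)
 finally have "of_even (z * z) = - ((a * a) * (b * b))" by (simp add: mult.assoc)
 hence "of_even (z * z) = of_even 0" by (simp add: odd_square[OF two a(1)])
 hence zz: "z * z = 0" by (simp only: of_even_inject)
 have "(1 + z * y) * (1 - z * y) = 1" for y
 proof -
  have "(1 + z * y) * (1 - z * y) = 1 - z * z * (y * y)" by (simp add: algebra_simps)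
  thus ?thesis by (simp add: zz)
 qed
 hence "(1 + z * y) dvd 1" for y by (metis dvdI)
 thus ?thesis by (simp add: jac_def)
qed

text \<open>The diagonal blocks of the generic matrix form an invertible matrix, since the product of the
 diagonal blocks of \<open>C\<close> and \<open>D\<close> differs from the identity by sums of products of two odd elements.\<close>

definition blkC :: "nat => nat => ('k::field,'m::len0,'n::len0) glc0"
 where "blkC i j = (if idx_par LENGTH('m) i = idx_par LENGTH('m) j then to_even (cc i j) else 0)"

lemma of_even_blkC: "of_even (blkC i j :: ('k::field,'m::len0,'n::len0) glc0) =
  (if idx_par LENGTH('m) i = idx_par LENGTH('m) j then cc i j else 0)"
proof (cases "idx_par LENGTH('m) i = idx_par LENGTH('m) j")
 case True
 hence "cc i j \<in> (glc_par False :: ('k,'m,'n) glc set)"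
  using glc_gen_par[of "GenC i j", where ?'k = 'k and ?'m = 'm and ?'n = 'n] by simp
 thus ?thesis using True by (simp add: blkC_def of_even_to_even)
qed (simp add: blkC_def)

lemma blkC_inverse:
 assumes two: "(2::'k) ~= 0"
 obtains G :: "nat => nat => ('k::field,'m::len0,'n::len0) glc0" and u where
  "!!i j. idx_par LENGTH('m) i ~= idx_par LENGTH('m) j ==> G i j = 0"
  "!!i j. i < LENGTH('m) + LENGTH('n) ==> j < LENGTH('m) + LENGTH('n) ==> (\<Sum>k<LENGTH('m) + LENGTH('n). G i k * blkC k j) = kron i j"
  "Determinant.det (mat (LENGTH('m) + LENGTH('n)) (LENGTH('m) + LENGTH('n)) (%(i, j). blkC i j)) * u = (1 :: ('k,'m,'n) glc0)"
  "!!S i j. subring_set S ==> ALL i<LENGTH('m) + LENGTH('n). ALL j<LENGTH('m) + LENGTH('n). blkC i j \<in> S ==>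
   i < LENGTH('m) + LENGTH('n) ==> j < LENGTH('m) + LENGTH('n) ==>
   Determinant.det (mat (LENGTH('m) + LENGTH('n)) (LENGTH('m) + LENGTH('n)) (%(i, j). blkC i j)) * G i j \<in> S"
proof -
 let ?N = "LENGTH('m) + LENGTH('n)" and ?p = "idx_par LENGTH('m)"
 define E :: "nat => nat => ('k,'m,'n) glc0" where
  "E i j = (if ?p i = ?p j then to_even (dd i j) else 0)" for i j
 have E: "of_even (E i j) = (if ?p i = ?p j then dd i j else 0)" for i j
 proof (cases "?p i = ?p j")
  case True
  hence "dd i j \<in> (glc_par False :: ('k,'m,'n) glc set)"
   using glc_gen_par[of "GenD i j", where ?'k = 'k and ?'m = 'm and ?'n = 'n] by simp
  thus ?thesis using True by (simp add: E_def of_even_to_even)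
 qed (simp add: E_def)
 have "(\<Sum>k<?N. blkC i k * E k j) - kron i j \<in> jac" if ij: "i < ?N" "j < ?N" for i j
 proof (cases "?p i = ?p j")
  case False
  have "blkC i k * E k j = 0" for k
   using False by (cases "?p i = ?p k") (auto simp: blkC_def E_def)
  thus ?thesis using False by (auto simp: jac_zero kron_def)
 next
  case True
  define z :: "nat => ('k,'m,'n) glc0" where "z k = (if ?p i ~= ?p k then to_even (cc i k * dd k j) else 0)" for k
  have odd: "cc i k \<in> (glc_par True :: ('k,'m,'n) glc set) & dd k j \<in> (glc_par True :: ('k,'m,'n) glc set)" if "?p i ~= ?p k" for k
   using glc_gen_par[of "GenC i k", where ?'k = 'k and ?'m = 'm and ?'n = 'n]
    glc_gen_par[of "GenD k j", where ?'k = 'k and ?'m = 'm and ?'n = 'n] that True by auto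
  have z: "of_even (z k) = (if ?p i ~= ?p k then cc i k * dd k j else 0)" for k
  proof (cases "?p i ~= ?p k")
   case True
   hence "cc i k * dd k j \<in> (glc_par (True ~= True) :: ('k,'m,'n) glc set)"
    using odd by (intro glc_par_mult) blast+
   hence "cc i k * dd k j \<in> (glc_par False :: ('k,'m,'n) glc set)" by simp
   thus ?thesis using True by (simp add: z_def of_even_to_even)
  qed (simp add: z_def)
  have "of_even ((\<Sum>k<?N. blkC i k * E k j) + (\<Sum>k<?N. z k)) = (\<Sum>k<?N. cc i k * dd k j)"
   unfolding of_even_add of_even_sum of_even_mult sum.distrib[symmetric]
   by (rule sum.cong[OF refl]) (use True in \<open>auto simp: of_even_blkC E z\<close>)
  also have "... = of_even (kron i j)"
   by (simp add: glc_inverse_right[OF ij] kron_def)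
  finally have "(\<Sum>k<?N. blkC i k * E k j) + (\<Sum>k<?N. z k) = kron i j" by (simp only: of_even_inject)
  hence "(\<Sum>k<?N. blkC i k * E k j) - kron i j = (\<Sum>k<?N. z k * - 1)"
   by (simp add: algebra_simps sum_negf)
  also have "... \<in> jac"
  proof (intro jac_sum jac_mult)
   fix k show "z k \<in> jac"
   proof (cases "?p i ~= ?p k")
    case True
    show ?thesis
     by (rule jac_even[OF two, of "cc i k" "dd k j"]) (use odd[OF True] z[of k] True in simp_all)
   qed (simp add: z_def jac_zero)
  qed
  finally show ?thesis .
 qed
 hence "Determinant.det (mat ?N ?N (%(i, j). \<Sum>k<?N. blkC i k * E k j)) - Determinant.det (mat ?N ?N (%(i, j). kron i j)) \<in> jac"
  by (rule det_cong_jac)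
 hence "(1 + (Determinant.det (mat ?N ?N (%(i, j). \<Sum>k<?N. blkC i k * E k j)) - 1) * 1) dvd (1 :: ('k,'m,'n) glc0)"
  unfolding jac_def det_kron by blast
 then obtain v where "1 = Determinant.det (mat ?N ?N (%(i, j). \<Sum>k<?N. blkC i k * E k j)) * v"
  by (auto elim: dvdE)
 hence u: "Determinant.det (mat ?N ?N (%(i, j). blkC i j)) * (Determinant.det (mat ?N ?N (%(i, j). E i j)) * v) = 1"
  by (simp add: det_mult_fun mult.assoc)
 have blk: "?p i ~= ?p j ==> (blkC i j :: ('k,'m,'n) glc0) = 0" for i j
  by (simp add: blkC_def)
 obtain g where g: "!!i j. ?p i ~= ?p j ==> g i j = 0"
  "!!i j. i < ?N ==> j < ?N ==> (\<Sum>k<?N. g i k * (blkC k j :: ('k,'m,'n) glc0)) = kron i j"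
  "!!S i j. subring_set S ==> ALL i<?N. ALL j<?N. (blkC i j :: ('k,'m,'n) glc0) \<in> S ==> i < ?N ==> j < ?N ==>
   Determinant.det (mat ?N ?N (%(i, j). blkC i j)) * g i j \<in> S"
  using block_inverse[where b = ?p and f = "blkC :: nat => nat => ('k,'m,'n) glc0", OF blk u] by blast
 show ?thesis by (rule that[OF g(1,2) u g(3)])
qed

subsection \<open>A curve from the identity to the generic matrix\<close>

definition fps_par :: "bool => ('k::field,'m::len0,'n::len0) glc fps set"
 where "fps_par p = {F. ALL n. fps_nth F n \<in> glc_par p}"

lemma fps_supercomm:
 assumes "F \<in> fps_par p" "G \<in> fps_par q"
 shows "F * G = psign p q * (G * F)"
proof (rule fps_ext)
 fix n
 have "(\<Sum>i=0..n. fps_nth F i * fps_nth G (n - i)) = (\<Sum>i=0..n. psign p q * (fps_nth G i * fps_nth F (n - i)))"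
 proof (rule sum.reindex_bij_witness[of _ "%i. n - i" "%i. n - i"])
  fix i assume "i \<in> {0..n}"
  hence "n - (n - i) = i" by simp
  thus "psign p q * (fps_nth G (n - i) * fps_nth F (n - (n - i))) = fps_nth F i * fps_nth G (n - i)"
   using glc_supercomm[of "fps_nth F i" p "fps_nth G (n - i)" q] assms by (simp add: fps_par_def)
 qed auto
 moreover have "fps_nth (psign p q * (G * F)) n = psign p q * fps_nth (G * F) n"
  by (cases p; cases q) (simp_all add: psign_def)
 ultimately show "fps_nth (F * G) n = fps_nth (psign p q * (G * F)) n"
  by (simp only: fps_mult_nth sum_distrib_left)
qed

text \<open>The value at 1 of a power series, meaningful only for series with finitely many terms.
  The witness bounds the degree.\<close>

definition poly_value :: "'a::ring_1 fps => 'a => bool"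
 where "poly_value F a \<longleftrightarrow> (EX n. (ALL k>=n. fps_nth F k = 0) & a = (\<Sum>k<n. fps_nth F k))"

lemma poly_valueD:
 assumes "poly_value F a"
 obtains n where "!!m. m >= n ==> a = (\<Sum>k<m. fps_nth F k)" "!!k. k >= n ==> fps_nth F k = 0"
proof -
 obtain n where n: "ALL k>=n. fps_nth F k = 0" "a = (\<Sum>k<n. fps_nth F k)"
  using assms by (auto simp: poly_value_def)
 have "a = (\<Sum>k<m. fps_nth F k)" if "m >= n" for m
  unfolding n(2) by (rule sum.mono_neutral_left) (use n(1) that in auto)
 thus ?thesis using that n(1) by blast
qed

lemma poly_value_zero: "poly_value 0 a ==> a = 0"
 by (auto simp: poly_value_def)

lemma poly_value_add:
 assumes "poly_value F a" "poly_value G b"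
 shows "poly_value (F + G) (a + b)"
proof -
 obtain n where n: "!!m. m >= n ==> a = (\<Sum>k<m. fps_nth F k)" "!!k. k >= n ==> fps_nth F k = 0"
  using assms(1) by (rule poly_valueD) blast
 obtain n' where n': "!!m. m >= n' ==> b = (\<Sum>k<m. fps_nth G k)" "!!k. k >= n' ==> fps_nth G k = 0"
  using assms(2) by (rule poly_valueD) blast
 show ?thesis
  unfolding poly_value_def
  by (rule exI[of _ "max n n'"])
   (use n(1)[of "max n n'"] n'(1)[of "max n n'"] n(2) n'(2) in \<open>auto simp: sum.distrib\<close>)
qed

lemma poly_value_mult:
 assumes "poly_value F a" "poly_value G b"
 shows "poly_value (F * G) (a * b)"
proof -
 obtain n where n: "!!m. m >= n ==> a = (\<Sum>k<m. fps_nth F k)" "!!k. k >= n ==> fps_nth F k = 0"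
  using assms(1) by (rule poly_valueD) blast
 obtain n' where n': "!!m. m >= n' ==> b = (\<Sum>k<m. fps_nth G k)" "!!k. k >= n' ==> fps_nth G k = 0"
  using assms(2) by (rule poly_valueD) blast
 have z: "fps_nth F i * fps_nth G j = 0" if "i >= n \<or> j >= n'" for i j
  using that n(2) n'(2) by auto
 have "fps_nth (F * G) k = 0" if "k >= n + n'" for k
  unfolding fps_mult_nth by (rule sum.neutral) (use that in \<open>auto intro!: z\<close>)
 moreover have "a * b = (\<Sum>k<n + n'. fps_nth (F * G) k)"
 proof -
  have fin: "finite {(i, j). i + j < n + n'}"
   by (rule finite_subset[of _ "{..<n + n'} \<times> {..<n + n'}"]) auto
  have "a * b = (\<Sum>i<n. \<Sum>j<n'. fps_nth F i * fps_nth G j)"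
   using n(1)[OF order_refl] n'(1)[OF order_refl] by (simp add: sum_product)
  also have "... = (\<Sum>(i, j)\<in>{..<n} \<times> {..<n'}. fps_nth F i * fps_nth G j)"
   by (simp add: sum.cartesian_product)
  also have "... = (\<Sum>(i, j)\<in>{(i, j). i + j < n + n'}. fps_nth F i * fps_nth G j)"
   by (rule sum.mono_neutral_left[OF fin]) (auto intro!: z)
  also have "... = (\<Sum>k<n + n'. \<Sum>i\<le>k. fps_nth F i * fps_nth G (k - i))"
   by (rule sum.triangle_reindex)
  finally show ?thesis by (simp add: fps_mult_nth atLeast0AtMost)
 qed
 ultimately show ?thesis unfolding poly_value_def by blast
qed

lemma poly_value_const: "poly_value (fps_const a) a"
 unfolding poly_value_def by (rule exI[of _ 1]) auto

definition low_order :: "nat => 'a::ring_1 fps => bool"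
 where "low_order n F \<longleftrightarrow> (ALL k<n. fps_nth F k = 0)"

lemma low_order_mult:
 assumes "low_order n F" "low_order m G"
 shows "low_order (n + m) (F * G)"
 unfolding low_order_def fps_mult_nth
proof (intro allI impI sum.neutral ballI)
 fix k i assume "k < n + m" "i \<in> {0..k}"
 hence "i < n \<or> k - i < m" by auto
 thus "fps_nth F i * fps_nth G (k - i) = 0"
  using assms by (auto simp: low_order_def)
qed

lemma low_order_add: "low_order n F ==> low_order n G ==> low_order n (F + G)"
 by (simp add: low_order_def)

primrec mat_pow :: "nat => (nat => nat => 'a::ring_1) => nat => nat => nat => 'a" where
 "mat_pow N M 0 = kron"
| "mat_pow N M (Suc n) = (%i j. \<Sum>k<N. M i k * mat_pow N M n k j)"

lemma mat_pow_Suc': "i < N ==> j < N ==> (\<Sum>k<N. mat_pow N M n i k * M k j) = mat_pow N M (Suc n) i j"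
proof (induction n arbitrary: i)
 case (Suc n)
 have "(\<Sum>k<N. mat_pow N M (Suc n) i k * M k j) = (\<Sum>k<N. \<Sum>l<N. M i l * (mat_pow N M n l k * M k j))"
  by (simp add: sum_distrib_right mult.assoc)
 also have "... = (\<Sum>l<N. M i l * (\<Sum>k<N. mat_pow N M n l k * M k j))"
  unfolding sum_distrib_left by (rule sum.swap)
 also have "... = mat_pow N M (Suc (Suc n)) i j"
  using Suc by (simp del: mat_pow.simps(2) add: mat_pow.simps(2)[of N M "Suc n"])
 finally show ?case .
qed simp

text \<open>The geometric series for the inverse of a matrix \<open>1 - s M\<close>. The entries of
  \<open>M\<close> need not commute, but the variable is central and can be moved to the
  front.\<close>

lemma geometric_inverse:
 fixes M :: "nat => nat => 'a::ring_1"
 assumes "i < N" "j < N"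
 shows "(\<Sum>k<N. (kron i k - fps_X * fps_const (M i k)) * Abs_fps (%n. mat_pow N M n k j)) = kron i j" (is ?L)
  and "(\<Sum>k<N. Abs_fps (%n. mat_pow N M n i k) * (kron k j - fps_X * fps_const (M k j))) = kron i j" (is ?R)
proof -
 have X: "F * (fps_X * fps_const a) = fps_X * (F * fps_const a)" for F and a :: 'a
  by (rule fps_ext) (simp add: mult.assoc[symmetric] fps_mult_fps_X_commute[symmetric])
 have k: "fps_nth (kron i j :: 'a fps) n = (if n = 0 then kron i j else 0)" for n by (simp add: kron_def)
 have "(\<Sum>k<N. (kron i k - fps_X * fps_const (M i k)) * Abs_fps (%n. mat_pow N M n k j)) =
   Abs_fps (%n. mat_pow N M n i j) - fps_X * (\<Sum>k<N. fps_const (M i k) * Abs_fps (%n. mat_pow N M n k j))"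
  using assms by (simp add: left_diff_distrib sum_subtractf sum_distrib_left mult.assoc)
 also have "... = kron i j"
  by (rule fps_ext) (simp add: k fps_X_mult_nth fps_sum_nth gr0_conv_Suc split: nat_diff_split)
 finally show ?L .
 have "(\<Sum>k<N. Abs_fps (%n. mat_pow N M n i k) * (kron k j - fps_X * fps_const (M k j))) =
   Abs_fps (%n. mat_pow N M n i j) - fps_X * (\<Sum>k<N. Abs_fps (%n. mat_pow N M n i k) * fps_const (M k j))"
  using assms by (simp add: right_diff_distrib sum_subtractf sum_distrib_left X)
 also have "... = kron i j"
 proof (rule fps_ext)
  fix n
  show "fps_nth (Abs_fps (%n. mat_pow N M n i j) - fps_X * (\<Sum>k<N. Abs_fps (%n. mat_pow N M n i k) * fps_const (M k j))) n =
    fps_nth (kron i j) n"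
   by (cases n) (simp_all add: k fps_X_mult_nth fps_sum_nth mat_pow_Suc'[OF assms] del: mat_pow.simps(2))
 qed
 finally show ?R .
qed

subsection \<open>Separation by distributions\<close>

lemma glc_const_zero: "glc_const 0 = 0"
 by transfer (simp add: ideal_gen.zero)

context odd_char
begin

text \<open>The homomorphism sends the generic matrix \<open>C\<close> to \<open>1 + s (C - 1)\<close>. It maps polynomials in
 the entries of \<open>C\<close> to polynomials in \<open>s\<close> that take their original value at \<open>s = 1\<close>, and every
 function becomes such a polynomial after multiplication by a power of the unit \<open>d\<close>: the odd
 entries of \<open>C\<close> that do not annihilate \<open>y\<close> become fewer when \<open>y\<close> is multiplied by one of them.\<close>

lemma curve_hom_exists:
 obtains \<Phi> :: "('k,'m,'n) glc => ('k,'m,'n) glc fps" where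
  "!!a b. \<Phi> (a + b) = \<Phi> a + \<Phi> b" "!!a b. \<Phi> (a * b) = \<Phi> a * \<Phi> b" "\<Phi> 0 = 0" "\<Phi> 1 = 1"
  "!!a. \<Phi> a = 0 ==> a = 0" "!!a. fps_nth (\<Phi> a) 0 = glc_const (counit a)"
proof -
 let ?N = "LENGTH('m) + LENGTH('n)" and ?p = "idx_par LENGTH('m)"
 \<comment> \<open>With \<open>M\<close> the difference of the identity and \<open>C\<close>, the
   curve is \<open>1 - s M\<close>: it starts at the identity, reaches \<open>C\<close> at
   \<open>s = 1\<close>, and is inverted by a geometric series.\<close>
 define M :: "nat => nat => ('k,'m,'n) glc" where "M i j = kron i j - cc i j" for i j
 define Cs where "Cs i j = kron i j - fps_X * fps_const (M i j)" for i j
 define Ds where "Ds i j = Abs_fps (%n. mat_pow ?N M n i j)" for i j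
 have kron_par: "(kron i j :: ('k,'m,'n) glc) \<in> glc_par (?p i ~= ?p j)" for i j
  by (cases "i = j") (simp_all add: one_glc_par zero_glc_par)
 have M_par: "M i j \<in> glc_par (?p i ~= ?p j)" for i j
  unfolding M_def using glc_gen_par[of "GenC i j", where ?'k = 'k and ?'m = 'm and ?'n = 'n]
  by (intro glc.subspace_diff[OF subspace_glc_par kron_par]) simp
 have pow_par: "mat_pow ?N M n i j \<in> glc_par (?p i ~= ?p j)" for n i j
 proof (induction n arbitrary: i)
  case 0
  show ?case using kron_par by simp
 next
  case (Suc n)
  have "M i k * mat_pow ?N M n k j \<in> glc_par (?p i ~= ?p j)" for k
  proof -
   have "M i k * mat_pow ?N M n k j \<in> glc_par ((?p i ~= ?p k) ~= (?p k ~= ?p j))"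
    by (rule glc_par_mult[OF M_par Suc])
   also have "((?p i ~= ?p k) ~= (?p k ~= ?p j)) = (?p i ~= ?p j)" by blast
   finally show ?thesis .
  qed
  thus ?case by (simp add: sum_glc_par)
 qed
 have k: "fps_nth (kron i j :: ('k,'m,'n) glc fps) n = (if n = 0 then kron i j else 0)" for i j n
  by (simp add: kron_def)
 have par: "Cs i j \<in> fps_par (?p i ~= ?p j)" "Ds i j \<in> fps_par (?p i ~= ?p j)" for i j
  unfolding fps_par_def Cs_def Ds_def
  using kron_par M_par pow_par glc.subspace_neg[OF subspace_glc_par M_par]
  by (auto simp: k fps_X_mult_nth zero_glc_par)
 define g where "g = (%x. if word_in_range ?N [x] then (case x of GenC i j => Cs i j | GenD i j => Ds i j) else 0)"
 have gpar: "g x \<in> fps_par (gen_par LENGTH('m) x)" for x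
  using par[simplified fps_par_def] by (cases x) (auto simp: g_def fps_par_def zero_glc_par)
 interpret L: glc_lift "%c. fps_const (glc_const c)" g "TYPE(('k,'m,'n) glc)"
 proof
  show "fps_const (glc_const (c + d)) = fps_const (glc_const c) + fps_const (glc_const d)"
   "fps_const (glc_const (c * d)) = fps_const (glc_const c) * fps_const (glc_const d)"
   "fps_const (glc_const 1) = 1" for c d :: 'k
   by (simp_all add: glc_const_add glc_const_mult glc_const_one)
  show "fps_const (glc_const c) * y = y * fps_const (glc_const c)" for c :: 'k and y :: "('k,'m,'n) glc fps"
   by (rule fps_ext) (simp, rule glc_const_central)
  show "g x * g y = psign (gen_par LENGTH('m) x) (gen_par LENGTH('m) y) * (g y * g x)" for x y
   by (rule fps_supercomm[OF gpar gpar])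
  show "(\<Sum>k<?N. g (GenC i k) * g (GenD k j)) = of_bool (i = j)" "(\<Sum>k<?N. g (GenD i k) * g (GenC k j)) = of_bool (i = j)"
   if "i < ?N" "j < ?N" for i j
   using geometric_inverse[OF that, of M] that by (simp_all add: g_def word_in_range_def kron_def Cs_def Ds_def)
  show "g x = 0" if "~ word_in_range ?N [x]" for x
   using that by (simp add: g_def)
 qed
 have g0: "fps_nth (g x) 0 = glc_const (counit (glc_gen x :: ('k,'m,'n) glc))" for x
  by (cases x) (auto simp: g_def word_in_range_def Cs_def Ds_def k counit_gen_eq counit_gen_def kron_def
    glc_const_one glc_const_zero)
 have n0: "fps_nth (L.lifted a) 0 = glc_const (counit a)" for a
 proof -
  have "a \<in> {a. fps_nth (L.lifted a) 0 = glc_const (counit a)}"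
   by (rule glc_gen_induct)
    (auto intro!: glc.subspaceI simp: L.lifted_zero L.lifted_add L.lifted_scale L.lifted_one L.lifted_mult L.lifted_gen
     counit_add counit_scale counit_mult glc_const_add glc_const_mult glc_const_one glc_const_zero g0)
  thus ?thesis by simp
 qed
 define P where "P = {a. poly_value (L.lifted a) a}"
 have P_const: "glc_const c \<in> P" for c by (simp add: P_def L.lifted_const poly_value_const)
 have P: "subring_set P"
 proof -
  have "- 1 = (glc_const (- 1) :: ('k,'m,'n) glc)"
   using glc_const_add[of 1 "- 1", where ?'b = 'm and ?'c = 'n] glc_const_one glc_const_zero by (metis add.right_inverse minus_unique)
  thus ?thesis
   unfolding subring_set_def using P_const[of 1] P_const[of "- 1"]
   by (auto simp: P_def glc_const_one L.lifted_add L.lifted_mult poly_value_add poly_value_mult)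
 qed
 have P_cc: "cc i j \<in> P" if "i < ?N" "j < ?N" for i j
  unfolding P_def mem_Collect_eq L.lifted_gen poly_value_def
  by (rule exI[of _ 2]) (use that in \<open>auto simp: g_def word_in_range_def Cs_def M_def k fps_X_mult_nth numeral_2_eq_2\<close>)
 define d where "d = Determinant.det (mat ?N ?N (%(i, j). blkC i j :: ('k,'m,'n) glc0))"
 obtain G :: "nat => nat => ('k,'m,'n) glc0" and u where
  G: "!!i j. i < ?N ==> j < ?N ==> (\<Sum>k<?N. G i k * blkC k j) = kron i j" and u: "d * u = 1"
  and dG: "!!S i j. subring_set S ==> ALL i<?N. ALL j<?N. blkC i j \<in> S ==> i < ?N ==> j < ?N ==> d * G i j \<in> S"
  by (rule blkC_inverse[OF two]) (rule that[unfolded d_def])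
 have P0: "subring_set {z. of_even z \<in> P}" "ALL i<?N. ALL j<?N. blkC i j \<in> {z. of_even z \<in> P}"
  using P P_cc subring_set_zero[OF P] by (auto simp: subring_set_def of_even_add of_even_mult of_even_minus of_even_blkC)
 have "d \<in> {z. of_even z \<in> P}"
  unfolding d_def by (rule subring_set_det[OF P0(1), of _ ?N]) (use P0(2) in auto)
 hence dP: "of_even (d ^ n) \<in> P" for n
  using P by (induction n) (auto simp: of_even_mult subring_set_def)
 note central = even_central[OF of_even_par]
 define Loc where "Loc = {a. EX n. of_even (d ^ n) * a \<in> P}"
 have Loc_mult: "a * b \<in> Loc" if ab: "a \<in> Loc" "b \<in> Loc" for a b
 proof -
  obtain n m where nm: "of_even (d ^ n) * a \<in> P" "of_even (d ^ m) * b \<in> P" using ab by (auto simp: Loc_def)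
  have "of_even (d ^ (n + m)) * (a * b) = of_even (d ^ n) * (of_even (d ^ m) * a) * b"
   by (simp only: power_add of_even_mult mult.assoc)
  also have "... = (of_even (d ^ n) * a) * (of_even (d ^ m) * b)" unfolding central[of "d ^ m" a] by (simp only: mult.assoc)
  finally show ?thesis using nm P unfolding Loc_def subring_set_def by (intro CollectI exI[of _ "n + m"]) simp
 qed
 have Loc_P: "a \<in> Loc" if "a \<in> P" for a
  unfolding Loc_def using that by (intro CollectI exI[of _ 0]) simp
 have Loc_add: "a + b \<in> Loc" if ab: "a \<in> Loc" "b \<in> Loc" for a b
 proof -
  obtain n m where nm: "of_even (d ^ n) * a \<in> P" "of_even (d ^ m) * b \<in> P" using ab by (auto simp: Loc_def)
  have "of_even (d ^ (m + n)) * (a + b) = of_even (d ^ m) * (of_even (d ^ n) * a) + of_even (d ^ n) * (of_even (d ^ m) * b)"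
   by (simp only: power_add of_even_mult mult.assoc distrib_left central[of "d ^ m" "of_even (d ^ n) * b"] central[of "d ^ m" b])
  thus ?thesis using nm dP P unfolding Loc_def subring_set_def by (intro CollectI exI[of _ "m + n"]) simp
 qed
 have Loc: "subring_set Loc"
  using Loc_P P Loc_mult Loc_add by (auto simp: subring_set_def)
 have Loc_G: "of_even (G i j) \<in> Loc" if "i < ?N" "j < ?N" for i j
  unfolding Loc_def using dG[OF P0 that] by (intro CollectI exI[of _ 1]) (simp add: of_even_mult)
 have Loc_m1: "- 1 \<in> Loc" using Loc by (simp add: subring_set_def)
 define c where "c i j = (if ?p i ~= ?p j then cc i j else 0 :: ('k,'m,'n) glc)" for i j
 have c_odd: "c i j \<in> glc_par True" for i j
  using glc_gen_par[of "GenC i j", where ?'k = 'k and ?'m = 'm and ?'n = 'n] by (auto simp: c_def zero_glc_par)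
 have cLoc: "c i j \<in> Loc" if "i < ?N" "j < ?N" for i j
  using Loc_P P_cc[OF that] subring_set_zero[OF Loc] by (simp add: c_def)
 \<comment> \<open>Split \<open>C\<close> into its diagonal blocks and its odd part
   \<open>c\<close>. As \<open>G\<close> inverts the blocks, the relation between \<open>C\<close>
   and \<open>D\<close> becomes the fixed point equation \<open>D = G - G c D\<close>, in which
   every further use of \<open>D\<close> comes with an odd factor.\<close>
 have D: "dd i j = of_even (G i j) - (\<Sum>l<?N. \<Sum>k<?N. of_even (G i k) * (c k l * dd l j))" if ij: "i < ?N" "j < ?N" for i j
 proof -
  have "kron i l = (\<Sum>k<?N. of_even (G i k) * cc k l) - (\<Sum>k<?N. of_even (G i k) * c k l)" if "l < ?N" for l
  proof -
   have "cc k l - c k l = of_even (blkC k l :: ('k,'m,'n) glc0)" for k by (simp add: c_def of_even_blkC)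
   hence "(\<Sum>k<?N. of_even (G i k) * cc k l) - (\<Sum>k<?N. of_even (G i k) * c k l) = of_even (\<Sum>k<?N. G i k * blkC k l)"
    by (simp only: sum_subtractf[symmetric] right_diff_distrib[symmetric] of_even_sum of_even_mult)
   thus ?thesis by (simp add: G[OF ij(1) that])
  qed
  hence "(\<Sum>l<?N. kron i l * dd l j) =
    (\<Sum>l<?N. (\<Sum>k<?N. of_even (G i k) * cc k l) * dd l j) - (\<Sum>l<?N. (\<Sum>k<?N. of_even (G i k) * c k l) * dd l j)"
   by (simp add: left_diff_distrib sum_subtractf)
  also have "(\<Sum>l<?N. (\<Sum>k<?N. of_even (G i k) * cc k l) * dd l j) = (\<Sum>k<?N. of_even (G i k) * (\<Sum>l<?N. cc k l * dd l j))"
   unfolding sum_distrib_left sum_distrib_right mult.assoc by (rule sum.swap)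
  also have "... = (\<Sum>k<?N. of_even (G i k) * kron k j)"
   by (rule sum.cong[OF refl]) (use ij in \<open>simp add: glc_inverse_right kron_def\<close>)
  finally show ?thesis using ij by (simp add: sum_distrib_right mult.assoc)
 qed
 define X where "X = case_prod c ` ({..<?N} \<times> {..<?N})"
 have Loc_D': "ALL i<?N. ALL j<?N. y * dd i j \<in> Loc" if "y \<in> Loc" for y
  using that
 proof (induction "card {x \<in> X. y * x ~= 0}" arbitrary: y rule: less_induct)
  case less
  have IH: "y * c k l * dd l j \<in> Loc" if kl: "k < ?N" "l < ?N" "j < ?N" for k l j
  proof (cases "y * c k l = 0")
   case False
   have sq: "c k l * c k l = 0" by (rule odd_square[OF two c_odd])
   \<comment> \<open>Odd elements anticommute, so every odd entry that annihilates \<open>y\<close>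
     still annihilates \<open>y * c k l\<close>; in addition \<open>c k l\<close> itself now does,
     its square being 0.\<close>
   have sub: "{x \<in> X. y * c k l * x ~= 0} \<subset> {x \<in> X. y * x ~= 0}"
   proof (rule psubsetI)
    show "{x \<in> X. y * c k l * x ~= 0} \<subseteq> {x \<in> X. y * x ~= 0}"
    proof
     fix x assume x: "x \<in> {x \<in> X. y * c k l * x ~= 0}"
     hence "c k l * x = - (x * c k l)" using glc_supercomm[OF c_odd, of x True] c_odd by (auto simp: X_def psign_def)
     hence "y * c k l * x = - (y * x * c k l)" by (simp add: mult.assoc)
     thus "x \<in> {x \<in> X. y * x ~= 0}" using x by auto
    qed
    have "c k l \<in> X" unfolding X_def using kl by (intro image_eqI[of _ _ "(k, l)"]) auto
    hence "c k l \<in> {x \<in> X. y * x ~= 0}" "c k l \<notin> {x \<in> X. y * c k l * x ~= 0}"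
     using False by (simp_all add: mult.assoc sq)
    thus "{x \<in> X. y * c k l * x ~= 0} ~= {x \<in> X. y * x ~= 0}" by blast
   qed
   have "card {x \<in> X. y * c k l * x ~= 0} < card {x \<in> X. y * x ~= 0}"
    by (rule psubset_card_mono[OF _ sub]) (simp add: X_def)
   thus ?thesis using less(1)[OF _ Loc_mult[OF less(2) cLoc[OF kl(1,2)]]] kl by blast
  qed (simp add: subring_set_zero[OF Loc])
  show ?case
  proof (intro allI impI)
   fix i j assume ij: "i < ?N" "j < ?N"
   have "y * dd i j = y * of_even (G i j) + - 1 * (\<Sum>l<?N. \<Sum>k<?N. of_even (G i k) * (y * c k l * dd l j))"
    unfolding D[OF ij] right_diff_distrib sum_distrib_left[of y] mult.assoc[symmetric] central[of _ y] by simp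
   also have "... \<in> Loc"
    by (rule Loc_add[OF Loc_mult[OF less(2) Loc_G[OF ij]] Loc_mult[OF Loc_m1]],
      intro subring_set_sum[OF Loc] Loc_mult[OF Loc_G IH]) (use ij in auto)
   finally show "y * dd i j \<in> Loc" .
  qed
 qed
 have Loc_D: "dd i j \<in> Loc" if "i < ?N" "j < ?N" for i j
  using Loc_D'[OF Loc_P[of 1]] P that unfolding subring_set_def by simp
 have all: "a \<in> Loc" for a
 proof (rule glc_word_induct)
  have "scA x a \<in> Loc" if "a \<in> Loc" for x a
   unfolding glc_scale_def by (rule Loc_mult[OF Loc_P[OF P_const] that])
  thus "glc.subspace Loc" using subring_set_zero[OF Loc] Loc_add by (intro glc.subspaceI)
  show "word_elt xs \<in> Loc" if "word_in_range ?N xs" for xs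
   using that
  proof (induction xs)
   case Nil
   thus ?case using Loc by (simp add: subring_set_def word_elt_def)
  next
   case (Cons x xs)
   hence "glc_gen x \<in> Loc" using Loc_P[OF P_cc] Loc_D by (cases x) (auto simp: word_in_range_def)
   thus ?case using Cons Loc_mult by (auto simp: word_elt_def word_in_range_def)
  qed
 qed
 show ?thesis
 proof (rule that[of L.lifted])
  fix a assume a: "L.lifted a = 0"
  obtain n where "of_even (d ^ n) * a \<in> P" using all[of a] by (auto simp: Loc_def)
  hence "of_even (d ^ n) * a = 0" by (simp add: P_def L.lifted_mult a poly_value_zero)
  hence "of_even (u ^ n * d ^ n) * a = 0" by (simp add: of_even_mult mult.assoc)
  moreover have "u ^ n * d ^ n = 1" using u by (simp add: power_mult_distrib[symmetric] mult.commute)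
  ultimately show "a = 0" by simp
 qed (rule L.lifted_add L.lifted_mult L.lifted_zero L.lifted_one n0)+
qed

text \<open>The curve starts at the identity, so elements of the augmentation ideal become series
  without constant term and its \<open>t\<close>-th power becomes series of order at least
  \<open>t\<close>. An element of all powers has image 0, and the curve homomorphism has trivial
  kernel.\<close>

lemma ideal_powers_separated:
 fixes a :: "('k,'m,'n) glc"
 assumes "!!t. a \<in> ideal_power {g. counit g = 0} t"
 shows "a = 0"
proof -
 obtain \<Phi> :: "('k,'m,'n) glc => ('k,'m,'n) glc fps" where \<Phi>:
  "!!a b. \<Phi> (a + b) = \<Phi> a + \<Phi> b" "!!a b. \<Phi> (a * b) = \<Phi> a * \<Phi> b" "\<Phi> 0 = 0" "\<Phi> 1 = 1"
  "!!a. \<Phi> a = 0 ==> a = 0" "!!a. fps_nth (\<Phi> a) 0 = glc_const (counit a)"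
  by (rule curve_hom_exists) blast
 have p: "low_order (length xs) (\<Phi> (prod_list xs))" if "set xs \<subseteq> {g. counit g = 0}" for xs
  using that
 proof (induction xs)
  case Nil
  show ?case by (simp add: low_order_def)
 next
  case (Cons x xs)
  hence "low_order (1 + length xs) (\<Phi> x * \<Phi> (prod_list xs))"
   by (intro low_order_mult) (simp_all add: low_order_def \<Phi>(6) glc_const_zero)
  thus ?case by (simp add: \<Phi>(2))
 qed
 have "low_order t (\<Phi> a)" if "a \<in> ideal_power {g. counit g = 0} t" for t a
  using that unfolding ideal_power_def
 proof (induction rule: ideal_gen.induct)
  case zero
  thus ?case by (simp add: low_order_def \<Phi>(3))
 next
  case (step x r a b)
  hence "low_order (0 + t + 0) (\<Phi> a * \<Phi> r * \<Phi> b)"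
   using p by (intro low_order_mult) (auto simp: low_order_def)
  thus ?case using step by (simp add: \<Phi>(1,2) low_order_add)
 qed
 hence "fps_nth (\<Phi> a) n = 0" for n
  using assms[of "Suc n"] by (simp add: low_order_def)
 hence "\<Phi> a = 0" by (intro fps_ext) simp
 thus ?thesis by (rule \<Phi>(5))
qed

lemma subspace_ideal_power: "glc.subspace (ideal_power I t :: ('k,'m,'n) glc set)"
 unfolding ideal_power_def
 by (rule glc.subspaceI) (simp_all add: ideal_gen.zero ideal_gen_add glc_scale_def ideal_gen_mult_left)

lemma ideal_power_antimono:
 assumes "s <= t"
 shows "ideal_power I t \<subseteq> (ideal_power I s :: ('k,'m,'n) glc set)"
proof
 fix x :: "('k,'m,'n) glc" assume "x \<in> ideal_power I t"
 thus "x \<in> ideal_power I s"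
  unfolding ideal_power_def
 proof (induction rule: ideal_gen.induct)
  case (step x r a b)
  obtain xs where xs: "r = prod_list xs" "length xs = t" "set xs \<subseteq> I" using step(2) by blast
  have "prod_list (take s xs) \<in> ideal_gen {prod_list xs | xs. length xs = s & set xs \<subseteq> I}"
   using xs assms set_take_subset[of s xs] by (intro ideal_gen_base CollectI exI[of _ "take s xs"]) auto
  hence "a * (prod_list (take s xs) * prod_list (drop s xs)) * b \<in> ideal_gen {prod_list xs | xs. length xs = s & set xs \<subseteq> I}"
   by (intro ideal_gen_mult ideal_gen_mult_right)
  thus ?case
   using step(3) by (simp only: ideal_gen_add xs(1) prod_list.append[symmetric] append_take_drop_id)
 qed (rule ideal_gen.zero)
qed

text \<open>The point is that \<open>e\<close> stays outside the sum of the span of \<open>B\<close>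
  and some power of the augmentation ideal. A form that vanishes on this sum and takes the value 1
  at \<open>e\<close> is then a distribution.\<close>

lemma Dist_separates:
 fixes e :: "('k,'m,'n) glc"
 assumes "finite B" "e \<notin> glc.span B"
 obtains \<xi> where "\<xi> \<in> Dist" "!!x. x \<in> B ==> \<xi> x = 0" "\<xi> e ~= 0"
proof -
 define U where "U t = (ideal_power {g :: ('k,'m,'n) glc. counit g = 0} t)" for t
 have sub: "glc.subspace (U t)" for t unfolding U_def by (rule subspace_ideal_power)
 have anti: "s <= t ==> U t \<subseteq> U s" for s t unfolding U_def by (rule ideal_power_antimono)
 \<comment> \<open>Induction on \<open>B\<close>, strengthened to all \<open>e\<close>:
   finite-dimensional subspaces are closed for the filtration by the powers.\<close>
 have main: "EX t. ALL b:glc.span B. e - b \<notin> U t" if "finite B" "e \<notin> glc.span B" for B and e :: "('k,'m,'n) glc"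
  using that
 proof (induction B arbitrary: e rule: finite_induct)
  case empty
  hence "e ~= 0" by simp
  then obtain t where "e \<notin> U t" using ideal_powers_separated[of e] unfolding U_def by blast
  thus ?case by auto
 next
  case (insert x B)
  show ?case
  proof (rule ccontr)
   assume neg: "\<nexists>t. ALL b:glc.span (insert x B). e - b \<notin> U t"
   have "e \<notin> glc.span B" using insert.prems glc.span_mono[of B "insert x B"] by auto
   then obtain t0 where t0: "ALL b:glc.span B. e - b \<notin> U t0" using insert.IH by blast
   have r: "EX c b. b \<in> glc.span B & e - scA c x - b \<in> U t" for t
   proof -
    obtain b where b: "b \<in> glc.span (insert x B)" "e - b \<in> U t" using neg by blast
    then obtain c where "b - scA c x \<in> glc.span B" by (auto simp: glc.span_insert)
    thus ?thesis using b by (intro exI[of _ c] exI[of _ "b - scA c x"]) (simp add: algebra_simps)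
   qed
   have "x \<notin> glc.span B \<or> x \<in> glc.span B" by blast
   obtain c0 b0 where c0: "b0 \<in> glc.span B" "e - scA c0 x - b0 \<in> U t0" using r by blast
   show False
   proof (cases "x \<in> glc.span B")
    case True
    hence "scA c0 x + b0 \<in> glc.span B" by (intro glc.span_add glc.span_scale c0)
    thus False using t0 c0(2) by (auto simp: algebra_simps)
   next
    case False
    then obtain t1 where t1: "ALL b:glc.span B. x - b \<notin> U t1" using insert.IH by blast
    \<comment> \<open>If \<open>e\<close> were approximated to every order by the span of
      \<open>insert x B\<close>, the coefficient of \<open>x\<close> would be the same from order
      \<open>t1\<close> on, because \<open>x\<close> itself is not approximated by the span of
      \<open>B\<close> to that order. Then \<open>e - scA c x\<close> would be approximated by the
      span of \<open>B\<close>, against the induction hypothesis.\<close>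
    have unique: "c = c1" if "b \<in> glc.span B" "e - scA c x - b \<in> U t" "t1 <= t"
     "b1 \<in> glc.span B" "e - scA c1 x - b1 \<in> U t'" "t1 <= t'" for c c1 b b1 t t'
    proof (rule ccontr)
     assume ne: "c ~= c1"
     have "e - scA c x - b \<in> U t1" "e - scA c1 x - b1 \<in> U t1"
      by (rule subsetD[OF anti[OF that(3)] that(2)], rule subsetD[OF anti[OF that(6)] that(5)])
     hence "(e - scA c1 x - b1) - (e - scA c x - b) \<in> U t1" by (rule glc.subspace_diff[OF sub, rotated])
     moreover have "(e - scA c1 x - b1) - (e - scA c x - b) = scA (c - c1) x - (b1 - b)"
      by (simp add: glc.scale_left_diff_distrib algebra_simps)
     ultimately have "scA (inverse (c - c1)) (scA (c - c1) x - (b1 - b)) \<in> U t1"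
      by (simp only: glc.subspace_scale[OF sub])
     hence "x - scA (inverse (c - c1)) (b1 - b) \<in> U t1"
      using ne by (simp add: glc.scale_right_diff_distrib)
     moreover have "scA (inverse (c - c1)) (b1 - b) \<in> glc.span B"
      by (intro glc.span_scale glc.span_diff that)
     ultimately show False using t1 by blast
    qed
    obtain c b where cb: "b \<in> glc.span B" "e - scA c x - b \<in> U t1" using r by blast
    have "e - scA c x \<notin> glc.span B"
    proof
     assume "e - scA c x \<in> glc.span B"
     hence "e \<in> glc.span (insert x B)" by (auto simp: glc.span_insert)
     thus False using insert.prems by blast
    qed
    then obtain t2 where t2: "ALL b:glc.span B. (e - scA c x) - b \<notin> U t2" using insert.IH by blast
    obtain c2 b2 where c2: "b2 \<in> glc.span B" "e - scA c2 x - b2 \<in> U (max t1 t2)" using r by blast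
    have "c2 = c" using unique[OF c2 max.cobounded1 cb order_refl] .
    hence "e - scA c x - b2 \<in> U t2" using c2(2) anti[OF max.cobounded2, of t1 t2] by auto
    thus False using t2 c2(1) by blast
   qed
  qed
 qed
 obtain t where t: "ALL b:glc.span B. e - b \<notin> U t" using main[OF assms] by blast
 define X where "X = {x + y | x y. x \<in> glc.span B & y \<in> U t}"
 have X: "glc.subspace X" unfolding X_def by (rule glc.subspace_sums[OF glc.subspace_span sub])
 have eX: "e \<notin> X"
 proof
  assume "e \<in> X"
  then obtain x y where "e = x + y" "x \<in> glc.span B" "y \<in> U t" by (auto simp: X_def)
  thus False using t by (metis add_diff_cancel_left')
 qed
 obtain \<phi> where \<phi>: "lfA \<phi>" "!!u. u \<in> X ==> \<phi> u = 0" "\<phi> e = 1"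
  by (rule lf_extend[OF vs_glc X eX]) (rule that)
 have XU: "u \<in> X" if "u \<in> U t" for u
  unfolding X_def by (rule CollectI, intro exI[of _ 0] exI[of _ u]) (simp add: that glc.span_zero)
 have XB: "u \<in> X" if "u \<in> B" for u
  unfolding X_def by (rule CollectI, intro exI[of _ u] exI[of _ 0]) (simp add: glc.subspace_0[OF sub] glc.span_base[OF that])
 show ?thesis
 proof (rule that[of \<phi>])
  have "ALL f:U (t + 1). \<phi> f = 0" using anti[of t "t + 1"] XU \<phi>(2) by auto
  thus "\<phi> \<in> Dist"
   using \<phi>(1) linear_lf[OF vs_glc] unfolding Dist_def U_def by blast
 qed (use \<phi> XB in auto)
qed

lemma counit_Dist: "counit \<in> (Dist :: (('k,'m,'n) glc => 'k) set)"
proof -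
 have "counit f = 0" if "f \<in> ideal_power {g :: ('k,'m,'n) glc. counit g = 0} 1" for f
  using that unfolding ideal_power_def
  by (induction rule: ideal_gen.induct) (auto simp: counit_add counit_mult length_Suc_conv)
 moreover have "lfA (counit :: ('k,'m,'n) glc => 'k)" by (simp add: lf_def counit_add counit_scale)
 ultimately show ?thesis
  unfolding Dist_def linear_lf[OF vs_glc] by (auto intro!: exI[of _ 0])
qed

lemma Dist_lf: "\<xi> \<in> Dist ==> lfA (\<xi> :: ('k,'m,'n) glc => 'k)"
 by (simp add: Dist_def linear_lf[OF vs_glc])

end

section \<open>The antipode and permutation matrices\<close>

lemma antipode_add: "antipode (a + b) = antipode a + antipode b"
 by transfer (simp add: free_endo.eval_add ideal_gen.zero)

lemma antipode_mult: "antipode (a * b) = antipode a * antipode b"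
 by transfer (simp add: free_endo.eval_mult ideal_gen.zero)

lemma antipode_one [simp]: "antipode 1 = 1"
 by transfer (simp add: free_endo.eval_one ideal_gen.zero)

lemma antipode_zero [simp]: "antipode 0 = 0"
 by transfer (simp add: free_endo.eval_zero ideal_gen.zero)

lemma antipode_gen: "antipode (glc_gen x) = glc_gen (swap_gen x)"
 by transfer (simp add: free_endo.eval_fgen ideal_gen.zero)

lemma antipode_scale: "antipode (scA c a) = scA c (antipode a)"
proof -
 have "antipode (glc_const c :: ('a, 'b, 'c) glc) = glc_const c"
  by transfer (simp add: free_endo.eval_single ideal_gen.zero)
 thus ?thesis by (simp add: glc_scale_def antipode_mult)
qed

lemma antipode_minus: "antipode (- a) = - antipode a"
 using antipode_add[of a "- a"] by (simp add: eq_neg_iff_add_eq_0 add.commute)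

lemma lf_antipode: "lfA g ==> lfA (%a. g (antipode a))"
 by (simp add: lf_def antipode_add antipode_scale)

lemma swap_swap_gen [simp]: "swap_gen (swap_gen x) = x"
 and gen_par_swap [simp]: "gen_par m (swap_gen x) = gen_par m x"
 by (cases x; simp)+

lemma antipode_antipode [simp]: "antipode (antipode a) = (a :: ('k::field,'m::len0,'n::len0) glc)"
proof -
 have "a \<in> {a. antipode (antipode a) = a}"
  by (rule glc_gen_induct)
   (auto intro!: glc.subspaceI simp: antipode_add antipode_scale antipode_mult antipode_gen)
 thus ?thesis by simp
qed

lemma antipode_psign: "antipode (psign p q) = psign p q"
 by (simp add: psign_def antipode_minus)

lemma antipode_sig: "antipode (sig s a) = sig s (antipode (a :: ('k::field,'m::len0,'n::len0) glc))"
proof -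
 have "a \<in> {a. antipode (sig s a) = sig s (antipode a)}"
  by (rule glc_gen_induct)
   (auto intro!: glc.subspaceI simp: sig_add sig_scale sig_mult sig_gen antipode_add antipode_scale antipode_mult
    antipode_gen antipode_psign)
 thus ?thesis by simp
qed

lemma antipode_pinv: "antipode (pinv a) = pinv (antipode (a :: ('k::field,'m::len0,'n::len0) glc))"
 using antipode_sig[of True a] by (simp add: sig_def)

lemma lf_psign: "lfA g ==> g (psign p q * a) = psign p q * g a"
 by (auto simp: psign_def lf_minus)

context odd_char
begin

definition form_par :: "bool => (('k,'m,'n) glc => 'k) => bool"
 where "form_par s h \<longleftrightarrow> lfA h & (ALL a. h (pinv a) = psign s True * h a)"

lemma form_par_sig: "form_par s h ==> h (sig t a) = psign t s * h a"
 by (cases t) (simp_all add: form_par_def sig_def psign_def)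

lemma convu_gen_mult:
 assumes g: "lfA g" and h: "lfA h"
 shows "convu g h (glc_gen x * a) = (\<Sum>k<LENGTH('m) + LENGTH('n). gen_sign LENGTH('m) x k *
  convu (%u. g (glc_gen (genL x k) * sig (gen_par LENGTH('m) (genR x k)) u)) (%v. h (glc_gen (genR x k) * v)) (a :: ('k,'m,'n) glc))"
proof -
 have b: "bilA (%u v. g (glc_gen (genL x k) * sig (gen_par LENGTH('m) (genR x k)) u) * h (glc_gen (genR x k) * v))" for k
  by (rule bilA_compose[OF bilA_prod[OF g h], of "%u. glc_gen (genL x k) * sig (gen_par LENGTH('m) (genR x k)) u" "%v. glc_gen (genR x k) * v"])
   (simp_all add: sig_add sig_scale distrib_left glc_scale_mult_right)
 show ?thesis
  unfolding convu_def comult_gen_mult[OF two bilA_prod[OF g h]] gen_op_def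
  by (rule comult_form_sum[OF two b])
qed

lemma lf_gen_mult: "lfA g ==> lfA (%u. g (glc_gen x * sig s u))" "lfA g ==> lfA (%u. g (glc_gen x * u))"
 by (auto simp: lf_def sig_add sig_scale distrib_left glc_scale_mult_right)

text \<open>The antipode interchanges the factors of a coproduct, with a Koszul sign. For
  \<open>h\<close> of parity \<open>s\<close> the sign turns into \<open>sig s\<close> on the other
  factor. Removing a letter changes the parity of the form, so \<open>s\<close> is generalized in
  the induction.\<close>

lemma convu_antipode_par:
 "lfA g ==> form_par s h ==>
  convu g h (antipode a) = convu (%u. h (antipode u)) (%v. g (antipode (sig s v))) (a :: ('k,'m,'n) glc)"
proof -
 let ?N = "LENGTH('m) + LENGTH('n)" and ?p = "gen_par LENGTH('m)"
 have "a \<in> {a. ALL g h s. lfA g --> form_par s h -->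
  convu g h (antipode a) = convu (%u. h (antipode u)) (%v. g (antipode (sig s v))) a}"
 proof (rule glc_gen_induct)
  show "glc.subspace {a. ALL g h s. lfA g --> form_par s h -->
   convu g h (antipode a) = convu (%u. h (antipode u)) (%v. g (antipode (sig s v))) a}"
   using lf_add[OF lf_convu'] lf_scale[OF lf_convu'] lf_zero[OF lf_convu']
   by (intro glc.subspaceI) (simp_all add: antipode_add antipode_scale)
  have "convu g h 1 = g 1 * h (1 :: ('k,'m,'n) glc)" if "lfA g" "lfA h" for g h :: "('k,'m,'n) glc => 'k"
   unfolding convu_def by (rule comult_one[OF two bilA_prod[OF that]])
  thus "1 \<in> {a. ALL g h s. lfA g --> form_par s h -->
   convu g h (antipode a) = convu (%u. h (antipode u)) (%v. g (antipode (sig s v))) a}"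
   by (simp add: form_par_def lf_antipode lf_def antipode_add antipode_scale sig_add sig_scale)
 next
  fix x and a :: "('k,'m,'n) glc"
  assume IH: "a \<in> {a. ALL g h s. lfA g --> form_par s h -->
   convu g h (antipode a) = convu (%u. h (antipode u)) (%v. g (antipode (sig s v))) a}"
  have "convu g h (antipode (glc_gen x * a)) = convu (%u. h (antipode u)) (%v. g (antipode (sig s v))) (glc_gen x * a)"
   if g: "lfA g" and h: "form_par s h" for g h s
  proof -
   define y where "y = swap_gen x"
   have lh: "lfA h" using h by (simp add: form_par_def)
   have lS: "lfA (%v. g (antipode (sig s v)))"
    using g by (simp add: lf_def antipode_add antipode_scale sig_add sig_scale)
   have "convu g h (antipode (glc_gen x * a)) = (\<Sum>k<?N. gen_sign LENGTH('m) y k *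
    convu (%u. g (glc_gen (genL y k) * sig (?p (genR y k)) u)) (%v. h (glc_gen (genR y k) * v)) (antipode a))"
    unfolding y_def antipode_mult antipode_gen by (rule convu_gen_mult[OF g lh])
   also have "... = (\<Sum>k<?N. gen_sign LENGTH('m) y k *
    convu (%u. h (glc_gen (genR y k) * antipode u)) (%v. g (glc_gen (genL y k) * antipode (sig s v))) a)"
   proof (rule sum.cong[OF refl])
    fix k
    let ?r = "?p (genR y k)"
    have "form_par (?r ~= s) (%v. h (glc_gen (genR y k) * v))"
    proof -
     have "h (glc_gen (genR y k) * pinv v) = psign (?r ~= s) True * h (glc_gen (genR y k) * v)" for v
     proof -
      have "glc_gen (genR y k) * pinv v = psign ?r True * pinv (glc_gen (genR y k) * v)"
       by (simp add: pinv_mult pinv_gen mult.assoc[symmetric] psign_def)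
      hence "h (glc_gen (genR y k) * pinv v) = psign ?r True * (psign s True * h (glc_gen (genR y k) * v))"
       using h by (simp add: lf_psign[OF lh] form_par_def)
      thus ?thesis by (simp only: psign_add_left mult.assoc)
     qed
     thus ?thesis using lf_gen_mult(2)[OF lh] by (simp add: form_par_def)
    qed
    hence "convu (%u. g (glc_gen (genL y k) * sig ?r u)) (%v. h (glc_gen (genR y k) * v)) (antipode a) =
     convu (%u. h (glc_gen (genR y k) * antipode u)) (%v. g (glc_gen (genL y k) * sig ?r (antipode (sig (?r ~= s) v)))) a"
     using IH lf_gen_mult(1)[OF g] by blast
    moreover have "sig ?r (antipode (sig (?r ~= s) v)) = antipode (sig s v)" for v :: "('k,'m,'n) glc"
     by (cases ?r; cases s) (simp_all add: antipode_pinv sig_def)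
    ultimately show "gen_sign LENGTH('m) y k * convu (%u. g (glc_gen (genL y k) * sig ?r u)) (%v. h (glc_gen (genR y k) * v)) (antipode a) =
     gen_sign LENGTH('m) y k * convu (%u. h (glc_gen (genR y k) * antipode u)) (%v. g (glc_gen (genL y k) * antipode (sig s v))) a"
     by (simp only:)
   qed
   also have "... = (\<Sum>k<?N. gen_sign LENGTH('m) x k *
    convu (%u. h (antipode (glc_gen (genL x k) * sig (?p (genR x k)) u))) (%v. g (antipode (sig s (glc_gen (genR x k) * v)))) a)"
   proof (rule sum.cong[OF refl])
    fix k
    let ?r = "?p (genR x k)" and ?l = "?p (genL x k)"
    have sw: "swap_gen (genL x k) = genR y k" "swap_gen (genR x k) = genL y k"
     by (cases x; simp add: y_def)+
    have "h (antipode (glc_gen (genL x k) * sig ?r u)) = psign ?r ?l * (psign ?r s * h (glc_gen (genR y k) * antipode u))" for u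
    proof -
     have "antipode (glc_gen (genL x k) * sig ?r u) = psign ?r ?l * sig ?r (glc_gen (genR y k) * antipode u)"
      using gen_par_swap[of "LENGTH('m)" "genL x k"]
      by (simp add: antipode_mult antipode_gen antipode_sig sig_mult sig_gen sw mult.assoc[symmetric])
     thus ?thesis by (simp add: lf_psign[OF lh] form_par_sig[OF h])
    qed
    moreover have "g (antipode (sig s (glc_gen (genR x k) * v))) = psign s ?r * g (glc_gen (genL y k) * antipode (sig s v))" for v
     by (simp add: sig_mult sig_gen antipode_mult antipode_psign antipode_gen sw mult.assoc lf_psign[OF g])
    ultimately have "convu (%u. h (antipode (glc_gen (genL x k) * sig ?r u))) (%v. g (antipode (sig s (glc_gen (genR x k) * v)))) a =
     comult a (%u v. psign ?r ?l * (h (glc_gen (genR y k) * antipode u) * g (glc_gen (genL y k) * antipode (sig s v))))"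
     unfolding convu_def by (cases ?r; cases s) (simp_all add: psign_def)
    also have "... = psign ?r ?l * convu (%u. h (glc_gen (genR y k) * antipode u)) (%v. g (glc_gen (genL y k) * antipode (sig s v))) a"
    proof -
     have "bilA (%u v. h (glc_gen (genR y k) * antipode u) * g (glc_gen (genL y k) * antipode (sig s v)))"
      using lh g by (intro bilA_prod) (simp_all add: lf_def antipode_add antipode_scale sig_add sig_scale distrib_left glc_scale_mult_right)
     from comult_form_sum[OF two, of "{0::nat}", OF this, of a "%_. psign ?r ?l"] show ?thesis by (simp add: convu_def)
    qed
    finally have "convu (%u. h (antipode (glc_gen (genL x k) * sig ?r u))) (%v. g (antipode (sig s (glc_gen (genR x k) * v)))) a =
     psign ?r ?l * convu (%u. h (glc_gen (genR y k) * antipode u)) (%v. g (glc_gen (genL y k) * antipode (sig s v))) a" .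
    moreover have "gen_sign LENGTH('m) y k = gen_sign LENGTH('m) x k * (psign ?r ?l :: 'k)"
     by (cases x) (auto simp: y_def psign_def)
    ultimately show "gen_sign LENGTH('m) y k * convu (%u. h (glc_gen (genR y k) * antipode u)) (%v. g (glc_gen (genL y k) * antipode (sig s v))) a =
     gen_sign LENGTH('m) x k * convu (%u. h (antipode (glc_gen (genL x k) * sig ?r u))) (%v. g (antipode (sig s (glc_gen (genR x k) * v)))) a"
     by (simp only: mult.assoc)
   qed
   also have "... = convu (%u. h (antipode u)) (%v. g (antipode (sig s v))) (glc_gen x * a)"
    by (rule convu_gen_mult[OF lf_antipode[OF lh] lS, symmetric])
   finally show ?thesis .
  qed
  thus "glc_gen x * a \<in> {a. ALL g h s. lfA g --> form_par s h -->
   convu g h (antipode a) = convu (%u. h (antipode u)) (%v. g (antipode (sig s v))) a}" by blast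
 qed
 thus "lfA g ==> form_par s h ==> ?thesis" by blast
qed

lemma convu_antipode:
 assumes "lfA g" "form_par False h"
 shows "convu g h (antipode a) = convu (%u. h (antipode u)) (%v. g (antipode v)) (a :: ('k,'m,'n) glc)"
 using convu_antipode_par[OF assms] by simp

end

section \<open>Evaluation at permutation matrices\<close>

locale block_perm = odd_char ty for ty :: "('k::field,'m::len0,'n::len0) glc itself" +
 fixes \<sigma> :: "nat => nat"
 assumes invol: "\<sigma> (\<sigma> i) = i"
  and block: "idx_par LENGTH('m) (\<sigma> i) = idx_par LENGTH('m) i"
  and bound: "\<sigma> i < LENGTH('m) + LENGTH('n) \<longleftrightarrow> i < LENGTH('m) + LENGTH('n)"
begin

definition perm_gen :: "glgen => 'k"
 where "perm_gen x = of_bool (gen_row x = \<sigma> (gen_col x) & gen_col x < LENGTH('m) + LENGTH('n))"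

lemma perm_gen_even: "gen_par LENGTH('m) x ==> perm_gen x = 0"
 by (cases x) (auto simp: perm_gen_def block)

lemma perm_gen_sum: "i < LENGTH('m) + LENGTH('n) ==> j < LENGTH('m) + LENGTH('n) ==>
  (\<Sum>k<LENGTH('m) + LENGTH('n). of_bool (i = \<sigma> k) * of_bool (k = \<sigma> j)) = (of_bool (i = j) :: 'k)"
proof -
 assume ij: "i < LENGTH('m) + LENGTH('n)" "j < LENGTH('m) + LENGTH('n)"
 have "(\<Sum>k<LENGTH('m) + LENGTH('n). of_bool (i = \<sigma> k) * of_bool (k = \<sigma> j)) =
  (\<Sum>k<LENGTH('m) + LENGTH('n). if k = \<sigma> j then of_bool (i = j) else (0 :: 'k))"
  by (rule sum.cong) (auto simp: invol)
 thus ?thesis using ij by (simp add: bound)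
qed

sublocale perm: glc_lift "id :: 'k => 'k" perm_gen "TYPE(('k,'m,'n) glc)"
proof
 show "perm_gen x * perm_gen y = psign (gen_par LENGTH('m) x) (gen_par LENGTH('m) y) * (perm_gen y * perm_gen x)" for x y
  using perm_gen_even[of x] by (cases "gen_par LENGTH('m) x") (auto simp: psign_def)
 fix i j assume ij: "i < LENGTH('m) + LENGTH('n)" "j < LENGTH('m) + LENGTH('n)"
 have "perm_gen (GenC i k) * perm_gen (GenD k j) = of_bool (i = \<sigma> k) * of_bool (k = \<sigma> j)"
  "perm_gen (GenD i k) * perm_gen (GenC k j) = of_bool (i = \<sigma> k) * of_bool (k = \<sigma> j)"
  if "k < LENGTH('m) + LENGTH('n)" for k
  using that ij by (simp_all add: perm_gen_def)
 thus "(\<Sum>k<LENGTH('m) + LENGTH('n). perm_gen (GenC i k) * perm_gen (GenD k j)) = of_bool (i = j)"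
  "(\<Sum>k<LENGTH('m) + LENGTH('n). perm_gen (GenD i k) * perm_gen (GenC k j)) = of_bool (i = j)"
  using perm_gen_sum[OF ij] by simp_all
next
 show "perm_gen x = 0" if "~ word_in_range (LENGTH('m) + LENGTH('n)) [x]" for x
  using that by (auto simp: perm_gen_def word_in_range_single bound)
qed

text \<open>Evaluation at the permutation matrix of the involution \<open>\<sigma>\<close>, a point
  of the even part because \<open>\<sigma>\<close> preserves the blocks. The matrix is its own
  inverse, so the entries of \<open>C\<close> and \<open>D\<close> have equal values. The instances
  are the longest element, for lowest weight vectors, and the simple reflections, for
  dominance.\<close>

definition pt :: "('k,'m,'n) glc => 'k" where "pt = perm.lifted"

lemma pt_add: "pt (a + b) = pt a + pt b"
 and pt_mult: "pt (a * b) = pt a * pt b"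
 and pt_scale: "pt (scA c a) = c * pt a"
 and pt_zero [simp]: "pt 0 = 0"
 and pt_one [simp]: "pt 1 = 1"
 and pt_minus: "pt (- a) = - pt a"
 and pt_gen: "pt (glc_gen x) = perm_gen x"
 unfolding pt_def perm.lifted_add perm.lifted_mult perm.lifted_scale perm.lifted_zero perm.lifted_one
  perm.lifted_gen perm.lifted_minus id_apply by (rule refl)+

lemma lf_pt: "lfA pt"
 by (simp add: lf_def pt_add pt_scale)

lemma pt_sig: "pt (sig s a) = pt a"
proof -
 have "pt (pinv a) = pt a"
 proof -
  have "a \<in> {a. pt (pinv a) = pt a}"
  proof (rule glc_gen_induct)
   have "pt (psign (gen_par LENGTH('m) x) True * glc_gen x) = pt (glc_gen x)" for x
    by (cases "gen_par LENGTH('m) x") (simp_all add: pt_minus pt_gen perm_gen_even psign_def)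
   thus "a \<in> {a. pt (pinv a) = pt a} ==> glc_gen x * a \<in> {a. pt (pinv a) = pt a}" for x a
    by (simp add: pinv_mult pinv_gen pt_mult)
  qed (auto intro!: glc.subspaceI simp: pinv_add pinv_scale pt_add pt_scale pt_zero)
  thus ?thesis by simp
 qed
 thus ?thesis by (simp add: sig_def)
qed

lemma pt_antipode: "pt (antipode a) = pt a"
proof -
 have "a \<in> {a. pt (antipode a) = pt a}"
 proof (rule glc_gen_induct)
  have "perm_gen (swap_gen x) = perm_gen x" for x by (cases x) (simp_all add: perm_gen_def)
  thus "a \<in> {a. pt (antipode a) = pt a} ==> glc_gen x * a \<in> {a. pt (antipode a) = pt a}" for x a
   by (simp add: antipode_mult antipode_gen pt_mult pt_gen)
 qed (auto intro!: glc.subspaceI simp: antipode_add antipode_scale pt_add pt_scale pt_zero)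
 thus ?thesis by simp
qed

text \<open>Each letter of a word that does not vanish at the permutation matrix has row
  \<open>\<sigma>\<close> of its column, so \<open>\<sigma>\<close> carries its right weight to its
  left weight.\<close>

lemma pt_word: "pt (word_elt xs) ~= 0 ==> list_lw xs = list_rw xs \<circ> \<sigma>"
proof (induction xs)
 case (Cons x xs)
 have e: "eps (\<sigma> j) = eps j \<circ> \<sigma>" for j
  unfolding eps_def by (rule ext) (use invol in \<open>auto simp: o_def\<close>; metis invol)
 have "perm_gen x ~= 0" using Cons.prems by (auto simp: pt_mult pt_gen)
 hence "gen_row x = \<sigma> (gen_col x)" by (auto simp: perm_gen_def)
 hence "gen_lw x = gen_rw x \<circ> \<sigma>"
 proof (cases x)
  case (GenD i j)
  hence "j = \<sigma> i" using \<open>gen_row x = \<sigma> (gen_col x)\<close> invol by simp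
  thus ?thesis using GenD e[of i] by (simp add: fun_eq_iff)
 qed (simp add: e)
 moreover have "list_lw xs = list_rw xs \<circ> \<sigma>" using Cons by (auto simp: pt_mult)
 ultimately show ?case by (simp add: fun_eq_iff)
qed (simp add: fun_eq_iff)

lemma convu_pt_pt: "convu pt pt = (counit :: ('k,'m,'n) glc => 'k)"
proof
 fix a :: "('k,'m,'n) glc"
 let ?N = "LENGTH('m) + LENGTH('n)"
 have "a \<in> {a. convu pt pt a = counit a}"
 proof (rule glc_gen_induct)
  show "glc.subspace {a. convu pt pt a = counit a}"
   using lf_add[OF lf_convu'] lf_scale[OF lf_convu'] lf_zero[OF lf_convu']
   by (intro glc.subspaceI) (simp_all add: counit_add counit_scale)
  show "1 \<in> {a. convu pt pt a = counit a}"
   using comult_one[OF two bilA_prod[OF lf_pt lf_pt]] by (simp add: convu_def pt_one)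
 next
  fix x and a :: "('k,'m,'n) glc" assume "a \<in> {a. convu pt pt a = counit a}"
  hence IH: "convu pt pt a = counit a" by simp
  have cm: "convu (%u. c * pt u) (%v. d * pt v) a = c * d * convu pt pt a" for c d
  proof -
   from comult_form_sum[OF two, of "{0::nat}", OF bilA_prod[OF lf_pt lf_pt], of a "%_. c * d"]
   show ?thesis by (simp add: convu_def mult_ac)
  qed
  have "convu pt pt (glc_gen x * a) = (\<Sum>k<?N. gen_sign LENGTH('m) x k *
    convu (%u. perm_gen (genL x k) * pt u) (%v. perm_gen (genR x k) * pt v) a)"
   using convu_gen_mult[OF lf_pt lf_pt, of x a] by (simp add: pt_mult pt_gen pt_sig)
  also have "... = (\<Sum>k<?N. gen_sign LENGTH('m) x k * (perm_gen (genL x k) * perm_gen (genR x k)) * counit a)"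
   by (simp only: cm IH mult.assoc)
  also have "... = (\<Sum>k<?N. gen_sign LENGTH('m) x k * (perm_gen (genL x k) * perm_gen (genR x k))) * counit a"
   by (rule sum_distrib_right[symmetric])
  also have "(\<Sum>k<?N. gen_sign LENGTH('m) x k * (perm_gen (genL x k) * perm_gen (genR x k))) = counit_gen ?N x"
  proof -
   have "gen_sign LENGTH('m) x k * (perm_gen (genL x k) * perm_gen (genR x k)) =
    of_bool (gen_row x = \<sigma> k & gen_col x < ?N) * of_bool (k = \<sigma> (gen_col x))" if "k < ?N" for k
   proof (cases x)
    case (GenC i j)
    thus ?thesis using that by (simp add: perm_gen_def)
   next
    case (GenD i j)
    have "gen_sign LENGTH('m) x k * perm_gen (GenD k j) = perm_gen (GenD k j)"
     using perm_gen_even[of "GenD k j"] by (cases "gen_par LENGTH('m) (GenD k j)") (auto simp: GenD psign_def)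
    thus ?thesis using that by (auto simp: GenD perm_gen_def)
   qed
   hence "(\<Sum>k<?N. gen_sign LENGTH('m) x k * (perm_gen (genL x k) * perm_gen (genR x k))) =
    (\<Sum>k<?N. if k = \<sigma> (gen_col x) then of_bool (gen_row x = gen_col x & gen_col x < ?N) else 0)"
    by (intro sum.cong refl) (auto simp: invol)
   also have "... = counit_gen ?N x"
    by (cases x) (auto simp: counit_gen_def bound)
   finally show ?thesis .
  qed
  finally show "glc_gen x * a \<in> {a. convu pt pt a = counit a}"
   by (simp add: counit_mult counit_gen_eq)
 qed
 thus "convu pt pt a = counit a" by simp
qed

text \<open>Translation by the permutation matrix permutes the weight spaces, by
  \<open>\<sigma>\<close>.\<close>

lemma convu_wform_pt: "convu (wform Q) pt = convu pt (wform (%\<mu>. Q (\<mu> \<circ> \<sigma>)) :: ('k,'m,'n) glc => 'k)"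
proof
 fix a :: "('k,'m,'n) glc"
 have "a \<in> {a. convu (wform Q) pt a = convu pt (wform (%\<mu>. Q (\<mu> \<circ> \<sigma>))) a}"
 proof (rule glc_word_induct)
  show "glc.subspace {a :: ('k,'m,'n) glc. convu (wform Q) pt a = convu pt (wform (%\<mu>. Q (\<mu> \<circ> \<sigma>))) a}"
   using lf_add[OF lf_convu'] lf_scale[OF lf_convu'] lf_zero[OF lf_convu']
   by (intro glc.subspaceI) simp_all
  fix xs assume xs: "word_in_range (LENGTH('m) + LENGTH('n)) xs"
  have "of_bool (Q (list_lw xs)) * pt (word_elt xs) = of_bool (Q (list_rw xs \<circ> \<sigma>)) * pt (word_elt xs)"
   using pt_word[of xs] by (cases "pt (word_elt xs) = 0") simp_all
  thus "word_elt xs \<in> {a :: ('k,'m,'n) glc. convu (wform Q) pt a = convu pt (wform (%\<mu>. Q (\<mu> \<circ> \<sigma>))) a}"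
   unfolding mem_Collect_eq convu_wform_left[OF lf_pt xs] convu_wform_right[OF lf_pt xs] .
 qed
 thus "convu (wform Q) pt a = convu pt (wform (%\<mu>. Q (\<mu> \<circ> \<sigma>))) a" by simp
qed

end

section \<open>Ideals of closed subgroups\<close>

lemma ideal_gen_sum: "(!!i. i \<in> T ==> f i \<in> ideal_gen S) ==> sum f T \<in> ideal_gen S"
 by (induction T rule: infinite_finite_induct) (auto intro: ideal_gen.zero ideal_gen_add)

lemma ideal_gen_cong: "x - y \<in> ideal_gen S ==> x \<in> ideal_gen S \<longleftrightarrow> y \<in> ideal_gen S"
 using ideal_gen_diff[of x S "x - y"] ideal_gen_add[of y S "x - y"] by auto

lemma subspace_ideal_gen: "glc.subspace (ideal_gen S)"
 by (rule glc.subspaceI) (simp_all add: ideal_gen.zero ideal_gen_add glc_scale_def ideal_gen_mult_left)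

lemma hom_kills_ideal:
 assumes "x \<in> ideal_gen S" "!!r. r \<in> S ==> f r = 0" "f 0 = 0"
  "!!a b. f (a + b) = f a + f b" "!!a b. f (a * b) = f a * (f b :: 'b::ring_1)"
 shows "f x = 0"
 using assms(1) by (induction rule: ideal_gen.induct) (simp_all add: assms(2-))

lemma word_in_ideal: "x \<in> set xs ==> glc_gen x \<in> ideal_gen S ==> word_elt xs \<in> ideal_gen S"
proof (induction xs)
 case (Cons y ys)
 thus ?case by (cases "x = y") (auto intro: ideal_gen_mult_left ideal_gen_mult_right)
qed simp

text \<open>\<open>B\<close> marks the positions at which \<open>C\<close> vanishes on the subgroup.
  In row \<open>i\<close> of the relation between \<open>C\<close> and \<open>D\<close>, each term
  with inner index other than \<open>i\<close> has a factor in the ideal: either the entry of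
  \<open>C\<close>, or, by the third hypothesis on \<open>B\<close> and induction on the row, the
  entry of \<open>D\<close>. What remains makes \<open>cc i i\<close> and \<open>dd i i\<close>
  inverse to each other and forces \<open>dd i j\<close> into the ideal.\<close>

lemma triangular_ideal:
 fixes S :: "('k::field,'m::len0,'n::len0) glc set"
 assumes c: "!!i j. B i j ==> cc i j \<in> ideal_gen S"
  and upper: "!!i j. i < j ==> B i j" and trans: "!!i j k. B i j ==> B i k \<or> B k j"
  and i: "i < LENGTH('m) + LENGTH('n)"
 shows "B i j ==> dd i j \<in> ideal_gen S" and "cc i i * dd i i - 1 \<in> ideal_gen S"
proof -
 let ?N = "LENGTH('m) + LENGTH('n)"
 have "(ALL j. B i j --> dd i j \<in> ideal_gen S) & cc i i * dd i i - 1 \<in> ideal_gen S"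
  using i
 proof (induction i rule: less_induct)
  case (less i)
  have row: "cc i i * dd i j - of_bool (i = j) \<in> ideal_gen S" if j: "j < ?N" and Bij: "B i j \<or> i = j" for j
  proof -
   have "cc i k * dd k j \<in> ideal_gen S" if "k \<in> {..<?N} - {i}" for k
   proof (cases "B i k")
    case True
    thus ?thesis by (intro ideal_gen_mult_right c)
   next
    case False
    hence "k < i" using upper[of i k] that by (metis DiffD2 nat_neq_iff singletonI)
    moreover have "B k j" using Bij False trans[of i j k] upper[OF \<open>k < i\<close>] by auto
    ultimately show ?thesis using less that by (intro ideal_gen_mult_left) auto
   qed
   hence "(\<Sum>k\<in>{..<?N} - {i}. cc i k * dd k j) \<in> ideal_gen S" by (rule ideal_gen_sum)
   hence "- (\<Sum>k\<in>{..<?N} - {i}. cc i k * dd k j) \<in> ideal_gen S" by (rule ideal_gen_uminus)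
   moreover have e: "(\<Sum>k<?N. cc i k * dd k j) = cc i i * dd i j + (\<Sum>k\<in>{..<?N} - {i}. cc i k * dd k j)"
    by (rule sum.remove) (use less in auto)
   have alg: "c - b = - r" if "a = c + r" "a = b" for a b c r :: "('k,'m,'n) glc" using that by (simp add: algebra_simps)
   have "cc i i * dd i j - (of_bool (i = j) :: ('k,'m,'n) glc) = - (\<Sum>k\<in>{..<?N} - {i}. cc i k * dd k j)"
    by (rule alg[OF e glc_inverse_right[OF less.prems j]])
   ultimately show ?thesis by (simp only:)
  qed
  have 1: "cc i i * dd i i - 1 \<in> ideal_gen S" using row[OF less.prems] by simp
  moreover have "dd i j \<in> ideal_gen S" if B: "B i j" for j
  proof (cases "j < ?N")
   case False
   thus ?thesis by (simp add: glc_gen_out_of_range word_in_range_def ideal_gen.zero)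
  next
   case True
   show ?thesis
   proof (cases "i = j")
    case True
    hence "cc i i \<in> ideal_gen S" using c B by blast
    hence "1 \<in> ideal_gen S" using 1 ideal_gen_cong[OF 1] ideal_gen_mult_right by blast
    thus ?thesis using ideal_gen_mult_left[of 1 S "dd i j"] by simp
   next
    case False
    hence "cc i i * dd i j \<in> ideal_gen S" using row[OF True] B by simp
    hence "dd i i * (cc i i * dd i j) - (cc i i * dd i i - 1) * dd i j \<in> ideal_gen S"
     by (rule ideal_gen_diff[OF ideal_gen_mult_left ideal_gen_mult_right[OF 1]])
    moreover have e: "cc i i * dd i i = (dd i i * cc i i :: ('k,'m,'n) glc)"
     by (rule even_central) (use glc_gen_par[of "GenC i i", where ?'k = 'k and ?'m = 'm and ?'n = 'n] in simp)
    have "dd i i * (cc i i * dd i j) - (cc i i * dd i i - 1) * dd i j = (dd i j :: ('k,'m,'n) glc)"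
     unfolding e by (simp add: algebra_simps)
    ultimately show ?thesis by (simp only:)
   qed
  qed
  ultimately show ?case by blast
 qed
 note m = this
 show "B i j ==> dd i j \<in> ideal_gen S" by (rule m[THEN conjunct1, rule_format])
 show "cc i i * dd i i - 1 \<in> ideal_gen S" by (rule m[THEN conjunct2])
qed

text \<open>When one off-diagonal block of \<open>C\<close> vanishes, the row relation says that the
  diagonal block of \<open>C\<close> times the corresponding block of \<open>D\<close> vanishes;
  multiplication by the inverse \<open>G\<close> of the diagonal block gives the claim.\<close>

lemma block_ideal:
 fixes S :: "('k::field,'m::len0,'n::len0) glc set"
 assumes two: "(2::'k) ~= 0" and c: "!!i j. idx_par LENGTH('m) i = p ==> idx_par LENGTH('m) j ~= p ==> cc i j \<in> ideal_gen S"
  and par: "idx_par LENGTH('m) l = p" "idx_par LENGTH('m) j ~= p"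
 shows "dd l j \<in> ideal_gen S"
proof -
 let ?N = "LENGTH('m) + LENGTH('n)" and ?p = "idx_par LENGTH('m)"
 obtain G :: "nat => nat => ('k,'m,'n) glc0" where G:
  "!!i j. ?p i ~= ?p j ==> G i j = 0"
  "!!i j. i < ?N ==> j < ?N ==> (\<Sum>k<?N. G i k * blkC k j) = kron i j"
  by (rule blkC_inverse[OF two]) (rule that)
 show ?thesis
 proof (cases "l < ?N & j < ?N")
  case False
  thus ?thesis by (simp add: glc_gen_out_of_range word_in_range_def ideal_gen.zero)
 next
  case True
  hence lj: "l < ?N" "j < ?N" by auto
  have B: "(\<Sum>k<?N. of_even (blkC i k) * dd k j) \<in> ideal_gen S" if i: "i < ?N" "?p i = p" for i
  proof -
   have "(of_even (blkC i k) * dd k j :: ('k,'m,'n) glc) = cc i k * dd k j - (if ?p i ~= ?p k then cc i k * dd k j else 0)" for k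
    by (simp add: of_even_blkC)
   hence "(\<Sum>k<?N. of_even (blkC i k) * dd k j :: ('k,'m,'n) glc) =
    (\<Sum>k<?N. cc i k * dd k j) - (\<Sum>k<?N. if ?p i ~= ?p k then cc i k * dd k j else 0)"
    by (simp only: sum_subtractf)
   also have "(\<Sum>k<?N. cc i k * dd k j) = (0 :: ('k,'m,'n) glc)"
    using glc_inverse_right[OF i(1) lj(2), where ?'k = 'k] i par by auto
   finally have "(\<Sum>k<?N. of_even (blkC i k) * dd k j :: ('k,'m,'n) glc) = - (\<Sum>k<?N. if ?p i ~= ?p k then cc i k * dd k j else 0)"
    by simp
   moreover have "(\<Sum>k<?N. if ?p i ~= ?p k then cc i k * dd k j else 0) \<in> ideal_gen S"
    using i c by (intro ideal_gen_sum) (auto intro: ideal_gen_mult_right ideal_gen.zero)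
   ultimately show ?thesis by (simp only: ideal_gen_uminus)
  qed
  have "of_even (G l i) * (\<Sum>k<?N. of_even (blkC i k) * dd k j) \<in> ideal_gen S" if "i < ?N" for i
   using B[OF that] G(1)[of l i] par by (cases "?p i = p") (auto intro: ideal_gen_mult_left simp: ideal_gen.zero)
  hence "(\<Sum>i<?N. of_even (G l i) * (\<Sum>k<?N. of_even (blkC i k) * dd k j)) \<in> ideal_gen S"
   by (intro ideal_gen_sum) simp
  also have "(\<Sum>i<?N. of_even (G l i) * (\<Sum>k<?N. of_even (blkC i k) * dd k j)) =
   (\<Sum>i<?N. \<Sum>k<?N. of_even (G l i * blkC i k) * dd k j)"
   by (simp only: sum_distrib_left of_even_mult mult.assoc)
  also have "... = (\<Sum>k<?N. \<Sum>i<?N. of_even (G l i * blkC i k) * dd k j)" by (rule sum.swap)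
  also have "... = (\<Sum>k<?N. of_even (\<Sum>i<?N. G l i * blkC i k) * dd k j)"
   by (simp only: of_even_sum sum_distrib_right)
  also have "... = (\<Sum>k<?N. kron l k * dd k j)"
   by (rule sum.cong[OF refl]) (use lj G(2) in \<open>auto simp: kron_def\<close>)
  also have "... = dd l j" using lj by simp
  finally show ?thesis .
 qed
qed

lemma triangular_letters:
 fixes S :: "('k::field,'m::len0,'n::len0) glc set"
 assumes c: "!!i j. B i j ==> cc i j \<in> S"
  and "!!i j. i < j ==> B i j" "!!i j k. B i j ==> B i k \<or> B k j"
  and x: "B (gen_row x) (gen_col x)" "word_in_range (LENGTH('m) + LENGTH('n)) [x]"
 shows "glc_gen x \<in> ideal_gen S"
proof (cases x)
 case (GenC i j)
 thus ?thesis using x c by (auto intro: ideal_gen_base)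
next
 case (GenD i j)
 have "dd i j \<in> ideal_gen S"
  by (rule triangular_ideal(1)[of B, OF ideal_gen_base[OF c] assms(2,3)])
   (use x GenD in \<open>auto simp: word_in_range_def\<close>)
 thus ?thesis using GenD by simp
qed

lemma torus_letters:
 assumes "gen_row x ~= gen_col x" "word_in_range (LENGTH('m) + LENGTH('n)) [x]"
 shows "glc_gen x \<in> (I_torus :: ('k::field,'m::len0,'n::len0) glc set)"
 unfolding I_torus_def by (rule triangular_letters[of "%i j. i ~= j"]) (use assms in auto)

lemma borel_letters:
 assumes "gen_row x < gen_col x" "word_in_range (LENGTH('m) + LENGTH('n)) [x]"
 shows "glc_gen x \<in> (I_borel :: ('k::field,'m::len0,'n::len0) glc set)"
 unfolding I_borel_def by (rule triangular_letters[of "%i j. i < j"]) (use assms in auto)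

lemma borel_ev_letters:
 assumes "gen_row x < gen_col x \<or> gen_par LENGTH('m) x" "word_in_range (LENGTH('m) + LENGTH('n)) [x]"
 shows "glc_gen x \<in> (I_borel_ev :: ('k::field,'m::len0,'n::len0) glc set)"
 unfolding I_borel_ev_def
 by (rule triangular_letters[of "%i j. i < j \<or> idx_par LENGTH('m) i ~= idx_par LENGTH('m) j"])
  (use assms in \<open>cases x; auto\<close>)+

lemma torus_unit: "i < LENGTH('m) + LENGTH('n) ==> cc i i * dd i i - 1 \<in> (I_torus :: ('k::field,'m::len0,'n::len0) glc set)"
 unfolding I_torus_def by (rule triangular_ideal(2)[of "%i j. i ~= j"]) (auto intro: ideal_gen_base)

lemma borel_unit: "i < LENGTH('m) + LENGTH('n) ==> cc i i * dd i i - 1 \<in> (I_borel :: ('k::field,'m::len0,'n::len0) glc set)"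
 unfolding I_borel_def by (rule triangular_ideal(2)[of "%i j. i < j"]) (auto intro: ideal_gen_base)

lemma borel_ev_unit: "i < LENGTH('m) + LENGTH('n) ==> cc i i * dd i i - 1 \<in> (I_borel_ev :: ('k::field,'m::len0,'n::len0) glc set)"
 unfolding I_borel_ev_def
 by (rule triangular_ideal(2)[of "%i j. i < j \<or> idx_par LENGTH('m) i ~= idx_par LENGTH('m) j"]) (auto intro: ideal_gen_base)

lemma ev_letters:
 assumes "(2::'k) ~= 0" "gen_par LENGTH('m) x"
 shows "glc_gen x \<in> (I_ev :: ('k::field,'m::len0,'n::len0) glc set)"
proof (cases x)
 case (GenD i j)
 have "dd i j \<in> (I_ev :: ('k,'m,'n) glc set)"
  unfolding I_ev_def
  by (rule block_ideal[OF assms(1) _ refl]) (use assms GenD in \<open>auto intro!: ideal_gen_base\<close>)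
 thus ?thesis using GenD by simp
qed (use assms in \<open>auto simp: I_ev_def intro!: ideal_gen_base\<close>)

lemma parabolic_letters:
 assumes "(2::'k) ~= 0" "idx_par LENGTH('m) (gen_row x)" "~ idx_par LENGTH('m) (gen_col x)"
 shows "glc_gen x \<in> (I_parabolic :: ('k::field,'m::len0,'n::len0) glc set)"
proof (cases x)
 case (GenD i j)
 have "dd i j \<in> (I_parabolic :: ('k,'m,'n) glc set)"
  unfolding I_parabolic_def
  by (rule block_ideal[OF assms(1), of True]) (use assms GenD in \<open>auto intro!: ideal_gen_base\<close>)
 thus ?thesis using GenD by simp
qed (use assms in \<open>auto simp: I_parabolic_def intro!: ideal_gen_base\<close>)

section \<open>Characters\<close>

lemma diff_add_diff_cancel: "(a - b) + (b - c) = a - (c :: 'a::ab_group_add)"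
 by simp

definition diag_power :: "nat => int => ('k::field,'m::len0,'n::len0) glc"
 where "diag_power i z = (if 0 <= z then cc i i ^ nat z else dd i i ^ nat (- z))"

lemma character_lift_diag_power:
 "(character_lift \<mu> :: ('k::field,'m::len0,'n::len0) glc) = prod_list (map (%i. diag_power i (\<mu> i)) [0..<LENGTH('m) + LENGTH('n)])"
 by (simp add: character_lift_def diag_power_def)

lemma diag_power_central: "diag_power i z * a = a * (diag_power i z :: ('k::field,'m::len0,'n::len0) glc)"
proof -
 have p: "x ^ k * a = a * x ^ k" if "x * a = a * x" for x a :: "('k,'m,'n) glc" and k
 proof (induction k)
  case (Suc k)
  have "x ^ Suc k * a = x * (x ^ k * a)" by (simp only: power_Suc mult.assoc)
  also have "... = (x * a) * x ^ k" by (simp only: Suc mult.assoc)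
  also have "... = a * (x * x ^ k)" by (simp only: that mult.assoc)
  finally show ?case by (simp only: power_Suc)
 qed simp
 have "cc i i * a = a * cc i i" "dd i i * a = a * dd i i" for a :: "('k,'m,'n) glc"
  using glc_gen_par[of "GenC i i", where ?'k = 'k and ?'m = 'm and ?'n = 'n]
   glc_gen_par[of "GenD i i", where ?'k = 'k and ?'m = 'm and ?'n = 'n]
  by (intro even_central; simp)+
 thus ?thesis by (auto simp: diag_power_def intro!: p)
qed

lemma diag_power_step:
 fixes S :: "('k::field,'m::len0,'n::len0) glc set"
 assumes "cc i i * dd i i - 1 \<in> ideal_gen S"
 shows "cc i i * diag_power i z - diag_power i (1 + z) \<in> ideal_gen S"
  and "dd i i * diag_power i z - diag_power i (z - 1) \<in> ideal_gen S"
proof -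
 have dc: "dd i i * cc i i - 1 \<in> ideal_gen S"
  using assms diag_power_central[of i 1 "dd i i :: ('k,'m,'n) glc"] by (simp add: diag_power_def)
 have "(x * y - 1) * y ^ k = x * y ^ Suc k - (y :: ('k,'m,'n) glc) ^ k" for x y k
  by (simp add: algebra_simps)
 hence s: "x * y ^ Suc k - y ^ k \<in> ideal_gen S" if "x * y - 1 \<in> ideal_gen S" for x y :: "('k,'m,'n) glc" and k
  using ideal_gen_mult_right[OF that, of "y ^ k"] by (simp only:)
 show "cc i i * diag_power i z - diag_power i (1 + z) \<in> ideal_gen S"
 proof (cases "0 <= z")
  case True
  hence "nat (1 + z) = Suc (nat z)" by simp
  thus ?thesis using True by (simp add: diag_power_def ideal_gen.zero)
 next
  case False
  define k where "k = nat (- z - 1)"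
  have z: "z = - 1 - int k" using False by (simp add: k_def)
  have n: "nat (1 + int k) = Suc k" "nat (int k + 1) = Suc k" by simp_all
  have "diag_power i z = (dd i i ^ Suc k :: ('k,'m,'n) glc)" "diag_power i (1 + z) = (dd i i ^ k :: ('k,'m,'n) glc)"
   unfolding z by (simp_all add: diag_power_def n del: power_Suc)
  thus ?thesis using s[OF assms, of k] by (simp only:)
 qed
 show "dd i i * diag_power i z - diag_power i (z - 1) \<in> ideal_gen S"
 proof (cases "0 < z")
  case False
  hence "nat (- (z - 1)) = Suc (nat (- z))" by simp
  thus ?thesis using False by (cases "z = 0") (auto simp add: diag_power_def ideal_gen.zero)
 next
  case True
  define k where "k = nat (z - 1)"
  have z: "z = 1 + int k" using True by (simp add: k_def)
  have n: "nat (1 + int k) = Suc k" "nat (int k + 1) = Suc k" by simp_all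
  have "diag_power i z = (cc i i ^ Suc k :: ('k,'m,'n) glc)" "diag_power i (z - 1) = (cc i i ^ k :: ('k,'m,'n) glc)"
   unfolding z by (simp_all add: diag_power_def n del: power_Suc)
  thus ?thesis using s[OF dc, of k] by (simp only:)
 qed
qed

lemma character_step:
 fixes S :: "('k::field,'m::len0,'n::len0) glc set"
 assumes i: "i < LENGTH('m) + LENGTH('n)"
  and step: "x * diag_power i (\<mu> i) - diag_power i (\<nu> i) \<in> ideal_gen S"
  and eq: "!!j. j ~= i ==> \<nu> j = \<mu> j"
 shows "x * character_lift \<mu> - character_lift \<nu> \<in> ideal_gen S"
proof -
 let ?N = "LENGTH('m) + LENGTH('n)"
 let ?P = "%\<mu> l. prod_list (map (%i. diag_power i (\<mu> i)) l) :: ('k,'m,'n) glc"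
 have split: "[0..<?N] = [0..<i] @ i # [Suc i..<?N]"
  using upt_add_eq_append[of 0 i "?N - i"] upt_conv_Cons[of i ?N] i by simp
 have P: "?P \<nu> l = ?P \<mu> l" if "i \<notin> set l" for l
  using that by (intro arg_cong[of _ _ prod_list] map_cong refl) (auto intro!: arg_cong[of _ _ "diag_power _"] eq)
 have c: "a * diag_power i z = diag_power i z * a" for a :: "('k,'m,'n) glc" and z
  by (rule diag_power_central[symmetric])
 have e: "character_lift \<kappa> = diag_power i (\<kappa> i) * (?P \<kappa> [0..<i] * ?P \<kappa> [Suc i..<?N])" for \<kappa>
 proof -
  have "character_lift \<kappa> = (?P \<kappa> [0..<i] * diag_power i (\<kappa> i)) * ?P \<kappa> [Suc i..<?N]"
   by (simp only: character_lift_diag_power split map_append prod_list.append list.map prod_list.Cons mult.assoc)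
  thus ?thesis by (simp only: c[of "?P \<kappa> [0..<i]"] mult.assoc)
 qed
 have "(x * diag_power i (\<mu> i) - diag_power i (\<nu> i)) * (?P \<mu> [0..<i] * ?P \<mu> [Suc i..<?N]) \<in> ideal_gen S"
  by (rule ideal_gen_mult_right[OF step])
 moreover have "(x * diag_power i (\<mu> i) - diag_power i (\<nu> i)) * (?P \<mu> [0..<i] * ?P \<mu> [Suc i..<?N]) =
   x * character_lift \<mu> - character_lift \<nu>"
  unfolding e P[of "[0..<i]", simplified] P[of "[Suc i..<?N]", simplified] by (simp only: left_diff_distrib mult.assoc)
 ultimately show ?thesis by (simp only:)
qed

lemma character_lift_zero [simp]: "character_lift 0 = 1"
proof -
 have "prod_list (map (%i. 1) xs) = (1 :: 'z::monoid_mult)" for xs :: "nat list" by (induction xs) auto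
 thus ?thesis by (simp add: character_lift_diag_power diag_power_def)
qed

text \<open>Modulo the ideal \<open>cc i i\<close> and \<open>dd i i\<close> are inverse to each
  other, so a diagonal word depends only on its weight. Letter by letter, one exponent of the
  character changes by 1.\<close>

lemma diag_word_character:
 fixes S :: "('k::field,'m::len0,'n::len0) glc set"
 assumes unit: "!!i. i < LENGTH('m) + LENGTH('n) ==> cc i i * dd i i - 1 \<in> ideal_gen S"
  and "word_in_range (LENGTH('m) + LENGTH('n)) xs" "diag_word xs"
 shows "word_elt xs - character_lift (list_lw xs) \<in> ideal_gen S"
 using assms(2,3)
proof (induction xs)
 case Nil
 show ?case unfolding word_elt_Nil list_lw_Nil character_lift_zero by (simp add: ideal_gen.zero)
next
 case (Cons x xs)
 let ?i = "gen_row x"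
 have i: "?i < LENGTH('m) + LENGTH('n)" "gen_row x = gen_col x"
  using Cons.prems by (auto simp: word_in_range_Cons[of _ x xs] word_in_range_single)
 have "word_elt xs - character_lift (list_lw xs) \<in> ideal_gen S"
  using Cons word_in_range_Cons[of _ x xs] by auto
 hence 1: "glc_gen x * (word_elt xs - character_lift (list_lw xs)) \<in> ideal_gen S" by (rule ideal_gen_mult_left)
 have 2: "glc_gen x * character_lift (list_lw xs) - character_lift (list_lw (x # xs)) \<in> ideal_gen S"
 proof (rule character_step[OF i(1)])
  show "glc_gen x * diag_power ?i (list_lw xs ?i) - diag_power ?i (list_lw (x # xs) ?i) \<in> ideal_gen S"
   using diag_power_step[OF unit[OF i(1)], of "list_lw xs ?i"] i by (cases x) (auto simp: eps_def)
  show "list_lw (x # xs) j = list_lw xs j" if "j ~= ?i" for j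
   using that i by (cases x) (auto simp: eps_def)
 qed
 have "glc_gen x * (word_elt xs - character_lift (list_lw xs)) + (glc_gen x * character_lift (list_lw xs) - character_lift (list_lw (x # xs)))
  = word_elt (x # xs) - (character_lift (list_lw (x # xs)) :: ('k,'m,'n) glc)"
  unfolding right_diff_distrib word_elt_Cons by (rule diff_add_diff_cancel)
 thus ?case using ideal_gen_add[OF 1 2] by (simp only:)
qed

lemma antipode_character: "antipode (character_lift \<mu>) = (character_lift (- \<mu>) :: ('k::field,'m::len0,'n::len0) glc)"
proof -
 have pw: "antipode (x ^ k) = antipode x ^ k" for x :: "('k,'m,'n) glc" and k
  by (induction k) (simp_all add: antipode_mult)
 have "antipode (diag_power i z) = (diag_power i (- z) :: ('k,'m,'n) glc)" for i z
  by (auto simp: diag_power_def pw antipode_gen)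
 hence "antipode (prod_list (map (%i. diag_power i (\<mu> i)) xs)) = (prod_list (map (%i. diag_power i ((- \<mu>) i)) xs) :: ('k,'m,'n) glc)" for xs
  by (induction xs) (simp_all add: antipode_mult)
 thus ?thesis by (simp only: character_lift_diag_power)
qed

lemma torus_character:
 assumes "\<mu> \<in> weight_lattice LENGTH('m) LENGTH('n)"
 shows "torus (character_lift \<mu> :: ('k::field,'m::len0,'n::len0) glc) = psingle \<mu> 1"
proof -
 let ?N = "LENGTH('m) + LENGTH('n)"
 have pw: "torus (x ^ k) = torus x ^ k" for x :: "('k,'m,'n) glc" and k
  by (induction k) (simp_all add: torus_mult)
 have spw: "psingle \<alpha> (1::'k) ^ k = psingle (%l. int k * \<alpha> l) 1" for \<alpha> :: "nat => int" and k
  by (induction k) (simp_all add: mult_single single_one[symmetric] zero_fun_def plus_fun_def algebra_simps del: single_one)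
 have t: "torus (diag_power i z :: ('k,'m,'n) glc) = psingle (%l. z * eps i l) 1" if "i < ?N" for i z
  using that by (auto simp: diag_power_def pw torus_gen torus_gen_def spw)
 have "torus (prod_list (map (%i. diag_power i (\<mu> i)) xs) :: ('k,'m,'n) glc) = psingle (%l. \<Sum>i\<leftarrow>xs. \<mu> i * eps i l) 1"
  if "set xs \<subseteq> {..<?N}" for xs
  using that
  by (induction xs) (simp_all add: torus_mult t mult_single plus_fun_def single_one[symmetric] zero_fun_def del: single_one)
 note this[of "[0..<?N]"]
 hence "torus (character_lift \<mu> :: ('k,'m,'n) glc) = psingle (%l. \<Sum>i\<leftarrow>[0..<?N]. \<mu> i * eps i l) 1"
  unfolding character_lift_diag_power by (simp add: atLeast0LessThan)
 also have "(%l. \<Sum>i\<leftarrow>[0..<?N]. \<mu> i * eps i l) = \<mu>"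
 proof
  fix l
  have "(\<Sum>i\<leftarrow>[0..<?N]. \<mu> i * eps i l) = (\<Sum>i<?N. if l = i then \<mu> i else 0)"
   by (simp add: interv_sum_list_conv_sum_set_nat atLeast0LessThan eps_def of_bool_def if_distrib cong: if_cong)
  thus "(\<Sum>i\<leftarrow>[0..<?N]. \<mu> i * eps i l) = \<mu> l" using assms by (auto simp: weight_lattice_def)
 qed
 finally show ?thesis .
qed

lemma wform_character:
 "\<mu> \<in> weight_lattice LENGTH('m) LENGTH('n) ==> wform Q (character_lift \<mu> :: ('k::field,'m::len0,'n::len0) glc) = of_bool (Q \<mu>)"
 by (simp add: wform_def torus_character)

lemma wform_torus_ideal:
 assumes "a \<in> ideal_gen S" "S \<subseteq> {cc i j | i j. i ~= j}"
 shows "wform Q (a :: ('k::field,'m::len0,'n::len0) glc) = 0"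
proof -
 have "torus a = 0"
  by (rule hom_kills_ideal[OF assms(1)]) (use assms(2) in \<open>auto simp: torus_gen torus_gen_def torus_add torus_mult\<close>)
 thus ?thesis by (simp add: wform_def)
qed

section \<open>A lexicographic order on weights\<close>

definition long_elt :: "nat => nat => nat => nat"
 where "long_elt m n i = (if i < m then m - 1 - i else if i < m + n then m + (m + n - 1 - i) else i)"

definition wd :: "nat => (nat => int) => int"
 where "wd m \<mu> = (\<Sum>i<m. \<mu> i)"

text \<open>The pairing with the sum of the positive roots of GL(m) x GL(n): the coefficient at
  \<open>i\<close> is \<open>m - 1 - 2 i\<close> in the first block, and likewise in the second. It
  changes sign under the longest element.\<close>

definition wl :: "nat => nat => (nat => int) => int"
 where "wl m n \<mu> = (\<Sum>i<m + n. (int (long_elt m n i) - int i) * \<mu> i)"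

text \<open>Odd positive roots raise \<open>wd\<close>, even ones preserve it and raise
  \<open>wl\<close>. Several weights may share both values, which is why the induction in
  \<open>annihilated_component\<close> also counts weights.\<close>

definition tlt :: "nat => nat => (nat => int) => (nat => int) => bool"
 where "tlt m n \<mu> \<nu> \<longleftrightarrow> wd m \<mu> < wd m \<nu> \<or> wd m \<mu> = wd m \<nu> & wl m n \<mu> < wl m n \<nu>"

lemma wd_add: "wd m (\<mu> + \<nu>) = wd m \<mu> + wd m \<nu>"
 and wd_diff: "wd m (\<mu> - \<nu>) = wd m \<mu> - wd m \<nu>"
 and wd_minus: "wd m (- \<mu>) = - wd m \<mu>"
 by (simp_all add: wd_def sum.distrib sum_subtractf sum_negf)

lemma wl_add: "wl m n (\<mu> + \<nu>) = wl m n \<mu> + wl m n \<nu>"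
 and wl_diff: "wl m n (\<mu> - \<nu>) = wl m n \<mu> - wl m n \<nu>"
 and wl_minus: "wl m n (- \<mu>) = - wl m n \<mu>"
 by (simp_all add: wl_def sum.distrib sum_subtractf sum_negf algebra_simps)

lemma wd_eps: "wd m (eps i) = of_bool (i < m)"
 by (simp add: wd_def eps_def of_bool_def cong: if_cong)

lemma wl_eps: "wl m n (eps i) = (if i < m + n then int (long_elt m n i) - int i else 0)"
proof -
 have "wl m n (eps i) = (\<Sum>l<m + n. if l = i then int (long_elt m n l) - int l else 0)"
  unfolding wl_def eps_def by (rule sum.cong) auto
 thus ?thesis by simp
qed

lemma tlt_add: "tlt m n \<mu> \<nu> ==> tlt m n \<mu>' \<nu>' ==> tlt m n (\<mu> + \<mu>') (\<nu> + \<nu>')"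
 and tlt_add_left: "tlt m n (\<kappa> + \<mu>) (\<kappa> + \<nu>) \<longleftrightarrow> tlt m n \<mu> \<nu>"
 and tlt_add_right: "tlt m n (\<mu> + \<kappa>) (\<nu> + \<kappa>) \<longleftrightarrow> tlt m n \<mu> \<nu>"
 by (auto simp: tlt_def wd_add wl_add)

lemma root_order:
 assumes "i < j" "j < m + n"
 shows "wd m (eps j) <= wd m (eps i)"
  and "wd m (eps j) = wd m (eps i) ==> wl m n (eps j) < wl m n (eps i)"
 using assms by (auto simp: wd_eps wl_eps long_elt_def split: if_splits)

lemma tlt_eps: "i < j ==> j < m + n ==> tlt m n (eps j) (eps i)"
 using root_order[of i j m n] by (auto simp: tlt_def)

text \<open>If the degrees agree, only even roots occur in the difference, as every odd positive
  root adds 1 to the degree. Each even root that occurs then contributes a positive amount to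
  \<open>wl\<close>.\<close>

lemma weight_le_tlt:
 assumes "weight_le m n \<mu> \<nu>" "\<mu> ~= \<nu>"
 shows "tlt m n \<mu> \<nu>"
proof -
 let ?T = "Sigma {..<m + n} (%j. {..<j})"
 obtain c :: "nat => nat => nat" where c: "!!l. \<nu> l - \<mu> l = (\<Sum>j<m + n. \<Sum>i<j. int (c i j) * (eps i l - eps j l))"
  using assms(1) unfolding weight_le_def by blast
 have cT: "\<nu> l - \<mu> l = (\<Sum>(j, i)\<in>?T. int (c i j) * (eps i l - eps j l))" for l
  unfolding c by (rule sum.Sigma) auto
 have lin: "(\<Sum>l<N. b l * (\<nu> l - \<mu> l)) = (\<Sum>(j, i)\<in>?T. int (c i j) * ((\<Sum>l<N. b l * eps i l) - (\<Sum>l<N. b l * eps j l)))"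
  for b :: "nat => int" and N
 proof -
  have "(\<Sum>l<N. b l * (\<nu> l - \<mu> l)) = (\<Sum>l<N. \<Sum>(j, i)\<in>?T. int (c i j) * (b l * eps i l - b l * eps j l))"
   unfolding cT sum_distrib_left by (intro sum.cong refl) (auto simp: algebra_simps)
  also have "... = (\<Sum>(j, i)\<in>?T. \<Sum>l<N. int (c i j) * (b l * eps i l - b l * eps j l))"
   unfolding split_def by (rule sum.swap)
  finally show ?thesis by (simp add: split_def sum_distrib_left[symmetric] sum_subtractf)
 qed
 have d: "wd m \<nu> - wd m \<mu> = (\<Sum>(j, i)\<in>?T. int (c i j) * (wd m (eps i) - wd m (eps j)))"
  using lin[of "%_. 1" m] by (simp add: wd_def sum_subtractf)
 have l: "wl m n \<nu> - wl m n \<mu> = (\<Sum>(j, i)\<in>?T. int (c i j) * (wl m n (eps i) - wl m n (eps j)))"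
  using lin[of "%i. int (long_elt m n i) - int i" "m + n"]
  by (simp add: wl_def sum_subtractf right_diff_distrib)
 have nn: "0 <= int (c i j) * (wd m (eps i) - wd m (eps j))" if "(j, i) \<in> ?T" for i j
  using root_order(1)[of i j m n] that by (intro mult_nonneg_nonneg) auto
 show ?thesis
 proof (cases "wd m \<mu> = wd m \<nu>")
  case False
  moreover have "0 <= wd m \<nu> - wd m \<mu>" unfolding d by (rule sum_nonneg) (use nn in auto)
  ultimately show ?thesis by (simp add: tlt_def)
 next
  case True
  hence "(\<Sum>(j, i)\<in>?T. int (c i j) * (wd m (eps i) - wd m (eps j))) = 0" using d by simp
  moreover have "finite ?T" by auto
  ultimately have z: "int (c i j) * (wd m (eps i) - wd m (eps j)) = 0" if "(j, i) \<in> ?T" for i j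
   using that nn by (subst (asm) sum_nonneg_eq_0_iff) auto
  have pos: "0 < wl m n (eps i) - wl m n (eps j)" if "(j, i) \<in> ?T" "c i j ~= 0" for i j
   using z[OF that(1)] that root_order(2)[of i j m n] by auto
  have "EX (j, i):?T. c i j ~= 0"
  proof (rule ccontr)
   assume "~ (EX (j, i):?T. c i j ~= 0)"
   hence "\<nu> l - \<mu> l = 0" for l unfolding cT by (intro sum.neutral) auto
   thus False using assms(2) by (auto simp: fun_eq_iff)
  qed
  then obtain i j where ij: "(j, i) \<in> ?T" "c i j ~= 0" by auto
  have "0 < (\<Sum>(j, i)\<in>?T. int (c i j) * (wl m n (eps i) - wl m n (eps j)))"
  proof (rule sum_pos2[OF _ ij(1)])
   show "0 < (case (j, i) of (j, i) => int (c i j) * (wl m n (eps i) - wl m n (eps j)))"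
    using pos[OF ij] ij by simp
   show "0 <= (case x of (j, i) => int (c i j) * (wl m n (eps i) - wl m n (eps j)))" if x: "x \<in> ?T" for x
   proof -
    obtain j i where ji: "x = (j, i)" by force
    have "0 <= int (c i j) * (wl m n (eps i) - wl m n (eps j))"
     using pos[of j i] x ji by (cases "c i j = 0") auto
    thus ?thesis using ji by simp
   qed
  qed auto
  thus ?thesis using True l by (simp add: tlt_def)
 qed
qed

lemma long_elt_invol: "long_elt m n (long_elt m n i) = i"
 and long_elt_bound: "long_elt m n i < m + n \<longleftrightarrow> i < m + n"
 and long_elt_block: "idx_par m (long_elt m n i) = idx_par m i"
 by (auto simp: long_elt_def idx_par_def)

lemma sum_block_perm:
 assumes "!!i. \<sigma> (\<sigma> i) = i" "!!i. \<sigma> i < k \<longleftrightarrow> i < (k :: nat)"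
 shows "(\<Sum>i<k. f i * \<mu> (\<sigma> i)) = (\<Sum>i<k. f (\<sigma> i) * (\<mu> i :: int))"
 by (rule sum.reindex_bij_witness[of _ \<sigma> \<sigma>]) (use assms in auto)

lemma wd_block_perm:
 assumes "!!i. \<sigma> (\<sigma> i) = i" "!!i. idx_par m (\<sigma> i) = idx_par m i"
 shows "wd m (\<mu> \<circ> \<sigma>) = wd m \<mu>"
 using sum_block_perm[of \<sigma> m "%_. 1" \<mu>] assms by (simp add: wd_def idx_par_def not_less[symmetric])

lemma wl_long_elt: "wl m n (\<mu> \<circ> long_elt m n) = - wl m n \<mu>"
 using sum_block_perm[of "long_elt m n" "m + n" "%i. int (long_elt m n i) - int i" \<mu>]
 by (simp add: wl_def long_elt_invol long_elt_bound sum_negf[symmetric] algebra_simps)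

lemma dominant_decreasing:
 assumes "\<mu> \<in> dominant_weights m n" "i <= j" "j < m \<or> m <= i & j < m + n"
 shows "\<mu> j <= \<mu> i"
 using assms(2,3)
proof (induction j rule: dec_induct)
 case (step k)
 hence "\<mu> k <= \<mu> i" by auto
 moreover have "\<mu> (k + 1) <= \<mu> k"
  using assms(1) step by (auto simp: dominant_weights_def)
 ultimately show ?case by simp
qed simp

text \<open>By antisymmetry under the longest element, twice \<open>wl\<close> is the sum of the
  products of \<open>long_elt m n i - i\<close> with the difference of the entries of
  \<open>\<mu>\<close> at \<open>i\<close> and at its mirror image. For dominant weights both
  factors have the same sign.\<close>

lemma wl_dominant: 
 assumes "\<mu> \<in> dominant_weights m n"
 shows "0 <= wl m n \<mu>"
proof -
 have "0 <= (int (long_elt m n i) - int i) * (\<mu> i - \<mu> (long_elt m n i))" if "i < m + n" for i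
 proof (cases "i <= long_elt m n i")
  case True
  hence "\<mu> (long_elt m n i) <= \<mu> i"
   using that by (intro dominant_decreasing[OF assms]) (auto simp: long_elt_def split: if_splits)
  thus ?thesis using True by simp
 next
  case False
  hence "\<mu> i <= \<mu> (long_elt m n i)"
   using that by (intro dominant_decreasing[OF assms]) (auto simp: long_elt_def split: if_splits)
  thus ?thesis using False by (simp add: mult_nonpos_nonpos)
 qed
 hence "0 <= (\<Sum>i<m + n. (int (long_elt m n i) - int i) * (\<mu> i - \<mu> (long_elt m n i)))"
  by (intro sum_nonneg) auto
 also have "... = wl m n \<mu> - wl m n (\<mu> \<circ> long_elt m n)"
  by (simp add: wl_def sum_subtractf right_diff_distrib)
 finally show ?thesis by (simp add: wl_long_elt)
qed

text \<open>Neighbouring coefficients of \<open>wl\<close> within a block differ by 2, so exchanging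
  an ascending pair raises \<open>wl\<close> by twice the gap.\<close>

lemma reflection_raises:
 assumes "i + 1 < m \<or> m <= i & i + 1 < m + n" "\<mu> i < \<mu> (i + 1)"
 defines "\<sigma> \<equiv> (%j. if j = i then i + 1 else if j = i + 1 then i else j)"
 shows "tlt m n \<mu> (\<mu> \<circ> \<sigma>)"
proof -
 have s: "\<sigma> (\<sigma> j) = j" "idx_par m (\<sigma> j) = idx_par m j" "\<sigma> j < m + n \<longleftrightarrow> j < m + n" for j
  using assms(1) by (auto simp: \<sigma>_def idx_par_def)
 let ?a = "%j. int (long_elt m n j) - int j"
 have "wl m n (\<mu> \<circ> \<sigma>) - wl m n \<mu> = (\<Sum>j<m + n. ?a j * (\<mu> (\<sigma> j) - \<mu> j))"
  by (simp add: wl_def sum_subtractf right_diff_distrib)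
 also have "... = (\<Sum>j\<in>{i, i + 1}. ?a j * (\<mu> (\<sigma> j) - \<mu> j))"
  by (rule sum.mono_neutral_right) (use assms(1) in \<open>auto simp: \<sigma>_def\<close>)
 also have "... = (?a i - ?a (i + 1)) * (\<mu> (i + 1) - \<mu> i)"
  by (simp add: \<sigma>_def algebra_simps)
 also have "?a i - ?a (i + 1) = 2" using assms(1) by (auto simp: long_elt_def)
 finally have e: "wl m n (\<mu> \<circ> \<sigma>) - wl m n \<mu> = 2 * (\<mu> (i + 1) - \<mu> i)" .
 have "b < a" if "a - b = 2 * (c - d)" "d < c" for a b c d :: int using that by simp
 from this[OF e assms(2)] have "wl m n \<mu> < wl m n (\<mu> \<circ> \<sigma>)" .
 moreover have "wd m (\<mu> \<circ> \<sigma>) = wd m \<mu>" by (rule wd_block_perm) (rule s)+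
 ultimately show ?thesis unfolding tlt_def by metis
qed

lemma not_dominant:
 assumes "\<mu> \<in> weight_lattice m n" "\<mu> \<notin> dominant_weights m n"
 obtains i where "i + 1 < m \<or> m <= i & i + 1 < m + n" "\<mu> i < \<mu> (i + 1)"
 using assms by (force simp: dominant_weights_def not_le)

section \<open>Words modulo the ideals\<close>

lemma gen_weights_diff: "gen_lw x + eps (gen_col x) = gen_rw x + eps (gen_row x)"
 by (cases x) (auto simp: fun_eq_iff)

text \<open>A letter strictly below the diagonal has a left weight strictly below its right weight,
  a diagonal letter has equal weights, and \<open>tlt\<close> is compatible with addition.\<close>

lemma word_lower_triangular:
 assumes "word_in_range (m + n) xs" "!!x. x \<in> set xs ==> gen_col x <= gen_row x"
 shows "diag_word xs \<or> tlt m n (list_lw xs) (list_rw xs)"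
 using assms
proof (induction xs)
 case (Cons x xs)
 hence IH: "diag_word xs \<or> tlt m n (list_lw xs) (list_rw xs)" and x: "gen_row x < m + n" "gen_col x <= gen_row x"
  by (auto simp: word_in_range_Cons[of _ x xs] word_in_range_single)
 show ?case
 proof (cases "gen_row x = gen_col x")
  case True
  hence "gen_lw x = gen_rw x" by (cases x) auto
  thus ?thesis using IH True by (simp only: tlt_add_left list_lw_Cons list_rw_Cons diag_word_Cons) simp
 next
  case False
  hence "tlt m n (eps (gen_row x)) (eps (gen_col x))" using x by (intro tlt_eps) auto
  hence t: "tlt m n (gen_lw x) (gen_rw x)"
   using arg_cong[OF gen_weights_diff[of x], of "wd m"] arg_cong[OF gen_weights_diff[of x], of "wl m n"]
   by (auto simp: tlt_def wd_add wl_add)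
  have "tlt m n (list_lw (x # xs)) (list_rw (x # xs))"
   using IH
  proof
   assume "diag_word xs"
   hence "list_lw xs = list_rw xs" by (rule diag_word_lw_rw[symmetric])
   thus ?thesis using t by (simp only: list_lw_Cons list_rw_Cons tlt_add_right)
  next
   assume "tlt m n (list_lw xs) (list_rw xs)"
   thus ?thesis unfolding list_lw_Cons list_rw_Cons by (rule tlt_add[OF t])
  qed
  thus ?thesis by blast
 qed
qed simp

text \<open>The odd letters that are left lie in the upper right block, and each of them makes the
  left degree exceed the right degree by 1. Equal degrees exclude them.\<close>

lemma word_upper_parabolic:
 assumes "!!x. x \<in> set xs ==> idx_par m (gen_row x) ==> idx_par m (gen_col x)"
 shows "wd m (list_rw xs) <= wd m (list_lw xs)"
  and "wd m (list_rw xs) = wd m (list_lw xs) ==> x \<in> set xs ==> ~ gen_par m x"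
proof -
 have d: "wd m (gen_lw x) = wd m (gen_rw x) + (of_bool (gen_row x < m) - of_bool (gen_col x < m))" for x
  using arg_cong[OF gen_weights_diff[of x], of "wd m"] by (auto simp: wd_add wd_eps)
 have le: "wd m (gen_rw x) <= wd m (gen_lw x)" and eq: "wd m (gen_rw x) = wd m (gen_lw x) ==> ~ gen_par m x"
  if "idx_par m (gen_row x) ==> idx_par m (gen_col x)" for x
  using that d[of x] by (cases x; auto simp: idx_par_def not_le not_less of_bool_def split: if_splits)+
 have z: "wd m 0 = 0" by (simp add: wd_def)
 have "wd m (list_rw xs) <= wd m (list_lw xs) & (wd m (list_rw xs) = wd m (list_lw xs) --> (ALL x:set xs. ~ gen_par m x))"
  using assms
 proof (induction xs)
  case (Cons x xs)
  hence IH: "wd m (list_rw xs) <= wd m (list_lw xs)"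
   "wd m (list_rw xs) = wd m (list_lw xs) ==> ALL x:set xs. ~ gen_par m x" by auto
  have x: "wd m (gen_rw x) <= wd m (gen_lw x)" "wd m (gen_rw x) = wd m (gen_lw x) ==> ~ gen_par m x"
   using le[of x] eq[of x] Cons.prems[of x] by auto
  have e: "wd m (list_rw (x # xs)) = wd m (gen_rw x) + wd m (list_rw xs)" "wd m (list_lw (x # xs)) = wd m (gen_lw x) + wd m (list_lw xs)"
   by (simp_all only: list_lw_Cons list_rw_Cons wd_add)
  show ?case unfolding e using IH x by auto
 qed simp
 thus "wd m (list_rw xs) <= wd m (list_lw xs)"
  "wd m (list_rw xs) = wd m (list_lw xs) ==> x \<in> set xs ==> ~ gen_par m x" by auto
qed

lemma word_even_wd: "(!!x. x \<in> set xs ==> ~ gen_par m x) ==> wd m (list_rw xs) = wd m (list_lw xs)"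
proof (induction xs)
 case (Cons x xs)
 have "~ gen_par m x" using Cons.prems[of x] by simp
 hence "gen_row x < m \<longleftrightarrow> gen_col x < m" by (cases x) (auto simp: idx_par_def)
 hence "wd m (gen_lw x) = wd m (gen_rw x)"
  using arg_cong[OF gen_weights_diff[of x], of "wd m"] by (auto simp: wd_add wd_eps)
 moreover have "wd m (list_rw xs) = wd m (list_lw xs)" using Cons by auto
 ultimately show ?case by (simp only: list_lw_Cons list_rw_Cons wd_add)
qed simp

context odd_char
begin

text \<open>A letter above the diagonal puts the word into the ideal. Otherwise the word is lower
  triangular, and the condition on its weights leaves only diagonal words.\<close>

lemma word_mod_borel:
 fixes \<mu> :: "nat => int"
 assumes xs: "word_in_range (LENGTH('m) + LENGTH('n)) xs" and t: "~ tlt LENGTH('m) LENGTH('n) (list_lw xs) (list_rw xs)"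
 shows "word_elt xs - scA (counit (word_elt xs :: ('k,'m,'n) glc)) (character_lift (list_lw xs)) \<in> (I_borel :: ('k,'m,'n) glc set)"
proof (cases "EX x:set xs. gen_row x < gen_col x")
 case True
 then obtain x where x: "x \<in> set xs" "gen_row x < gen_col x" by blast
 hence "~ diag_word xs" by (auto simp: diag_word_def intro!: bexI[of _ x])
 hence "counit (word_elt xs :: ('k,'m,'n) glc) = 0" by (simp add: counit_word[OF xs])
 moreover have "word_elt xs \<in> (I_borel :: ('k,'m,'n) glc set)"
  using borel_letters[OF x(2), where ?'k = 'k and ?'m = 'm and ?'n = 'n] xs x(1) word_in_ideal[OF x(1)]
  by (auto simp: I_borel_def word_in_range_def)
 ultimately show ?thesis by simp
next
 case False
 hence "diag_word xs" using word_lower_triangular[OF xs] t by (auto simp: not_less)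
 thus ?thesis
  using diag_word_character[OF borel_unit[unfolded I_borel_def] xs, where ?'k = 'k]
  by (simp add: counit_word[OF xs] I_borel_def)
qed

lemma word_mod_torus:
 assumes xs: "word_in_range (LENGTH('m) + LENGTH('n)) xs"
 shows "word_elt xs - scA (counit (word_elt xs :: ('k,'m,'n) glc)) (character_lift (list_rw xs)) \<in> (I_torus :: ('k,'m,'n) glc set)"
proof (cases "diag_word xs")
 case False
 then obtain x where x: "x \<in> set xs" "gen_row x ~= gen_col x" by (auto simp: diag_word_def)
 have "counit (word_elt xs :: ('k,'m,'n) glc) = 0" using False by (simp add: counit_word[OF xs])
 moreover have "word_elt xs \<in> (I_torus :: ('k,'m,'n) glc set)"
  using torus_letters[OF x(2), where ?'k = 'k and ?'m = 'm and ?'n = 'n] xs x(1) word_in_ideal[OF x(1)]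
  by (auto simp: I_torus_def word_in_range_def)
 ultimately show ?thesis by simp
next
 case True
 thus ?thesis
  using diag_word_character[OF torus_unit[unfolded I_torus_def] xs, where ?'k = 'k] diag_word_lw_rw[OF True]
  by (simp add: counit_word[OF xs] I_torus_def)
qed

text \<open>Odd letters lie in this ideal, and without them both degrees agree; this is why only
  words of equal degrees need a comparison by \<open>wl\<close>.\<close>

lemma word_mod_borel_ev:
 assumes xs: "word_in_range (LENGTH('m) + LENGTH('n)) xs"
  and t: "wd LENGTH('m) (list_lw xs) = wd LENGTH('m) (list_rw xs) ==> ~ wl LENGTH('m) LENGTH('n) (list_lw xs) < wl LENGTH('m) LENGTH('n) (list_rw xs)"
 shows "word_elt xs - scA (counit (word_elt xs :: ('k,'m,'n) glc)) (character_lift (list_rw xs)) \<in> (I_borel_ev :: ('k,'m,'n) glc set)"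
proof (cases "EX x:set xs. gen_row x < gen_col x \<or> gen_par LENGTH('m) x")
 case True
 then obtain x where x: "x \<in> set xs" "gen_row x < gen_col x \<or> gen_par LENGTH('m) x" by blast
 have "gen_row x ~= gen_col x" using x(2) torus_psign[of x "LENGTH('m)"] by auto
 hence "~ diag_word xs" using x(1) by (auto simp: diag_word_def)
 hence "counit (word_elt xs :: ('k,'m,'n) glc) = 0" by (simp add: counit_word[OF xs])
 moreover have "word_elt xs \<in> (I_borel_ev :: ('k,'m,'n) glc set)"
  using borel_ev_letters[OF x(2), where ?'k = 'k and ?'n = 'n] xs x(1) word_in_ideal[OF x(1)]
  by (auto simp: I_borel_ev_def word_in_range_def)
 ultimately show ?thesis by simp
next
 case False
 hence e: "wd LENGTH('m) (list_rw xs) = wd LENGTH('m) (list_lw xs)" by (intro word_even_wd) auto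
 have "diag_word xs \<or> tlt LENGTH('m) LENGTH('n) (list_lw xs) (list_rw xs)"
  using word_lower_triangular[OF xs] False by (auto simp: not_less)
 hence d: "diag_word xs" using t e by (auto simp: tlt_def)
 thus ?thesis
  using diag_word_character[OF borel_ev_unit[unfolded I_borel_ev_def] xs, where ?'k = 'k] diag_word_lw_rw[OF d]
  by (simp add: counit_word[OF xs] I_borel_ev_def)
qed

end

section \<open>Induced modules and weight spaces\<close>

interpretation fs: vector_space "fscale :: 'k::field => ('x => 'k) => _"
 by (rule vector_space_fscale)

lemma tens_space_apply_zero:
 fixes sv :: "'k::field => 'v::ab_group_add => 'v" and sw :: "'k => 'w::ab_group_add => 'w"
 assumes "t \<in> tens_space sv sw V W" "bilin sv sw b" "!!v w. v \<in> V ==> w \<in> W ==> b v w = 0"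
 shows "t b = 0"
proof -
 have "tens_space sv sw V W \<subseteq> {t. t b = 0}"
  unfolding tens_space_def
  by (rule fs.span_minimal) (use assms(2,3) in \<open>auto simp: tens_apply fs.subspace_def fscale_def\<close>)
 thus ?thesis using assms(1) by auto
qed

lemma tens_space_diff: "t \<in> tens_space sv sw V W ==> u \<in> tens_space sv sw V W ==> t - u \<in> tens_space sv sw V W"
 unfolding tens_space_def
 by (rule fs.span_diff)

lemma tens_in_space: "v \<in> V ==> w \<in> W ==> tens sv sw v w \<in> tens_space sv sw V W"
 unfolding tens_space_def by (rule fs.span_base) blast

text \<open>Each dual form is extended from the span of the basis to the ambient space, so it can be
  inserted into \<open>tau\<close> and \<open>ract\<close>.\<close>

lemma dual_basis:
 assumes vs: "vector_space s" and D: "module.subspace s D" and B0: "finite B0" "D \<subseteq> module.span s B0"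
 obtains B \<phi> where "finite B" "B \<subseteq> D" "!!x. x \<in> B ==> lf s (\<phi> x)" "!!y. y \<in> D ==> y = (\<Sum>x\<in>B. s (\<phi> x y) x)"
proof -
 interpret vector_space s by fact
 obtain B where B: "B \<subseteq> D" "independent B" "D \<subseteq> span B" using basis_exists by metis
 have fin: "finite B" using independent_span_bound[OF B0(1) B(2)] B(1) B0(2) by blast
 have "ALL x:B. EX \<phi>. lf s \<phi> & (ALL u:span (B - {x}). \<phi> u = 0) & \<phi> x = 1"
 proof
  fix x assume "x \<in> B"
  hence x: "x \<notin> span (B - {x})" using B(2) unfolding dependent_def by blast
  show "EX \<phi>. lf s \<phi> & (ALL u:span (B - {x}). \<phi> u = 0) & \<phi> x = 1"
  proof (rule lf_extend[OF vs subspace_span x])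
   fix \<phi> assume \<phi>: "lf s \<phi>" "!!u. u \<in> span (B - {x}) ==> \<phi> u = 0" "\<phi> x = 1"
   show ?thesis by (rule exI[of _ \<phi>]) (simp add: \<phi>)
  qed
 qed
 from bchoice[OF this] obtain \<phi> where \<phi>: "ALL x:B. lf s (\<phi> x) & (ALL u:span (B - {x}). \<phi> x u = 0) & \<phi> x x = 1"
  by (elim exE)
 have "y = (\<Sum>x\<in>B. s (\<phi> x y) x)" if y: "y \<in> D" for y
 proof -
  have "y \<in> range (%c. \<Sum>b\<in>B. s (c b) b)" using span_finite[OF fin] B(3) y by auto
  then obtain c where c: "y = (\<Sum>b\<in>B. s (c b) b)" by (elim rangeE)
  have "\<phi> x y = c x" if x: "x \<in> B" for x
  proof -
   have l: "lf s (\<phi> x)" using \<phi> x by blast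
   have "\<phi> x y = (\<Sum>b\<in>B. c b * \<phi> x b)"
    unfolding c by (simp add: lf_sum[OF l] lf_scale[OF l])
   also have "... = (\<Sum>b\<in>B. if b = x then c x else 0)"
    by (rule sum.cong[OF refl]) (use \<phi> x span_base in auto)
   finally show ?thesis using x fin by simp
  qed
  thus ?thesis by (subst c) (rule sum.cong[OF refl], simp)
 qed
 thus ?thesis using that[of B \<phi>] fin B(1) \<phi> by blast
qed

text \<open>Left factors are expanded in a finite basis of their span, which lies in
  \<open>C\<close>. The right coefficient \<open>u x\<close> of a basis vector lies in
  \<open>J\<close>, because every form vanishing on \<open>J\<close> kills it: pair \<open>t\<close>
  with that form and the dual form of \<open>x\<close>.\<close>

lemma tens_space_right:
 fixes sv :: "'k::field => 'v::ab_group_add => 'v" and sw :: "'k => 'w::ab_group_add => 'w"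
 assumes vs: "vector_space sv" "vector_space sw" and sub: "module.subspace sv C" "module.subspace sw J"
  and t: "t \<in> tens_space sv sw C UNIV"
  and z: "!!g h. lf sv g ==> lf sw h ==> (!!w. w \<in> J ==> h w = 0) ==> t (%v w. g v * h w) = 0"
 shows "t \<in> tens_space sv sw C J"
proof -
 interpret V: vector_space sv by fact
 interpret W: vector_space sw by fact
 obtain xs where xs: "set xs \<subseteq> C \<times> UNIV" "t = (\<Sum>(v, w)\<leftarrow>xs. tens sv sw v w)"
  by (rule tens_space_rep[OF t sub(1) vs]) (rule that)
 let ?X = "V.span (fst ` set xs)"
 obtain B \<phi> where B: "finite B" "B \<subseteq> ?X" "!!x. x \<in> B ==> lf sv (\<phi> x)" "!!y. y \<in> ?X ==> y = (\<Sum>x\<in>B. sv (\<phi> x y) x)"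
  by (rule dual_basis[OF vs(1) V.subspace_span finite_imageI[OF finite_set] subset_refl]) (rule that)
 define u where "u x = (\<Sum>(v, w)\<leftarrow>xs. sw (\<phi> x v) w)" for x
 have "u x \<in> J" if x: "x \<in> B" for x
 proof (rule ccontr)
  assume "u x \<notin> J"
  then obtain h where h: "lf sw h" "!!w. w \<in> J ==> h w = 0" "h (u x) = 1"
   by (rule lf_extend[OF vs(2) sub(2)]) (rule that)
  have "h (u x) = (\<Sum>(v, w)\<leftarrow>xs. \<phi> x v * h w)"
   unfolding u_def by (induction xs) (auto simp: lf_zero[OF h(1)] lf_add[OF h(1)] lf_scale[OF h(1)])
  also have "... = t (%v w. \<phi> x v * h w)"
   unfolding xs(2) by (rule tens_list_apply[OF bilin_prod[OF vs B(3)[OF x] h(1)], symmetric])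
  also have "... = 0" using z B(3)[OF x] h by blast
  finally show False using h(3) by simp
 qed
 moreover have "B \<subseteq> C"
  using B(2) V.span_minimal[OF _ sub(1), of "fst ` set xs"] xs(1) by fastforce
 ultimately have "(\<Sum>x\<in>B. tens sv sw x (u x)) \<in> tens_space sv sw C J"
  unfolding tens_space_def by (intro fs.span_sum fs.span_base) blast
 also have "(\<Sum>x\<in>B. tens sv sw x (u x)) = t"
 proof
  fix b :: "'v => 'w => 'k"
  have sum: "(\<Sum>x\<in>B. tens sv sw x (u x)) b = (\<Sum>x\<in>B. tens sv sw x (u x) b)"
   by (induction B rule: infinite_finite_induct) auto
  show "(\<Sum>x\<in>B. tens sv sw x (u x)) b = t b"
  proof (cases "bilin sv sw b")
   case True
   note lf = bilin_lf_left[OF True vs] bilin_lf_right[OF True vs]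
   have "b x (u x) = (\<Sum>(v, w)\<leftarrow>xs. \<phi> x v * b x w)" for x
    unfolding u_def by (induction xs) (auto simp: lf_zero[OF lf(2)] lf_add[OF lf(2)] lf_scale[OF lf(2)])
   hence "(\<Sum>x\<in>B. b x (u x)) = (\<Sum>x\<in>B. \<Sum>(v, w)\<leftarrow>xs. \<phi> x v * b x w)" by (simp only:)
   also have "... = (\<Sum>(v, w)\<leftarrow>xs. b (\<Sum>x\<in>B. sv (\<phi> x v) x) w)"
    by (induction xs) (auto simp: lf_sum[OF lf(1)] lf_scale[OF lf(1)] sum.distrib)
   also have "... = (\<Sum>(v, w)\<leftarrow>xs. b v w)"
    using B(4)[OF V.span_base] by (intro arg_cong[of _ _ sum_list] map_cong) force+
   finally show ?thesis unfolding sum xs(2) tens_list_apply[OF True] by (simp add: tens_apply[OF True])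
  next
   case False
   show ?thesis unfolding sum xs(2) tens_list_apply_non[OF False] by (simp add: tens_def False)
  qed
 qed
 finally show ?thesis .
qed

context comod
begin

text \<open>A form that vanishes on \<open>D\<close> kills all \<open>ract h v\<close>, so the
  duality for left factors applies.\<close>

lemma ca_in_closed:
 assumes "subspace D" "v \<in> D" "!!x g. x \<in> D ==> lfA g ==> ract g x \<in> D"
 shows "ca v \<in> tens_space s scA D UNIV"
proof (rule tensor_duality_left[OF vs vs_glc assms(1) ca_range])
 fix g and h :: "('k,'m,'n) glc => 'k" assume "lf s g" "lfA h" "!!v. v \<in> D ==> g v = 0"
 thus "ca v (%v w. g v * h w) = 0"
  using lf_ract[of h g v] assms(2,3) by auto
qed

text \<open>Passes from the eigenvector condition for \<open>wp\<close> to the congruence in the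
  definition of \<open>weight_space\<close>. The matrix coefficients of \<open>v\<close> are
  combinations of words of right weight \<open>\<mu>\<close>, and each such word is a multiple of
  the character modulo the ideal of the torus.\<close>

lemma weight_vector_coaction:
 assumes v: "v \<in> C" "wp \<mu> v = v"
 shows "ca v - tens s scA v (character_lift \<mu>) \<in> tens_space s scA C I_torus"
proof (rule tens_space_right[OF vs vs_glc sub])
 show "glc.subspace (I_torus :: ('k,'m,'n) glc set)" unfolding I_torus_def by (rule subspace_ideal_gen)
 show "ca v - tens s scA v (character_lift \<mu>) \<in> tens_space s scA C UNIV"
  by (intro tens_space_diff tens_in_space v ca_in_closed sub closed UNIV_I)
 fix g and h :: "('k,'m,'n) glc => 'k"
 assume g: "lf s g" and h: "lfA h" "!!w. w \<in> I_torus ==> h w = 0"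
 have "tau g v \<in> words (%xs. True & \<mu> = list_rw xs)"
  by (rule tau_words[OF v(1) g _ v(2), of "%_. True"]) (simp add: wproj_True)
 hence "tau g v \<in> {a. h a = counit a * h (character_lift \<mu>)}"
 proof (rule words_induct)
  show "glc.subspace {a. h a = counit a * h (character_lift \<mu>)}"
   by (rule glc.subspaceI) (simp_all add: lf_add[OF h(1)] lf_scale[OF h(1)] lf_zero[OF h(1)] counit_add counit_scale distrib_right)
  fix xs assume xs: "word_in_range (LENGTH('m) + LENGTH('n)) xs" "True & \<mu> = list_rw xs"
  have "h (word_elt xs - scA (counit (word_elt xs :: ('k,'m,'n) glc)) (character_lift (list_rw xs))) = 0"
   by (rule h(2)[OF word_mod_torus[OF xs(1)]])
  thus "word_elt xs \<in> {a. h a = counit a * h (character_lift \<mu>)}"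
   using xs(2) by (simp add: lf_diff[OF h(1)] lf_scale[OF h(1)])
 qed
 hence "h (tau g v) = g v * h (character_lift \<mu>)" by (simp add: counit_tau[OF v(1) g])
 thus "(ca v - tens s scA v (character_lift \<mu>)) (%v w. g v * h w) = 0"
  using lf_tau_ca[OF h(1) g, of v] by (simp add: tens_apply[OF bil_prod[OF g h(1)]])
qed

end

lemma weight_space_mem:
 fixes M :: "('k::field, 'm::len0, 'n::len0, 'v::ab_group_add) gsmod"
 assumes "G_supermodule M" "(2::'k) ~= 0" "v \<in> carrier M"
  "precomod.ract (sc M) (coact M) (wform ((=) \<mu>)) v = v"
 shows "v \<in> weight_space M \<mu>"
proof -
 interpret comod "sc M" "coact M" "carrier M" by (rule G_supermodule_comod[OF assms(1,2)])
 show ?thesis unfolding weight_space_def using weight_vector_coaction[OF assms(3,4)] assms(3) by simp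
qed

section \<open>Induced modules and Frobenius reciprocity\<close>

context odd_char
begin

text \<open>The cotensor condition read through forms: every linear form that factors through the
  lower triangular Borel acts on \<open>f\<close> from the left by its value on the
  character.\<close>

lemma H0_minus_carrier: "f \<in> carrier (H0m \<mu>) \<longleftrightarrow>
  (ALL g. lfA g --> (ALL x:I_borel. g x = 0) --> reg.tau g f = scA (g (character_lift \<mu>)) f)"
proof -
 have mem: "f \<in> carrier (H0m \<mu>) \<longleftrightarrow>
  comult f - tensA (character_lift \<mu>) f \<in> tens_space scA scA I_borel UNIV"
  by (simp add: H0_minus_def)
 have app: "(comult f - tensA (character_lift \<mu>) f) (%v w. g v * h w) = h (reg.tau g f) - g (character_lift \<mu>) * h f"
  if "lfA g" "lfA h" for g h
  using reg.lf_tau_ca[OF that(2,1), of f] by (simp add: tens_apply[OF bilA_prod[OF that]])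
 show ?thesis
  unfolding mem
 proof (intro iffI allI impI)
  fix g :: "('k,'m,'n) glc => 'k"
  assume t: "comult f - tensA (character_lift \<mu>) f \<in> tens_space scA scA I_borel UNIV"
   and g: "lfA g" "ALL x:I_borel. g x = 0"
  show "reg.tau g f = scA (g (character_lift \<mu>)) f"
  proof (rule lf_separate[OF vs_glc])
   fix h :: "('k,'m,'n) glc => 'k" assume h: "lfA h"
   have "(comult f - tensA (character_lift \<mu>) f) (%v w. g v * h w) = 0"
    by (rule tens_space_apply_zero[OF t bilA_prod[OF g(1) h]]) (use g in simp)
   thus "h (reg.tau g f) = h (scA (g (character_lift \<mu>)) f)"
    by (simp only: app[OF g(1) h] lf_scale[OF h] right_minus_eq)
  qed
 next
  assume H: "ALL g. lfA g --> (ALL x:I_borel. g x = 0) --> reg.tau g f = scA (g (character_lift \<mu>)) f"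
  show "comult f - tensA (character_lift \<mu>) f \<in> tens_space scA scA I_borel UNIV"
  proof (rule tensor_duality_left[OF vs_glc vs_glc])
   show "glc.subspace (I_borel :: ('k,'m,'n) glc set)" unfolding I_borel_def by (rule subspace_ideal_gen)
   show "comult f - tensA (character_lift \<mu>) f \<in> tens_space scA scA UNIV UNIV"
    by (intro tens_space_diff tens_in_space comult_in_tens_space two UNIV_I)
   fix g h :: "('k,'m,'n) glc => 'k"
   assume g: "lfA g" and h: "lfA h" and "!!v. v \<in> I_borel ==> g v = 0"
   hence "reg.tau g f = scA (g (character_lift \<mu>)) f" using H by blast
   thus "(comult f - tensA (character_lift \<mu>) f) (%v w. g v * h w) = 0"
    by (simp only: app[OF g h] lf_scale[OF h] right_minus_eq)
  qed
 qed
qed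

lemma words_character:
 assumes "a \<in> words (%xs. \<mu> = list_lw xs & \<nu> = list_rw xs)" "~ tlt LENGTH('m) LENGTH('n) \<mu> \<nu>"
  and g: "lfA g" "ALL x:I_borel. g x = 0"
 shows "g a = counit a * g (character_lift \<mu> :: ('k,'m,'n) glc)"
proof -
 have "a \<in> {a. g a = counit a * g (character_lift \<mu>)}"
  using assms(1)
 proof (rule words_induct)
  show "glc.subspace {a. g a = counit a * g (character_lift \<mu>)}"
   by (rule glc.subspaceI) (simp_all add: lf_add[OF g(1)] lf_scale[OF g(1)] lf_zero[OF g(1)] counit_add counit_scale distrib_right)
  fix xs assume xs: "word_in_range (LENGTH('m) + LENGTH('n)) xs" "\<mu> = list_lw xs & \<nu> = list_rw xs"
  have "g (word_elt xs - scA (counit (word_elt xs :: ('k,'m,'n) glc)) (character_lift (list_lw xs))) = 0"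
   using g(2) word_mod_borel[OF xs(1)] assms(2) xs(2) by blast
  thus "word_elt xs \<in> {a. g a = counit a * g (character_lift \<mu>)}"
   using xs(2) by (simp add: lf_diff[OF g(1)] lf_scale[OF g(1)])
 qed
 thus ?thesis by simp
qed

text \<open>Frobenius reciprocity. The form \<open>\<psi>\<close> is concentrated in weight
  \<open>\<mu>\<close>, and by \<open>top\<close> the weights above \<open>\<mu>\<close> in
  \<open>D\<close> do not contribute to \<open>tau \<psi>\<close>. It follows that
  \<open>\<psi>\<close> is an eigenform for the lower triangular Borel, so the homomorphism that it
  defines lands in the induced module.\<close>

lemma H0_minus_tau:
 assumes D: "glc.subspace D" "!!x g. x \<in> D ==> lfA g ==> reg.ract g x \<in> D"
  and \<psi>: "lfA \<psi>" "!!x. \<psi> (reg.wp \<mu> x) = \<psi> x"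
  and top: "!!x \<nu>. x \<in> D ==> reg.wp \<nu> x = x ==> tlt LENGTH('m) LENGTH('n) \<mu> \<nu> ==> reg.tau \<psi> x = 0"
  and y: "y \<in> D"
 shows "reg.tau \<psi> y \<in> carrier (H0m \<mu>)"
 unfolding H0_minus_carrier
proof (intro allI impI)
 fix g :: "('k,'m,'n) glc => 'k"
 assume g: "lfA g" "ALL x:I_borel. g x = 0"
 \<comment> \<open>For \<open>x\<close> of weight \<open>\<nu>\<close> the coefficient has left
   weight \<open>\<mu>\<close> and right weight \<open>\<nu>\<close>. Unless \<open>\<nu>\<close> is
   above \<open>\<mu>\<close>, it is congruent to a multiple of the character modulo the ideal of
   the Borel, and the multiple is its value at the identity.\<close>
 have hom: "\<psi> (reg.ract g x) = g (character_lift \<mu>) * \<psi> x" if x: "x \<in> D" "reg.wp \<nu> x = x" for x \<nu>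
 proof (cases "tlt LENGTH('m) LENGTH('n) \<mu> \<nu>")
  case True
  hence z: "reg.tau \<psi> x = 0" by (rule top[OF x])
  have "\<psi> (reg.ract g x) = g (reg.tau \<psi> x)" by (rule reg.lf_tau[OF g(1) \<psi>(1), symmetric])
  moreover have "\<psi> x = counit (reg.tau \<psi> x)" using reg.counit_tau[OF _ \<psi>(1), of x] by simp
  ultimately show ?thesis using z by (simp add: lf_zero[OF g(1)])
 next
  case False
  have "reg.tau \<psi> x \<in> words (%xs. \<mu> = list_lw xs & \<nu> = list_rw xs)"
   by (rule reg.tau_words[OF UNIV_I \<psi>(1) \<psi>(2) x(2)])
  hence "g (reg.tau \<psi> x) = counit (reg.tau \<psi> x) * g (character_lift \<mu>)"
   by (rule words_character[OF _ False g])
  thus ?thesis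
   using reg.counit_tau[OF UNIV_I \<psi>(1), of x] reg.lf_tau[OF g(1) \<psi>(1), of x] by simp
 qed
 have gen: "\<psi> (reg.ract g x) = g (character_lift \<mu>) * \<psi> x" if "x \<in> D" for x
 proof -
  obtain S where S: "finite S" "x = (\<Sum>\<nu>\<in>S. reg.wp \<nu> x)"
   by (rule reg.wproj_sum[of x]) simp
  have P: "reg.wp \<nu> x \<in> D" for \<nu> by (rule D(2)[OF that lf_wform])
  have PP: "reg.wp \<nu> (reg.wp \<nu> x) = reg.wp \<nu> x" for \<nu>
   by (simp add: reg.wproj_wproj)
  have "\<psi> (reg.ract g (\<Sum>\<nu>\<in>S. reg.wp \<nu> x)) = g (character_lift \<mu>) * \<psi> (\<Sum>\<nu>\<in>S. reg.wp \<nu> x)"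
   by (simp add: reg.ract_sum[OF g(1)] lf_sum[OF \<psi>(1)] hom[OF P PP] sum_distrib_left)
  thus ?thesis by (simp only: S(2)[symmetric])
 qed
 show "reg.tau g (reg.tau \<psi> y) = scA (g (character_lift \<mu>)) (reg.tau \<psi> y)"
 proof (rule lf_separate[OF vs_glc])
  fix h :: "('k,'m,'n) glc => 'k" assume h: "lfA h"
  have "h (reg.tau g (reg.tau \<psi> y)) = g (reg.ract h (reg.tau \<psi> y))" by (rule reg.lf_tau[OF h g(1)])
  also have "... = g (reg.tau \<psi> (reg.ract h y))" by (simp only: reg.ract_tau[OF UNIV_I h \<psi>(1)])
  also have "... = \<psi> (reg.ract g (reg.ract h y))" by (rule reg.lf_tau[OF g(1) \<psi>(1)])
  also have "... = g (character_lift \<mu>) * h (reg.tau \<psi> y)"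
   by (simp add: gen[OF D(2)[OF y h]] reg.lf_tau[OF h \<psi>(1)])
  finally show "h (reg.tau g (reg.tau \<psi> y)) = h (scA (g (character_lift \<mu>)) (reg.tau \<psi> y))"
   by (simp add: lf_scale[OF h])
 qed
qed

lemma H0_minus_left_weight:
 assumes "f \<in> carrier (H0m \<mu>)" "\<mu> \<in> weight_lattice LENGTH('m) LENGTH('n)"
 shows "reg.tau (wform ((=) \<mu>)) f = f"
proof -
 have "ALL x:I_borel. wform ((=) \<mu>) (x :: ('k,'m,'n) glc) = 0"
  unfolding I_borel_def by (auto elim!: wform_torus_ideal)
 hence "reg.tau (wform ((=) \<mu>)) f = scA (wform ((=) \<mu>) (character_lift \<mu> :: ('k,'m,'n) glc)) f"
  using assms(1) lf_wform unfolding H0_minus_carrier by blast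
 thus ?thesis by (simp add: wform_character[OF assms(2)])
qed

text \<open>Left and right translation by the torus agree at the identity, and from the left the
  torus acts on the induced module by \<open>\<mu>\<close> alone. Values at the identity therefore
  see only the right weight \<open>\<mu>\<close>.\<close>

lemma H0_minus_counit:
 assumes f: "f \<in> carrier (H0m \<mu>)" "\<mu> \<in> weight_lattice LENGTH('m) LENGTH('n)"
 shows "counit (reg.wp \<mu> f) = counit f"
proof -
 have "counit (reg.wp \<mu> f) = wform ((=) \<mu>) f" by (rule counit_ract[OF lf_wform])
 also have "... = counit (reg.tau (wform ((=) \<mu>)) f)"
  by (rule reg.counit_tau[OF UNIV_I lf_wform, symmetric])
 finally show ?thesis by (simp only: H0_minus_left_weight[OF f])
qed

lemma H0_minus_subspace: "glc.subspace (carrier (H0m \<mu>))"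
 by (rule glc.subspaceI)
  (simp_all add: H0_minus_carrier reg.tau_add reg.tau_scale reg.tau_zero glc.scale_right_distrib glc.scale_left_commute)

lemma H0_minus_closed:
 assumes "f \<in> carrier (H0m \<mu>)" "lfA h"
 shows "reg.ract h f \<in> carrier (H0m \<mu>)"
 using assms unfolding H0_minus_carrier
 by (auto simp: reg.ract_tau[symmetric] reg.ract_scale)

text \<open>Both factors are taken modulo ideals, since the module induced over the even part lives
  in the quotient by \<open>I_ev\<close>. Accordingly both test forms vanish on ideals.\<close>

lemma H0_ev_mem:
 assumes "!!g h. lfA g ==> lfA h ==> ALL x:I_borel_ev. g x = 0 ==> ALL x:I_ev. h x = 0 ==>
  convu g h f = g (character_lift \<mu>) * h f"
 shows "f \<in> (H0_ev \<mu> :: ('k,'m,'n) glc set)"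
 unfolding H0_ev_def mem_Collect_eq
proof (rule tensor_duality[OF vs_glc vs_glc])
 show "glc.subspace (I_borel_ev :: ('k,'m,'n) glc set)" "glc.subspace (I_ev :: ('k,'m,'n) glc set)"
  unfolding I_borel_ev_def I_ev_def by (rule subspace_ideal_gen)+
 show "comult f - tensA (character_lift \<mu>) f \<in> tens_space scA scA UNIV UNIV"
  by (intro tens_space_diff tens_in_space comult_in_tens_space two UNIV_I)
 fix g h :: "('k,'m,'n) glc => 'k"
 assume gh: "lfA g" "lfA h" "!!v. v \<in> I_borel_ev ==> g v = 0" "!!v. v \<in> I_ev ==> h v = 0"
 hence "convu g h f = g (character_lift \<mu>) * h f" using assms by blast
 thus "(comult f - tensA (character_lift \<mu>) f) (%v w. g v * h w) = 0"
  by (simp add: tens_apply[OF bilA_prod[OF gh(1,2)]] convu_def)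
qed

lemma subspace_H0_ev: "glc.subspace (H0_ev \<mu> :: ('k,'m,'n) glc set)"
proof -
 let ?T = "%f :: ('k,'m,'n) glc. comult f - tensA (character_lift \<mu>) f"
 have non: "comult f b = 0" if "~ bilA b" for f :: "('k,'m,'n) glc" and b
 proof -
  obtain xs where "comult f = (\<Sum>(v, w)\<leftarrow>xs. tensA v w)"
   by (rule tens_space_rep[OF comult_in_tens_space[OF two, of f] glc.subspace_UNIV vs_glc vs_glc]) (rule that)
  thus ?thesis using tens_list_apply_non[OF that] by simp
 qed
 have add: "?T (f + g) = ?T f + ?T g" and scl: "?T (scA c f) = fscale c (?T f)" for f g c
 proof (rule_tac [!] ext)
  fix b :: "('k,'m,'n) glc => ('k,'m,'n) glc => 'k"
  show "?T (f + g) b = (?T f + ?T g) b"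
   by (cases "bilA b") (simp_all add: tens_apply tens_def comult_add[OF two] bilA_simps)
  show "?T (scA c f) b = fscale c (?T f) b"
   by (cases "bilA b") (simp_all add: tens_apply tens_def comult_scale[OF two] bilA_simps fscale_def algebra_simps)
 qed
 have z: "?T 0 = 0" using scl[of 0 0] by (simp add: fscale_def fun_eq_iff)
 show ?thesis
  unfolding H0_ev_def
  by (rule glc.subspaceI) (simp_all only: mem_Collect_eq z add scl fs.span_zero fs.span_add fs.span_scale)
qed

end

section \<open>The action of functionals\<close>

lemma tens_span_eq:
 assumes "t \<in> module.span fscale {tens sv sw v w | v w p. P v w p}" "bilin sv sw b" "bilin sv sw b'"
  "!!v w p. P v w p ==> b v w = b' v w"
 shows "t b = (t b' :: 'k::field)"
proof -
 have "fs.span {tens sv sw v w | v w p. P v w p} \<subseteq> {t. t b = t b'}"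
  by (rule fs.span_minimal) (use assms(2-) in \<open>auto simp: tens_apply fs.subspace_def fscale_def\<close>)
 thus ?thesis using assms(1) by auto
qed

context odd_char
begin

lemma lf_sig: "lfA g ==> lfA (%a. g (sig p a))"
 by (simp add: lf_def sig_add sig_scale)

lemma lf_hcomp_glc: "lfA g ==> lfA (%a. g (hcA p (a :: ('k,'m,'n) glc)))"
 by (rule lf_hcomp[OF superspace_glc[OF two]])

lemma sum_psign_form: "lfA g ==> (\<Sum>q\<in>UNIV. psign p q * g (hcA q a)) = g (sig p (a :: ('k,'m,'n) glc))"
 unfolding sum_psign_hcomp[OF two, symmetric] by (simp add: lf_sum lf_psign)

lemma hcomp_word:
 "hcA q (word_elt xs :: ('k,'m,'n) glc) = (if q = list_par LENGTH('m) xs then word_elt xs else 0)"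
 by (rule hcomp_glc_hom[OF two word_elt_par])

lemma pinv_hcomp: "pinv (hcA q a) = psign q True * hcA q (a :: ('k,'m,'n) glc)"
 by (rule glc_par_pinv[OF hcomp_glc_par(1)[OF two]])

text \<open>\<open>pinv\<close> is compatible with \<open>comult\<close>; it acts by the sign of
  \<open>p\<close> on \<open>v\<close> and by the product of the signs of \<open>q\<close> and
  \<open>r\<close> on the component. A component of the wrong total parity equals its own negative
  and vanishes.\<close>

lemma comult_graded:
 assumes v: "v \<in> glc_par p" and b: "bilA b"
 shows "comult (v :: ('k,'m,'n) glc) (%x a. b (hcA q x) (hcA r a)) =
  (if r = (p ~= q) then comult v (%x a. b (hcA q x) a) else 0)"
proof -
 let ?c = "%r. comult v (%x a. b (hcA q x) (hcA r a))"
 have bil: "bilA (%x a. b (hcA q x) (hcA r a))" "bilA (%x a. b (hcA q x) a)" for r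
  using b by (simp_all add: bilA_iff lf_def hcomp_glc_linear[OF two])
 have z: "?c r = 0" if r: "r ~= (p ~= q)" for r
 proof -
  have hp: "hcA q (pinv a) = psign q True * hcA q a" for q and a :: "('k,'m,'n) glc"
   unfolding hcomp_glc[OF two]
   by (cases q) (simp_all add: psign_def glc_scale_def algebra_simps)
  have "psign p True * ?c r = comult (pinv v) (%x a. b (hcA q x) (hcA r a))"
   unfolding glc_par_pinv[OF v] by (rule lf_psign[OF lf_comult[OF two], symmetric])
  also have "... = comult v (%x a. b (hcA q (pinv x)) (hcA r (pinv a)))"
   by (rule comult_pinv[OF two bil(1)])
  also have "... = comult v (%x a. psign q True * psign r True * b (hcA q x) (hcA r a))"
   unfolding hp bilA_psign_left[OF b] bilA_psign_right[OF b] by (simp only: mult.assoc mult.left_commute)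
  also have "... = psign q True * psign r True * ?c r"
   using comult_form_sum[OF two, of "{0::nat}" "%_ x a. b (hcA q x) (hcA r a)" v "%_. psign q True * psign r True", OF bil(1)]
   by simp
  finally have e: "psign p True * ?c r = psign q True * psign r True * ?c r" .
  have n: "x = 0" if "x = - x" for x :: 'k
  proof -
   have "x + x = 0" by (subst (2) that) simp
   hence "2 * x = 0" by (simp only: mult_2)
   thus ?thesis using two by simp
  qed
  show ?thesis
   using e r n[of "?c r"] by (cases p; cases q; cases r) (simp_all add: psign_def)
 qed
 have "comult v (%x a. b (hcA q x) a) = (\<Sum>r\<in>UNIV. ?c r)"
 proof -
  have "b (hcA q x) a = (\<Sum>r\<in>UNIV. 1 * b (hcA q x) (hcA r a))" for x a
  proof -
   have "b (hcA q x) a = b (hcA q x) (hcA False a + hcA True a)"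
    by (simp only: hcomp_glc_sum[OF two])
   also have "... = b (hcA q x) (hcA False a) + b (hcA q x) (hcA True a)"
    by (rule lf_add[OF bilA_lf_right[OF b]])
   finally show ?thesis by (simp add: UNIV_bool add.commute)
  qed
  hence "comult v (%x a. b (hcA q x) a) = comult v (%x a. \<Sum>r\<in>UNIV. 1 * b (hcA q x) (hcA r a))"
   by (intro arg_cong[of _ _ "comult v"] ext)
  also have "... = (\<Sum>r\<in>UNIV. 1 * ?c r)"
   by (rule comult_form_sum[OF two bil(1)])
  finally show ?thesis by simp
 qed
 hence "comult v (%x a. b (hcA q x) a) = ?c (p ~= q) + ?c (p = q)"
  by (cases p; cases q) (simp_all add: UNIV_bool)
 thus ?thesis using z[of r] z[of "p = q"] by (cases "r = (p ~= q)") auto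
qed

text \<open>The condition to work for is that the coaction of a homogeneous vector is a sum of
  homogeneous pure tensors with left factors in \<open>N\<close>. A representation with left factors
  in \<open>N\<close> is split by the parity of these factors, and \<open>comult_graded\<close>
  allows each right factor to be replaced by its component of complementary parity.\<close>

lemma regular_sub:
 assumes N: "glc.subspace N" and cl: "!!x g. x \<in> N ==> lfA g ==> reg.ract g x \<in> N"
  and hc: "!!x p. x \<in> N ==> hcA p x \<in> N"
 shows "G_supermodule (regA N :: ('k, 'm, 'n, ('k,'m,'n) glc) gsmod)"
 unfolding G_supermodule_def
proof (intro conjI ballI allI impI; simp only: regular_def gsmod.simps gsmod.update_convs)
 show "superspace (scA :: 'k => ('k,'m,'n) glc => _) glc_par" by (rule superspace_glc[OF two])
 show "glc.subspace N" by (rule N)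
 show "hcA p v \<in> N" if "v \<in> N" for v p by (rule hc[OF that])
 show "Vector_Spaces.linear scA fscale (comult :: ('k,'m,'n) glc => _)" by (rule reg.ca_linear)
 show "range comult \<subseteq> tens_space scA scA UNIV (UNIV :: ('k,'m,'n) glc set)"
  using reg.ca_range by auto
 show "comult v (%x a. comult x (%y b. \<theta> y b a)) = comult v (%x a. comult a (\<theta> x))"
  if "trilin scA \<theta>" for v and \<theta> :: "('k,'m,'n) glc => ('k,'m,'n) glc => ('k,'m,'n) glc => 'k"
  by (rule reg.coassoc[OF UNIV_I that])
 show "comult v (%x a. \<phi> x * counit a) = \<phi> v" if "Vector_Spaces.linear scA (*) \<phi>" for v and \<phi> :: "('k,'m,'n) glc => 'k"
  using that by (intro reg.counit_law UNIV_I) (simp add: linear_lf[OF vs_glc])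
 fix p and v :: "('k,'m,'n) glc" assume v: "v \<in> N \<inter> glc_par p"
 have "comult v \<in> tens_space scA scA N UNIV"
  by (rule reg.ca_in_closed[OF N _ cl]) (use v in auto)
 then obtain xs where xs: "set xs \<subseteq> N \<times> UNIV" "comult v = (\<Sum>(x, a)\<leftarrow>xs. tensA x a)"
  by (rule tens_space_rep[OF _ N vs_glc vs_glc]) (rule that)
 define f where "f q = (%(x :: ('k,'m,'n) glc, a :: ('k,'m,'n) glc). (hcA q x, hcA (p ~= q) a))" for q
 let ?ys = "map (f False) xs @ map (f True) xs"
 have "comult v b = (\<Sum>(x, a)\<leftarrow>?ys. tensA x a) b" for b
 proof (cases "bilA b")
  case True
  have bil: "bilA (%x a. b (hcA q x) (hcA r a))" "bilA (%x a. b (hcA q x) a)" for q r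
   using True by (simp_all add: bilA_iff lf_def hcomp_glc_linear[OF two])
  have c: "comult v (%x a. b (hcA q x) a) = (\<Sum>(x, a)\<leftarrow>map (f q) xs. b x a)" for q
  proof -
   have "comult v (%x a. b (hcA q x) a) = comult v (%x a. b (hcA q x) (hcA (p ~= q) a))"
    using comult_graded[OF _ True, of v p q "p ~= q"] v by simp
   also have "... = (\<Sum>(x, a)\<leftarrow>xs. b (hcA q x) (hcA (p ~= q) a))"
    unfolding xs(2) by (rule tens_list_apply[OF bil(1)])
   also have "... = (\<Sum>(x, a)\<leftarrow>map (f q) xs. b x a)"
    by (simp add: f_def o_def split_def)
   finally show ?thesis .
  qed
  have s: "b x a = (\<Sum>q\<in>UNIV. 1 * b (hcA q x) a)" for x a
  proof -
   have "b x a = b (hcA False x + hcA True x) a"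
    by (simp only: hcomp_glc_sum[OF two])
   also have "... = b (hcA False x) a + b (hcA True x) a"
    by (rule lf_add[OF bilA_lf_left[OF True]])
   finally show ?thesis by (simp add: UNIV_bool add.commute)
  qed
  have "comult v b = comult v (%x a. \<Sum>q\<in>UNIV. 1 * b (hcA q x) a)"
   by (rule arg_cong[of _ _ "comult v"]) (intro ext, rule s)
  also have "... = (\<Sum>q\<in>UNIV. 1 * comult v (%x a. b (hcA q x) a))"
   by (rule comult_form_sum[OF two bil(2)])
  also have "... = (\<Sum>(x, a)\<leftarrow>?ys. b x a)"
   by (simp only: c UNIV_bool) (simp add: o_def)
  also have "... = (\<Sum>(x, a)\<leftarrow>?ys. tensA x a) b" by (rule tens_list_apply[OF True, symmetric])
  finally show ?thesis .
 next
  case False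
  show ?thesis unfolding xs(2) by (simp only: tens_list_apply_non[OF False])
 qed
 hence e: "comult v = (\<Sum>(x, a)\<leftarrow>?ys. tensA x a)" by (rule ext)
 have ys: "EX q. x \<in> N \<inter> glc_par q & a \<in> glc_par (p ~= q)" if "(x, a) \<in> set ?ys" for x a
 proof -
  have "(x, a) \<in> f False ` set xs \<union> f True ` set xs" using that by simp
  then obtain q where "(x, a) \<in> f q ` set xs" by blast
  then obtain z where z: "z \<in> set xs" "(x, a) = f q z" by (elim imageE)
  hence "fst z \<in> N" using xs(1) by auto
  moreover have "x = hcA q (fst z)" "a = hcA (p ~= q) (snd z)"
   using z(2) by (simp_all add: f_def split_def)
  ultimately show ?thesis using hc by (intro exI[of _ q]) (simp add: hcomp_glc_par(1)[OF two])
 qed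
 have "(\<Sum>(x, a)\<leftarrow>zs. tensA x a) \<in> fs.span {tensA x a | x a q. x \<in> N \<inter> glc_par q & a \<in> glc_par (p ~= q)}"
  if "!!x a. (x, a) \<in> set zs ==> EX q. x \<in> N \<inter> glc_par q & a \<in> glc_par (p ~= q)" for zs
  using that
 proof (induction zs)
  case (Cons z zs)
  have "(case z of (x, a) => tensA x a) \<in> fs.span {tensA x a | x a q. x \<in> N \<inter> glc_par q & a \<in> glc_par (p ~= q)}"
   using Cons.prems[of "fst z" "snd z"] by (intro fs.span_base) (auto simp: split_def)
  moreover have "(\<Sum>(x, a)\<leftarrow>zs. tensA x a) \<in> fs.span {tensA x a | x a q. x \<in> N \<inter> glc_par q & a \<in> glc_par (p ~= q)}"
   using Cons by auto
  ultimately show ?case unfolding list.map sum_list.Cons by (rule fs.span_add)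
 qed (simp add: fs.span_zero)
 thus "comult v \<in> fs.span {tensA x a | x a q. x \<in> N \<inter> glc_par q & a \<in> glc_par (p ~= q)}"
  unfolding e using ys by blast
qed

lemma regular_subsupermodule:
 "subsupermodule (regular\<lparr>carrier := N'\<rparr>) N \<longleftrightarrow> N \<subseteq> N' & glc.subspace N &
  (ALL x:N. ALL g. lfA g --> reg.ract g x \<in> N) & (ALL x:N. ALL p. hcA p (x :: ('k,'m,'n) glc) \<in> N)"
proof
 assume L: "subsupermodule (regular\<lparr>carrier := N'\<rparr>) N"
 let ?M = "regA N :: ('k, 'm, 'n, ('k,'m,'n) glc) gsmod"
 have G: "G_supermodule ?M" and sub: "N \<subseteq> N'" using L by (simp_all add: subsupermodule_def)
 have "comod scA comult N" using G_supermodule_comod[OF G two] by (simp add: regular_def)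
 thus "N \<subseteq> N' & glc.subspace N &
  (ALL x:N. ALL g. lfA g --> reg.ract g x \<in> N) & (ALL x:N. ALL p. hcA p x \<in> N)"
  using G_supermodule_hcomp[OF G] G_supermodule_subspace[OF G] sub comod.closed[of scA comult N]
  by (simp add: regular_def)
next
 assume R: "N \<subseteq> N' & glc.subspace N &
  (ALL x:N. ALL g. lfA g --> reg.ract g x \<in> N) & (ALL x:N. ALL p. hcA p x \<in> N)"
 thus "subsupermodule (regular\<lparr>carrier := N'\<rparr>) N"
  using regular_sub[of N] by (simp add: subsupermodule_def)
qed

lemma regular_subsupermodule': "subsupermodule regular N \<longleftrightarrow> glc.subspace N &
  (ALL x:N. ALL g. lfA g --> reg.ract g x \<in> N) & (ALL x:N. ALL p. hcA p (x :: ('k,'m,'n) glc) \<in> N)"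
 using regular_subsupermodule[of UNIV N] by (simp add: regular_def)

end

section \<open>The signed action on an arbitrary supermodule\<close>

locale supermod = odd_char "TYPE(('k,'m,'n) glc)" for M :: "('k::field, 'm::len0, 'n::len0, 'v::ab_group_add) gsmod" +
 assumes G: "G_supermodule M"
begin

sublocale comod "sc M" "coact M" "carrier M" by (rule G_supermodule_comod[OF G two])

abbreviation hc where "hc \<equiv> hcomp (par M)"

lemma superspace: "superspace (sc M) (par M)" by (rule G_supermodule_superspace[OF G])

text \<open>The sign in the action is trivial on components of even parity and amounts to
  \<open>pinv\<close> in the argument of the form on components of odd parity.\<close>

lemma act_eq:
 assumes "lfA \<xi>"
 shows "act M \<xi> v = hc False (ract \<xi> v) + hc True (ract (%a. \<xi> (pinv a)) v)"
 unfolding act_def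
proof (rule the_equality)
 let ?u = "hc False (ract \<xi> v) + hc True (ract (%a. \<xi> (pinv a)) v)"
 have form: "\<phi> ?u = coact M v (%x a. \<Sum>p\<in>UNIV. \<Sum>q\<in>UNIV. psign q p * (\<phi> (hc p x) * \<xi> (hcA q a)))"
  if "lf (sc M) \<phi>" for \<phi>
 proof -
  have lh: "lf (sc M) (%x. \<phi> (hc p x))" for p by (rule lf_hcomp[OF superspace that])
  have lp: "lfA (%a. \<xi> (pinv a))" using lf_sig[OF assms, of True] by (simp add: sig_def)
  have "(\<Sum>p\<in>UNIV. \<Sum>q\<in>UNIV. psign q p * (\<phi> (hc p x) * \<xi> (hcA q a))) =
    (\<Sum>p\<in>UNIV. \<phi> (hc p x) * \<xi> (sig p a))" for x and a :: "('k,'m,'n) glc"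
   unfolding sum_psign_form[OF assms, symmetric] by (simp add: UNIV_bool psign_def algebra_simps)
  hence "coact M v (%x a. \<Sum>p\<in>UNIV. \<Sum>q\<in>UNIV. psign q p * (\<phi> (hc p x) * \<xi> (hcA q a))) =
    coact M v (%x a. \<phi> (hc False x) * \<xi> a + \<phi> (hc True x) * \<xi> (pinv a))"
   by (simp add: UNIV_bool sig_def add.commute)
  also have "... = coact M v (%x a. \<phi> (hc False x) * \<xi> a) + coact M v (%x a. \<phi> (hc True x) * \<xi> (pinv a))"
  proof -
   obtain xs where xs: "!!\<beta>. bilin (sc M) scA \<beta> ==> coact M v \<beta> = (\<Sum>(x, a)\<leftarrow>xs. \<beta> x a)"
    by (rule ca_rep[of v]) (rule that)
   have b: "bilin (sc M) scA (%x a. \<phi> (hc False x) * \<xi> a)" "bilin (sc M) scA (%x a. \<phi> (hc True x) * \<xi> (pinv a))"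
    by (intro bil_prod lh lp assms)+
   hence b': "bilin (sc M) scA (%x a. \<phi> (hc False x) * \<xi> a + \<phi> (hc True x) * \<xi> (pinv a))"
    unfolding bilin_iff[OF vs vs_glc] by (simp add: lf_plus)
   show ?thesis unfolding xs[OF b(1)] xs[OF b(2)] xs[OF b'] by (simp add: sum_list_addf split_def)
  qed
  also have "... = \<phi> (hc False (ract \<xi> v)) + \<phi> (hc True (ract (%a. \<xi> (pinv a)) v))"
   by (simp only: lf_ract[OF assms lh] lf_ract[OF lp lh])
  finally show ?thesis by (simp add: lf_add[OF that])
 qed
 thus "ALL \<phi>. Vector_Spaces.linear (sc M) (*) \<phi> -->
  \<phi> ?u = coact M v (%x a. \<Sum>p\<in>UNIV. \<Sum>q\<in>UNIV. psign q p * (\<phi> (hc p x) * \<xi> (hcA q a)))"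
  by (simp add: linear_lf[OF vs])
 fix u
 assume "ALL \<phi>. Vector_Spaces.linear (sc M) (*) \<phi> -->
  \<phi> u = coact M v (%x a. \<Sum>p\<in>UNIV. \<Sum>q\<in>UNIV. psign q p * (\<phi> (hc p x) * \<xi> (hcA q a)))"
 thus "u = ?u"
  using form by (intro lf_separate[OF vs]) (simp add: linear_lf[OF vs])
qed

lemma hc_ract:
 assumes v: "v \<in> carrier M" "v \<in> par M r" and g: "lfA g"
 shows "hc p (ract g v) = ract (%a. g (hcA (p ~= r) a)) v"
proof (rule lf_separate[OF vs])
 fix \<phi> assume \<phi>: "lf (sc M) \<phi>"
 have lh: "lf (sc M) (%x. \<phi> (hc p x))" by (rule lf_hcomp[OF superspace \<phi>])
 have lg: "lfA (%a. g (hcA (p ~= r) a))" by (rule lf_hcomp_glc[OF g])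
 have "coact M v \<in> module.span fscale {tens (sc M) scA x a | x a q. x \<in> carrier M \<inter> par M q & a \<in> glc_par (r ~= q)}"
  using G v by (simp add: G_supermodule_def)
 hence "coact M v (%x a. \<phi> (hc p x) * g a) = coact M v (%x a. \<phi> x * g (hcA (p ~= r) a))"
 proof (rule tens_span_eq)
  show "bilin (sc M) scA (%x a. \<phi> (hc p x) * g a)" "bilin (sc M) scA (%x a. \<phi> x * g (hcA (p ~= r) a))"
   by (intro bil_prod lh lg g \<phi>)+
  fix x and a :: "('k,'m,'n) glc" and q assume xa: "x \<in> carrier M \<inter> par M q & a \<in> glc_par (r ~= q)"
  hence "hc p x = (if p = q then x else 0)" by (intro hcomp_hom[OF superspace]) auto
  moreover have "hcA (p ~= r) a = (if (p ~= r) = (r ~= q) then a else 0)"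
   using xa by (intro hcomp_glc_hom[OF two]) auto
  ultimately show "\<phi> (hc p x) * g a = \<phi> x * g (hcA (p ~= r) a)"
   by (auto simp: lf_zero[OF \<phi>] lf_zero[OF g])
 qed
 thus "\<phi> (hc p (ract g v)) = \<phi> (ract (%a. g (hcA (p ~= r) a)) v)"
  by (simp only: lf_ract[OF g lh] lf_ract[OF lg \<phi>])
qed

lemma hc_ract_pinv:
 assumes v: "v \<in> carrier M" "v \<in> par M r" and g: "lfA g"
 shows "hc True (ract (%a. g (pinv a)) v) = sc M (if r then 1 else - 1) (hc True (ract g v))"
proof -
 have lp: "lfA (%a. g (pinv a))" using lf_sig[OF g, of True] by (simp add: sig_def)
 have "g (pinv (hcA (True ~= r) a)) = (if r then 1 else - 1) * g (hcA (True ~= r) a)" for a :: "('k,'m,'n) glc"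
  unfolding pinv_hcomp lf_psign[OF g] by (auto simp: psign_def)
 hence "ract (%a. g (pinv (hcA (True ~= r) a))) v = sc M (if r then 1 else - 1) (ract (%a. g (hcA (True ~= r) a)) v)"
  using ract_cmult_form[OF lf_hcomp_glc[OF g], of "if r then 1 else - 1"] by (simp only:)
 thus ?thesis by (simp only: hc_ract[OF v g] hc_ract[OF v lp])
qed

text \<open>For homogeneous \<open>v\<close> the signed and the unsigned result have the same even
  component, and odd components that agree up to sign.\<close>

lemma act_homogeneous:
 assumes v: "v \<in> carrier M" "v \<in> par M r" and g: "lfA g"
 shows "act M g v = 0 \<longleftrightarrow> ract g v = 0"
proof -
 have zero: "hc p 0 = 0" for p
  using hcomp_scale[OF superspace, of p 0 0] by simp
 have a: "act M g v = hc False (ract g v) + sc M (if r then 1 else - 1) (hc True (ract g v))"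
  using act_eq[OF g, of v] hc_ract_pinv[OF v g] by (simp only:)
 show ?thesis
 proof
  assume "ract g v = 0"
  thus "act M g v = 0" unfolding a by (simp add: zero)
 next
  assume "act M g v = 0"
  hence z: "hc p (hc False (ract g v) + sc M (if r then 1 else - 1) (hc True (ract g v))) = 0" for p
   unfolding a by (simp add: zero)
  have "hc False (ract g v) = 0" "hc True (ract g v) = 0"
   using z[of False] z[of True]
   by (auto simp: hcomp_add[OF superspace] hcomp_scale[OF superspace] hcomp_hcomp[OF superspace] split: if_splits)
  thus "ract g v = 0" using hcomp_sum[OF superspace, of "ract g v"] by simp
 qed
qed

lemma act_zero_iff:
 assumes g: "lfA g"
 shows "(ALL v:carrier M. act M g v = 0) \<longleftrightarrow> (ALL v:carrier M. ract g v = 0)"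
proof -
 have lp: "lfA (%a. g (pinv a))" using lf_sig[OF g, of True] by (simp add: sig_def)
 have hcM: "hc p v \<in> carrier M" if "v \<in> carrier M" for p v by (rule G_supermodule_hcomp[OF G that])
 have sum: "hc False v + hc True v = v" for v by (rule hcomp_sum[OF superspace])
 show ?thesis
 proof (intro iffI ballI)
  fix v assume H: "ALL v:carrier M. act M g v = 0" and v: "v \<in> carrier M"
  have "ract g (hc p v) = 0" for p
   using act_homogeneous[OF hcM[OF v] hcomp_mem[OF superspace] g] H hcM[OF v] by auto
  thus "ract g v = 0" using ract_add[OF g, of "hc False v" "hc True v"] by (simp add: sum)
 next
  fix v assume H: "ALL v:carrier M. ract g v = 0" and v: "v \<in> carrier M"
  have z: "act M g (hc p v) = 0" for p
   using act_homogeneous[OF hcM[OF v] hcomp_mem[OF superspace] g] H hcM[OF v] by auto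
  have "act M g (x + y) = act M g x + act M g y" for x y
   by (simp add: act_eq[OF g] ract_add[OF g] ract_add[OF lp] hcomp_add[OF superspace])
  from this[of "hc False v" "hc True v"] show "act M g v = 0" by (simp only: sum z add_0_left)
 qed
qed

end

section \<open>Highest weight vectors of the Weyl supermodules\<close>

abbreviation levi :: "nat => (glgen, 'k::field) free_alg => (glgen, 'k) free_alg"
 where "levi m \<equiv> free_eval (psingle 0) (%x. if gen_par m x then 0 else fgen x)"

context odd_char
begin

text \<open>Omitting the odd letters does not preserve the relations for the inverse. The missing
  terms are products of two odd letters, one of which has its row in the second and its column in
  the first block, so they lie in the ideal of the parabolic.\<close>

lemma levi_relations:
 assumes "r \<in> gl_rels LENGTH('m) LENGTH('n)"
 shows "abs_glc (levi LENGTH('m) r) \<in> (I_parabolic :: ('k,'m,'n) glc set)"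
proof -
 let ?N = "LENGTH('m) + LENGTH('n)" and ?p = "idx_par LENGTH('m)"
 define G :: "glgen => ('k,'m,'n) glc" where "G x = (if gen_par LENGTH('m) x then 0 else glc_gen x)" for x
 note simps = free_endo.eval_diff free_endo.eval_mult free_endo.eval_sum free_endo.eval_fgen
  free_endo.eval_uminus free_endo.eval_one free_endo.eval_zero
 have z: "0 \<in> (I_parabolic :: ('k,'m,'n) glc set)" unfolding I_parabolic_def by (rule ideal_gen.zero)
 have G: "abs_glc (levi LENGTH('m) (fgen x)) = G x" for x
  by (simp add: simps G_def abs_glc_zero abs_glc_fgen)
 have ob: "abs_glc (levi LENGTH('m) (of_bool b)) = (of_bool b :: ('k,'m,'n) glc)" for b
  by (cases b) (simp_all add: simps abs_glc_zero abs_glc_one)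
 have lm: "abs_glc (levi LENGTH('m) (x * y)) = abs_glc (levi LENGTH('m) x) * (abs_glc (levi LENGTH('m) y) :: ('k,'m,'n) glc)" for x y
  by (simp add: simps abs_glc_mult)
 have ld: "abs_glc (levi LENGTH('m) (x - y)) = abs_glc (levi LENGTH('m) x) - (abs_glc (levi LENGTH('m) y) :: ('k,'m,'n) glc)" for x y
  by (simp add: free_endo.eval_diff minus_glc.abs_eq)
 have ls: "abs_glc (levi LENGTH('m) (sum f S)) = (\<Sum>i\<in>S. abs_glc (levi LENGTH('m) (f i)) :: ('k,'m,'n) glc)" for f :: "nat => _" and S
  by (simp add: simps abs_glc_sum)
 have inv: "(\<Sum>k<?N. G (X i k) * G (Y k j)) - of_bool (i = j) \<in> (I_parabolic :: ('k,'m,'n) glc set)"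
  if ij: "i < ?N" "j < ?N" and XY: "(\<Sum>k<?N. glc_gen (X i k) * glc_gen (Y k j)) = (of_bool (i = j) :: ('k,'m,'n) glc)"
   and X: "!!i j. gen_row (X i j) = i & gen_col (X i j) = j & gen_row (Y i j) = i & gen_col (Y i j) = j"
   "!!i j. gen_par LENGTH('m) (X i j) = (?p i ~= ?p j) & gen_par LENGTH('m) (Y i j) = (?p i ~= ?p j)" for i j X Y
 proof (cases "?p i = ?p j")
  case False
  hence "(\<Sum>k<?N. G (X i k) * G (Y k j)) = 0" by (intro sum.neutral) (auto simp: G_def X)
  thus ?thesis using False z by auto
 next
  case True
  have e: "G (X i k) * G (Y k j) = glc_gen (X i k) * glc_gen (Y k j) - (if ?p k ~= ?p i then glc_gen (X i k) * glc_gen (Y k j) else 0)" for k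
   using True by (auto simp: G_def X)
  have "(\<Sum>k<?N. G (X i k) * G (Y k j)) - of_bool (i = j) =
   - (\<Sum>k<?N. if ?p k ~= ?p i then glc_gen (X i k) * (glc_gen (Y k j) :: ('k,'m,'n) glc) else 0)"
   unfolding e sum_subtractf XY by simp
  moreover have "(\<Sum>k<?N. if ?p k ~= ?p i then glc_gen (X i k) * (glc_gen (Y k j) :: ('k,'m,'n) glc) else 0) \<in> I_parabolic"
  proof -
   have "glc_gen (X i k) * (glc_gen (Y k j) :: ('k,'m,'n) glc) \<in> I_parabolic" if "?p k ~= ?p i" for k
   proof (cases "?p i")
    case True
    hence "glc_gen (X i k) \<in> (I_parabolic :: ('k,'m,'n) glc set)"
     using that X by (intro parabolic_letters two) auto
    thus ?thesis unfolding I_parabolic_def by (rule ideal_gen_mult_right)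
   next
    case False
    hence "glc_gen (Y k j) \<in> (I_parabolic :: ('k,'m,'n) glc set)"
     using that X \<open>?p i = ?p j\<close> by (intro parabolic_letters two) auto
    thus ?thesis unfolding I_parabolic_def by (rule ideal_gen_mult_left)
   qed
   thus ?thesis unfolding I_parabolic_def by (intro ideal_gen_sum) (auto simp: ideal_gen.zero)
  qed
  ultimately show ?thesis unfolding I_parabolic_def by (simp only: ideal_gen_uminus)
 qed
 from assms show ?thesis
 proof cases
  case (comm x y)
  have sg: "abs_glc (levi LENGTH('m) (psign s t)) = (psign s t :: ('k,'m,'n) glc)" for s t
   using ld[of 0 1] by (auto simp: psign_def simps abs_glc_zero abs_glc_one)
  have "abs_glc (levi LENGTH('m) r) = G x * G y - psign (gen_par LENGTH('m) x) (gen_par LENGTH('m) y) * (G y * G x)"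
   unfolding comm ld lm sg G ..
  also have "... = 0"
   using glc_gen_comm[of x y, where ?'k = 'k and ?'m = 'm and ?'n = 'n] by (auto simp: G_def)
  finally show ?thesis using z by simp
 next
  case (inv_right i j)
  show ?thesis unfolding inv_right(1) ld ls lm ob G
   by (rule inv[where X = GenC and Y = GenD, OF inv_right(2,3) glc_inverse_right[OF inv_right(2,3)]]) auto
 next
  case (inv_left i j)
  show ?thesis unfolding inv_left(1) ld ls lm ob G
   by (rule inv[where X = GenD and Y = GenC, OF inv_left(2,3) glc_inverse_left[OF inv_left(2,3)]]) auto
 next
  case (rangeC i j)
  thus ?thesis unfolding rangeC(1) G using z by (simp add: G_def glc_gen_out_of_range word_in_range_def)
 next
  case (rangeD i j)
  thus ?thesis unfolding rangeD(1) G using z by (simp add: G_def glc_gen_out_of_range word_in_range_def)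
 qed
qed

lemma levi_ideal:
 assumes "x \<in> ideal_gen (gl_rels LENGTH('m) LENGTH('n))"
 shows "abs_glc (levi LENGTH('m) x) \<in> (I_parabolic :: ('k,'m,'n) glc set)"
 using assms
proof (induction rule: ideal_gen.induct)
 case zero
 show ?case unfolding I_parabolic_def by (simp add: free_endo.eval_zero abs_glc_zero ideal_gen.zero)
next
 case (step x r a b)
 have "abs_glc (levi LENGTH('m) a) * abs_glc (levi LENGTH('m) r) * abs_glc (levi LENGTH('m) b) \<in> (I_parabolic :: ('k,'m,'n) glc set)"
  using levi_relations[OF step(2)] unfolding I_parabolic_def by (intro ideal_gen_mult)
 thus ?case
  using step.IH unfolding I_parabolic_def
  by (simp add: free_endo.eval_add free_endo.eval_mult abs_glc_add abs_glc_mult ideal_gen_add)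
qed

context
 fixes \<eta> :: "('k,'m,'n) glc => 'k"
 assumes \<eta>: "lfA \<eta>" "!!x. x \<in> I_parabolic ==> \<eta> x = 0"
begin

text \<open>\<open>\<eta>\<close> vanishes on the ideal that contains the images of the relations,
  so the representative in the definition of \<open>Dist_levi\<close> is immaterial.\<close>

lemma Dist_levi_abs: "Dist_levi \<eta> (abs_glc f) = \<eta> (abs_glc (levi LENGTH('m) f))"
proof -
 have "rep_glc (abs_glc f :: ('k,'m,'n) glc) - f \<in> ideal_gen (gl_rels LENGTH('m) LENGTH('n))"
  using abs_glc_eq_iff[of "rep_glc (abs_glc f :: ('k,'m,'n) glc)" f, where ?'m = 'm and ?'n = 'n] by simp
 hence "\<eta> (abs_glc (levi LENGTH('m) (rep_glc (abs_glc f :: ('k,'m,'n) glc) - f))) = 0"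
  by (intro \<eta>(2) levi_ideal)
 moreover have "abs_glc (levi LENGTH('m) (x - y)) = abs_glc (levi LENGTH('m) x) - (abs_glc (levi LENGTH('m) y) :: ('k,'m,'n) glc)" for x y
  by (simp add: free_endo.eval_diff minus_glc.abs_eq)
 ultimately show ?thesis by (simp add: lf_diff[OF \<eta>(1)] Dist_levi_def)
qed

lemma lf_Dist_levi: "lfA (Dist_levi \<eta>)"
 unfolding lf_def
proof (intro conjI allI)
 fix a b :: "('k,'m,'n) glc" and c
 have "a + b = abs_glc (rep_glc a + rep_glc b)" by (simp add: abs_glc_add)
 hence "Dist_levi \<eta> (a + b) = \<eta> (abs_glc (levi LENGTH('m) (rep_glc a + rep_glc b)))" by (simp only: Dist_levi_abs)
 thus "Dist_levi \<eta> (a + b) = Dist_levi \<eta> a + Dist_levi \<eta> b"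
  by (simp add: free_endo.eval_add abs_glc_add lf_add[OF \<eta>(1)] Dist_levi_def)
 have "scA c a = abs_glc (psingle 0 c * rep_glc a)"
  by (simp add: abs_glc_mult abs_glc_const glc_scale_def)
 hence "Dist_levi \<eta> (scA c a) = \<eta> (abs_glc (levi LENGTH('m) (psingle 0 c * rep_glc a)))" by (simp only: Dist_levi_abs)
 also have "... = \<eta> (scA c (abs_glc (levi LENGTH('m) (rep_glc a))))"
  by (simp add: free_endo.eval_mult free_endo.eval_single abs_glc_mult abs_glc_const glc_scale_def)
 finally show "Dist_levi \<eta> (scA c a) = c * Dist_levi \<eta> a" by (simp add: lf_scale[OF \<eta>(1)] Dist_levi_def)
qed

lemma Dist_levi_word: "Dist_levi \<eta> (word_elt xs) = (if EX x:set xs. gen_par LENGTH('m) x then 0 else \<eta> (word_elt xs))"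
proof -
 have "abs_glc (prod_list (map (%x. if gen_par LENGTH('m) x then 0 else fgen x) xs)) =
  (if EX x:set xs. gen_par LENGTH('m) x then 0 else (word_elt xs :: ('k,'m,'n) glc))"
  by (induction xs) (simp_all add: abs_glc_one abs_glc_mult abs_glc_zero abs_glc_fgen)
 moreover have "word_elt xs = (abs_glc (psingle (FMon xs) 1) :: ('k,'m,'n) glc)"
  by (simp add: abs_glc_single_one)
 ultimately show ?thesis
  by (simp add: Dist_levi_abs free_endo.eval_single lf_zero[OF \<eta>(1)])
qed

lemma form_par_Dist_levi: "form_par False (Dist_levi \<eta>)"
proof -
 have "Dist_levi \<eta> (pinv a) = Dist_levi \<eta> a" for a
 proof -
  have "a \<in> {a. Dist_levi \<eta> (pinv a) = Dist_levi \<eta> a}"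
  proof (rule glc_word_induct)
   show "glc.subspace {a. Dist_levi \<eta> (pinv a) = Dist_levi \<eta> a}"
    by (rule glc.subspaceI)
     (simp_all add: pinv_add pinv_scale lf_add[OF lf_Dist_levi] lf_scale[OF lf_Dist_levi])
   fix xs
   have "psign (list_par LENGTH('m) xs) True * Dist_levi \<eta> (word_elt xs) = Dist_levi \<eta> (word_elt xs)"
   proof (cases "EX x:set xs. gen_par LENGTH('m) x")
    case False
    hence "~ list_par LENGTH('m) xs" by (induction xs) auto
    thus ?thesis by (simp add: psign_def)
   qed (simp add: Dist_levi_word)
   thus "word_elt xs \<in> {a. Dist_levi \<eta> (pinv a) = Dist_levi \<eta> a}"
    by (simp add: pinv_word lf_psign[OF lf_Dist_levi])
  qed
  thus ?thesis by simp
 qed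
 thus ?thesis by (simp add: form_par_def lf_Dist_levi psign_def)
qed

text \<open>The words on which the two sides could differ have a letter in the odd lower left block, or
 have left degree larger than right degree.\<close>

lemma parabolic_forms:
 fixes d :: int
 defines "Q \<equiv> %\<mu>. wd LENGTH('m) \<mu> = d" and "R \<equiv> %\<mu>. wd LENGTH('m) \<mu> <= d"
 shows "convu (wform R) (convu (%a. \<eta> (hcA q a)) (wform Q)) =
  (if q then (%a. 0) else convu (wform Q) (Dist_levi \<eta>))"
proof -
 let ?eq = "%a :: ('k,'m,'n) glc. convu (wform R) (convu (%a. \<eta> (hcA q a)) (wform Q)) a =
  of_bool (~ q) * convu (wform Q) (Dist_levi \<eta>) a"
 have "a \<in> {a. ?eq a}" for a
 proof (rule glc_word_induct)
  show "glc.subspace {a. ?eq a}"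
   by (rule glc.subspaceI)
    (simp_all add: lf_add[OF lf_convu'] lf_scale[OF lf_convu'] lf_zero[OF lf_convu'] algebra_simps)
  fix xs assume xs: "word_in_range (LENGTH('m) + LENGTH('n)) xs"
  let ?w = "word_elt xs :: ('k,'m,'n) glc"
  have "of_bool (R (list_lw xs)) * (of_bool (Q (list_rw xs)) * \<eta> (hcA q ?w)) =
   of_bool (~ q) * (of_bool (Q (list_lw xs)) * Dist_levi \<eta> ?w)"
  proof (cases "EX x:set xs. idx_par LENGTH('m) (gen_row x) & ~ idx_par LENGTH('m) (gen_col x)")
   case True
   then obtain x where x: "x \<in> set xs" "idx_par LENGTH('m) (gen_row x)" "~ idx_par LENGTH('m) (gen_col x)" by blast
   have "gen_par LENGTH('m) x" using x(2,3) by (cases x) auto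
   hence 1: "Dist_levi \<eta> ?w = 0" using x(1) by (auto simp: Dist_levi_word)
   have "?w \<in> I_parabolic"
    using parabolic_letters[OF two x(2,3), where ?'n = 'n] unfolding I_parabolic_def by (rule word_in_ideal[OF x(1)])
   hence "\<eta> ?w = 0" by (rule \<eta>(2))
   thus ?thesis using 1 by (simp add: hcomp_word lf_zero[OF \<eta>(1)])
  next
   case False
   hence up: "!!x. x \<in> set xs ==> idx_par LENGTH('m) (gen_row x) ==> idx_par LENGTH('m) (gen_col x)" by blast
   show ?thesis
   proof (cases "EX x:set xs. gen_par LENGTH('m) x")
    case True
    hence "wd LENGTH('m) (list_rw xs) < wd LENGTH('m) (list_lw xs)"
     using word_upper_parabolic[OF up] by (metis order_le_less)
    hence "~ (R (list_lw xs) & Q (list_rw xs))" by (auto simp: Q_def R_def)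
    thus ?thesis using True by (auto simp: Dist_levi_word)
   next
    case F: False
    hence "wd LENGTH('m) (list_rw xs) = wd LENGTH('m) (list_lw xs)" by (intro word_even_wd) blast
    moreover have "~ list_par LENGTH('m) xs" using F by (induction xs) auto
    ultimately show ?thesis using F by (auto simp: Dist_levi_word hcomp_word Q_def R_def lf_zero[OF \<eta>(1)])
   qed
  qed
  thus "?w \<in> {a. ?eq a}"
   unfolding mem_Collect_eq convu_wform_left[OF lf_convu' xs] convu_wform_left[OF lf_Dist_levi xs]
    convu_wform_right[OF lf_hcomp_glc[OF \<eta>(1)] xs] .
 qed
 thus ?thesis by (auto simp: fun_eq_iff)
qed

end

end


section \<open>Highest weight vectors in the regular comodule\<close>

lemma (in block_perm) pt_pt: "reg.ract pt (reg.ract pt y) = y"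
 by (simp only: reg.ract_ract[OF UNIV_I lf_pt lf_pt] convu_pt_pt reg.ract_counit[OF UNIV_I])

text \<open>The condition \<open>top\<close> concerns everything generated by \<open>e\<close>, not
  \<open>e\<close> alone: the comodule \<open>D\<close> of all \<open>reg.ract g e\<close> has no
  weight above \<open>lam\<close>.\<close>

locale highest_weight = odd_char ty for ty :: "('k::field,'m::len0,'n::len0) glc itself" +
 fixes lam :: "nat => int" and e :: "('k,'m,'n) glc"
 assumes lattice: "lam \<in> weight_lattice LENGTH('m) LENGTH('n)"
  and weight: "reg.wp lam e = e"
  and top: "lfA g ==> tlt LENGTH('m) LENGTH('n) lam \<nu> ==> reg.wp \<nu> (reg.ract g e) = 0"
begin

sublocale w0: block_perm ty "long_elt LENGTH('m) LENGTH('n)"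
 by standard (rule long_elt_invol long_elt_block long_elt_bound)+

definition D :: "('k,'m,'n) glc set"
 where "D = {reg.ract g e | g. lfA g}"

lemma subspace_D: "glc.subspace D"
proof (rule glc.subspaceI)
 show "0 \<in> D" unfolding D_def
  using reg.ract_zero_form[of e] lf_cmult[OF lf_counit, of 0] by (intro CollectI exI[of _ "%x. 0"]) simp
next
 fix x y assume "x \<in> D" "y \<in> D"
 thus "x + y \<in> D" unfolding D_def
  using reg.ract_plus_form[symmetric] lf_plus by blast
next
 fix c x assume "x \<in> D"
 thus "scA c x \<in> D" unfolding D_def
  using reg.ract_cmult_form[symmetric] lf_cmult by blast
qed

lemma D_closed: "x \<in> D ==> lfA g ==> reg.ract g x \<in> D"
 unfolding D_def by (auto simp: reg.ract_ract intro: lf_convu')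

lemma e_in_D: "e \<in> D"
 unfolding D_def using reg.ract_counit[of e] lf_counit by (intro CollectI exI[of _ counit]) auto

lemma D_top: "y \<in> D ==> tlt LENGTH('m) LENGTH('n) lam \<nu> ==> reg.wp \<nu> y = 0"
 unfolding D_def using top by blast

lemma D_proj:
 assumes "!!\<nu>. ~ Q \<nu> ==> reg.wp \<nu> y = 0"
 shows "reg.ract (wform Q) y = y"
proof -
 obtain S where S: "finite S" "S \<subseteq> weight_lattice LENGTH('m) LENGTH('n)"
  "!!Q. reg.ract (wform Q) y = (\<Sum>\<mu>\<in>S. scA (of_bool (Q \<mu>)) (reg.wp \<mu> y))"
  by (rule reg.wproj_finite[of y]) (rule that)
 have "reg.ract (wform Q) y = (\<Sum>\<mu>\<in>S. scA (of_bool (Q \<mu>)) (reg.wp \<mu> y))" by (rule S(3))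
 also have "... = (\<Sum>\<mu>\<in>S. scA (of_bool True) (reg.wp \<mu> y))"
  by (rule sum.cong[OF refl]) (use assms in auto)
 also have "... = reg.ract (wform (%_. True)) y" by (rule S(3)[symmetric])
 finally show ?thesis by (simp only: reg.wproj_True[OF UNIV_I])
qed

text \<open>The translate of \<open>e\<close> by the longest element, a vector of weight
  \<open>w0 lam\<close>. It enters because the Weyl module over the even part is defined as the dual
  of the module induced from \<open>-w0 lam\<close>.\<close>

definition u :: "('k,'m,'n) glc"
 where "u = reg.ract w0.pt e"

lemma u_in_D: "u \<in> D"
 unfolding u_def by (rule D_closed[OF e_in_D w0.lf_pt])

lemma pt_u: "reg.ract w0.pt u = e"
 unfolding u_def by (rule w0.pt_pt)

lemma pt_weight: "reg.ract (wform Q) (reg.ract w0.pt y) = reg.ract w0.pt (reg.ract (wform (%\<mu>. Q (\<mu> \<circ> long_elt LENGTH('m) LENGTH('n)))) y)"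
 by (simp add: reg.ract_ract lf_wform w0.lf_pt w0.convu_wform_pt)

lemma sigma_invol: "(\<mu> \<circ> long_elt LENGTH('m) LENGTH('n)) \<circ> long_elt LENGTH('m) LENGTH('n) = (\<mu> :: nat => int)"
 by (simp add: fun_eq_iff long_elt_invol)

lemma u_weight: "reg.ract (wform ((=) (lam \<circ> long_elt LENGTH('m) LENGTH('n)))) u = u"
proof -
 have "(%\<mu>. lam \<circ> long_elt LENGTH('m) LENGTH('n) = \<mu> \<circ> long_elt LENGTH('m) LENGTH('n)) = ((=) lam)"
  by (intro ext) (metis sigma_invol)
 thus ?thesis unfolding u_def pt_weight by (simp only: weight)
qed

lemma antipode_borel_ev:
 assumes "x \<in> (I_borel_ev :: ('k,'m,'n) glc set)"
 shows "antipode x \<in> (I_borel_ev :: ('k,'m,'n) glc set)"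
proof -
 let ?S = "{cc i j | i j. i < j \<or> idx_par LENGTH('m) i ~= idx_par LENGTH('m) j} :: ('k,'m,'n) glc set"
 have gen: "antipode r \<in> ideal_gen ?S" if r: "r \<in> ?S" for r
 proof -
  obtain i j where ij: "r = cc i j" "i < j \<or> idx_par LENGTH('m) i ~= idx_par LENGTH('m) j" using r by blast
  have "dd i j \<in> (I_borel_ev :: ('k,'m,'n) glc set)"
  proof (cases "word_in_range (LENGTH('m) + LENGTH('n)) [GenD i j]")
   case True
   show ?thesis by (rule borel_ev_letters[OF _ True]) (use ij(2) in simp)
  next
   case False
   thus ?thesis by (simp add: glc_gen_out_of_range I_borel_ev_def ideal_gen.zero)
  qed
  thus ?thesis by (simp add: ij(1) antipode_gen I_borel_ev_def)
 qed
 show ?thesis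
  using assms unfolding I_borel_ev_def
 proof (induction rule: ideal_gen.induct)
  case (step x r a b)
  have "antipode a * antipode r * antipode b \<in> ideal_gen ?S" by (intro ideal_gen_mult gen step(2))
  thus ?case using step.IH by (simp add: antipode_add antipode_mult ideal_gen_add)
 qed (simp add: ideal_gen.zero)
qed

text \<open>\<open>u\<close> has extremal weight within the degree of \<open>lam\<close>, so forms
  of the lower triangular Borel of the even part, composed with the antipode, act on it by scalars.
  Applying the antipode to the character of \<open>w0 lam\<close> gives that of
  \<open>-w0 lam\<close>.\<close>

lemma u_borel:
 assumes g: "lfA g" "ALL x:I_borel_ev. g x = 0"
 shows "reg.ract (%a. g (antipode a)) u = scA (g (character_lift (neg_w0 LENGTH('m) LENGTH('n) lam))) u"
proof (rule lf_separate[OF vs_glc])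
 fix \<phi> :: "('k,'m,'n) glc => 'k" assume \<phi>: "lfA \<phi>"
 let ?g = "%a. g (antipode a)" and ?\<kappa> = "lam \<circ> long_elt LENGTH('m) LENGTH('n)"
 have lg: "lfA ?g" by (rule lf_antipode[OF g(1)])
 \<comment> \<open>The excluded weights have the degree of \<open>lam\<close> and a smaller
   \<open>wl\<close> than \<open>u\<close>. The longest element would move them to weights above
   \<open>lam\<close>, so they do not occur in \<open>D\<close>.\<close>
 define Q where "Q \<nu> \<longleftrightarrow> ~ (wd LENGTH('m) \<nu> = wd LENGTH('m) lam & wl LENGTH('m) LENGTH('n) \<nu> < - wl LENGTH('m) LENGTH('n) lam)" for \<nu>
 have wds: "wd LENGTH('m) (\<nu> \<circ> long_elt LENGTH('m) LENGTH('n)) = wd LENGTH('m) \<nu>" for \<nu>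
  by (rule wd_block_perm[OF long_elt_invol long_elt_block])
 have fixed: "reg.ract (wform Q) y = y" if y: "y \<in> D" for y
 proof (rule D_proj)
  fix \<nu> assume "~ Q \<nu>"
  hence "tlt LENGTH('m) LENGTH('n) lam (\<nu> \<circ> long_elt LENGTH('m) LENGTH('n))"
   by (simp add: Q_def tlt_def wds wl_long_elt)
  hence "reg.ract (wform ((=) (\<nu> \<circ> long_elt LENGTH('m) LENGTH('n)))) (reg.ract w0.pt y) = 0"
   by (rule D_top[OF D_closed[OF y w0.lf_pt]])
  moreover have "(%\<mu>. \<nu> \<circ> long_elt LENGTH('m) LENGTH('n) = \<mu> \<circ> long_elt LENGTH('m) LENGTH('n)) = ((=) \<nu>)" by (intro ext) (metis sigma_invol)
  ultimately have "reg.ract w0.pt (reg.wp \<nu> y) = 0" by (simp only: pt_weight)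
  hence "reg.ract w0.pt (reg.ract w0.pt (reg.wp \<nu> y)) = 0"
   by (simp add: reg.ract_zero[OF w0.lf_pt])
  thus "reg.wp \<nu> y = 0" by (simp only: w0.pt_pt)
 qed
 let ?\<phi> = "%x. \<phi> (reg.ract (wform Q) x)"
 have l\<phi>: "lfA ?\<phi>" by (rule reg.lf_compose_ract[OF lf_wform \<phi>])
 have "reg.tau ?\<phi> u \<in> words (%xs. Q (list_lw xs) & ?\<kappa> = list_rw xs)"
  by (rule reg.tau_words[OF UNIV_I l\<phi> _ u_weight]) (simp add: reg.wproj_wproj)
 hence "reg.tau ?\<phi> u \<in> {a. ?g a = counit a * ?g (character_lift ?\<kappa>)}"
 proof (rule words_induct)
  show "glc.subspace {a. ?g a = counit a * ?g (character_lift ?\<kappa>)}"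
   by (rule glc.subspaceI) (simp_all add: lf_add[OF lg] lf_scale[OF lg] lf_zero[OF g(1)] counit_add counit_scale distrib_right)
  fix xs assume xs: "word_in_range (LENGTH('m) + LENGTH('n)) xs" "Q (list_lw xs) & ?\<kappa> = list_rw xs"
  have "word_elt xs - scA (counit (word_elt xs :: ('k,'m,'n) glc)) (character_lift (list_rw xs)) \<in> (I_borel_ev :: ('k,'m,'n) glc set)"
  proof (rule word_mod_borel_ev[OF xs(1)])
   have r: "wd LENGTH('m) (list_rw xs) = wd LENGTH('m) lam" "wl LENGTH('m) LENGTH('n) (list_rw xs) = - wl LENGTH('m) LENGTH('n) lam"
    unfolding conjunct2[OF xs(2), symmetric] by (rule wds wl_long_elt)+
   show "~ wl LENGTH('m) LENGTH('n) (list_lw xs) < wl LENGTH('m) LENGTH('n) (list_rw xs)"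
    if "wd LENGTH('m) (list_lw xs) = wd LENGTH('m) (list_rw xs)"
    using xs(2) that unfolding Q_def r by blast
  qed
  hence "?g (word_elt xs - scA (counit (word_elt xs :: ('k,'m,'n) glc)) (character_lift (list_rw xs))) = 0"
   using g(2) antipode_borel_ev by blast
  thus "word_elt xs \<in> {a. ?g a = counit a * ?g (character_lift ?\<kappa>)}"
   using xs(2) by (simp only: lf_diff[OF lg] lf_scale[OF lg] mem_Collect_eq right_minus_eq)
 qed
 hence "?g (reg.tau ?\<phi> u) = counit (reg.tau ?\<phi> u) * ?g (character_lift ?\<kappa>)" by simp
 moreover have "- ?\<kappa> = neg_w0 LENGTH('m) LENGTH('n) lam"
  using lattice by (auto simp: fun_eq_iff neg_w0_def long_elt_def weight_lattice_def)
 moreover have "?g (reg.tau ?\<phi> u) = \<phi> (reg.ract ?g u)"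
  using fixed[OF D_closed[OF u_in_D lg]] by (simp add: reg.lf_tau[OF lg l\<phi>])
 moreover have "counit (reg.tau ?\<phi> u) = \<phi> u"
  using reg.counit_tau[OF UNIV_I l\<phi>, of u] fixed[OF u_in_D] by simp
 ultimately show "\<phi> (reg.ract ?g u) = \<phi> (scA (g (character_lift (neg_w0 LENGTH('m) LENGTH('n) lam))) u)"
  by (simp add: lf_scale[OF \<phi>] antipode_character)
qed

abbreviation H :: "('k,'m,'n) glc set" where "H \<equiv> H0_ev (neg_w0 LENGTH('m) LENGTH('n) lam)"

lemma ev_form_par:
 assumes h: "lfA h" "ALL x:I_ev. h x = 0"
 shows "form_par False h"
proof -
 have "h (pinv a) = h a" for a :: "('k,'m,'n) glc"
 proof -
  have "a \<in> {a. h (pinv a) = h a}"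
  proof (rule glc_word_induct)
   show "glc.subspace {a. h (pinv a) = h a}"
    by (rule glc.subspaceI) (simp_all add: pinv_add pinv_scale lf_add[OF h(1)] lf_scale[OF h(1)])
   fix xs
   show "word_elt xs \<in> {a. h (pinv a) = h a}"
   proof (cases "EX x:set xs. gen_par LENGTH('m) x")
    case True
    then obtain x where x: "x \<in> set xs" "gen_par LENGTH('m) x" by blast
    have "word_elt xs \<in> (I_ev :: ('k,'m,'n) glc set)"
     using ev_letters[OF two x(2), where ?'n = 'n] unfolding I_ev_def by (rule word_in_ideal[OF x(1)])
    hence "h (word_elt xs) = 0" using h(2) by blast
    thus ?thesis by (simp add: pinv_word lf_psign[OF h(1)])
   next
    case False
    hence "~ list_par LENGTH('m) xs" by (induction xs) auto
    thus ?thesis by (simp add: pinv_word psign_def)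
   qed
  qed
  thus ?thesis by simp
 qed
 thus ?thesis by (simp add: form_par_def h psign_def)
qed

text \<open>The antipode exchanges the two sides, so the behaviour of \<open>u\<close> under the
  Borel of the even part becomes the left condition that defines the module induced from
  \<open>-w0 lam\<close>.\<close>

lemma antipode_tau_H:
 assumes \<phi>: "lfA \<phi>"
 shows "antipode (reg.tau \<phi> u) \<in> H"
proof (rule H0_ev_mem)
 fix g h :: "('k,'m,'n) glc => 'k"
 assume g: "lfA g" "ALL x:I_borel_ev. g x = 0" and h: "lfA h" "ALL x:I_ev. h x = 0"
 let ?c = "g (character_lift (neg_w0 LENGTH('m) LENGTH('n) lam))"
 have "convu g h (antipode (reg.tau \<phi> u)) = convu (%a. h (antipode a)) (%a. g (antipode a)) (reg.tau \<phi> u)"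
  by (rule convu_antipode[OF g(1) ev_form_par[OF h]])
 also have "... = h (antipode (reg.tau \<phi> (reg.ract (%a. g (antipode a)) u)))"
  unfolding convu_ract[OF lf_antipode[OF h(1)] lf_antipode[OF g(1)]] reg.ract_tau[OF UNIV_I lf_antipode[OF g(1)] \<phi>] ..
 also have "... = ?c * h (antipode (reg.tau \<phi> u))"
  unfolding u_borel[OF g] reg.tau_scale[OF \<phi>] antipode_scale lf_scale[OF h(1)] ..
 finally show "convu g h (antipode (reg.tau \<phi> u)) = ?c * h (antipode (reg.tau \<phi> u))" .
qed

end

context odd_char
begin

lemma conv_eq:
 assumes \<zeta>: "lfA \<zeta>" and \<eta>: "lfA \<eta>"
 shows "conv \<zeta> \<eta> a = \<zeta> (reg.ract (%b. \<eta> (hcA False b)) a) + \<zeta> (pinv (reg.ract (%b. \<eta> (hcA True b)) (a :: ('k,'m,'n) glc)))"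
proof -
 have lp: "lfA (%a. \<zeta> (pinv a))" using lf_sig[OF \<zeta>, of True] by (simp add: sig_def)
 have b: "bilA (%x a. \<zeta> (sig q x) * \<eta> (hcA q a))" for q
  by (rule bilA_prod[OF lf_sig[OF \<zeta>] lf_hcomp_glc[OF \<eta>]])
 have "(\<Sum>p\<in>UNIV. \<Sum>q\<in>UNIV. psign q p * (\<zeta> (hcA p x) * \<eta> (hcA q y))) =
  (\<Sum>q\<in>UNIV. 1 * (\<zeta> (sig q x) * \<eta> (hcA q y)))" for x y :: "('k,'m,'n) glc"
  unfolding sum_psign_form[OF \<zeta>, symmetric] by (simp add: UNIV_bool algebra_simps)
 hence "conv \<zeta> \<eta> a = comult a (%x y. \<Sum>q\<in>UNIV. 1 * (\<zeta> (sig q x) * \<eta> (hcA q y)))"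
  unfolding conv_def by (intro arg_cong[of _ _ "comult a"] ext)
 also have "... = (\<Sum>q\<in>UNIV. 1 * comult a (%x y. \<zeta> (sig q x) * \<eta> (hcA q y)))"
  by (rule comult_form_sum[OF two b])
 also have "... = convu \<zeta> (%b. \<eta> (hcA False b)) a + convu (%a. \<zeta> (pinv a)) (%b. \<eta> (hcA True b)) a"
  by (simp add: UNIV_bool convu_def sig_def add.commute)
 finally show ?thesis by (simp only: convu_ract[OF \<zeta> lf_hcomp_glc[OF \<eta>]] convu_ract[OF lp lf_hcomp_glc[OF \<eta>]])
qed

end

section \<open>The balanced bilinear form attached to a highest weight vector\<close>

context highest_weight
begin

text \<open>The vector of the Weyl module that corresponds to \<open>e\<close>. Evaluation at the
  longest element is insensitive to the antipode and carries \<open>u\<close> back to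
  \<open>e\<close>, so on the coefficients of \<open>u\<close> it returns the coordinates of
  \<open>e\<close>.\<close>

definition ev_point :: "('k,'m,'n) glc => 'k"
 where "ev_point f = (if f \<in> H then w0.pt f else 0)"

lemma ev_point_V_ev: "ev_point \<in> (V_ev lam :: (('k,'m,'n) glc => 'k) set)"
proof -
 have "w0.pt f = 0" if "f \<in> I_ev" for f
  by (rule hom_kills_ideal[OF that[unfolded I_ev_def]])
   (auto simp: w0.pt_gen w0.perm_gen_even w0.pt_add w0.pt_mult)
 thus ?thesis
  unfolding V_ev_def Let_def ev_point_def
  using glc.subspace_add[OF subspace_H0_ev] glc.subspace_scale[OF subspace_H0_ev]
  by (auto simp: w0.pt_add w0.pt_scale)
qed

lemma V_ev_linear:
 assumes "\<Phi> \<in> (V_ev lam :: (('k,'m,'n) glc => 'k) set)" "finite B" "!!x. x \<in> B ==> F x \<in> H"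
 shows "\<Phi> (\<Sum>x\<in>B. scA (c x) (F x)) = (\<Sum>x\<in>B. c x * \<Phi> (F x))"
proof -
 have z: "(0 :: ('k,'m,'n) glc) \<in> I_ev" unfolding I_ev_def by (rule ideal_gen.zero)
 have \<Phi>: "f \<in> H ==> g \<in> H ==> \<Phi> (f + g) = \<Phi> f + \<Phi> g" "f \<in> H ==> \<Phi> (scA a f) = a * \<Phi> f" "\<Phi> 0 = 0" for f g a
  using assms(1) z unfolding V_ev_def Let_def by blast+
 show ?thesis
  using assms(2,3)
 proof (induction B rule: finite_induct)
  case (insert x B)
  have "(\<Sum>x\<in>B. scA (c x) (F x)) \<in> H"
   by (rule glc.subspace_sum[OF subspace_H0_ev]) (use insert.prems in \<open>auto intro: glc.subspace_scale[OF subspace_H0_ev]\<close>)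
  moreover have "scA (c x) (F x) \<in> H" "F x \<in> H"
   using insert.prems by (auto intro: glc.subspace_scale[OF subspace_H0_ev])
  ultimately show ?case using insert by (simp add: \<Phi>)
 qed (simp add: \<Phi>)
qed

text \<open>The basis \<open>B\<close> of \<open>D\<close> with dual forms \<open>\<phi>\<close> gives the matrix coefficients that define the
 bilinear form below.\<close>

context
 fixes B :: "('k,'m,'n) glc set" and \<phi> :: "('k,'m,'n) glc => ('k,'m,'n) glc => 'k"
 assumes B: "finite B" "B \<subseteq> D" and \<phi>: "!!x. x \<in> B ==> lfA (\<phi> x)"
  and expand: "!!y. y \<in> D ==> y = (\<Sum>x\<in>B. scA (\<phi> x y) x)"
begin

text \<open>The part of \<open>D\<close> in the degree of \<open>lam\<close>, which is the largest
  degree that occurs. On it a distribution of the parabolic acts through the Levi factor.\<close>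

definition pd :: "('k,'m,'n) glc => ('k,'m,'n) glc"
 where "pd = reg.ract (wform (%\<mu>. wd LENGTH('m) \<mu> = wd LENGTH('m) lam))"

definition coefF :: "('k,'m,'n) glc => ('k,'m,'n) glc"
 where "coefF x = antipode (reg.tau (\<phi> x) u)"

text \<open>Sending \<open>\<Phi>\<close> to the sum of the vectors \<open>pd x\<close> with
  coefficients \<open>\<Phi> (coefF x)\<close> is a map from the Weyl module to the top degree part
  of \<open>D\<close> that takes \<open>ev_point\<close> to \<open>e\<close>; the pairing evaluates
  \<open>\<zeta>\<close> on the image.\<close>

definition pairing :: "(('k,'m,'n) glc => 'k) => (('k,'m,'n) glc => 'k) => 'k"
 where "pairing \<zeta> \<Phi> = (\<Sum>x\<in>B. \<zeta> (pd x) * \<Phi> (coefF x))"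

lemma bilin_pairing: "bilin fscale fscale pairing"
proof -
 have vs: "vector_space (fscale :: 'k => (('k,'m,'n) glc => 'k) => _)" by (rule vector_space_fscale)
 show ?thesis
  unfolding bilin_iff[OF vs vs] lf_def pairing_def
  by (simp add: fscale_def algebra_simps sum.distrib sum_distrib_left)
qed

lemma coefF_H: "x \<in> B ==> coefF x \<in> H"
 unfolding coefF_def by (rule antipode_tau_H[OF \<phi>])

lemma linear_expand:
 assumes "lfA \<zeta>" "y \<in> D"
 shows "(\<Sum>x\<in>B. \<phi> x y * \<zeta> (pd x)) = \<zeta> (pd y)"
proof -
 have "\<zeta> (pd y) = \<zeta> (pd (\<Sum>x\<in>B. scA (\<phi> x y) x))" using expand[OF assms(2)] by simp
 thus ?thesis
  by (simp add: pd_def reg.ract_sum[OF lf_wform] reg.ract_scale[OF lf_wform] lf_sum[OF assms(1)] lf_scale[OF assms(1)])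
qed

lemma pairing_ev_point:
 assumes "lfA \<zeta>"
 shows "pairing \<zeta> ev_point = \<zeta> e"
proof -
 have "ev_point (coefF x) = \<phi> x e" if "x \<in> B" for x
  using coefF_H[OF that] pt_u reg.lf_tau[OF w0.lf_pt \<phi>[OF that], of u]
  by (simp add: ev_point_def coefF_def w0.pt_antipode)
 hence "pairing \<zeta> ev_point = (\<Sum>x\<in>B. \<phi> x e * \<zeta> (pd x))"
  unfolding pairing_def by (intro sum.cong) (auto simp: mult.commute)
 also have "... = \<zeta> (pd e)" by (rule linear_expand[OF assms e_in_D])
 also have "pd e = e"
 proof -
  have "pd (reg.wp lam e) = reg.ract (wform (%\<mu>. wd LENGTH('m) \<mu> = wd LENGTH('m) lam & lam = \<mu>)) e"
   unfolding pd_def by (rule reg.wproj_wproj) simp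
  also have "(%\<mu>. wd LENGTH('m) \<mu> = wd LENGTH('m) lam & lam = \<mu>) = ((=) lam)" by auto
  finally show ?thesis by (simp only: weight)
 qed
 finally show ?thesis .
qed

text \<open>On the left side \<open>\<eta>\<close> acts on the top degree part of \<open>D\<close>,
  where \<open>parabolic_forms\<close> replaces it by its Levi image and discards its odd component.
  On the right side the contragredient action moves the same Levi image through the antipode onto
  the coefficients of \<open>u\<close>. Expansion in \<open>B\<close> shows that both give the same
  matrix.\<close>

lemma pairing_balanced:
 assumes \<zeta>: "\<zeta> \<in> Dist" and \<eta>: "\<eta> \<in> Dist_sub I_parabolic" and \<Phi>: "\<Phi> \<in> V_ev lam"
 shows "pairing (conv \<zeta> \<eta>) \<Phi> = pairing \<zeta> (V_ev_act lam \<eta> \<Phi>)"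
proof -
 have l\<zeta>: "lfA \<zeta>" by (rule Dist_lf[OF \<zeta>])
 have \<eta>': "lfA \<eta>" "!!x. x \<in> I_parabolic ==> \<eta> x = 0"
  using \<eta> Dist_lf by (auto simp: Dist_sub_def)
 let ?L = "Dist_levi \<eta>"
 have lL: "lfA ?L" and fL: "form_par False ?L"
  by (rule lf_Dist_levi[OF \<eta>'] form_par_Dist_levi[OF \<eta>']; assumption)+
 let ?Q = "%\<mu>. wd LENGTH('m) \<mu> = wd LENGTH('m) lam" and ?R = "%\<mu>. wd LENGTH('m) \<mu> <= wd LENGTH('m) lam"
 \<comment> \<open>No weight of \<open>D\<close> has larger degree than \<open>lam\<close>, so
   projecting to degrees at most that of \<open>lam\<close> changes nothing; it brings the product
   of forms into the shape of \<open>parabolic_forms\<close>.\<close>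
 have R: "reg.ract (wform ?R) y = y" if "y \<in> D" for y
  by (rule D_proj, rule D_top[OF that]) (simp add: tlt_def)
 have ev: "reg.ract (%b. \<eta> (hcA q b)) (pd y) = (if q then 0 else pd (reg.ract ?L y))" if y: "y \<in> D" for q y
 proof -
  have lq: "lfA (%b. \<eta> (hcA q (b :: ('k,'m,'n) glc)))" by (rule lf_hcomp_glc[OF \<eta>'(1)])
  have "reg.ract (%b. \<eta> (hcA q b)) (pd y) = reg.ract (wform ?R) (reg.ract (%b. \<eta> (hcA q b)) (pd y))"
   unfolding pd_def by (rule R[symmetric]) (intro D_closed y lf_wform lq)
  also have "... = reg.ract (convu (wform ?R) (convu (%b. \<eta> (hcA q b)) (wform ?Q))) y"
   unfolding pd_def by (simp only: reg.ract_ract[OF UNIV_I lq lf_wform] reg.ract_ract[OF UNIV_I lf_wform lf_convu'])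
  also have "convu (wform ?R) (convu (%b. \<eta> (hcA q b)) (wform ?Q)) = (if q then (%a. 0) else convu (wform ?Q) ?L)"
   by (rule parabolic_forms[OF \<eta>'])
  finally show ?thesis
   by (cases q) (simp_all add: reg.ract_zero_form pd_def reg.ract_ract[OF UNIV_I lf_wform lL])
 qed
 have left: "conv \<zeta> \<eta> (pd x) = \<zeta> (pd (reg.ract ?L x))" if "x \<in> D" for x
  using ev[OF that, of False] ev[OF that, of True] by (simp add: conv_eq[OF l\<zeta> \<eta>'(1)] lf_zero[OF l\<zeta>])
 \<comment> \<open>The Levi form is even, so its signed action agrees with \<open>ract\<close>, and
   the antipode turns it into \<open>reg.tau\<close> on the coefficient of \<open>u\<close>.\<close>
 have right: "V_ev_act lam \<eta> \<Phi> (coefF x) = (\<Sum>z\<in>B. \<phi> x (reg.ract ?L z) * \<Phi> (coefF z))" if x: "x \<in> B" for x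
 proof -
  let ?S = "%g. ?L (antipode g)"
  have lS: "lfA ?S" by (rule lf_antipode[OF lL])
  have fS: "form_par False ?S" using fL by (simp add: form_par_def lf_antipode antipode_pinv)
  interpret A: supermod "regular :: ('k, 'm, 'n, ('k,'m,'n) glc) gsmod"
   using regular_sub[of UNIV] by unfold_locales (simp add: regular_def)
  have Ar: "A.ract = reg.ract" by (simp add: regular_def)
  have "(%a. ?S (pinv a)) = ?S" using fS by (simp add: form_par_def psign_def)
  hence "act regular ?S (coefF x) = A.hc False (reg.ract ?S (coefF x)) + A.hc True (reg.ract ?S (coefF x))"
   using A.act_eq[OF lS] by (simp only: Ar)
  also have "... = reg.ract ?S (coefF x)" by (rule hcomp_sum[OF A.superspace])
  also have "... = antipode (reg.tau ?L (reg.tau (\<phi> x) u))"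
  proof (rule lf_separate[OF vs_glc])
   fix g :: "('k,'m,'n) glc => 'k" assume g: "lfA g"
   have "g (reg.ract ?S (coefF x)) = convu g ?S (antipode (reg.tau (\<phi> x) u))"
    unfolding coefF_def by (rule convu_ract[OF g lS, symmetric])
   also have "... = convu ?L (%v. g (antipode v)) (reg.tau (\<phi> x) u)"
    using convu_antipode[OF g fS] by simp
   also have "... = g (antipode (reg.tau ?L (reg.tau (\<phi> x) u)))"
    by (rule convu_tau[OF lL lf_antipode[OF g]])
   finally show "g (reg.ract ?S (coefF x)) = g (antipode (reg.tau ?L (reg.tau (\<phi> x) u)))" .
  qed
  also have "reg.tau ?L (reg.tau (\<phi> x) u) = (\<Sum>z\<in>B. scA (\<phi> x (reg.ract ?L z)) (reg.tau (\<phi> z) u))"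
  proof (rule lf_separate[OF vs_glc])
   fix g :: "('k,'m,'n) glc => 'k" assume g: "lfA g"
   have l: "lfA (%y. \<phi> x (reg.ract ?L y))" by (rule reg.lf_compose_ract[OF lL \<phi>[OF x]])
   have "g (reg.tau ?L (reg.tau (\<phi> x) u)) = \<phi> x (reg.ract ?L (reg.ract g u))"
    unfolding reg.tau_tau[OF UNIV_I lL \<phi>[OF x]] by (rule reg.lf_tau[OF g l])
   also have "... = (%y. \<phi> x (reg.ract ?L y)) (\<Sum>z\<in>B. scA (\<phi> z (reg.ract g u)) z)"
    using expand[OF D_closed[OF u_in_D g]] by simp
   also have "... = (\<Sum>z\<in>B. \<phi> z (reg.ract g u) * \<phi> x (reg.ract ?L z))"
    by (simp add: lf_sum[OF l] lf_scale[OF l])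
   also have "... = g (\<Sum>z\<in>B. scA (\<phi> x (reg.ract ?L z)) (reg.tau (\<phi> z) u))"
    by (simp add: lf_sum[OF g] lf_scale[OF g] reg.lf_tau[OF g \<phi>] mult.commute)
   finally show "g (reg.tau ?L (reg.tau (\<phi> x) u)) = g (\<Sum>z\<in>B. scA (\<phi> x (reg.ract ?L z)) (reg.tau (\<phi> z) u))" .
  qed
  finally have a: "act regular ?S (coefF x) = antipode (\<Sum>z\<in>B. scA (\<phi> x (reg.ract ?L z)) (reg.tau (\<phi> z) u))" .
  have "antipode (sum f T) = (\<Sum>z\<in>T. antipode (f z))" for f :: "('k,'m,'n) glc => ('k,'m,'n) glc" and T
   by (induction T rule: infinite_finite_induct) (simp_all add: antipode_add)
  hence "act regular ?S (coefF x) = (\<Sum>z\<in>B. scA (\<phi> x (reg.ract ?L z)) (coefF z))"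
   unfolding a by (simp add: antipode_scale coefF_def)
  moreover have "V_ev_act lam \<eta> \<Phi> (coefF x) = \<Phi> (act regular ?S (coefF x))"
   using coefF_H[OF x] by (simp add: V_ev_act_def)
  ultimately show ?thesis using V_ev_linear[OF \<Phi> B(1) coefF_H] by simp
 qed
 have "pairing \<zeta> (V_ev_act lam \<eta> \<Phi>) = (\<Sum>x\<in>B. \<Sum>z\<in>B. \<zeta> (pd x) * (\<phi> x (reg.ract ?L z) * \<Phi> (coefF z)))"
  unfolding pairing_def by (rule sum.cong[OF refl]) (simp add: right sum_distrib_left)
 also have "... = (\<Sum>z\<in>B. \<Sum>x\<in>B. \<zeta> (pd x) * (\<phi> x (reg.ract ?L z) * \<Phi> (coefF z)))" by (rule sum.swap)
 also have "... = (\<Sum>z\<in>B. (\<Sum>x\<in>B. \<phi> x (reg.ract ?L z) * \<zeta> (pd x)) * \<Phi> (coefF z))"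
  unfolding sum_distrib_right by (intro sum.cong refl) (simp add: mult_ac)
 also have "... = (\<Sum>z\<in>B. conv \<zeta> \<eta> (pd z) * \<Phi> (coefF z))"
  by (rule sum.cong[OF refl]) (use B(2) in \<open>auto simp: left linear_expand[OF l\<zeta> D_closed[OF _ lL]]\<close>)
 finally show ?thesis by (simp add: pairing_def)
qed

end

lemma pairing_exists:
 obtains b where "bilin fscale fscale b" "!!\<zeta>. lfA \<zeta> ==> b \<zeta> ev_point = \<zeta> e"
  "!!\<zeta> \<eta> \<Phi>. \<zeta> \<in> Dist ==> \<eta> \<in> Dist_sub I_parabolic ==> \<Phi> \<in> V_ev lam ==> b (conv \<zeta> \<eta>) \<Phi> = b \<zeta> (V_ev_act lam \<eta> \<Phi>)"
proof -
 obtain B0 where B0: "finite B0" "!!g. lfA g ==> reg.ract g e \<in> glc.span B0"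
  by (rule reg.ract_finite[of e]) (rule that)
 hence "D \<subseteq> glc.span B0" unfolding D_def by blast
 then obtain B \<phi> where B: "finite B" "B \<subseteq> D" "!!x. x \<in> B ==> lfA (\<phi> x)" "!!y. y \<in> D ==> y = (\<Sum>x\<in>B. scA (\<phi> x y) x)"
  by (rule dual_basis[OF vs_glc subspace_D B0(1)]) (rule that)
 show ?thesis
  by (rule that[OF bilin_pairing[OF B] pairing_ev_point[OF B] pairing_balanced[OF B]])
qed

end

text \<open>\<open>w\<close> is the image of the tensor of \<open>counit\<close> with the generator
  \<open>\<Phi>\<close>. If \<open>\<xi>\<close> kills \<open>w\<close>, the tensor of
  \<open>\<xi>\<close> and \<open>\<Phi>\<close> lies in the span of the balancing relations, which
  every balanced bilinear form annihilates; the form attached to \<open>e\<close> gives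
  \<open>\<xi> e = 0\<close>.\<close>

lemma highest_weight_vector:
 fixes M :: "('k::field, 'm::len0, 'n::len0, 'v::ab_group_add) gsmod"
 assumes M: "G_supermodule M" and two: "(2::'k) ~= 0" and N: "N \<subseteq> carrier M" "is_V_minus lam (M\<lparr>carrier := N\<rparr>)"
 obtains w where "w \<in> carrier M"
  "!!(e :: ('k,'m,'n) glc) \<xi>. highest_weight lam e ==> \<xi> \<in> Dist ==> precomod.ract (sc M) (coact M) \<xi> w = 0 ==> \<xi> e = 0"
proof -
 interpret supermod M by unfold_locales (rule two M)+
 let ?W = "M\<lparr>carrier := N\<rparr>" and ?H = "H0_ev (neg_w0 LENGTH('m) LENGTH('n) lam) :: ('k,'m,'n) glc set"
 interpret w0: block_perm "TYPE(('k,'m,'n) glc)" "long_elt LENGTH('m) LENGTH('n)"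
  by standard (rule long_elt_invol long_elt_block long_elt_bound)+
 \<comment> \<open>This is \<open>ev_point\<close> for every \<open>e\<close> of highest weight
   \<open>lam\<close>. It does not involve \<open>e\<close>, so that a single \<open>w\<close>
   serves all of them.\<close>
 define \<Phi> where "\<Phi> f = (if f \<in> ?H then w0.pt f else 0)" for f
 obtain h where h: "Vector_Spaces.linear fscale (sc ?W) h"
  "h ` tens_space fscale fscale Dist (V_ev lam) = carrier ?W"
  "{t \<in> tens_space fscale fscale Dist (V_ev lam). h t = 0} = module.span fscale
     {tens fscale fscale (conv \<xi> \<eta>) v - tens fscale fscale \<xi> (V_ev_act lam \<eta> v) | \<xi> \<eta> v.
      \<xi> \<in> (Dist :: (('k,'m,'n) glc => 'k) set) & \<eta> \<in> Dist_sub I_parabolic & v \<in> V_ev lam}"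
  "ALL p. ALL \<xi>:Dist_par p. ALL v:V_ev lam. h (tens fscale fscale \<xi> v) \<in> par ?W p"
  "ALL \<zeta>:Dist. ALL \<xi>:Dist. ALL v:V_ev lam.
   h (tens fscale fscale (conv \<zeta> \<xi>) v) = act ?W \<zeta> (h (tens fscale fscale \<xi> v))"
  using N(2) unfolding is_V_minus_def
  by (elim conjE exE) (rule that)
 have hN: "h ` tens_space fscale fscale Dist (V_ev lam) = N" and hp: "ALL p. ALL \<xi>:Dist_par p. ALL v:V_ev lam. h (tens fscale fscale \<xi> v) \<in> par M p"
  using h(2,4) by simp_all
 define w where "w = h (tens fscale fscale counit \<Phi>)"
 show ?thesis
 proof (cases "EX e :: ('k,'m,'n) glc. highest_weight lam e")
  case False
  \<comment> \<open>Membership of \<open>\<Phi>\<close> in the Weyl module is taken from the locale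
    of some \<open>e\<close>. When there is none, the claim about \<open>w\<close> is empty and 0
    will do.\<close>
  show ?thesis by (rule that[OF subspace_0[OF sub]]) (use False in blast)
 next
  case True
  then obtain e0 :: "('k,'m,'n) glc" where E0: "highest_weight lam e0" by blast
  interpret E0: highest_weight "TYPE(('k,'m,'n) glc)" lam e0 by (rule E0)
  have \<Phi>: "\<Phi> \<in> V_ev lam" using E0.ev_point_V_ev unfolding E0.ev_point_def \<Phi>_def .
  have cD: "counit \<in> (Dist :: (('k,'m,'n) glc => 'k) set)" by (rule counit_Dist)
  have odd: "counit f = 0" if "f \<in> glc_par True" for f :: "('k,'m,'n) glc"
  proof -
   have "counit f = - counit f" using counit_pinv[of f] glc_par_odd[of f] that lf_minus[OF lf_counit, of f] by simp
   hence "counit f + counit f = 0" by (simp add: eq_neg_iff_add_eq_0)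
   hence "2 * counit f = 0" by (simp only: mult_2)
   thus ?thesis using two by simp
  qed
  have w_even: "w \<in> par M False"
   unfolding w_def using cD \<Phi> by (intro hp[rule_format]) (auto simp: Dist_par_def odd)
  have wN: "w \<in> carrier M"
   unfolding w_def using hN tens_in_space[OF cD \<Phi>] N(1) by blast
  have "\<xi> e = 0" if E: "highest_weight lam e" and \<xi>: "\<xi> \<in> Dist" and z: "ract \<xi> w = 0" for e \<xi>
  proof -
   interpret E: highest_weight "TYPE(('k,'m,'n) glc)" lam e by (rule E)
   have l\<xi>: "lfA \<xi>" by (rule Dist_lf[OF \<xi>])
   obtain b where b: "bilin fscale fscale b" "!!\<zeta>. lfA \<zeta> ==> b \<zeta> \<Phi> = \<zeta> e"
    "!!\<zeta> \<eta> \<Psi>. \<zeta> \<in> Dist ==> \<eta> \<in> Dist_sub I_parabolic ==> \<Psi> \<in> V_ev lam ==> b (conv \<zeta> \<eta>) \<Psi> = b \<zeta> (V_ev_act lam \<eta> \<Psi>)"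
    using E.pairing_exists unfolding E.ev_point_def[abs_def] \<Phi>_def[abs_def] by blast
   have cv: "conv \<xi> counit = \<xi>"
   proof
    fix a :: "('k,'m,'n) glc"
    have "counit (hcA q b) = of_bool (~ q) * counit b" for q and b :: "('k,'m,'n) glc"
    proof -
     have "counit (hcA True b) = 0" for b :: "('k,'m,'n) glc"
      by (rule odd[OF hcomp_glc_par(1)[OF two]])
     thus ?thesis using counit_add[of "hcA False b" "hcA True b"]
      by (cases q) (simp_all add: hcomp_glc_sum[OF two])
    qed
    thus "conv \<xi> counit a = \<xi> a"
     by (simp add: conv_eq[OF l\<xi> lf_counit] reg.ract_counit reg.ract_zero_form lf_zero[OF l\<xi>])
   qed
   have "h (tens fscale fscale \<xi> \<Phi>) = act ?W \<xi> w"
    using h(5)[rule_format, OF \<xi> cD \<Phi>] unfolding cv w_def .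
   also have "... = act M \<xi> w" by (simp add: act_def)
   also have "... = 0" using act_homogeneous[OF wN w_even l\<xi>] z by blast
   finally have "h (tens fscale fscale \<xi> \<Phi>) = 0" .
   hence "tens fscale fscale \<xi> \<Phi> \<in> {t \<in> tens_space fscale fscale Dist (V_ev lam). h t = 0}"
    using tens_in_space[OF \<xi> \<Phi>] by blast
   hence "tens fscale fscale \<xi> \<Phi> \<in> module.span fscale
     {tens fscale fscale (conv \<xi> \<eta>) v - tens fscale fscale \<xi> (V_ev_act lam \<eta> v) | \<xi> \<eta> v.
      \<xi> \<in> (Dist :: (('k,'m,'n) glc => 'k) set) & \<eta> \<in> Dist_sub I_parabolic & v \<in> V_ev lam}"
    by (simp only: h(3))
   moreover have "... \<subseteq> {t. t b = 0}"
    by (rule fs.span_minimal) (auto simp: tens_apply[OF b(1)] b(3) fs.subspace_def fscale_def)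
   ultimately have "tens fscale fscale \<xi> \<Phi> b = 0" by blast
   thus ?thesis by (simp add: tens_apply[OF b(1)] b(2)[OF l\<xi>])
  qed
  thus ?thesis by (rule that[OF wN])
 qed
qed

section \<open>Functionals annihilating the modules with given highest weights\<close>

lemma finite_tlt_maximal:
 assumes "finite S" "S ~= {}"
 obtains \<mu> where "\<mu> \<in> S" "!!\<nu>. \<nu> \<in> S ==> ~ tlt m n \<mu> \<nu>"
proof -
 have "EX \<mu>:S. ALL \<nu>:S. \<nu> ~= \<mu> --> ~ tlt m n \<mu> \<nu>"
  by (rule Finite_Set.bex_max_element[OF assms(1) _ _ assms(2)])
   (auto simp: asymp_on_def transp_on_def tlt_def)
 then obtain \<mu> where \<mu>: "\<mu> \<in> S" "ALL \<nu>:S. \<nu> ~= \<mu> --> ~ tlt m n \<mu> \<nu>" by blast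
 moreover have "~ tlt m n \<mu> \<mu>" by (simp add: tlt_def)
 ultimately show ?thesis by (intro that[of \<mu>]) auto
qed

context comod
begin

lemma wproj_lattice:
 assumes "wp \<mu> v ~= 0"
 shows "\<mu> \<in> weight_lattice LENGTH('m) LENGTH('n)"
proof (rule ccontr)
 assume n: "\<mu> \<notin> weight_lattice LENGTH('m) LENGTH('n)"
 have "wform ((=) \<mu>) a = 0" for a :: "('k,'m,'n) glc"
  unfolding wform_def coeff_sum_def
  by (rule sum.neutral) (use torus_keys_lattice[of a] n in auto)
 hence "wform ((=) \<mu>) = (%a :: ('k,'m,'n) glc. 0)" by auto
 thus False using assms by (simp add: ract_zero_form)
qed

lemma wproj_idem: "v \<in> C ==> wp \<mu> (wp \<mu> v) = wp \<mu> v"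
 by (simp add: wproj_wproj)

lemma finite_span_weights:
 assumes "finite B"
 shows "finite {\<nu>. EX v:span B. wp \<nu> v ~= 0}"
proof -
 have "EX S. finite S & (ALL \<nu>. \<nu> \<notin> S --> wp \<nu> b = 0)" for b
 proof -
  obtain S where S: "finite S" "S \<subseteq> weight_lattice LENGTH('m) LENGTH('n)"
   "!!Q. ract (wform Q) b = (\<Sum>\<mu>\<in>S. s (of_bool (Q \<mu>)) (wp \<mu> b))"
   by (rule wproj_finite[of b]) (rule that)
  have "wp \<nu> b = 0" if "\<nu> \<notin> S" for \<nu>
  proof -
   have "(\<Sum>\<mu>\<in>S. s (of_bool (\<nu> = \<mu>)) (wp \<mu> b)) = 0"
    by (rule sum.neutral) (use that in auto)
   thus ?thesis using S(3)[of "(=) \<nu>"] by (rule trans[rotated])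
  qed
  thus ?thesis using S(1) by blast
 qed
 then obtain S where S: "!!b. finite (S b)" "!!b \<nu>. \<nu> \<notin> S b ==> wp \<nu> b = 0" by metis
 have "{\<nu>. EX v:span B. wp \<nu> v ~= 0} \<subseteq> (\<Union>b\<in>B. S b)"
 proof
  fix \<nu> assume "\<nu> \<in> {\<nu>. EX v:span B. wp \<nu> v ~= 0}"
  then obtain v where v: "v \<in> span B" "wp \<nu> v ~= 0" by blast
  show "\<nu> \<in> (\<Union>b\<in>B. S b)"
  proof (rule ccontr)
   assume "\<nu> \<notin> (\<Union>b\<in>B. S b)"
   hence "B \<subseteq> {x. wp \<nu> x = 0}" using S(2) by blast
   moreover have "subspace {x. wp \<nu> x = 0}"
    by (rule subspaceI) (simp_all add: ract_zero[OF lf_wform] ract_add[OF lf_wform] ract_scale[OF lf_wform])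
   ultimately have "span B \<subseteq> {x. wp \<nu> x = 0}" by (rule span_minimal)
   thus False using v by blast
  qed
 qed
 thus ?thesis using assms S(1) by (meson finite_UN_I finite_subset)
qed

end

lemma G_hom_ract:
 assumes M: "precomod (sc M) (coact M)" and L: "precomod (sc L) (coact L)"
  and h: "G_hom M L h" and v: "v \<in> carrier M" and g: "lfA g"
 shows "h (precomod.ract (sc M) (coact M) g v) = precomod.ract (sc L) (coact L) g (h v)"
proof -
 interpret M: precomod "sc M" "coact M" by (rule M)
 interpret L: precomod "sc L" "coact L" by (rule L)
 interpret h: Vector_Spaces.linear "sc M" "sc L" h using h by (simp add: G_hom_def)
 show ?thesis
 proof (rule lf_separate[OF L.vs])
  fix \<phi> assume \<phi>: "lf (sc L) \<phi>"
  have \<phi>h: "lf (sc M) (%x. \<phi> (h x))" using \<phi> by (simp add: lf_def h.add h.scale)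
  have "\<phi> (L.ract g (h v)) = coact M v (%x a. \<phi> (h x) * g a)"
   using h v L.bil_prod[OF \<phi> g] by (simp add: L.lf_ract[OF g \<phi>] G_hom_def)
  thus "\<phi> (h (M.ract g v)) = \<phi> (L.ract g (h v))" by (simp add: M.lf_ract[OF g \<phi>h])
 qed
qed

context odd_char
begin

text \<open>The weights of the whole comodule generated by \<open>f\<close>, a finite set that
  contains those of \<open>f\<close>.\<close>

definition wts :: "('k,'m,'n) glc => (nat => int) set"
 where "wts f = {\<nu>. EX g. lfA g & reg.wp \<nu> (reg.ract g f) ~= 0}"

lemma wts_lattice: "wts f \<subseteq> weight_lattice LENGTH('m) LENGTH('n)"
 unfolding wts_def using reg.wproj_lattice by blast

lemma finite_wts: "finite (wts f)"
proof -
 obtain B where B: "finite B" "!!g. lfA g ==> reg.ract g f \<in> glc.span B"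
  by (rule reg.ract_finite[of f]) (rule that)
 hence "wts f \<subseteq> {\<nu>. EX v:glc.span B. reg.wp \<nu> v ~= 0}" unfolding wts_def by blast
 thus ?thesis using reg.finite_span_weights[OF B(1)] by (rule finite_subset)
qed

lemma wts_self: "reg.wp \<nu> f ~= 0 ==> \<nu> \<in> wts f"
 unfolding wts_def using lf_counit reg.ract_counit[of f] by (intro CollectI exI[of _ counit]) simp

lemma reflection_block_perm:
 assumes "i + 1 < LENGTH('m) \<or> LENGTH('m) <= i & i + 1 < LENGTH('m) + LENGTH('n)"
 shows "block_perm TYPE('k) TYPE('m) TYPE('n) (%j. if j = i then i + 1 else if j = i + 1 then i else j)"
 using assms two by unfold_locales (auto simp: idx_par_def)

text \<open>A violation of dominance is an ascending pair of neighbours. The corresponding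
  reflection preserves \<open>N2\<close>, and, being an involution, it also preserves the complement
  of \<open>N1\<close>; it would move \<open>x\<close> to a higher weight. The pair
  \<open>N1\<close>, \<open>N2\<close> stands for a subquotient.\<close>

lemma top_weight_dominant:
 assumes cl: "!!x g. x \<in> N1 ==> lfA g ==> reg.ract g x \<in> N1" "!!x g. x \<in> N2 ==> lfA g ==> reg.ract g x \<in> N2"
  and x: "x \<in> N2" "x \<notin> N1" "reg.wp lam x = x" and lam: "lam \<in> weight_lattice LENGTH('m) LENGTH('n)"
  and top: "!!\<nu> y. y \<in> N2 ==> y \<notin> N1 ==> reg.wp \<nu> y = y ==> ~ tlt LENGTH('m) LENGTH('n) lam \<nu>"
 shows "lam \<in> dominant_weights LENGTH('m) LENGTH('n)"
proof (rule ccontr)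
 assume "lam \<notin> dominant_weights LENGTH('m) LENGTH('n)"
 then obtain i where i: "i + 1 < LENGTH('m) \<or> LENGTH('m) <= i & i + 1 < LENGTH('m) + LENGTH('n)" "lam i < lam (i + 1)"
  using not_dominant[of lam] lam by blast
 let ?\<sigma> = "%j. if j = i then i + 1 else if j = i + 1 then i else j"
 interpret P: block_perm ty ?\<sigma> by (rule reflection_block_perm[OF i(1)])
 have "lam \<circ> ?\<sigma> = \<mu> \<circ> ?\<sigma> \<longleftrightarrow> lam = \<mu>" for \<mu> :: "nat => int"
 proof
  assume "lam \<circ> ?\<sigma> = \<mu> \<circ> ?\<sigma>"
  hence "(lam \<circ> ?\<sigma>) (?\<sigma> j) = (\<mu> \<circ> ?\<sigma>) (?\<sigma> j)" for j by (simp only:)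
  thus "lam = \<mu>" unfolding o_def P.invol by (rule ext)
 qed simp
 hence e: "(%\<mu>. lam \<circ> ?\<sigma> = \<mu> \<circ> ?\<sigma>) = ((=) lam)" by (intro ext)
 have "reg.wp (lam \<circ> ?\<sigma>) (reg.ract P.pt x) = reg.ract P.pt (reg.wp lam x)"
  by (simp only: reg.ract_ract[OF UNIV_I lf_wform P.lf_pt] P.convu_wform_pt e reg.ract_ract[OF UNIV_I P.lf_pt lf_wform, symmetric])
 hence "reg.wp (lam \<circ> ?\<sigma>) (reg.ract P.pt x) = reg.ract P.pt x" by (simp only: x(3))
 moreover have "reg.ract P.pt x \<notin> N1" using cl(1)[OF _ P.lf_pt, of "reg.ract P.pt x"] x(2) by (auto simp: P.pt_pt)
 ultimately show False using top[OF cl(2)[OF x(1) P.lf_pt]] reflection_raises[OF i] by blast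
qed

lemma top_dominant:
 assumes lam: "lam \<in> wts f" and top: "!!\<nu>. \<nu> \<in> wts f ==> ~ tlt LENGTH('m) LENGTH('n) lam \<nu>"
 shows "lam \<in> dominant_weights LENGTH('m) LENGTH('n)"
proof -
 obtain g where g: "lfA g" "reg.wp lam (reg.ract g f) ~= 0" using lam by (auto simp: wts_def)
 let ?N = "{reg.ract g f | g. lfA g}" and ?x = "reg.wp lam (reg.ract g f)"
 show ?thesis
 proof (rule top_weight_dominant[of "{0}" ?N ?x])
  show "reg.ract g x \<in> {0}" if "x \<in> {0}" "lfA g" for x g using that by (simp add: reg.ract_zero)
  show cl: "reg.ract g x \<in> ?N" if "x \<in> ?N" "lfA g" for x g
   using that by (auto simp: reg.ract_ract intro: lf_convu')
  show "?x \<in> ?N" using cl[OF _ lf_wform] g(1) by blast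
  show "?x \<notin> {0}" "reg.wp lam ?x = ?x" using g(2) by (simp_all add: reg.wproj_idem)
  show "lam \<in> weight_lattice LENGTH('m) LENGTH('n)" using wts_lattice lam by blast
  show "~ tlt LENGTH('m) LENGTH('n) lam \<nu>" if "y \<in> ?N" "y \<notin> {0}" "reg.wp \<nu> y = y" for \<nu> y
   using that by (intro top) (auto simp: wts_def)
 qed
qed

end

section \<open>Matrix coefficients of a single module of the family\<close>

locale weyl_cover = odd_char ty for ty :: "('k::field,'m::len0,'n::len0) glc itself" +
 fixes lam :: "nat => int" and M :: "('k, 'm, 'n, 'v::ab_group_add) gsmod"
 assumes lattice: "lam \<in> weight_lattice LENGTH('m) LENGTH('n)"
  and M: "G_supermodule M" "finite_dimensional M"
  and V: "EX N. subsupermodule M N & is_V_minus lam (M\<lparr>carrier := N\<rparr>)"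
  and H0: "EX q. G_hom M (H0_minus lam) q & q ` carrier M = carrier (H0_minus lam)"
  and below: "!!\<mu>. \<mu> \<in> weights M ==> weight_le LENGTH('m) LENGTH('n) \<mu> lam"
  and dim1: "vector_space.dim (sc M) (weight_space M lam) = 1"
begin

sublocale supermod M by unfold_locales (rule M(1))

lemma weight_below:
 assumes "v \<in> carrier M" "wp \<mu> v ~= 0"
 shows "weight_le LENGTH('m) LENGTH('n) \<mu> lam"
proof (rule below)
 have "wp \<mu> v \<in> weight_space M \<mu>"
  by (rule weight_space_mem[OF M(1) two closed[OF assms(1) lf_wform]]) (rule wproj_idem[OF assms(1)])
 thus "\<mu> \<in> weights M"
  using assms(2) wproj_lattice[OF assms(2)] unfolding weights_def by auto
qed

lemma weight_line:
 assumes v: "v \<in> carrier M" "wp lam v = v"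
  and w: "w \<in> carrier M" "wp lam w = w" "w ~= 0"
 obtains c where "v = sc M c w"
proof -
 obtain B where B: "B \<subseteq> weight_space M lam" "weight_space M lam \<subseteq> span B" "card B = dim (weight_space M lam)"
  by (rule basis_exists) (rule that)
 then obtain b where b: "B = {b}" using dim1 by (auto simp: card_1_singleton_iff)
 have "v \<in> span {b}" "w \<in> span {b}"
  using weight_space_mem[OF M(1) two v] weight_space_mem[OF M(1) two w(1,2)] B(2) b by auto
 then obtain a c where a: "v = sc M a b" and c: "w = sc M c b" by (auto simp: span_singleton)
 hence "c ~= 0" using w(3) by auto
 hence "v = sc M (a / c) w" by (simp add: a c)
 thus ?thesis by (rule that)
qed

definition coefficients :: "('k,'m,'n) glc set"
 where "coefficients = {tau \<theta> y | \<theta> y. lf (sc M) \<theta> & y \<in> carrier M}"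

text \<open>The coefficients of \<open>w\<close> span a finite-dimensional space. If
  \<open>e\<close> were outside, a distribution would kill that space but not \<open>e\<close>;
  killing all coefficients of \<open>w\<close> means killing \<open>w\<close>, which contradicts
  \<open>highest_weight_vector\<close>. Projecting \<open>w\<close> to weight \<open>lam\<close> is
  harmless, since \<open>e\<close> has this weight.\<close>

lemma highest_weight_coefficient:
 obtains w where "w \<in> carrier M" "wp lam w = w"
  "!!e :: ('k,'m,'n) glc. highest_weight lam e ==> EX \<theta>. lf (sc M) \<theta> & e = tau \<theta> w"
proof -
 obtain N where N: "subsupermodule M N" "is_V_minus lam (M\<lparr>carrier := N\<rparr>)" using V by blast
 have NM: "N \<subseteq> carrier M" using N(1) by (simp add: subsupermodule_def)
 obtain w where w: "w \<in> carrier M"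
  "!!(e :: ('k,'m,'n) glc) \<xi>. highest_weight lam e ==> \<xi> \<in> Dist ==> ract \<xi> w = 0 ==> \<xi> e = 0"
  by (rule highest_weight_vector[OF M(1) two NM N(2)]) (rule that)
 have coef: "EX \<theta>. lf (sc M) \<theta> & e = tau \<theta> w" if e: "highest_weight lam e" for e :: "('k,'m,'n) glc"
 proof (rule ccontr)
  assume neg: "\<nexists>\<theta>. lf (sc M) \<theta> & e = tau \<theta> w"
  define X where "X = {tau \<theta> w | \<theta>. lf (sc M) \<theta>}"
  obtain B0 where B0: "finite B0" "!!\<phi>. lf (sc M) \<phi> ==> tau \<phi> w \<in> glc.span B0"
   by (rule tau_finite[of w]) (rule that)
  have lf0: "lf (sc M) (%x. 0)" by (simp add: lf_def)
  have X: "glc.subspace X"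
  proof (rule glc.subspaceI)
   show "0 \<in> X" unfolding X_def using lf0 tau_zero_form[of w] by (intro CollectI exI[of _ "%x. 0"]) simp
   show "x + y \<in> X" if xy: "x \<in> X" "y \<in> X" for x y
   proof -
    obtain \<theta> \<theta>' where "lf (sc M) \<theta>" "lf (sc M) \<theta>'" "x = tau \<theta> w" "y = tau \<theta>' w"
     using xy unfolding X_def by blast
    thus ?thesis unfolding X_def using tau_plus_form[of \<theta> \<theta>' w] lf_plus[of "sc M" \<theta> \<theta>']
     by (intro CollectI exI[of _ "%x. \<theta> x + \<theta>' x"]) simp
   qed
   show "scA c x \<in> X" if x: "x \<in> X" for c x
   proof -
    obtain \<theta> where "lf (sc M) \<theta>" "x = tau \<theta> w" using x unfolding X_def by blast
    thus ?thesis unfolding X_def using tau_cmult_form[of \<theta> c w] lf_cmult[of "sc M" \<theta> c]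
     by (intro CollectI exI[of _ "%x. c * \<theta> x"]) simp
   qed
  qed
  have XB0: "X \<subseteq> glc.span B0" unfolding X_def using B0(2) by blast
  obtain B \<phi> where B: "finite B" "B \<subseteq> X" "!!x. x \<in> B ==> lfA (\<phi> x)" "!!y. y \<in> X ==> y = (\<Sum>x\<in>B. scA (\<phi> x y) x)"
   by (rule dual_basis[OF vs_glc X B0(1) XB0]) (rule that)
  have "glc.span B \<subseteq> X" by (rule glc.span_minimal[OF B(2) X])
  hence "e \<notin> glc.span B" using neg unfolding X_def by blast
  then obtain \<xi> where \<xi>: "\<xi> \<in> Dist" "!!x. x \<in> B ==> \<xi> x = 0" "\<xi> e ~= 0"
   by (rule Dist_separates[OF B(1)]) (rule that)
  have l\<xi>: "lfA \<xi>" by (rule Dist_lf[OF \<xi>(1)])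
  have "ract \<xi> w = 0"
  proof (rule lf_separate[OF vs])
   fix \<theta> assume \<theta>: "lf (sc M) \<theta>"
   hence x: "tau \<theta> w \<in> X" unfolding X_def by blast
   have "\<xi> (\<Sum>x\<in>B. scA (\<phi> x (tau \<theta> w)) x) = 0" by (simp add: lf_sum[OF l\<xi>] lf_scale[OF l\<xi>] \<xi>(2))
   hence "\<xi> (tau \<theta> w) = 0" by (simp only: B(4)[OF x, symmetric])
   thus "\<theta> (ract \<xi> w) = \<theta> 0" by (simp add: lf_tau[OF l\<xi> \<theta>] lf_zero[OF \<theta>])
  qed
  thus False using w(2)[OF e \<xi>(1)] \<xi>(3) by blast
 qed
 show ?thesis
 proof (rule that[of "wp lam w"])
  show "wp lam w \<in> carrier M" by (rule closed[OF w(1) lf_wform])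
  show "wp lam (wp lam w) = wp lam w" by (rule wproj_idem[OF w(1)])
  fix e :: "('k,'m,'n) glc" assume e: "highest_weight lam e"
  then obtain \<theta> where \<theta>: "lf (sc M) \<theta>" "e = tau \<theta> w" using coef by blast
  have "e = reg.wp lam e" using e by (simp add: highest_weight_def highest_weight_axioms_def)
  also have "... = tau \<theta> (wp lam w)"
   unfolding \<theta>(2) by (rule ract_tau[OF w(1) lf_wform \<theta>(1)])
  finally show "EX \<theta>. lf (sc M) \<theta> & e = tau \<theta> (wp lam w)" using \<theta>(1) by blast
 qed
qed

lemma H0_precomod: "precomod (sc (H0m lam)) (coact (H0_minus lam))"
 using reg.precomod_axioms by (simp add: H0_minus_def regular_def)

lemma H0_ract:
 assumes "G_hom M (H0_minus lam) q" "v \<in> carrier M" "lfA g"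
 shows "q (ract g v) = reg.ract g (q v)"
 using G_hom_ract[OF precomod_axioms H0_precomod assms] by (simp add: H0_minus_def regular_def)

text \<open>Let \<open>Dl\<close> be the weight space \<open>lam\<close> of the comodule generated
  by \<open>f\<close>, with basis \<open>B\<close>. A basis vector \<open>z\<close> is on the one
  hand a coefficient of \<open>w\<close>, with form \<open>\<theta> z\<close>; on the other hand its
  coordinate function yields \<open>h z\<close> in the induced module, lifted to \<open>y z\<close>.
  The form \<open>\<theta> z\<close> applied to the lift yields a coefficient whose part of weight
  \<open>lam\<close> is a multiple of \<open>z\<close>, because weight \<open>lam\<close> of the
  module is the line through \<open>w\<close>.\<close>

lemma remove_highest_weight:
 assumes top: "!!\<nu>. \<nu> \<in> wts f ==> ~ tlt LENGTH('m) LENGTH('n) lam \<nu>"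
 obtains F where "F \<in> glc.span coefficients" "lam \<notin> wts (f - F)"
proof -
 let ?P = "wform ((=) lam) :: ('k,'m,'n) glc => 'k"
 define D where "D = {reg.ract g f | g. lfA g}"
 define Dl where "Dl = {x \<in> D. reg.ract ?P x = x}"
 have D: "glc.subspace D"
 proof (rule glc.subspaceI)
  show "0 \<in> D" unfolding D_def
   using reg.ract_zero_form[of f] lf_cmult[OF lf_counit, of 0] by (intro CollectI exI[of _ "%x. 0"]) simp
 next
  fix x y assume "x \<in> D" "y \<in> D"
  thus "x + y \<in> D" unfolding D_def
   using reg.ract_plus_form[symmetric] lf_plus by blast
 next
  fix c x assume "x \<in> D"
  thus "scA c x \<in> D" unfolding D_def
   using reg.ract_cmult_form[symmetric] lf_cmult by blast
 qed
 have Dcl: "reg.ract g x \<in> D" if "x \<in> D" "lfA g" for x g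
  using that unfolding D_def by (auto simp: reg.ract_ract intro: lf_convu')
 have fD: "f \<in> D"
  unfolding D_def using reg.ract_counit[of f] lf_counit by (intro CollectI exI[of _ counit]) auto
 have Dtop: "reg.wp \<nu> x = 0" if "x \<in> D" "tlt LENGTH('m) LENGTH('n) lam \<nu>" for x \<nu>
  using top[of \<nu>] that unfolding D_def wts_def by blast
 have Dl: "glc.subspace Dl"
  unfolding Dl_def using glc.subspace_0[OF D] glc.subspace_add[OF D] glc.subspace_scale[OF D]
  by (intro glc.subspaceI) (auto simp: reg.ract_zero[OF lf_wform] reg.ract_add[OF lf_wform] reg.ract_scale[OF lf_wform])
 have PDl: "reg.ract ?P (reg.ract g f) \<in> Dl" if "lfA g" for g
  unfolding Dl_def using Dcl[OF Dcl[OF fD that] lf_wform] reg.wproj_idem by simp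
 obtain B0 where B0: "finite B0" "!!g. lfA g ==> reg.ract g f \<in> glc.span B0"
  by (rule reg.ract_finite[of f]) (rule that)
 hence "Dl \<subseteq> glc.span B0" unfolding Dl_def D_def by blast
 then obtain B \<phi> where B: "finite B" "B \<subseteq> Dl" "!!x. x \<in> B ==> lfA (\<phi> x)" "!!y. y \<in> Dl ==> y = (\<Sum>x\<in>B. scA (\<phi> x y) x)"
  by (rule dual_basis[OF vs_glc Dl B0(1)]) (rule that)
 show ?thesis
 proof (cases "Dl = {0}")
  case True
  hence "lam \<notin> wts (f - 0)" using PDl unfolding wts_def by auto
  thus ?thesis by (rule that[OF glc.span_zero])
 next
  case False
  \<comment> \<open>The coordinate of \<open>z\<close> after projection to weight
    \<open>lam\<close>: a form on all of K[G] concentrated in one weight, as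
    \<open>H0_minus_tau\<close> demands.\<close>
  define \<epsilon> where "\<epsilon> z x = \<phi> z (reg.ract ?P x)" for z x
  have l\<epsilon>: "lfA (\<epsilon> z)" if "z \<in> B" for z
   unfolding \<epsilon>_def[abs_def] by (rule reg.lf_compose_ract[OF lf_wform B(3)[OF that]])
  define h where "h z = reg.tau (\<epsilon> z) f" for z
  have hH: "h z \<in> carrier (H0m lam)" if "z \<in> B" for z
   unfolding h_def
  proof (rule H0_minus_tau[OF D Dcl l\<epsilon>[OF that] _ _ fD])
   show "\<epsilon> z (reg.ract ?P x) = \<epsilon> z x" for x by (simp add: \<epsilon>_def reg.wproj_idem)
   show "reg.tau (\<epsilon> z) x = 0"
    if x: "x \<in> D" "reg.wp \<nu> x = x" "tlt LENGTH('m) LENGTH('n) lam \<nu>" for x \<nu>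
    using Dtop[OF x(1,3)] x(2) reg.tau_zero[OF l\<epsilon>[OF \<open>z \<in> B\<close>]] by simp
  qed
  have gh: "g (h z) = \<phi> z (reg.ract ?P (reg.ract g f))" if "lfA g" "z \<in> B" for g z
   unfolding h_def by (simp add: reg.lf_tau[OF that(1) l\<epsilon>[OF that(2)]] \<epsilon>_def)
  obtain q where q: "G_hom M (H0_minus lam) q" "q ` carrier M = carrier (H0_minus lam)" using H0 by blast
  have "ALL z:B. EX y. y \<in> carrier M & q y = h z" using hH q(2) by (metis imageE)
  from bchoice[OF this] obtain y where y: "ALL z:B. y z \<in> carrier M & q (y z) = h z" by (elim exE)
  obtain w where w: "w \<in> carrier M" "ract ?P w = w"
   "!!e :: ('k,'m,'n) glc. highest_weight lam e ==> EX \<theta>. lf (sc M) \<theta> & e = tau \<theta> w"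
   by (rule highest_weight_coefficient) (rule that)
  have "highest_weight lam z" if z: "z \<in> B" for z
  proof unfold_locales
   show "lam \<in> weight_lattice LENGTH('m) LENGTH('n)" by (rule lattice)
   show "reg.ract ?P z = z" using z B(2) by (auto simp: Dl_def)
   show "reg.wp \<nu> (reg.ract g z) = 0" if "lfA g" "tlt LENGTH('m) LENGTH('n) lam \<nu>" for g \<nu>
    by (rule Dtop[OF Dcl[OF _ that(1)] that(2)]) (use z B(2) in \<open>auto simp: Dl_def\<close>)
  qed
  hence "ALL z:B. EX \<theta>. lf (sc M) \<theta> & z = tau \<theta> w" using w(3) by blast
  from bchoice[OF this] obtain \<theta> where \<theta>: "ALL z:B. lf (sc M) (\<theta> z) & z = tau (\<theta> z) w" by (elim exE)
  have w0: "w ~= 0"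
  proof
   assume "w = 0"
   hence "z = 0" if "z \<in> B" for z using \<theta> that tau_zero[of "\<theta> z"] by auto
   hence "v = 0" if "v \<in> Dl" for v using B(4)[OF that] by (metis (no_types, lifting) glc.scale_zero_right sum.neutral)
   thus False using False glc.subspace_0[OF Dl] by blast
  qed
  \<comment> \<open>The scalar by which multiples of \<open>w\<close> are measured in the induced
    module: the value at the identity of the image of \<open>s w\<close> is
    \<open>s * c\<close>.\<close>
  define c where "c = counit (q w)"
  have s: "EX s. ract ?P (ract g (y z)) = sc M s w & s * c = g (h z)" if g: "lfA g" and z: "z \<in> B" for g z
  proof -
   have yz: "y z \<in> carrier M" "q (y z) = h z" using y z by auto
   have gy: "ract g (y z) \<in> carrier M" by (rule closed[OF yz(1) g])
   obtain s where s: "ract ?P (ract g (y z)) = sc M s w"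
    by (rule weight_line[OF closed[OF gy lf_wform] wproj_idem[OF gy] w(1,2) w0]) (rule that)
   interpret q: Vector_Spaces.linear "sc M" scA q
    using q(1) by (simp add: G_hom_def H0_minus_def regular_def)
   have "s * c = counit (q (sc M s w))" by (simp add: c_def q.scale counit_scale)
   also have "... = counit (reg.ract ?P (reg.ract g (h z)))"
    unfolding s[symmetric] H0_ract[OF q(1) gy lf_wform] H0_ract[OF q(1) yz(1) g] yz(2) ..
   also have "... = counit (reg.ract g (h z))"
    by (rule H0_minus_counit[OF H0_minus_closed[OF hH[OF z] g] lattice])
   also have "... = g (h z)" by (rule counit_ract[OF g])
   finally show ?thesis using s by blast
  qed
  \<comment> \<open>If \<open>c\<close> were 0, every value \<open>g (h z)\<close> would vanish.
    These values are the coordinates of all elements of \<open>Dl\<close>, which is not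
    zero.\<close>
  have c0: "c ~= 0"
  proof
   assume c: "c = 0"
   have "\<phi> z v = 0" if zv: "z \<in> B" "v \<in> Dl" for z v
   proof -
    obtain g where g: "lfA g" "v = reg.ract g f" using zv(2) by (auto simp: Dl_def D_def)
    have "g (h z) = 0" using s[OF g(1) zv(1)] c by auto
    thus ?thesis using gh[OF g(1) zv(1)] zv(2) g(2) by (simp add: Dl_def)
   qed
   hence "v = 0" if "v \<in> Dl" for v using B(4)[OF that] that by simp
   thus False using False glc.subspace_0[OF Dl] by blast
  qed
  \<comment> \<open>The factor is \<open>c\<close> and not its inverse: the weight
    \<open>lam\<close> part of the coefficient is \<open>s\<close> times \<open>z\<close>, and the
    coordinate to be matched is \<open>s * c\<close>.\<close>
  define F where "F = (\<Sum>z\<in>B. scA c (tau (\<theta> z) (y z)))"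
  have "F \<in> glc.span coefficients"
   unfolding F_def
  proof (intro glc.span_sum glc.span_scale glc.span_base)
   show "tau (\<theta> z) (y z) \<in> coefficients" if "z \<in> B" for z
    unfolding coefficients_def using \<theta> y that by blast
  qed
  moreover have "lam \<notin> wts (f - F)"
  proof -
   have "reg.ract ?P (reg.ract g F) = reg.ract ?P (reg.ract g f)" if g: "lfA g" for g
   proof -
    have t: "reg.ract ?P (reg.ract g (scA c (tau (\<theta> z) (y z)))) = scA (\<phi> z (reg.ract ?P (reg.ract g f))) z"
     if z: "z \<in> B" for z
    proof -
     have \<theta>z: "lf (sc M) (\<theta> z)" "tau (\<theta> z) w = z" using \<theta> z by auto
     have yz: "y z \<in> carrier M" using y z by auto
     obtain s where s: "ract ?P (ract g (y z)) = sc M s w" "s * c = g (h z)" using s[OF g z] by blast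
     have "reg.ract ?P (reg.ract g (scA c (tau (\<theta> z) (y z)))) = scA c (tau (\<theta> z) (ract ?P (ract g (y z))))"
      by (simp add: reg.ract_scale g lf_wform ract_tau[OF yz g \<theta>z(1)] ract_tau[OF closed[OF yz g] lf_wform \<theta>z(1)])
     also have "... = scA (s * c) z"
      by (simp add: s(1) tau_scale[OF \<theta>z(1)] \<theta>z(2) mult.commute)
     finally show ?thesis by (simp only: s(2) gh[OF g z])
    qed
    have "reg.ract ?P (reg.ract g F) = (\<Sum>z\<in>B. scA (\<phi> z (reg.ract ?P (reg.ract g f))) z)"
     unfolding F_def reg.ract_sum[OF g] reg.ract_sum[OF lf_wform] by (rule sum.cong[OF refl t])
    also have "... = reg.ract ?P (reg.ract g f)" by (rule B(4)[OF PDl[OF g], symmetric])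
    finally show ?thesis .
   qed
   thus ?thesis
    unfolding wts_def by (auto simp: reg.ract_diff lf_wform)
  qed
  ultimately show ?thesis by (rule that)
 qed
qed

lemma coefficients_span_closed:
 assumes "F \<in> glc.span coefficients" "lfA g"
 shows "reg.ract g F \<in> glc.span coefficients"
proof -
 have "glc.span coefficients \<subseteq> {F. reg.ract g F \<in> glc.span coefficients}"
 proof (rule glc.span_minimal)
  show "coefficients \<subseteq> {F. reg.ract g F \<in> glc.span coefficients}"
  proof
   fix x assume "x \<in> coefficients"
   then obtain \<theta> y where x: "lf (sc M) \<theta>" "y \<in> carrier M" "x = tau \<theta> y" by (auto simp: coefficients_def)
   have "reg.ract g x = tau \<theta> (ract g y)" unfolding x(3) by (rule ract_tau[OF x(2) assms(2) x(1)])
   thus "x \<in> {F. reg.ract g F \<in> glc.span coefficients}"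
    using closed[OF x(2) assms(2)] x(1) by (auto simp: coefficients_def intro!: glc.span_base)
  qed
  show "glc.subspace {F. reg.ract g F \<in> glc.span coefficients}"
   by (rule glc.subspaceI) (auto simp: reg.ract_zero[OF assms(2)] reg.ract_add[OF assms(2)] reg.ract_scale[OF assms(2)]
     intro: glc.span_add glc.span_scale glc.span_zero)
 qed
 thus ?thesis using assms(1) by blast
qed

lemma coefficients_wts:
 assumes "F \<in> glc.span coefficients" "\<nu> \<in> wts F"
 shows "weight_le LENGTH('m) LENGTH('n) \<nu> lam"
proof (rule ccontr)
 assume neg: "~ weight_le LENGTH('m) LENGTH('n) \<nu> lam"
 have "glc.span coefficients \<subseteq> {F. reg.wp \<nu> F = 0}"
 proof (rule glc.span_minimal)
  show "coefficients \<subseteq> {F. reg.wp \<nu> F = 0}"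
  proof
   fix x assume "x \<in> coefficients"
   then obtain \<theta> y where x: "lf (sc M) \<theta>" "y \<in> carrier M" "x = tau \<theta> y" by (auto simp: coefficients_def)
   have "wp \<nu> y = 0" using weight_below[OF x(2)] neg by blast
   thus "x \<in> {F. reg.wp \<nu> F = 0}"
    by (simp add: x(3) ract_tau[OF x(2) lf_wform x(1)] tau_zero[OF x(1)])
  qed
  show "glc.subspace {F. reg.wp \<nu> F = 0}"
   by (rule glc.subspaceI) (simp_all add: reg.ract_zero[OF lf_wform] reg.ract_add[OF lf_wform] reg.ract_scale[OF lf_wform])
 qed
 thus False using assms coefficients_span_closed[OF assms(1)] unfolding wts_def by blast
qed

end

lemma not_tltD: "~ tlt m n lam \<nu> ==> wd m \<nu> < wd m lam \<or> wd m \<nu> = wd m lam & wl m n \<nu> <= wl m n lam"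
 unfolding tlt_def by linarith

section \<open>Parity and coaction of matrix coefficients\<close>

context supermod
begin

lemma hcomp_tau:
 assumes v: "v \<in> carrier M" "v \<in> par M s" and \<psi>: "lf (sc M) \<psi>" "!!x. \<psi> (hc p x) = \<psi> x"
 shows "hcA r (tau \<psi> v) = (if r = (p ~= s) then tau \<psi> v else 0)"
proof (rule lf_separate[OF vs_glc])
 fix g :: "('k,'m,'n) glc => 'k" assume g: "lfA g"
 have lr: "lfA (%a. g (hcA r a))" by (rule lf_hcomp_glc[OF g])
 have hh: "hcA r (hcA (p ~= s) a) = (if r = (p ~= s) then hcA (p ~= s) a else 0)" for a :: "('k,'m,'n) glc"
  by (rule hcomp_hcomp[OF superspace_glc[OF two]])
 have "g (hcA r (tau \<psi> v)) = \<psi> (ract (%a. g (hcA r a)) v)"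
  by (rule lf_tau[OF lr \<psi>(1)])
 also have "... = \<psi> (hc p (ract (%a. g (hcA r a)) v))" by (rule \<psi>(2)[symmetric])
 also have "... = \<psi> (ract (%a. g (hcA r (hcA (p ~= s) a))) v)"
  by (simp only: hc_ract[OF v lr])
 finally have e: "g (hcA r (tau \<psi> v)) = \<psi> (ract (%a. g (hcA r (hcA (p ~= s) a))) v)" .
 show "g (hcA r (tau \<psi> v)) = g (if r = (p ~= s) then tau \<psi> v else 0)"
 proof (cases "r = (p ~= s)")
  case True
  have "g (hcA r (tau \<psi> v)) = \<psi> (ract (%a. g (hcA (p ~= s) a)) v)"
   unfolding e hh if_P[OF True] by (rule refl)
  also have "... = \<psi> (hc p (ract g v))" by (simp only: hc_ract[OF v g])
  also have "... = g (tau \<psi> v)" by (simp only: \<psi>(2) lf_tau[OF g \<psi>(1)])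
  finally show ?thesis unfolding if_P[OF True] .
 next
  case False
  show ?thesis unfolding e hh if_not_P[OF False] lf_zero[OF g] ract_zero_form lf_zero[OF \<psi>(1)] by (rule refl)
 qed
qed

lemma hcomp_tau':
 assumes v: "v \<in> carrier M" and \<psi>: "lf (sc M) \<psi>" "!!x. \<psi> (hc p x) = \<psi> x"
 shows "hcA r (tau \<psi> v) = tau \<psi> (hc (r ~= p) v)"
proof -
 have h: "hcA r (tau \<psi> (hc s v)) = (if r = (p ~= s) then tau \<psi> (hc s v) else 0)" for s
  by (rule hcomp_tau[OF G_supermodule_hcomp[OF G v] hcomp_mem[OF superspace] \<psi>])
 have "tau \<psi> v = tau \<psi> (hc False v) + tau \<psi> (hc True v)"
  by (simp only: tau_add[OF \<psi>(1), symmetric] hcomp_sum[OF superspace])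
 hence "hcA r (tau \<psi> v) = hcA r (tau \<psi> (hc False v)) + hcA r (tau \<psi> (hc True v))"
  by (simp only: hcomp_glc_linear(1)[OF two])
 thus ?thesis unfolding h by (cases r; cases p) simp_all
qed

text \<open>The homomorphism property of \<open>tau \<phi>\<close> on the level of tensors, which is
  the form required by \<open>G_hom\<close>.\<close>

lemma comult_tau:
 assumes v: "v \<in> carrier M" and \<phi>: "lf (sc M) \<phi>" and b: "bilA b"
 shows "comult (tau \<phi> v) b = coact M v (%x a. b (tau \<phi> x) a)"
proof -
 have lc: "lfA (%a. comult a b)" by (rule lf_comult[OF two])
 have bt: "lfA (b u)" "lfA (%u. b u a)" for u a
  using bilA_lf_right[OF b] bilA_lf_left[OF b] by blast+
 have tri: "trilin (sc M) (%y c a. \<phi> y * b c a)"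
  unfolding trilin_def linear_lf[OF vs_glc]
  by (auto intro!: bil_prod \<phi> bt lf_cmult)
 have "comult (tau \<phi> v) b = coact M v (%x a. \<phi> x * comult a b)" by (rule lf_tau_ca[OF lc \<phi>])
 also have "... = coact M v (%x a. comult a (%c a. \<phi> x * b c a))"
 proof -
  have "\<phi> x * comult a b = comult a (%c d. \<phi> x * b c d)" for x a
   using comult_form_sum[OF two, of "{0::nat}" "%_. b" a "%_. \<phi> x"] b by simp
  thus ?thesis by (simp only:)
 qed
 also have "... = coact M v (%x a. coact M x (%y c. \<phi> y * b c a))"
  by (rule coassoc[OF v tri, symmetric])
 also have "... = coact M v (%x a. b (tau \<phi> x) a)"
  by (simp only: lf_tau_ca[OF bt(2) \<phi>])
 finally show ?thesis .
qed

end

context odd_char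
begin

lemma supermod_regular: "supermod (regular :: ('k, 'm, 'n, ('k,'m,'n) glc) gsmod)"
 using regular_sub[of UNIV] by unfold_locales (simp add: regular_def)

lemma hcomp_ract: "v \<in> glc_par r ==> lfA g ==>
  hcA p (reg.ract g v) = reg.ract (%a. g (hcA (p ~= r) a)) (v :: ('k,'m,'n) glc)"
 using supermod.hc_ract[OF supermod_regular, of v r g p] by (simp add: regular_def)

lemma regular_hcomp_tau: "lfA \<psi> ==> (!!x. \<psi> (hcA p x) = \<psi> x) ==>
  hcA r (reg.tau \<psi> v) = reg.tau \<psi> (hcA (r ~= p) (v :: ('k,'m,'n) glc))"
 using supermod.hcomp_tau'[OF supermod_regular, of v \<psi> p r] by (simp add: regular_def)

lemma regular_comult_tau: "lfA \<phi> ==> bilA b ==>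
  comult (reg.tau \<phi> v) b = comult (v :: ('k,'m,'n) glc) (%x a. b (reg.tau \<phi> x) a)"
 using supermod.comult_tau[OF supermod_regular, of v \<phi> b] by (simp add: regular_def)

lemma hcomp_wproj: "hcA p (reg.ract (wform Q) v) = reg.ract (wform Q) (hcA p (v :: ('k,'m,'n) glc))"
proof -
 have pin: "pinv (reg.ract (wform Q) v) = reg.ract (wform Q) (pinv v)"
 proof (rule lf_separate[OF vs_glc])
  fix h :: "('k,'m,'n) glc => 'k" assume h: "lfA h"
  have lh: "lfA (%a. h (pinv a))" using lf_sig[OF h, of True] by (simp add: sig_def)
  have "h (reg.ract (wform Q) (pinv v)) = comult v (%x a. h (pinv x) * wform Q (pinv a))"
   by (simp only: reg.lf_ract[OF lf_wform h] comult_pinv[OF two bilA_prod[OF h lf_wform]])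
  also have "... = comult v (%x a. h (pinv x) * wform Q a)" by (simp only: wform_def torus_pinv)
  also have "... = h (pinv (reg.ract (wform Q) v))" by (rule reg.lf_ract[OF lf_wform lh, symmetric])
  finally show "h (pinv (reg.ract (wform Q) v)) = h (reg.ract (wform Q) (pinv v))" by (rule sym)
 qed
 have "psign p True * a = scA (psign p True) a" for a :: "('k,'m,'n) glc"
  by (cases p) (simp_all add: psign_def)
 thus ?thesis
  by (simp add: hcomp_glc[OF two] pin reg.ract_scale[OF lf_wform] reg.ract_add[OF lf_wform])
qed

end

section \<open>Functionals killing the coefficients kill the truncation\<close>

locale truncation = odd_char ty for ty :: "('k::field,'m::len0,'n::len0) glc itself" +
 fixes \<Gamma> :: "(nat => int) set" and W :: "(nat => int) => ('k, 'm, 'n, 'w::ab_group_add) gsmod"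
 assumes ideal: "weight_ideal LENGTH('m) LENGTH('n) \<Gamma>"
  and cover: "lam \<in> \<Gamma> ==> weyl_cover lam (W lam)"
begin

definition bounded_wts :: "(nat => int) set => bool"
 where "bounded_wts S \<longleftrightarrow> (ALL \<nu>:S. EX \<gamma>:\<Gamma>. weight_le LENGTH('m) LENGTH('n) \<nu> \<gamma>)"

lemma dominant_bounded:
 assumes "lam \<in> dominant_weights LENGTH('m) LENGTH('n)" "\<gamma> \<in> \<Gamma>" "weight_le LENGTH('m) LENGTH('n) lam \<gamma>"
 shows "lam \<in> \<Gamma>"
 using ideal assms unfolding weight_ideal_def by blast

text \<open>Repeated removal of a highest weight by \<open>remove_highest_weight\<close>. The
  removed coefficients are killed by \<open>\<xi>\<close>, and the new weights are strictly below
  the removed one. Fixing the component \<open>\<nu>0\<close> makes the process finite: degrees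
  below that of \<open>\<nu>0\<close> are irrelevant.\<close>

lemma annihilated_component:
 assumes l\<xi>: "lfA \<xi>" and \<xi>: "!!lam x. lam \<in> \<Gamma> ==> x \<in> glc.span (weyl_cover.coefficients (W lam)) ==> \<xi> x = 0"
  and f: "bounded_wts (wts f)"
 shows "\<xi> (reg.wp \<nu>0 f) = 0"
proof -
 let ?d = "wd LENGTH('m)" and ?l = "wl LENGTH('m) LENGTH('n)" and ?P = "reg.wp \<nu>0"
 let ?r = "less_than <*lex*> less_than <*lex*> less_than"
 have wf: "wf ?r" by auto
 \<comment> \<open>\<open>D\<close> bounds the degrees, \<open>L\<close> bounds \<open>wl\<close>
   among the weights of degree \<open>D\<close>, and the last entry counts the weights that attain
   both bounds.\<close>
 have main: "ALL f D L. p = (nat (D - ?d \<nu>0 + 1), nat L, card {\<nu> \<in> wts f. ?d \<nu> = D & ?l \<nu> = L}) --> bounded_wts (wts f) -->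
  (ALL \<nu>:wts f. ?d \<nu> < D \<or> ?d \<nu> = D & ?l \<nu> <= L) --> \<xi> (?P f) = 0" for p
 proof (induction p rule: wf_induct_rule[OF wf])
  case (1 p)
  show ?case
  proof (intro allI impI)
   fix f D L
   assume p: "p = (nat (D - ?d \<nu>0 + 1), nat L, card {\<nu> \<in> wts f. ?d \<nu> = D & ?l \<nu> = L})"
    and bnd: "bounded_wts (wts f)" and le: "ALL \<nu>:wts f. ?d \<nu> < D \<or> ?d \<nu> = D & ?l \<nu> <= L"
   have IH: "\<xi> (?P f') = 0"
    if "((nat (D' - ?d \<nu>0 + 1), nat L', card {\<nu> \<in> wts f'. ?d \<nu> = D' & ?l \<nu> = L'}), p) \<in> ?r"
     "bounded_wts (wts f')" "ALL \<nu>:wts f'. ?d \<nu> < D' \<or> ?d \<nu> = D' & ?l \<nu> <= L'" for f' D' L'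
    using 1[OF that(1), rule_format, OF refl that(2)] that(3) by blast
   show "\<xi> (?P f) = 0"
   proof (cases "\<nu>0 \<in> wts f")
    case False
    hence "?P f = 0" using wts_self by blast
    thus ?thesis by (simp add: lf_zero[OF l\<xi>])
   next
    case n0: True
    then obtain lam where lam: "lam \<in> wts f" "!!\<nu>. \<nu> \<in> wts f ==> ~ tlt LENGTH('m) LENGTH('n) lam \<nu>"
     using finite_tlt_maximal[OF finite_wts[of f]] by blast
    have dom: "lam \<in> dominant_weights LENGTH('m) LENGTH('n)" by (rule top_dominant[OF lam])
    show ?thesis
    proof (cases "?d lam = D & ?l lam = L")
     case True
     have "lam \<in> \<Gamma>" using dominant_bounded[OF dom] bnd lam(1) unfolding bounded_wts_def by blast
     then interpret C: weyl_cover ty lam "W lam" by (rule cover)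
     obtain F where F: "F \<in> glc.span C.coefficients" "lam \<notin> wts (f - F)"
      using C.remove_highest_weight[of f, OF lam(2)] by blast
     have sub: "\<nu> \<in> wts f \<or> \<nu> \<in> wts F" if \<nu>: "\<nu> \<in> wts (f - F)" for \<nu>
     proof -
      obtain g where g: "lfA g" "reg.wp \<nu> (reg.ract g (f - F)) ~= 0" using \<nu> by (auto simp: wts_def)
      have "reg.wp \<nu> (reg.ract g f) ~= 0 \<or> reg.wp \<nu> (reg.ract g F) ~= 0"
       using g(2) by (auto simp: reg.ract_diff g(1) lf_wform)
      thus ?thesis using g(1) unfolding wts_def by blast
     qed
     have FW: "weight_le LENGTH('m) LENGTH('n) \<nu> lam" if "\<nu> \<in> wts F" for \<nu>
      by (rule C.coefficients_wts[OF F(1) that])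
     have b': "bounded_wts (wts (f - F))"
      using bnd sub FW \<open>lam \<in> \<Gamma>\<close> unfolding bounded_wts_def by blast
     \<comment> \<open>A weight that was not there before comes from \<open>F\<close>, hence is at
       most \<open>lam\<close>, and it differs from \<open>lam\<close>, which has been removed. It
       cannot refill the counted set.\<close>
     have tl: "tlt LENGTH('m) LENGTH('n) \<nu> lam" if "\<nu> \<in> wts (f - F)" "\<nu> \<notin> wts f" for \<nu>
      using weight_le_tlt[OF FW] sub[OF that(1)] that F(2) by metis
     have le': "?d \<nu> < D \<or> ?d \<nu> = D & ?l \<nu> <= L" if "\<nu> \<in> wts (f - F)" for \<nu>
      using bspec[OF le, of \<nu>] tl[OF that] True unfolding tlt_def by (cases "\<nu> \<in> wts f") (blast, auto)
     have "{\<nu> \<in> wts (f - F). ?d \<nu> = D & ?l \<nu> = L} \<subset> {\<nu> \<in> wts f. ?d \<nu> = D & ?l \<nu> = L}"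
     proof (rule psubsetI)
      show "{\<nu> \<in> wts (f - F). ?d \<nu> = D & ?l \<nu> = L} \<subseteq> {\<nu> \<in> wts f. ?d \<nu> = D & ?l \<nu> = L}"
       using tl True unfolding tlt_def by fastforce
      show "{\<nu> \<in> wts (f - F). ?d \<nu> = D & ?l \<nu> = L} ~= {\<nu> \<in> wts f. ?d \<nu> = D & ?l \<nu> = L}"
       using F(2) lam(1) True by blast
     qed
     hence "card {\<nu> \<in> wts (f - F). ?d \<nu> = D & ?l \<nu> = L} < card {\<nu> \<in> wts f. ?d \<nu> = D & ?l \<nu> = L}"
      by (intro psubset_card_mono) (simp_all add: finite_wts)
     hence "\<xi> (?P (f - F)) = 0" by (intro IH[where f' = "f - F" and D' = D and L' = L] b' ballI le') (simp_all add: p)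
     moreover have "\<xi> (?P F) = 0"
      by (rule \<xi>[OF \<open>lam \<in> \<Gamma>\<close> C.coefficients_span_closed[OF F(1) lf_wform]])
     ultimately show ?thesis by (simp add: reg.ract_diff[OF lf_wform] lf_diff[OF l\<xi>])
    next
     case ne: False
     show ?thesis
     proof (cases "?d lam = D")
      case True
      hence "?l lam < L" using bspec[OF le lam(1)] ne by auto
      \<comment> \<open>The bound \<open>L\<close> is lowered to the value at a dominant weight,
        which is non-negative; this makes the natural number \<open>nat L\<close> decrease
        properly.\<close>
      have "0 <= ?l lam" by (rule wl_dominant[OF dom])
      have "?d \<nu> < D \<or> ?d \<nu> = D & ?l \<nu> <= ?l lam" if "\<nu> \<in> wts f" for \<nu>
       using not_tltD[OF lam(2)[OF that]] unfolding True .
      thus ?thesis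
       using \<open>?l lam < L\<close> \<open>0 <= ?l lam\<close> by (intro IH[where f' = f and D' = D and L' = "?l lam"] bnd ballI) (simp_all add: p)
     next
      case False
      hence "?d lam < D" using le lam(1) by blast
      have top: "?d \<nu> < ?d lam \<or> ?d \<nu> = ?d lam & ?l \<nu> <= ?l lam" if "\<nu> \<in> wts f" for \<nu>
       by (rule not_tltD[OF lam(2)[OF that]])
      \<comment> \<open>As \<open>\<nu>0\<close> is still among the weights, the degree bound does
        not fall below the degree of \<open>\<nu>0\<close>, so the first entry of the measure
        decreases properly.\<close>
      have "?d \<nu>0 <= ?d lam" using top[OF n0] by linarith
      thus ?thesis
       using \<open>?d lam < D\<close> top by (intro IH[where f' = f and D' = "?d lam" and L' = "?l lam"] bnd ballI) (simp_all add: p)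
     qed
    qed
   qed
  qed
 qed
 show ?thesis
 proof (cases "wts f = {}")
  case True
  hence "?P f = 0" using wts_self by blast
  thus ?thesis by (simp add: lf_zero[OF l\<xi>])
 next
  case False
  obtain lam where lam: "lam \<in> wts f" "!!\<nu>. \<nu> \<in> wts f ==> ~ tlt LENGTH('m) LENGTH('n) lam \<nu>"
   using finite_tlt_maximal[OF finite_wts[of f] False] by blast
  have "ALL \<nu>:wts f. ?d \<nu> < ?d lam \<or> ?d \<nu> = ?d lam & ?l \<nu> <= ?l lam"
   using not_tltD[OF lam(2)] by blast
  thus ?thesis using main f by blast
 qed
qed

lemma annihilated:
 assumes l\<xi>: "lfA \<xi>" and \<xi>: "!!lam x. lam \<in> \<Gamma> ==> x \<in> glc.span (weyl_cover.coefficients (W lam)) ==> \<xi> x = 0"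
  and f: "bounded_wts (wts f)"
 shows "\<xi> f = 0"
proof -
 obtain S where S: "finite S" "f = (\<Sum>\<nu>\<in>S. reg.wp \<nu> f)" by (rule reg.wproj_sum[of f]) simp
 have "\<xi> (\<Sum>\<nu>\<in>S. reg.wp \<nu> f) = 0"
  by (simp add: lf_sum[OF l\<xi>] annihilated_component[OF l\<xi> \<xi> f])
 thus ?thesis by (simp only: S(2)[symmetric])
qed

lemma L_minus_subset:
 "carrier (L0m lam) \<subseteq> carrier (H0_minus lam)"
proof -
 have "carrier (L0m lam) =
  glc.span (\<Union>{N. subsupermodule (H0_minus lam) N & simple_supermodule (H0_minus lam\<lparr>carrier := N\<rparr>)})"
  by (simp add: L_minus_def socle_def H0_minus_def regular_def)
 also have "... \<subseteq> carrier (H0_minus lam)"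
  by (rule glc.span_minimal[OF _ H0_minus_subspace]) (auto simp: subsupermodule_def)
 finally show ?thesis .
qed

lemma H0_minus_weights:
 assumes lam: "lam \<in> \<Gamma>" and x: "x \<in> carrier (H0m lam)"
  "reg.wp \<nu> x ~= 0"
 shows "weight_le LENGTH('m) LENGTH('n) \<nu> lam"
proof -
 interpret C: weyl_cover ty lam "W lam" by (rule cover[OF lam])
 obtain q where q: "G_hom (W lam) (H0_minus lam) q" "q ` carrier (W lam) = carrier (H0_minus lam)" using C.H0 by blast
 then obtain y where y: "y \<in> carrier (W lam)" "x = q y" using x(1) by blast
 interpret q: Vector_Spaces.linear "sc (W lam)" scA q
  using q(1) by (simp add: G_hom_def H0_minus_def regular_def)
 have "q (C.wp \<nu> y) ~= 0"
  using x(2) unfolding C.H0_ract[OF q(1) y(1) lf_wform] y(2) .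
 hence "C.wp \<nu> y ~= 0" by (auto simp: q.zero)
 thus ?thesis by (rule C.weight_below[OF y(1)])
qed

text \<open>The isomorphism commutes with weight projections, so the non-zero image of
  \<open>x\<close> is a vector of weight \<open>\<nu>\<close> in the socle of the induced module,
  which is a quotient of \<open>W lam\<close>.\<close>

lemma composition_factor_bound:
 assumes iso: "subquotient_iso (regA N) N1 N2 L"
  and L: "L = L_minus lam \<or> L = parity_shift (L_minus lam)" and lam: "lam \<in> \<Gamma>"
  and x: "x \<in> N2" "x \<notin> N1" "reg.wp \<nu> x = (x :: ('k,'m,'n) glc)"
 shows "weight_le LENGTH('m) LENGTH('n) \<nu> lam"
proof -
 obtain h where h: "G_hom ((regA N)\<lparr>carrier := N2\<rparr>) L h" "h ` N2 = carrier L" "{x \<in> N2. h x = 0} = N1"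
  using iso unfolding subquotient_iso_def by blast
 have scL: "sc L = scA" "coact L = comult"
  using L by (auto simp: L_minus_def socle_def H0_minus_def regular_def parity_shift_def)
 have "h (reg.wp \<nu> x) = reg.wp \<nu> (h x)"
  using G_hom_ract[of "(regA N)\<lparr>carrier := N2\<rparr>" L, OF _ _ h(1) _ lf_wform, of x "(=) \<nu>"] x(1) reg.precomod_axioms
  by (simp add: regular_def scL)
 hence "reg.wp \<nu> (h x) = h x" by (simp only: x(3))
 moreover have "h x ~= 0" using h(3) x(1,2) by blast
 moreover have "h x \<in> carrier (H0m lam)"
 proof -
  have "h x \<in> carrier L" using h(2) x(1) by blast
  hence "h x \<in> carrier (L0m lam)"
   using L by (auto simp: parity_shift_def)
  thus ?thesis using L_minus_subset by blast
 qed
 ultimately show ?thesis using H0_minus_weights[OF lam, of "h x" \<nu>] by simp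
qed

text \<open>Composition factors are seen only through simple subquotients, so one carrying the
  weight \<open>\<nu>\<close> has to be exhibited: the module generated by a vector of weight
  \<open>\<nu>\<close>, modulo a submodule maximal among those that avoid the vector.\<close>

lemma comp_factors_bounded:
 assumes N: "subsupermodule regular N" "comp_factors_in (regA N) \<Gamma>"
  and x: "x \<in> N" "reg.wp \<nu> x ~= (0 :: ('k,'m,'n) glc)"
 shows "EX \<gamma>:\<Gamma>. weight_le LENGTH('m) LENGTH('n) \<nu> \<gamma>"
proof -
 have Nsub: "glc.subspace N" and Ncl: "!!x g. x \<in> N ==> lfA g ==> reg.ract g x \<in> N"
  and Nh: "!!x p. x \<in> N ==> hcA p x \<in> N"
  using N(1) unfolding regular_subsupermodule' by blast+
 let ?x = "reg.wp \<nu> x"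
 have "EX p. hcA p ?x ~= 0"
 proof (rule ccontr)
  assume "\<nexists>p. hcA p ?x ~= 0"
  hence "hcA False ?x + hcA True ?x = 0" by simp
  thus False using x(2) by (simp only: hcomp_glc_sum[OF two])
 qed
 then obtain p where p: "hcA p ?x ~= 0" by blast
 \<comment> \<open>A homogeneous vector is taken so that the submodule which it generates is
   graded.\<close>
 define y where "y = hcA p ?x"
 have y: "y \<in> N" "y \<in> glc_par p" "y ~= 0" "reg.wp \<nu> y = y"
  using Nh[OF Ncl[OF x(1) lf_wform]] hcomp_glc_par(1)[OF two] p
  by (simp_all add: y_def hcomp_wproj[symmetric] reg.wproj_idem)
 define N2 where "N2 = {reg.ract g y | g. lfA g}"
 have N2: "subsupermodule (regA N) N2"
  unfolding regular_subsupermodule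
 proof (intro conjI ballI allI impI)
  show "N2 \<subseteq> N" using Ncl[OF y(1)] by (auto simp: N2_def)
  show "glc.subspace N2"
  proof (rule glc.subspaceI)
   show "0 \<in> N2" unfolding N2_def
    using reg.ract_zero_form[of y] lf_cmult[OF lf_counit, of 0] by (intro CollectI exI[of _ "%x. 0"]) simp
  next
   fix x z assume "x \<in> N2" "z \<in> N2"
   thus "x + z \<in> N2" unfolding N2_def using reg.ract_plus_form[symmetric] lf_plus by blast
  next
   fix c x assume "x \<in> N2"
   thus "scA c x \<in> N2" unfolding N2_def using reg.ract_cmult_form[symmetric] lf_cmult by blast
  qed
  show "reg.ract g x \<in> N2" if "x \<in> N2" "lfA g" for x g
   using that unfolding N2_def by (auto simp: reg.ract_ract intro: lf_convu')
  show "hcA r x \<in> N2" if "x \<in> N2" for x r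
   using that unfolding N2_def by (auto simp: hcomp_ract[OF y(2)] intro: lf_hcomp_glc)
 qed
 have yN2: "y \<in> N2"
  unfolding N2_def using reg.ract_counit[of y] lf_counit by (intro CollectI exI[of _ counit]) auto
 define A where "A = {K. subsupermodule (regA N) K & K \<subseteq> N2 & y \<notin> K}"
 have sub0: "subsupermodule (regA N) {0}"
  unfolding regular_subsupermodule
  using glc.subspace_0[OF Nsub] by (auto simp: reg.ract_zero glc.subspace_single_0 hcomp_glc[OF two])
 \<comment> \<open>Zorn's lemma: the union of a chain of submodules avoiding \<open>y\<close> avoids
   \<open>y\<close>. Any larger submodule of \<open>N2\<close> contains \<open>y\<close>, hence all
   of \<open>N2\<close>.\<close>
 have "EX N1:A. ALL K:A. N1 \<subseteq> K --> K = N1"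
 proof (rule subset_Zorn_nonempty)
  show "A ~= {}" using sub0 y(3) glc.subspace_0 N2 unfolding A_def regular_subsupermodule by blast
  fix C assume C: "C ~= {}" "subset.chain A C"
  have mem: "K \<subseteq> N" "glc.subspace K" "!!x g. x \<in> K ==> lfA g ==> reg.ract g x \<in> K" "!!x p. x \<in> K ==> hcA p x \<in> K"
   "K \<subseteq> N2" "y \<notin> K" if "K \<in> C" for K
  proof -
   have "K \<in> A" using C(2) that by (auto simp: subset.chain_def)
   thus "K \<subseteq> N" "glc.subspace K" "!!x g. x \<in> K ==> lfA g ==> reg.ract g x \<in> K" "!!x p. x \<in> K ==> hcA p x \<in> K"
    "K \<subseteq> N2" "y \<notin> K" unfolding A_def regular_subsupermodule by blast+
  qed
  have "glc.subspace (\<Union>C)"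
  proof (rule glc.subspaceI)
   show "0 \<in> \<Union>C" using C(1) glc.subspace_0[OF mem(2)] by blast
   show "x + z \<in> \<Union>C" if "x \<in> \<Union>C" "z \<in> \<Union>C" for x z
   proof -
    obtain K K' where K: "K \<in> C" "x \<in> K" "K' \<in> C" "z \<in> K'" using \<open>x \<in> \<Union>C\<close> \<open>z \<in> \<Union>C\<close> by blast
    hence "K \<subseteq> K' \<or> K' \<subseteq> K" using C(2) by (auto simp: subset.chain_def)
    thus ?thesis using K glc.subspace_add[OF mem(2)[OF K(1)]] glc.subspace_add[OF mem(2)[OF K(3)]] by blast
   qed
   show "scA c x \<in> \<Union>C" if "x \<in> \<Union>C" for c x
    using that glc.subspace_scale[OF mem(2)] by blast
  qed
  thus "\<Union>C \<in> A"
   unfolding A_def regular_subsupermodule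
  proof (intro CollectI conjI ballI allI impI)
   show "\<Union>C \<subseteq> N" "\<Union>C \<subseteq> N2" using mem(1,5) by (intro Union_least; blast)+
   show "y \<notin> \<Union>C" using mem(6) by (intro notI, elim UnionE) blast
   show "reg.ract g x \<in> \<Union>C" if x: "x \<in> \<Union>C" and g: "lfA g" for x g
    using x by (elim UnionE) (rule UnionI[OF _ mem(3)[OF _ _ g]])
   show "hcA p x \<in> \<Union>C" if x: "x \<in> \<Union>C" for x p
    using x by (elim UnionE) (rule UnionI[OF _ mem(4)])
  qed
 qed
 then obtain N1 where N1: "N1 \<in> A" "!!K. K \<in> A ==> N1 \<subseteq> K ==> K = N1" by blast
 have "simple_subquotient (regA N) N1 N2"
  unfolding simple_subquotient_def
 proof (intro conjI allI impI)
  show "subsupermodule (regA N) N1" "N1 \<subset> N2" using N1(1) yN2 by (auto simp: A_def)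
  show "subsupermodule (regA N) N2" by (rule N2)
  fix K assume K: "subsupermodule (regA N) K & N1 \<subseteq> K & K \<subseteq> N2"
  show "K = N1 \<or> K = N2"
  proof (cases "y \<in> K")
   case True
   hence "N2 \<subseteq> K" using K unfolding N2_def regular_subsupermodule by blast
   thus ?thesis using K by blast
  next
   case False
   hence "K \<in> A" using K by (simp add: A_def)
   thus ?thesis using N1(2) K by blast
  qed
 qed
 then obtain lam where "lam \<in> \<Gamma>" "subquotient_iso (regA N) N1 N2 (L_minus lam) \<or>
      subquotient_iso (regA N) N1 N2 (parity_shift (L_minus lam))"
  using N(2) unfolding comp_factors_in_def by blast
 moreover have "y \<notin> N1" using N1(1) by (simp add: A_def)
 ultimately show ?thesis using composition_factor_bound yN2 y(4) by blast
qed

lemma C_trunc_annihilated: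
 assumes l\<xi>: "lfA \<xi>" and \<xi>: "!!lam x. lam \<in> \<Gamma> ==> x \<in> glc.span (weyl_cover.coefficients (W lam)) ==> \<xi> x = 0"
  and f: "f \<in> C_trunc \<Gamma>"
 shows "\<xi> (f :: ('k,'m,'n) glc) = 0"
proof -
 let ?U = "\<Union>{N. subsupermodule regular N & comp_factors_in (regA N) \<Gamma>} :: ('k,'m,'n) glc set"
 have "?U \<subseteq> {x. \<xi> x = 0}"
 proof
  fix x assume "x \<in> ?U"
  then obtain N where N: "subsupermodule regular N" "comp_factors_in (regA N) \<Gamma>" "x \<in> N" by blast
  have "bounded_wts (wts x)"
   unfolding bounded_wts_def
  proof
   fix \<nu> assume "\<nu> \<in> wts x"
   then obtain g where g: "lfA g" "reg.wp \<nu> (reg.ract g x) ~= 0" by (auto simp: wts_def)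
   have "reg.ract g x \<in> N" using N(1,3) g(1) unfolding regular_subsupermodule' by blast
   thus "EX \<gamma>:\<Gamma>. weight_le LENGTH('m) LENGTH('n) \<nu> \<gamma>" by (rule comp_factors_bounded[OF N(1,2) _ g(2)])
  qed
  thus "x \<in> {x. \<xi> x = 0}" using annihilated[OF l\<xi> \<xi>] by simp
 qed
 hence "glc.span ?U \<subseteq> {x. \<xi> x = 0}"
  by (rule glc.span_minimal) (rule glc.subspaceI; simp add: lf_zero[OF l\<xi>] lf_add[OF l\<xi>] lf_scale[OF l\<xi>])
 thus ?thesis using f unfolding C_trunc_def O_trunc_def by (auto simp: regular_def)
qed

end

section \<open>Coefficients of the modules lie in the truncation\<close>

context odd_char
begin

text \<open>A form of weight \<open>\<mu>\<close> that vanishes on \<open>N1\<close> but not on a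
  vector of weight \<open>\<mu>\<close> gives, by Frobenius reciprocity, a map from
  \<open>N2\<close> to the induced module whose kernel is \<open>N1\<close> by simplicity. Its image
  is the whole socle, because by \<open>line\<close> every simple submodule shares its vectors of
  weight \<open>\<mu>\<close> with the image.\<close>

lemma simple_subquotient_iso:
 assumes ss: "simple_subquotient (regA N) N1 N2"
  and x0: "x0 \<in> N2" "x0 \<notin> N1" "reg.wp \<mu> x0 = (x0 :: ('k,'m,'n) glc)"
  and top: "!!\<nu> x. x \<in> N2 ==> x \<notin> N1 ==> reg.wp \<nu> x = x ==> ~ tlt LENGTH('m) LENGTH('n) \<mu> \<nu>"
  and \<mu>: "\<mu> \<in> weight_lattice LENGTH('m) LENGTH('n)"
  and line: "!!f g. f \<in> carrier (H0m \<mu>) ==> g \<in> carrier (H0m \<mu>) ==>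
   reg.wp \<mu> f = f ==> reg.wp \<mu> g = g ==> g ~= 0 ==> EX c. f = scA c g"
 shows "subquotient_iso (regA N) N1 N2 (L_minus \<mu>) \<or>
  subquotient_iso (regA N) N1 N2 (parity_shift (L_minus \<mu>))"
proof -
 let ?P = "reg.wp \<mu>" and ?H = "carrier (H0m \<mu>)"
 have sub: "subsupermodule (regA N) N1" "subsupermodule (regA N) N2"
  using ss by (auto simp: simple_subquotient_def)
 have N1: "glc.subspace N1" "!!x g. x \<in> N1 ==> lfA g ==> reg.ract g x \<in> N1" "!!x p. x \<in> N1 ==> hcA p x \<in> N1"
  using sub(1) unfolding regular_subsupermodule by blast+
 have N2: "glc.subspace N2" "!!x g. x \<in> N2 ==> lfA g ==> reg.ract g x \<in> N2" "!!x p. x \<in> N2 ==> hcA p x \<in> N2"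
  "N2 \<subseteq> N"
  using sub(2) unfolding regular_subsupermodule by blast+
 have N12: "N1 \<subseteq> N2" "N2 \<subseteq> N"
  using ss N2(4) by (auto simp: simple_subquotient_def)
 have simple: "K = N1 \<or> K = N2" if "subsupermodule (regA N) K" "N1 \<subseteq> K" "K \<subseteq> N2" for K
  using ss that by (auto simp: simple_subquotient_def)
 obtain r where r: "hcA r x0 \<notin> N1"
 proof (rule ccontr)
  assume "~ thesis"
  hence "hcA False x0 + hcA True x0 \<in> N1" using that glc.subspace_add[OF N1(1)] by blast
  thus False using x0(2) by (simp only: hcomp_glc_sum[OF two])
 qed
 define x1 where "x1 = hcA r x0"
 have x1: "x1 \<in> N2" "x1 \<notin> N1" "?P x1 = x1" "hcA r x1 = x1"
  using N2(3)[OF x0(1)] r x0(3) by (simp_all add: x1_def hcomp_wproj[symmetric] hcomp_hcomp[OF superspace_glc[OF two]])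
 obtain \<psi> where \<psi>: "lfA \<psi>" "!!x. x \<in> N1 ==> \<psi> x = 0" "\<psi> x1 = 1"
  by (rule lf_extend[OF vs_glc N1(1) x1(2)]) (rule that)
 \<comment> \<open>The separating form is cut down to weight \<open>\<mu>\<close>, for
   \<open>H0_minus_tau\<close>, and to parity \<open>r\<close>, which makes the map homogeneous. It
   still takes the value 1 at \<open>x1\<close>.\<close>
 define \<chi> where "\<chi> a = \<psi> (hcA r (?P a))" for a
 have l\<chi>: "lfA \<chi>" unfolding \<chi>_def[abs_def] by (rule reg.lf_compose_ract[OF lf_wform lf_hcomp_glc[OF \<psi>(1)]])
 have \<chi>P: "\<chi> (?P a) = \<chi> a" for a by (simp add: \<chi>_def reg.wproj_idem)
 have \<chi>h: "\<chi> (hcA r a) = \<chi> a" for a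
  by (simp add: \<chi>_def hcomp_wproj[symmetric] hcomp_hcomp[OF superspace_glc[OF two]])
 have \<chi>N1: "\<chi> x = 0" if "x \<in> N1" for x
  unfolding \<chi>_def by (rule \<psi>(2)[OF N1(3)[OF N1(2)[OF that lf_wform]]])
 have \<chi>1: "\<chi> x1 = 1" by (simp add: \<chi>_def x1 \<psi>(3))
 let ?k = "reg.tau \<chi>"
 interpret k: Vector_Spaces.linear scA scA ?k by (rule reg.tau_linear[OF l\<chi>])
 have kr: "reg.ract g (?k x) = ?k (reg.ract g x)" if "lfA g" for g x
  by (rule reg.ract_tau[OF UNIV_I that l\<chi>])
 have kh: "hcA p (?k x) = ?k (hcA (p ~= r) x)" for p x
  by (rule regular_hcomp_tau[OF l\<chi> \<chi>h])
 have kN1: "?k x = 0" if "x \<in> N1" for x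
 proof (rule lf_separate[OF vs_glc])
  fix h :: "('k,'m,'n) glc => 'k" assume h: "lfA h"
  show "h (?k x) = h 0" by (simp add: reg.lf_tau[OF h l\<chi>] \<chi>N1[OF N1(2)[OF that h]] lf_zero[OF h])
 qed
 have kH: "?k x \<in> ?H" if "x \<in> N2" for x
 proof (rule H0_minus_tau[OF N2(1,2) l\<chi> \<chi>P _ that])
  show "?k y = 0" if "y \<in> N2" "reg.wp \<nu> y = y" "tlt LENGTH('m) LENGTH('n) \<mu> \<nu>" for y \<nu>
   using top[OF that(1) _ that(2)] that(3) kN1 by blast
 qed
 have kx1: "?k x1 ~= 0" "?P (?k x1) = ?k x1"
  using reg.counit_tau[OF UNIV_I l\<chi>, of x1] \<chi>1 kr[OF lf_wform] x1(3) lf_zero[OF lf_counit] by auto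
 \<comment> \<open>Preimages of submodules are submodules even if the map is odd, in which case it
   shifts parities; both the kernel and the simplicity of the image are read off from this.\<close>
 have pre: "subsupermodule (regA N) {x \<in> N2. ?k x \<in> K}"
  if K: "glc.subspace K" "!!x g. x \<in> K ==> lfA g ==> reg.ract g x \<in> K" "!!x p. x \<in> K ==> hcA p x \<in> K" for K
  unfolding regular_subsupermodule
 proof (intro conjI ballI allI impI)
  show "{x \<in> N2. ?k x \<in> K} \<subseteq> N" using N12 by blast
  show "glc.subspace {x \<in> N2. ?k x \<in> K}"
   using K(1) N2(1) by (auto simp: glc.subspace_def k.zero k.add k.scale)
  show "reg.ract g x \<in> {x \<in> N2. ?k x \<in> K}" if "x \<in> {x \<in> N2. ?k x \<in> K}" "lfA g" for g x
   using that N2(2) K(2)[of "?k x" g] by (simp add: kr)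
  show "hcA p x \<in> {x \<in> N2. ?k x \<in> K}" if x: "x \<in> {x \<in> N2. ?k x \<in> K}" for p x
  proof -
   have "hcA (p ~= r) (?k x) \<in> K" using K(3) x by blast
   moreover have "((p ~= r) ~= r) = p" by auto
   ultimately show ?thesis using N2(3) x unfolding kh by simp
  qed
 qed
 have ker: "{x \<in> N2. ?k x = 0} = N1"
 proof -
  have "subsupermodule (regA N) {x \<in> N2. ?k x \<in> {0}}"
   by (rule pre) (auto simp: reg.ract_zero glc.subspace_single_0 hcomp_glc[OF two])
  hence "{x \<in> N2. ?k x \<in> {0}} = N1 \<or> {x \<in> N2. ?k x \<in> {0}} = N2"
   using N12 kN1 by (intro simple) auto
  moreover have "x1 \<notin> {x \<in> N2. ?k x \<in> {0}}" using kx1(1) by simp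
  ultimately show ?thesis using x1(1) by auto
 qed
 have Lsub: "subsupermodule (regA X) (?k ` N2)" if "?k ` N2 \<subseteq> X" for X
  unfolding regular_subsupermodule
 proof (intro conjI ballI allI impI that)
  show "glc.subspace (?k ` N2)" by (rule k.subspace_image[OF N2(1)])
  show "reg.ract g y \<in> ?k ` N2" if "y \<in> ?k ` N2" "lfA g" for g y
   using that N2(2) by (auto simp: kr)
  show "hcA p y \<in> ?k ` N2" if "y \<in> ?k ` N2" for p y
   using that N2(3) by (auto simp: kh)
 qed
 have Lsimple: "simple_supermodule (regA (?k ` N2))"
  unfolding simple_supermodule_def
 proof (intro conjI allI impI)
  show "G_supermodule (regA (?k ` N2))" using Lsub[OF subset_refl] by (simp add: subsupermodule_def)
  show "carrier (regA (?k ` N2)) ~= {0}" using x1(1) kx1(1) by auto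
  fix K assume "subsupermodule (regA (?k ` N2)) K"
  hence K: "K \<subseteq> ?k ` N2" "glc.subspace K" "!!x g. x \<in> K ==> lfA g ==> reg.ract g x \<in> K" "!!x p. x \<in> K ==> hcA p x \<in> K"
   unfolding regular_subsupermodule by blast+
  have "{x \<in> N2. ?k x \<in> K} = N1 \<or> {x \<in> N2. ?k x \<in> K} = N2"
   using N12 kN1 glc.subspace_0[OF K(2)] by (intro simple pre K(2-)) auto
  thus "K = {0} \<or> K = carrier (regA (?k ` N2))"
  proof
   assume e: "{x \<in> N2. ?k x \<in> K} = N1"
   have "K \<subseteq> {0}" using K(1) e kN1 by blast
   thus ?thesis using glc.subspace_0[OF K(2)] by blast
  next
   assume "{x \<in> N2. ?k x \<in> K} = N2"
   thus ?thesis using K(1) by auto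
  qed
 qed
 have L: "carrier (L0m \<mu>) = ?k ` N2"
 proof -
  have "carrier (L0m \<mu>) =
   glc.span (\<Union>{K. subsupermodule (regA ?H) K & simple_supermodule (regA K)})"
   by (simp add: L_minus_def socle_def H0_minus_def regular_def)
  also have "... = ?k ` N2"
  proof (rule glc.span_unique)
   show "?k ` N2 \<supseteq> \<Union>{K. subsupermodule (regA ?H) K & simple_supermodule (regA K)}"
   proof (rule Union_least)
    fix K assume "K \<in> {K. subsupermodule (regA ?H) K & simple_supermodule (regA K)}"
    hence Ks: "subsupermodule (regA ?H) K" "simple_supermodule (regA K)" by auto
    hence K: "K \<subseteq> ?H" "glc.subspace K" "!!x g. x \<in> K ==> lfA g ==> reg.ract g x \<in> K" "!!x p. x \<in> K ==> hcA p x \<in> K"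
     unfolding regular_subsupermodule by blast+
    have "K ~= {0}" using Ks(2) by (simp add: simple_supermodule_def)
    then obtain f where f: "f \<in> K" "f ~= 0" using glc.subspace_0[OF K(2)] by blast
    \<comment> \<open>Some translate of \<open>f\<close> has a non-zero value at the identity. On
      the induced module such values come from weight \<open>\<mu>\<close> alone, so
      \<open>K\<close> contains a non-zero vector of weight \<open>\<mu>\<close>, of which
      \<open>line\<close> makes the image of \<open>x1\<close> a multiple.\<close>
    obtain g where g: "lfA g" "counit (reg.ract g f) ~= 0" using ract_eq_zero[of f] f(2) by blast
    let ?f = "?P (reg.ract g f)"
    have fK: "?f \<in> K" by (intro K(3) f(1) g(1) lf_wform)
    have "counit ?f ~= 0" using H0_minus_counit[OF _ \<mu>] K(1) K(3)[OF f(1) g(1)] g(2) by auto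
    hence "?f ~= 0" by (auto simp: lf_zero[OF lf_counit])
    then obtain c where c: "?k x1 = scA c ?f"
     using line[OF kH[OF x1(1)] _ kx1(2), of ?f] fK K(1) reg.wproj_idem by blast
    have "?k x1 \<in> K" unfolding c by (rule glc.subspace_scale[OF K(2) fK])
    hence mem: "?k x1 \<in> K \<inter> ?k ` N2" using x1(1) by blast
    have "subsupermodule (regA K) (K \<inter> ?k ` N2)"
     using K(2-) Lsub[OF subset_refl] unfolding regular_subsupermodule by (auto intro: glc.subspace_inter)
    hence "K \<inter> ?k ` N2 = {0} \<or> K \<inter> ?k ` N2 = K"
     using Ks(2) by (simp add: simple_supermodule_def)
    thus "K \<subseteq> ?k ` N2" using mem kx1(1) by blast
   qed
   show "glc.subspace (?k ` N2)" by (rule k.subspace_image[OF N2(1)])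
   fix T assume T: "\<Union>{K. subsupermodule (regA ?H) K & simple_supermodule (regA K)} \<subseteq> T"
   have "?k ` N2 \<subseteq> ?H" using kH by blast
   hence "subsupermodule (regA ?H) (?k ` N2)" by (rule Lsub)
   thus "?k ` N2 \<subseteq> T" using Lsimple by (intro order_trans[OF Union_upper T] CollectI conjI)
  qed
  finally show ?thesis .
 qed
 have scL: "sc (L0m \<mu>) = scA" "coact (L0m \<mu>) = comult"
  "par (L0m \<mu>) = glc_par"
  by (simp_all add: L_minus_def socle_def H0_minus_def regular_def)
 have par: "?k x \<in> glc_par (p ~= r)" if "x \<in> glc_par p" for x p
 proof -
  have "hcA (p ~= r) (?k x) = ?k (hcA ((p ~= r) ~= r) x)" by (rule kh)
  also have "((p ~= r) ~= r) = p" by auto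
  also have "hcA p x = x" using hcomp_glc_hom[OF two that, of p] by simp
  finally show ?thesis using hcomp_glc_par(1)[OF two] by metis
 qed
 have co: "comult (?k x) b = comult x (%y a. b (?k y) a)" if "bilA b" for x b
  by (rule regular_comult_tau[OF l\<chi> that])
 show ?thesis
 \<comment> \<open>The map has parity \<open>r\<close>. An odd map is an even one into the parity
   shift, which accounts for the two alternatives.\<close>
 proof (cases r)
  case False
  have "G_hom ((regA N)\<lparr>carrier := N2\<rparr>) (L_minus \<mu>) ?k"
   unfolding G_hom_def scL L using k.linear_axioms par False co by (auto simp: regular_def)
  thus ?thesis unfolding subquotient_iso_def L using ker by blast
 next
  case True
  have "G_hom ((regA N)\<lparr>carrier := N2\<rparr>) (parity_shift (L_minus \<mu>)) ?k"
   unfolding G_hom_def parity_shift_def using k.linear_axioms par True co by (auto simp: regular_def scL L)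
  moreover have "carrier (parity_shift (L0m \<mu>)) = ?k ` N2"
   by (simp add: parity_shift_def L)
  ultimately show ?thesis unfolding subquotient_iso_def using ker by blast
 qed
qed

end

context weyl_cover
begin

text \<open>Vectors of weight \<open>lam\<close> in the quotient lift to vectors of weight
  \<open>lam\<close> in the module, which all lie on one line.\<close>

lemma H0_weight_line:
 assumes f: "f \<in> carrier (H0m lam)" "reg.wp lam f = f"
  and g: "g \<in> carrier (H0m lam)" "reg.wp lam g = g" "g ~= 0"
 shows "EX c. f = scA c g"
proof -
 obtain q where q: "G_hom M (H0_minus lam) q" "q ` carrier M = carrier (H0_minus lam)" using H0 by blast
 interpret q: Vector_Spaces.linear "sc M" scA q
  using q(1) by (simp add: G_hom_def H0_minus_def regular_def)
 have lift: "EX v. v \<in> carrier M & wp lam v = v & q v = f"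
  if f: "f \<in> carrier (H0m lam)" "reg.wp lam f = f" for f
 proof -
  obtain v where v: "v \<in> carrier M" "q v = f" using f(1) q(2) by (metis imageE)
  have "q (wp lam v) = f" unfolding H0_ract[OF q(1) v(1) lf_wform] v(2) by (rule f(2))
  thus ?thesis using closed[OF v(1) lf_wform] wproj_idem[OF v(1)] by blast
 qed
 obtain v where v: "v \<in> carrier M" "wp lam v = v" "q v = f" using lift[OF f] by blast
 obtain w where w: "w \<in> carrier M" "wp lam w = w" "q w = g" using lift[OF g(1,2)] by blast
 have "w ~= 0" using w(3) g(3) q.zero by blast
 then obtain c where "v = sc M c w" using weight_line[OF v(1,2) w(1,2)] by blast
 hence "f = scA c g" using v(3) w(3) by (simp add: q.scale)
 thus ?thesis by blast
qed

end

context truncation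
begin

text \<open>All coefficients with a fixed form make up the image of \<open>W lam\<close> in the
  regular supermodule, graded because the form has a fixed parity. A highest weight of a simple
  subquotient of this image is dominant and at most \<open>lam\<close>, so it belongs to the ideal,
  and its own module supplies the line that \<open>simple_subquotient_iso\<close> requires.\<close>

lemma coefficients_C_trunc:
 assumes lam: "lam \<in> \<Gamma>" and \<psi>: "lf (sc (W lam)) \<psi>" "!!x. \<psi> (hcomp (par (W lam)) p x) = \<psi> x"
  and v: "v \<in> carrier (W lam)"
 shows "precomod.tau (coact (W lam)) \<psi> v \<in> (C_trunc \<Gamma> :: ('k,'m,'n) glc set)"
proof -
 interpret C: weyl_cover ty lam "W lam" by (rule cover[OF lam])
 let ?t = "C.tau \<psi>"
 interpret t: Vector_Spaces.linear "sc (W lam)" scA ?t by (rule C.tau_linear[OF \<psi>(1)])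
 let ?N = "?t ` carrier (W lam)"
 have N: "subsupermodule regular ?N"
  unfolding regular_subsupermodule'
 proof (intro conjI ballI allI impI)
  show "glc.subspace ?N" by (rule t.subspace_image[OF G_supermodule_subspace[OF C.M(1)]])
  show "reg.ract g x \<in> ?N" if x: "x \<in> ?N" and g: "lfA g" for g x
   using x by (elim imageE) (simp add: C.ract_tau[OF _ g \<psi>(1)] C.closed[OF _ g])
  show "hcA q x \<in> ?N" if x: "x \<in> ?N" for q x
   using x by (elim imageE) (simp add: C.hcomp_tau'[OF _ \<psi>] G_supermodule_hcomp[OF C.M(1)])
 qed
 have "comp_factors_in (regA ?N) \<Gamma>"
  unfolding comp_factors_in_def
 proof (intro allI impI)
  fix N1 N2 assume ss: "simple_subquotient (regA ?N) N1 N2"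
  hence s: "subsupermodule (regA ?N) N1" "subsupermodule (regA ?N) N2" "N1 \<subset> N2"
   by (auto simp: simple_subquotient_def)
  hence N1: "glc.subspace N1" "!!x g. x \<in> N1 ==> lfA g ==> reg.ract g x \<in> N1"
   and N2: "N2 \<subseteq> ?N" "!!x g. x \<in> N2 ==> lfA g ==> reg.ract g x \<in> N2"
   unfolding regular_subsupermodule by blast+
  define S where "S = {\<nu>. EX x:N2. x \<notin> N1 & reg.wp \<nu> x = x}"
  have S: "EX v:carrier (W lam). C.wp \<nu> v ~= 0" if \<nu>: "\<nu> \<in> S" for \<nu>
  proof -
   obtain x where x: "x \<in> N2" "x \<notin> N1" "reg.wp \<nu> x = x" using \<nu> by (auto simp: S_def)
   obtain v where v: "v \<in> carrier (W lam)" "x = ?t v" using x(1) N2(1) by blast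
   have "?t (C.wp \<nu> v) = x"
    using x(3) unfolding v(2) C.ract_tau[OF v(1) lf_wform \<psi>(1)] .
   moreover have "x ~= 0" using x(2) glc.subspace_0[OF N1(1)] by blast
   ultimately have "C.wp \<nu> v ~= 0" using t.zero by auto
   thus ?thesis using v(1) by blast
  qed
  obtain B where B: "finite B" "carrier (W lam) = C.span B"
   using C.M(2) by (auto simp: finite_dimensional_def)
  have "finite S"
   by (rule finite_subset[OF _ C.finite_span_weights[OF B(1)]]) (use S B(2) in blast)
  moreover have "S ~= {}"
  proof
   assume e: "S = {}"
   obtain x where x: "x \<in> N2" "x \<notin> N1" using s(3) by blast
   obtain T where T: "finite T" "x = (\<Sum>\<nu>\<in>T. reg.wp \<nu> x)" by (rule reg.wproj_sum[of x]) simp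
   have "reg.wp \<nu> x \<in> N1" for \<nu>
    \<comment> \<open>With no weight outside \<open>N1\<close>, all weight components of
      \<open>x\<close> lie in \<open>N1\<close>, and so does their sum \<open>x\<close>.\<close>
    using e N2(2)[OF x(1) lf_wform, of "(=) \<nu>"] reg.wproj_idem[OF UNIV_I, of \<nu> x] unfolding S_def by blast
   hence "(\<Sum>\<nu>\<in>T. reg.wp \<nu> x) \<in> N1" by (intro glc.subspace_sum[OF N1(1)])
   thus False using x(2) by (simp only: T(2)[symmetric])
  qed
  ultimately obtain \<mu> where \<mu>: "\<mu> \<in> S" "!!\<nu>. \<nu> \<in> S ==> ~ tlt LENGTH('m) LENGTH('n) \<mu> \<nu>"
   by (rule finite_tlt_maximal) (rule that)
  obtain x where x: "x \<in> N2" "x \<notin> N1" "reg.wp \<mu> x = x" using \<mu>(1) by (auto simp: S_def)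
  have top: "~ tlt LENGTH('m) LENGTH('n) \<mu> \<nu>" if "y \<in> N2" "y \<notin> N1" "reg.wp \<nu> y = y" for \<nu> y
   using that by (intro \<mu>(2)) (auto simp: S_def)
  obtain v where v: "v \<in> carrier (W lam)" "C.wp \<mu> v ~= 0" using S[OF \<mu>(1)] by blast
  have lat: "\<mu> \<in> weight_lattice LENGTH('m) LENGTH('n)" by (rule C.wproj_lattice[OF v(2)])
  have "\<mu> \<in> dominant_weights LENGTH('m) LENGTH('n)"
   by (rule top_weight_dominant[OF N1(2) N2(2) x lat top])
  hence \<mu>\<Gamma>: "\<mu> \<in> \<Gamma>" using dominant_bounded[OF _ lam C.weight_below[OF v]] by blast
  interpret D: weyl_cover ty \<mu> "W \<mu>" by (rule cover[OF \<mu>\<Gamma>])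
  have "subquotient_iso (regA ?N) N1 N2 (L_minus \<mu>) \<or>
    subquotient_iso (regA ?N) N1 N2 (parity_shift (L_minus \<mu>))"
   by (rule simple_subquotient_iso[OF ss x _ lat]) (erule (2) top, erule (4) D.H0_weight_line)
  thus "EX lam:\<Gamma>. subquotient_iso (regA ?N) N1 N2 (L_minus lam) \<or>
    subquotient_iso (regA ?N) N1 N2 (parity_shift (L_minus lam))"
   using \<mu>\<Gamma> by blast
 qed
 hence "?t v \<in> \<Union>{N. subsupermodule regular N & comp_factors_in (regA N) \<Gamma>}"
  using N v by blast
 hence "?t v \<in> glc.span (\<Union>{N. subsupermodule regular N & comp_factors_in (regA N) \<Gamma>})"
  by (rule glc.span_base)
 thus ?thesis by (simp add: C_trunc_def O_trunc_def regular_def)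
qed

lemma annihilates_modules_iff:
 assumes l\<xi>: "lfA \<xi>"
 shows "(ALL f:C_trunc \<Gamma>. \<xi> f = 0) \<longleftrightarrow> (ALL lam:\<Gamma>. ALL v:carrier (W lam). act (W lam) \<xi> v = 0)"
proof (intro iffI ballI)
 fix lam v assume C0: "ALL f:C_trunc \<Gamma>. \<xi> f = 0" and lam: "lam \<in> \<Gamma>" and v: "v \<in> carrier (W lam)"
 interpret C: weyl_cover ty lam "W lam" by (rule cover[OF lam])
 have "C.ract \<xi> v = 0" if v: "v \<in> carrier (W lam)" for v
 proof (rule lf_separate[OF C.vs])
  fix \<phi> assume \<phi>: "lf (sc (W lam)) \<phi>"
  \<comment> \<open>An arbitrary form is split into its two homogeneous parts, since only forms of
    fixed parity are known to have coefficients in the truncation.\<close>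
  let ?\<phi> = "%p x. \<phi> (C.hc p x)"
  have l: "lf (sc (W lam)) (?\<phi> p)" for p by (rule lf_hcomp[OF C.superspace \<phi>])
  have "C.tau (?\<phi> p) v \<in> C_trunc \<Gamma>" for p
   by (rule coefficients_C_trunc[OF lam l _ v, where p = p]) (simp add: hcomp_hcomp[OF C.superspace])
  hence "?\<phi> p (C.ract \<xi> v) = 0" for p
   using C0 by (simp add: C.lf_tau[OF l\<xi> l, symmetric])
  hence "\<phi> (C.hc False (C.ract \<xi> v)) + \<phi> (C.hc True (C.ract \<xi> v)) = 0" by simp
  thus "\<phi> (C.ract \<xi> v) = \<phi> 0"
   by (simp only: lf_add[OF \<phi>, symmetric] hcomp_sum[OF C.superspace] lf_zero[OF \<phi>])
 qed
 thus "act (W lam) \<xi> v = 0" using C.act_zero_iff[OF l\<xi>] v by blast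
next
 fix f :: "('k,'m,'n) glc" assume W0: "ALL lam:\<Gamma>. ALL v:carrier (W lam). act (W lam) \<xi> v = 0" and f: "f \<in> C_trunc \<Gamma>"
 show "\<xi> f = 0"
 proof (rule C_trunc_annihilated[OF l\<xi> _ f])
  fix lam x assume lam: "lam \<in> \<Gamma>" and x: "x \<in> glc.span (weyl_cover.coefficients (W lam))"
  interpret C: weyl_cover ty lam "W lam" by (rule cover[OF lam])
  have "glc.span C.coefficients \<subseteq> {x. \<xi> x = 0}"
  proof (rule glc.span_minimal)
   have "ALL v:carrier (W lam). C.ract \<xi> v = 0" using C.act_zero_iff[OF l\<xi>] W0 lam by blast
   thus "C.coefficients \<subseteq> {x. \<xi> x = 0}"
    unfolding C.coefficients_def by (auto simp: C.lf_tau[OF l\<xi>] lf_zero)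
   show "glc.subspace {x. \<xi> x = 0}"
    by (rule glc.subspaceI) (simp_all add: lf_zero[OF l\<xi>] lf_add[OF l\<xi>] lf_scale[OF l\<xi>])
  qed
  thus "\<xi> x = 0" using x by blast
 qed
qed

end

theorem lemma10p5:
  fixes \<Gamma> :: "(nat \<Rightarrow> int) set"
    and W :: "(nat \<Rightarrow> int) \<Rightarrow> ('k::field, 'm::len0, 'n::len0, 'w::ab_group_add) gsmod"
    and \<xi> :: "('k, 'm, 'n) glc \<Rightarrow> 'k"
    and p :: nat
  assumes "CHAR('k) = p" and "p > 2"
    and "weight_ideal LENGTH('m) LENGTH('n) \<Gamma>"
    and "\<And>lam. lam \<in> \<Gamma> \<Longrightarrow> G_supermodule (W lam)"
    and "\<And>lam. lam \<in> \<Gamma> \<Longrightarrow> finite_dimensional (W lam)"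
    and "\<And>lam. lam \<in> \<Gamma> \<Longrightarrow> \<exists>N. subsupermodule (W lam) N \<and> is_V_minus lam ((W lam)\<lparr>carrier := N\<rparr>)"
    and "\<And>lam. lam \<in> \<Gamma> \<Longrightarrow>
           \<exists>q. G_hom (W lam) (H0_minus lam) q \<and> q ` carrier (W lam) = carrier (H0_minus lam)"
    and "\<And>lam \<mu>. lam \<in> \<Gamma> \<Longrightarrow> \<mu> \<in> weights (W lam) \<Longrightarrow> weight_le LENGTH('m) LENGTH('n) \<mu> lam"
    and "\<And>lam. lam \<in> \<Gamma> \<Longrightarrow> vector_space.dim (sc (W lam)) (weight_space (W lam) lam) = 1"
    and "\<xi> \<in> Dist"
  shows "\<xi> \<in> ker_pi \<Gamma> \<longleftrightarrow> (\<forall>lam\<in>\<Gamma>. \<forall>v\<in>carrier (W lam). act (W lam) \<xi> v = 0)"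
proof -
 have "~ CHAR('k) dvd 2" using assms(1,2) by (auto dest: dvd_imp_le)
 hence "of_nat 2 ~= (0 :: 'k)" by (simp only: of_nat_eq_0_iff_char_dvd not_False_eq_True)
 hence two: "(2 :: 'k) ~= 0" by simp
 have lat: "lam \<in> weight_lattice LENGTH('m) LENGTH('n)" if "lam \<in> \<Gamma>" for lam
  using assms(3) that unfolding weight_ideal_def dominant_weights_def by blast
 interpret truncation "TYPE(('k,'m,'n) glc)" \<Gamma> W
  by unfold_locales (rule two | erule lat | fact assms(3-9))+
 have "\<xi> \<in> ker_pi \<Gamma> \<longleftrightarrow> (ALL f:C_trunc \<Gamma>. \<xi> f = 0)"
  using assms(10) by (auto simp: ker_pi_def pi_trunc_def fun_eq_iff)
 thus ?thesis using annihilates_modules_iff Dist_lf[OF assms(10)] by blast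
qed

end
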